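(* Let $A$ be a concrete function system that generates a commutative C*-algebra $\mathrm{C}(X)$, and let $\mu\in M^+(X)$ be a measure with corresponding GNS representation $\pi_\mu:\mathrm{C}(X)\to\mathcal{B}(L^2(\mu))$. Let $K=S(A)$ denote the state space of $A$, let $\iota:A\to A(K)$ denote the canonical order isomorphism, and let $q:\mathrm{C}(K)\to\mathrm{C}(X)$ denote the canonical quotient map (the $*$-homomorphism with $q\circ\iota=\mathrm{id}_A$). Then $\pi_\mu$ has the unique extension property relative to $A$ if and only if the pushforward measure $\mu\circ(q^* )^{-1}\in M^+(K)$ is maximal in the dilation order.
   Context: $X$ is a compact Hausdorff space and $\mathrm{C}(X)$ is the C*-algebra of continuous complex-valued functions on $X$; $M^+(X)$ is the set of (finite) positive regular Borel measures. A concrete function system is a unital self-adjoint subspace of a unital commutative C*-algebra; function systems are assumed complete (norm closed). The state space $S(A)$ is the set of unital positive linear functionals on $A$ with the weak-$*$ topology, a compact convex set. $A(K)\subset \mathrm{C}(K)$ is the space of continuous affine functions on $K$, and $\iota(a)=\hat a$ where $\hat a(\alpha)=\alpha(a)$ for $\alpha\in K$. The adjoint $q^*$ restricts, after identifying points of $X$ and $K$ with their point evaluations, to a map $q^*:X\to K$, namely $q^*(x)=$ the state $a\mapsto a(x)$ of $A$. GNS representation: $\pi_\mu(f)h=fh$ for $f\in\mathrm{C}(X)$, $h\in L^2(\mu)$. Unique extension property: a $*$-representation $\pi:\mathrm{C}(X)\to\mathcal{B}(H)$ has the unique extension property relative to $A$ if $\pi|_A$ has a unique completely positive extension $\mathrm{C}(X)\to\mathcal{B}(H)$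 (which is then the $*$-homomorphism $\pi$). Dilation order on $M^+(K)$: a representation of $\mu\in M^+(K)$ is a tuple $(\pi,H,\xi)$ with $\pi:\mathrm{C}(K)\to\mathcal{B}(H)$ a $*$-representation and $\xi\in H$ such that $\int_K f\,d\mu=\langle\pi(f)\xi,\xi\rangle$ for all $f\in\mathrm{C}(K)$. A representation $(\pi,H,\xi)$ of $\mu$ is dilated by a representation $(\sigma,L,\eta)$ of $\nu$ if there is an isometry $V:H\to L$ with $\pi(a)=V^*\sigma(a)V$ for all $a\in A(K)$ and $\eta=V\xi$. Then $\mu\prec_d\nu$ if some representation of $\mu$ is dilated by a representation of $\nu$. A measure $\mu\in M^+(K)$ is maximal in the dilation order if $\mu\prec_d\nu$, $\nu\in M^+(K)$, implies $\nu=\mu$. *)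

theory Defs
  imports "HOL-Analysis.Analysis"
begin

text \<open>Spaces are abstract topologies, because the state space below is a topology on a set of
  functionals rather than a type. Functions are normalised to be \<^const>\<open>undefined\<close> outside
  \<^term>\<open>topspace X\<close>, so that equality of elements is equality of functions.\<close>

definition cfun :: "'x topology \<Rightarrow> ('x \<Rightarrow> complex) set" where
  "cfun X = {f \<in> extensional (topspace X). continuous_map X euclidean f}"

definition cf_one :: "'x topology \<Rightarrow> 'x \<Rightarrow> complex" where
  "cf_one X = (\<lambda>x\<in>topspace X. 1)"

definition cf_add :: "'x topology \<Rightarrow> ('x \<Rightarrow> complex) \<Rightarrow> ('x \<Rightarrow> complex) \<Rightarrow> 'x \<Rightarrow> complex" where
  "cf_add X f g = (\<lambda>x\<in>topspace X. f x + g x)"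

definition cf_scale :: "'x topology \<Rightarrow> complex \<Rightarrow> ('x \<Rightarrow> complex) \<Rightarrow> 'x \<Rightarrow> complex" where
  "cf_scale X c f = (\<lambda>x\<in>topspace X. c * f x)"

definition cf_mult :: "'x topology \<Rightarrow> ('x \<Rightarrow> complex) \<Rightarrow> ('x \<Rightarrow> complex) \<Rightarrow> 'x \<Rightarrow> complex" where
  "cf_mult X f g = (\<lambda>x\<in>topspace X. f x * g x)"

definition cf_star :: "'x topology \<Rightarrow> ('x \<Rightarrow> complex) \<Rightarrow> 'x \<Rightarrow> complex" where
  "cf_star X f = (\<lambda>x\<in>topspace X. cnj (f x))"

text \<open>For compact \<open>X\<close> the points of \<^term>\<open>cfunspace X (euclidean_metric :: complex metric)\<close> are
  exactly the elements of \<^term>\<open>cfun X\<close>, and its metric is the supremum-norm distance.\<close>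

definition norm_closed :: "'x topology \<Rightarrow> ('x \<Rightarrow> complex) set \<Rightarrow> bool" where
  "norm_closed X B \<longleftrightarrow> closedin (mtopology_of (cfunspace X euclidean_metric)) B"

definition function_system :: "'x topology \<Rightarrow> ('x \<Rightarrow> complex) set \<Rightarrow> bool" where
  "function_system X A \<longleftrightarrow>
     A \<subseteq> cfun X \<and> cf_one X \<in> A \<and>
     (\<forall>f\<in>A. \<forall>g\<in>A. cf_add X f g \<in> A) \<and>
     (\<forall>c. \<forall>f\<in>A. cf_scale X c f \<in> A) \<and>
     (\<forall>f\<in>A. cf_star X f \<in> A) \<and>
     norm_closed X A"

definition cstar_subalgebra :: "'x topology \<Rightarrow> ('x \<Rightarrow> complex) set \<Rightarrow> bool" where
  "cstar_subalgebra X B \<longleftrightarrow>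
     B \<subseteq> cfun X \<and> B \<noteq> {} \<and>
     (\<forall>f\<in>B. \<forall>g\<in>B. cf_add X f g \<in> B) \<and>
     (\<forall>c. \<forall>f\<in>B. cf_scale X c f \<in> B) \<and>
     (\<forall>f\<in>B. \<forall>g\<in>B. cf_mult X f g \<in> B) \<and>
     (\<forall>f\<in>B. cf_star X f \<in> B) \<and>
     norm_closed X B"

definition generates_cfun :: "'x topology \<Rightarrow> ('x \<Rightarrow> complex) set \<Rightarrow> bool" where
  "generates_cfun X A \<longleftrightarrow> \<Inter>{B. cstar_subalgebra X B \<and> A \<subseteq> B} = cfun X"

definition star_hom :: "'x topology \<Rightarrow> 'y topology \<Rightarrow> (('x \<Rightarrow> complex) \<Rightarrow> 'y \<Rightarrow> complex) \<Rightarrow> bool" where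
  "star_hom X Y q \<longleftrightarrow>
     (\<forall>f\<in>cfun X. q f \<in> cfun Y) \<and>
     (\<forall>f\<in>cfun X. \<forall>g\<in>cfun X. q (cf_add X f g) = cf_add Y (q f) (q g)) \<and>
     (\<forall>c. \<forall>f\<in>cfun X. q (cf_scale X c f) = cf_scale Y c (q f)) \<and>
     (\<forall>f\<in>cfun X. \<forall>g\<in>cfun X. q (cf_mult X f g) = cf_mult Y (q f) (q g)) \<and>
     (\<forall>f\<in>cfun X. q (cf_star X f) = cf_star Y (q f))"

text \<open>The adjoint of \<open>q : C(K) \<rightarrow> C(X)\<close> sends the evaluation at \<open>x\<close> to the functional
  \<open>f \<mapsto> q f x\<close>; the following is the point of \<open>K\<close> at which that functional is the evaluation.\<close>

definition adjoint_point :: "'k topology \<Rightarrow> (('k \<Rightarrow> complex) \<Rightarrow> 'x \<Rightarrow> complex) \<Rightarrow> 'x \<Rightarrow> 'k" where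
  "adjoint_point K q x = (THE k. k \<in> topspace K \<and> (\<forall>f\<in>cfun K. q f x = f k))"

definition states :: "'x topology \<Rightarrow> ('x \<Rightarrow> complex) set \<Rightarrow> (('x \<Rightarrow> complex) \<Rightarrow> complex) set" where
  "states X A = {\<phi> \<in> extensional A.
     (\<forall>f\<in>A. \<forall>g\<in>A. \<phi> (cf_add X f g) = \<phi> f + \<phi> g) \<and>
     (\<forall>c. \<forall>f\<in>A. \<phi> (cf_scale X c f) = c * \<phi> f) \<and>
     (\<forall>f\<in>A. (\<forall>x\<in>topspace X. f x \<in> \<real>\<^sub>\<ge>\<^sub>0) \<longrightarrow> \<phi> f \<in> \<real>\<^sub>\<ge>\<^sub>0) \<and>
     \<phi> (cf_one X) = 1}"

text \<open>The weak-* topology is that of pointwise convergence on \<open>A\<close>.\<close>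

definition state_space :: "'x topology \<Rightarrow> ('x \<Rightarrow> complex) set \<Rightarrow> (('x \<Rightarrow> complex) \<Rightarrow> complex) topology" where
  "state_space X A = subtopology (product_topology (\<lambda>_. euclidean) A) (states X A)"

definition iota :: "'x topology \<Rightarrow> ('x \<Rightarrow> complex) set \<Rightarrow> ('x \<Rightarrow> complex) \<Rightarrow> (('x \<Rightarrow> complex) \<Rightarrow> complex) \<Rightarrow> complex" where
  "iota X A a = (\<lambda>\<alpha>\<in>topspace (state_space X A). \<alpha> a)"

text \<open>The continuous (complex-valued) affine functions on a convex set \<open>K\<close> of functions that are
  extensional on \<open>I\<close>; for the state space of \<open>A\<close> we have \<open>I = A\<close>.\<close>

definition affine_cfun :: "'i set \<Rightarrow> ('i \<Rightarrow> complex) topology \<Rightarrow> (('i \<Rightarrow> complex) \<Rightarrow> complex) set" where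
  "affine_cfun I K = {f \<in> cfun K.
     \<forall>\<alpha>\<in>topspace K. \<forall>\<beta>\<in>topspace K. \<forall>t\<in>{0..1}.
       f (\<lambda>i\<in>I. of_real t * \<alpha> i + of_real (1 - t) * \<beta> i) =
       of_real t * f \<alpha> + of_real (1 - t) * f \<beta>}"

definition borel_of_top :: "'x topology \<Rightarrow> 'x measure" where
  "borel_of_top X = sigma (topspace X) {U. openin X U}"

definition pos_regular_measures :: "'x topology \<Rightarrow> 'x measure set" where
  "pos_regular_measures X = {\<mu>. sets \<mu> = sets (borel_of_top X) \<and> finite_measure \<mu> \<and>
     (\<forall>E\<in>sets \<mu>.
        emeasure \<mu> E = (INF U\<in>{U. openin X U \<and> E \<subseteq> U}. emeasure \<mu> U) \<and>
        emeasure \<mu> E = (SUP C\<in>{C. C \<in> sets \<mu> \<and> compactin X C \<and> C \<subseteq> E}. emeasure \<mu> C))}"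

record 'h hspace =
  hcarrier :: "'h set"
  hzero :: 'h
  hadd :: "'h \<Rightarrow> 'h \<Rightarrow> 'h"
  hscale :: "complex \<Rightarrow> 'h \<Rightarrow> 'h"
  hinner :: "'h \<Rightarrow> 'h \<Rightarrow> complex"

definition hnorm :: "'h hspace \<Rightarrow> 'h \<Rightarrow> real" where
  "hnorm H x = sqrt (Re (hinner H x x))"

definition hdist :: "'h hspace \<Rightarrow> 'h \<Rightarrow> 'h \<Rightarrow> real" where
  "hdist H x y = hnorm H (hadd H x (hscale H (-1) y))"

locale hilbert_space =
  fixes H :: "'h hspace"
  assumes zero_closed: "hzero H \<in> hcarrier H"
    and add_closed: "\<lbrakk>x \<in> hcarrier H; y \<in> hcarrier H\<rbrakk> \<Longrightarrow> hadd H x y \<in> hcarrier H"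
    and scale_closed: "x \<in> hcarrier H \<Longrightarrow> hscale H c x \<in> hcarrier H"
    and add_assoc: "\<lbrakk>x \<in> hcarrier H; y \<in> hcarrier H; z \<in> hcarrier H\<rbrakk> \<Longrightarrow>
          hadd H (hadd H x y) z = hadd H x (hadd H y z)"
    and add_commute: "\<lbrakk>x \<in> hcarrier H; y \<in> hcarrier H\<rbrakk> \<Longrightarrow> hadd H x y = hadd H y x"
    and add_zero: "x \<in> hcarrier H \<Longrightarrow> hadd H x (hzero H) = x"
    and add_neg: "x \<in> hcarrier H \<Longrightarrow> hadd H x (hscale H (-1) x) = hzero H"
    and scale_one: "x \<in> hcarrier H \<Longrightarrow> hscale H 1 x = x"
    and scale_scale: "x \<in> hcarrier H \<Longrightarrow> hscale H c (hscale H d x) = hscale H (c * d) x"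
    and scale_add_right: "\<lbrakk>x \<in> hcarrier H; y \<in> hcarrier H\<rbrakk> \<Longrightarrow>
          hscale H c (hadd H x y) = hadd H (hscale H c x) (hscale H c y)"
    and scale_add_left: "x \<in> hcarrier H \<Longrightarrow>
          hscale H (c + d) x = hadd H (hscale H c x) (hscale H d x)"
    and inner_add: "\<lbrakk>x \<in> hcarrier H; y \<in> hcarrier H; z \<in> hcarrier H\<rbrakk> \<Longrightarrow>
          hinner H (hadd H x y) z = hinner H x z + hinner H y z"
    and inner_scale: "\<lbrakk>x \<in> hcarrier H; y \<in> hcarrier H\<rbrakk> \<Longrightarrow>
          hinner H (hscale H c x) y = c * hinner H x y"
    and inner_commute: "\<lbrakk>x \<in> hcarrier H; y \<in> hcarrier H\<rbrakk> \<Longrightarrow> hinner H y x = cnj (hinner H x y)"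
    and inner_nonneg: "x \<in> hcarrier H \<Longrightarrow> hinner H x x \<in> \<real>\<^sub>\<ge>\<^sub>0"
    and inner_definite: "\<lbrakk>x \<in> hcarrier H; hinner H x x = 0\<rbrakk> \<Longrightarrow> x = hzero H"
    and complete: "\<lbrakk>\<And>n::nat. s n \<in> hcarrier H;
          \<And>e. e > 0 \<Longrightarrow> \<exists>N. \<forall>m\<ge>N. \<forall>n\<ge>N. hdist H (s m) (s n) < e\<rbrakk> \<Longrightarrow>
          \<exists>l\<in>hcarrier H. (\<lambda>n. hdist H (s n) l) \<longlonglongrightarrow> 0"

definition hlinear :: "'h hspace \<Rightarrow> 'l hspace \<Rightarrow> ('h \<Rightarrow> 'l) \<Rightarrow> bool" where
  "hlinear H L T \<longleftrightarrow> T \<in> hcarrier H \<rightarrow>\<^sub>E hcarrier L \<and>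
     (\<forall>x\<in>hcarrier H. \<forall>y\<in>hcarrier H. T (hadd H x y) = hadd L (T x) (T y)) \<and>
     (\<forall>c. \<forall>x\<in>hcarrier H. T (hscale H c x) = hscale L c (T x))"

definition hisometry :: "'h hspace \<Rightarrow> 'l hspace \<Rightarrow> ('h \<Rightarrow> 'l) \<Rightarrow> bool" where
  "hisometry H L V \<longleftrightarrow> hlinear H L V \<and> (\<forall>x\<in>hcarrier H. hnorm L (V x) = hnorm H x)"

definition bops :: "'h hspace \<Rightarrow> ('h \<Rightarrow> 'h) set" where
  "bops H = {T. hlinear H H T \<and> (\<exists>B. \<forall>x\<in>hcarrier H. hnorm H (T x) \<le> B * hnorm H x)}"

definition hadjoint :: "'h hspace \<Rightarrow> 'l hspace \<Rightarrow> ('h \<Rightarrow> 'l) \<Rightarrow> 'l \<Rightarrow> 'h" where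
  "hadjoint H L T = (\<lambda>y\<in>hcarrier L.
     THE z. z \<in> hcarrier H \<and> (\<forall>x\<in>hcarrier H. hinner L (T x) y = hinner H x z))"

definition linear_into_bops :: "'x topology \<Rightarrow> 'h hspace \<Rightarrow> (('x \<Rightarrow> complex) \<Rightarrow> 'h \<Rightarrow> 'h) \<Rightarrow> bool" where
  "linear_into_bops X H \<Phi> \<longleftrightarrow> \<Phi> \<in> cfun X \<rightarrow>\<^sub>E bops H \<and>
     (\<forall>f\<in>cfun X. \<forall>g\<in>cfun X. \<Phi> (cf_add X f g) = (\<lambda>h\<in>hcarrier H. hadd H (\<Phi> f h) (\<Phi> g h))) \<and>
     (\<forall>c. \<forall>f\<in>cfun X. \<Phi> (cf_scale X c f) = (\<lambda>h\<in>hcarrier H. hscale H c (\<Phi> f h)))"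

definition star_rep :: "'x topology \<Rightarrow> 'h hspace \<Rightarrow> (('x \<Rightarrow> complex) \<Rightarrow> 'h \<Rightarrow> 'h) \<Rightarrow> bool" where
  "star_rep X H \<pi> \<longleftrightarrow> linear_into_bops X H \<pi> \<and>
     (\<forall>f\<in>cfun X. \<forall>g\<in>cfun X. \<pi> (cf_mult X f g) = compose (hcarrier H) (\<pi> f) (\<pi> g)) \<and>
     (\<forall>f\<in>cfun X. \<pi> (cf_star X f) = hadjoint H H (\<pi> f))"

text \<open>Positivity in the C*-algebra of \<open>n \<times> n\<close> matrices over \<open>C(X)\<close>: being of the form \<open>c* c\<close>.\<close>

definition matrix_pos :: "'x topology \<Rightarrow> nat \<Rightarrow> (nat \<Rightarrow> nat \<Rightarrow> 'x \<Rightarrow> complex) \<Rightarrow> bool" where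
  "matrix_pos X n F \<longleftrightarrow> (\<exists>c. (\<forall>i<n. \<forall>j<n. c i j \<in> cfun X) \<and>
     (\<forall>i<n. \<forall>j<n. F i j = (\<lambda>x\<in>topspace X. \<Sum>k<n. cnj (c k i x) * c k j x)))"

text \<open>Positivity of an \<open>n \<times> n\<close> operator matrix acting on the direct sum of \<open>n\<close> copies of \<open>H\<close>.\<close>

definition op_matrix_pos :: "'h hspace \<Rightarrow> nat \<Rightarrow> (nat \<Rightarrow> nat \<Rightarrow> 'h \<Rightarrow> 'h) \<Rightarrow> bool" where
  "op_matrix_pos H n T \<longleftrightarrow> (\<forall>h. (\<forall>i<n. h i \<in> hcarrier H) \<longrightarrow>
     (\<Sum>i<n. \<Sum>j<n. hinner H (T i j (h j)) (h i)) \<in> \<real>\<^sub>\<ge>\<^sub>0)"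

definition completely_positive :: "'x topology \<Rightarrow> 'h hspace \<Rightarrow> (('x \<Rightarrow> complex) \<Rightarrow> 'h \<Rightarrow> 'h) \<Rightarrow> bool" where
  "completely_positive X H \<Phi> \<longleftrightarrow> linear_into_bops X H \<Phi> \<and>
     (\<forall>n F. matrix_pos X n F \<longrightarrow> op_matrix_pos H n (\<lambda>i j. \<Phi> (F i j)))"

definition unique_extension_property ::
  "'x topology \<Rightarrow> ('x \<Rightarrow> complex) set \<Rightarrow> 'h hspace \<Rightarrow> (('x \<Rightarrow> complex) \<Rightarrow> 'h \<Rightarrow> 'h) \<Rightarrow> bool" where
  "unique_extension_property X A H \<pi> \<longleftrightarrow>
     (\<exists>!\<Phi>. completely_positive X H \<Phi> \<and> (\<forall>a\<in>A. \<Phi> a = \<pi> a))"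

definition sq_integrable :: "'x measure \<Rightarrow> ('x \<Rightarrow> complex) set" where
  "sq_integrable \<mu> = {f \<in> borel_measurable \<mu>. integrable \<mu> (\<lambda>x. (cmod (f x))\<^sup>2)}"

definition ae_rel :: "'x measure \<Rightarrow> (('x \<Rightarrow> complex) \<times> ('x \<Rightarrow> complex)) set" where
  "ae_rel \<mu> = {(f, g). f \<in> sq_integrable \<mu> \<and> g \<in> sq_integrable \<mu> \<and> (AE x in \<mu>. f x = g x)}"

definition l2_class :: "'x measure \<Rightarrow> ('x \<Rightarrow> complex) \<Rightarrow> ('x \<Rightarrow> complex) set" where
  "l2_class \<mu> f = ae_rel \<mu> `` {f}"

definition l2_rep :: "('x \<Rightarrow> complex) set \<Rightarrow> 'x \<Rightarrow> complex" where
  "l2_rep u = (SOME f. f \<in> u)"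

definition L2 :: "'x measure \<Rightarrow> ('x \<Rightarrow> complex) set hspace" where
  "L2 \<mu> = \<lparr>
     hcarrier = sq_integrable \<mu> // ae_rel \<mu>,
     hzero = l2_class \<mu> (\<lambda>x. 0),
     hadd = (\<lambda>u v. l2_class \<mu> (\<lambda>x. l2_rep u x + l2_rep v x)),
     hscale = (\<lambda>c u. l2_class \<mu> (\<lambda>x. c * l2_rep u x)),
     hinner = (\<lambda>u v. \<integral>x. l2_rep u x * cnj (l2_rep v x) \<partial>\<mu>)\<rparr>"

definition gns_rep :: "'x topology \<Rightarrow> 'x measure \<Rightarrow>
    ('x \<Rightarrow> complex) \<Rightarrow> ('x \<Rightarrow> complex) set \<Rightarrow> ('x \<Rightarrow> complex) set" where
  "gns_rep X \<mu> = (\<lambda>f\<in>cfun X. \<lambda>u\<in>hcarrier (L2 \<mu>). l2_class \<mu> (\<lambda>x. f x * l2_rep u x))"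

definition represents :: "'k topology \<Rightarrow> 'k measure \<Rightarrow>
    (('k \<Rightarrow> complex) \<Rightarrow> 'h \<Rightarrow> 'h) \<Rightarrow> 'h hspace \<Rightarrow> 'h \<Rightarrow> bool" where
  "represents K \<mu> \<pi> H \<xi> \<longleftrightarrow> hilbert_space H \<and> star_rep K H \<pi> \<and> \<xi> \<in> hcarrier H \<and>
     (\<forall>f\<in>cfun K. (\<integral>x. f x \<partial>\<mu>) = hinner H (\<pi> f \<xi>) \<xi>)"

definition dilated_by :: "'i set \<Rightarrow> ('i \<Rightarrow> complex) topology \<Rightarrow>
    ((('i \<Rightarrow> complex) \<Rightarrow> complex) \<Rightarrow> 'h \<Rightarrow> 'h) \<Rightarrow> 'h hspace \<Rightarrow> 'h \<Rightarrow>
    ((('i \<Rightarrow> complex) \<Rightarrow> complex) \<Rightarrow> 'l \<Rightarrow> 'l) \<Rightarrow> 'l hspace \<Rightarrow> 'l \<Rightarrow> bool" where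
  "dilated_by I K \<pi> H \<xi> \<sigma> L \<eta> \<longleftrightarrow> (\<exists>V. hisometry H L V \<and>
     (\<forall>a\<in>affine_cfun I K. \<pi> a = (\<lambda>h\<in>hcarrier H. hadjoint H L V (\<sigma> a (V h)))) \<and>
     \<eta> = V \<xi>)"

text \<open>HOL cannot quantify over all Hilbert spaces, only over those with underlying set in a given
  type, here the type argument \<open>'u\<close>.\<close>

definition dilation_le :: "'u itself \<Rightarrow> 'i set \<Rightarrow> ('i \<Rightarrow> complex) topology \<Rightarrow>
    ('i \<Rightarrow> complex) measure \<Rightarrow> ('i \<Rightarrow> complex) measure \<Rightarrow> bool" where
  "dilation_le _ I K \<mu> \<nu> \<longleftrightarrow>
     (\<exists>\<pi> (H :: 'u hspace) \<xi> \<sigma> (L :: 'u hspace) \<eta>.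
        represents K \<mu> \<pi> H \<xi> \<and> represents K \<nu> \<sigma> L \<eta> \<and> dilated_by I K \<pi> H \<xi> \<sigma> L \<eta>)"

definition dilation_maximal :: "'u itself \<Rightarrow> 'i set \<Rightarrow> ('i \<Rightarrow> complex) topology \<Rightarrow>
    ('i \<Rightarrow> complex) measure \<Rightarrow> bool" where
  "dilation_maximal U I K \<mu> \<longleftrightarrow> \<mu> \<in> pos_regular_measures K \<and>
     (\<forall>\<nu>\<in>pos_regular_measures K. dilation_le U I K \<mu> \<nu> \<longrightarrow> \<nu> = \<mu>)"

text \<open>A universe of Hilbert spaces for the dilation order on a space with points in \<open>'k\<close>. After
  restriction to the subspaces generated by \<open>\<xi>\<close> (restricting \<open>\<pi>\<close>) and by its image (restricting
  \<open>\<sigma>\<close>), the Hilbert spaces in the definition of the order have a dense subset of size at most that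
  of \<open>C(K)\<close>, so they embed into the left summand and no instance of the order is lost.
  The right summand is arbitrary: any Hilbert space has a copy in some such universe.\<close>

type_synonym ('k, 'u) hilbert_universe = "('k \<Rightarrow> complex) set + 'u"

end

theory Submission
 imports Defs
begin

text \<open>Both directions pass through dilations. Write \<open>\<nu>\<close> for the pushforward of \<open>\<mu>\<close> to the state space
 \<open>K\<close> of \<open>A\<close>. The homomorphism \<open>q\<close> is composition with \<open>x \<mapsto>\<close> (evaluation at \<open>x\<close>), an embedding of \<open>X\<close>
 in \<open>K\<close> because \<open>A\<close> generates \<open>C(X)\<close>, so that \<open>\<integral> f d\<nu> = \<integral> q f d\<mu>\<close> (\<open>quotient_eval\<close>,
 \<open>integral_pushforward\<close>), and the cyclic representation of \<open>\<nu>\<close> is \<open>\<pi>\<^sub>\<mu> \<circ> q\<close> on \<open>L\<^sup>2(\<mu>)\<close> with vector \<open>1\<close>.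

 Suppose that \<open>\<nu>\<close> is maximal and that \<open>\<Phi>\<close> is a completely positive extension of \<open>\<pi>\<^sub>\<mu>\<close> restricted to \<open>A\<close>.
 Stinespring's theorem gives an isometry \<open>V\<close> and a representation \<open>\<rho>\<close> of \<open>C(X)\<close> with \<open>\<Phi> = V\<^sup>* \<rho> V\<close>.
 Then \<open>\<rho> \<circ> q\<close> with vector \<open>V1\<close> represents some measure, obtained from the Riesz representation theorem,
 and dilates \<open>\<pi>\<^sub>\<mu> \<circ> q\<close>: on a continuous affine function of \<open>K\<close> the maps \<open>\<Phi>\<close> and \<open>\<pi>\<^sub>\<mu>\<close> agree because their
 vector functionals agree on \<open>A\<close> and every functional evaluates an affine function at its barycentre
 (\<open>affine_determined_on_system\<close>). Maximality says that \<open>\<langle>\<Phi>(f)1, 1\<rangle> = \<integral> f d\<mu>\<close> for all \<open>f\<close>, and a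
 Cauchy-Schwarz argument spreads this equality to \<open>\<Phi> = \<pi>\<^sub>\<mu>\<close>, multiplying by elements of \<open>A\<close> until all of
 \<open>C(X)\<close> is reached (\<open>vector_state_determines_extension\<close>).

 Suppose conversely that \<open>\<pi>\<^sub>\<mu>\<close> has the unique extension property, and that a representation \<open>\<sigma>\<close> of \<open>C(K)\<close>
 on \<open>L\<close> dilates one of \<open>\<nu>\<close>. It restricts to a dilation of \<open>\<pi>\<^sub>\<mu> \<circ> q\<close> along an isometry
 \<open>V : L\<^sup>2(\<mu>) \<rightarrow> L\<close>. The restriction of \<open>\<sigma>\<close> to \<open>A\<close> extends to a completely positive map on \<open>C(X)\<close>
 (\<open>completely_positive_extension_form\<close>). Arveson's extension theorem is easy here because \<open>C(K)\<close> is
 commutative: with a partition of unity \<open>p\<^sub>j\<close> on \<open>K\<close> and states \<open>m\<^sub>j\<close> of \<open>C(X)\<close> near the points where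
 \<open>p\<^sub>j\<close> lives, \<open>f \<mapsto> \<Sum> m\<^sub>j(f) \<sigma>(p\<^sub>j)\<close> is an approximate extension, and a limit exists by compactness. The
 compression of the extension to \<open>L\<^sup>2(\<mu>)\<close> extends \<open>\<pi>\<^sub>\<mu>\<close> from \<open>A\<close>, hence equals \<open>\<pi>\<^sub>\<mu>\<close>. The multiplicativity
 of \<open>\<pi>\<^sub>\<mu>\<close> then forces \<open>\<sigma>(a) V = V \<pi>\<^sub>\<mu>(a)\<close> for \<open>a \<in> A\<close> (\<open>unique_extension_intertwines\<close>), and by the
 Stone-Weierstrass theorem on \<open>K\<close> also \<open>\<sigma>(f) V = V \<pi>\<^sub>\<mu>(q f)\<close> for all \<open>f \<in> C(K)\<close>: the dilation represents
 \<open>\<nu>\<close> itself.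

 In the dilation order only Hilbert spaces inside the given universe count. The second direction is
 valid in every universe; for the first, \<open>L\<^sup>2(\<mu>)\<close> and the Stinespring space are copied into it
 (\<open>dilation_leI\<close>).\<close>

section \<open>Continuous functions on a compact space\<close>

lemma continuous_map_compose_fun:
 "continuous_map X euclidean f ==> continuous_on UNIV g ==> continuous_map X euclidean (\<lambda>x. g (f x))"
 using continuous_map_compose[of X euclidean f euclidean g] by (simp add: o_def)

lemma continuous_map_times:
 fixes f g :: "'x => 'b::real_normed_algebra"
 shows "continuous_map X euclidean f ==> continuous_map X euclidean g ==>
  continuous_map X euclidean (\<lambda>x. f x * g x)"
 by (simp add: continuous_map_atin tendsto_mult)

lemma continuous_map_cnj:
 "continuous_map X euclidean f ==> continuous_map X euclidean (\<lambda>x. cnj (f x))"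
 by (simp add: continuous_map_atin tendsto_cnj)

lemma continuous_map_Re:
 "continuous_map X euclidean f ==> continuous_map X euclidean (\<lambda>x. Re (f x))"
 by (simp add: continuous_map_atin tendsto_Re)

lemma continuous_map_Im:
 "continuous_map X euclidean f ==> continuous_map X euclidean (\<lambda>x. Im (f x))"
 by (simp add: continuous_map_atin tendsto_Im)

lemma continuous_map_of_real:
 fixes f :: "'x => real"
 shows "continuous_map X euclidean f ==> continuous_map X euclidean (\<lambda>x. complex_of_real (f x))"
 by (simp add: continuous_map_atin tendsto_of_real)

lemma cfun_continuous: "f \<in> cfun X ==> continuous_map X euclidean f"
 by (simp add: cfun_def)

lemma cfun_eqI:
 "f \<in> cfun X ==> g \<in> cfun X ==> (!!x. x \<in> topspace X ==> f x = g x) ==> f = g"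
 by (auto simp: cfun_def intro: extensionalityI)

lemma restrict_in_cfun: "continuous_map X euclidean f ==> restrict f (topspace X) \<in> cfun X"
 by (auto simp: cfun_def intro: continuous_map_eq)

lemma cf_one_in [simp]: "cf_one X \<in> cfun X"
 unfolding cf_one_def by (intro restrict_in_cfun) simp

lemma cf_add_in: "f \<in> cfun X ==> g \<in> cfun X ==> cf_add X f g \<in> cfun X"
 unfolding cf_add_def by (intro restrict_in_cfun continuous_map_add cfun_continuous)

lemma cf_scale_in: "f \<in> cfun X ==> cf_scale X c f \<in> cfun X"
 unfolding cf_scale_def
 by (intro restrict_in_cfun continuous_map_compose_fun[where g = "(*) c"] cfun_continuous continuous_intros)

lemma cf_mult_in: "f \<in> cfun X ==> g \<in> cfun X ==> cf_mult X f g \<in> cfun X"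
 unfolding cf_mult_def by (intro restrict_in_cfun continuous_map_times cfun_continuous)

lemma cf_star_in: "f \<in> cfun X ==> cf_star X f \<in> cfun X"
 unfolding cf_star_def by (intro restrict_in_cfun continuous_map_cnj cfun_continuous)

lemmas cfun_closed = cf_add_in cf_scale_in cf_mult_in cf_star_in

lemma cf_apply [simp]:
 assumes "x \<in> topspace X"
 shows "cf_one X x = 1" "cf_add X f g x = f x + g x" "cf_scale X c f x = c * f x"
  "cf_mult X f g x = f x * g x" "cf_star X f x = cnj (f x)"
 using assms by (auto simp: cf_one_def cf_add_def cf_scale_def cf_mult_def cf_star_def)

lemma continuous_map_bounded:
 fixes f :: "'x => 'b::real_normed_vector"
 assumes "compact_space X" "continuous_map X euclidean f"
 obtains B where "B \<ge> 0" "!!x. x \<in> topspace X ==> norm (f x) \<le> B"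
proof -
 have "compact (f ` topspace X)"
  using assms image_compactin[of X "topspace X" euclidean f] by (simp add: compact_space_def)
 then obtain B where B: "\<forall>y\<in>f ` topspace X. norm y \<le> B"
  using compact_imp_bounded bounded_iff by metis
 show thesis
  by (rule that[of "max 0 B"]) (use B in \<open>auto intro: max.coboundedI2\<close>)
qed

lemma cfun_bounded:
 assumes "compact_space X" "f \<in> cfun X"
 obtains B where "B \<ge> 0" "!!x. x \<in> topspace X ==> cmod (f x) \<le> B"
 using continuous_map_bounded[OF assms(1) cfun_continuous[OF assms(2)]] by metis

lemma norm_closed_iff:
 assumes X: "compact_space X"
 shows "norm_closed X B \<longleftrightarrow> B \<subseteq> cfun X \<and>
  (\<forall>f\<in>cfun X. (\<forall>e>0. \<exists>g\<in>B. \<forall>x\<in>topspace X. cmod (f x - g x) \<le> e) \<longrightarrow> f \<in> B)"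
proof -
 let ?m = "cfunspace X (euclidean_metric :: complex metric)"
 interpret F: Metric_space "mspace ?m" "mdist ?m" by (rule Metric_space_mspace_mdist)
 have ms: "mspace ?m = cfun X"
  using X by (subst compactin_mspace_cfunspace) (auto simp: compact_space_def cfun_def)
 have top: "mtopology_of ?m = F.mtopology" by (simp add: mtopology_of_def)
 have small: "(\<forall>x\<in>topspace X. cmod (f x - g x) \<le> r)" if "mdist ?m f g \<le> r" "f \<in> cfun X" "g \<in> cfun X" for f g r
  using mdist_cfunspace_imp_mdist_le[of f X euclidean_metric g r] that
  by (simp add: ms dist_norm del: mspace_cfunspace)
 have conv: "mdist ?m f g \<le> r" if "\<forall>x\<in>topspace X. cmod (f x - g x) \<le> r" "r \<ge> 0" for f g r
  using that by (intro mdist_cfunspace_le) (auto simp: dist_norm)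
 have "norm_closed X B \<longleftrightarrow> B \<subseteq> cfun X \<and> (\<forall>f. f \<in> cfun X - B \<longrightarrow> (\<exists>r>0. disjnt B (F.mball f r)))"
  unfolding norm_closed_def top F.closedin_metric by (simp only: ms)
 also have "\<dots> \<longleftrightarrow> B \<subseteq> cfun X \<and>
  (\<forall>f\<in>cfun X. (\<forall>e>0. \<exists>g\<in>B. \<forall>x\<in>topspace X. cmod (f x - g x) \<le> e) \<longrightarrow> f \<in> B)"
 proof (intro conj_cong refl iffI ballI impI allI)
  fix f assume B: "B \<subseteq> cfun X" and *: "\<forall>f. f \<in> cfun X - B \<longrightarrow> (\<exists>r>0. disjnt B (F.mball f r))"
   and f: "f \<in> cfun X" and ap: "\<forall>e>0. \<exists>g\<in>B. \<forall>x\<in>topspace X. cmod (f x - g x) \<le> e"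
  show "f \<in> B"
  proof (rule ccontr)
   assume "f \<notin> B"
   with * f obtain r where r: "r > 0" "disjnt B (F.mball f r)" by blast
   from ap r(1) obtain g where g: "g \<in> B" "\<forall>x\<in>topspace X. cmod (f x - g x) \<le> r/2"
    by (meson half_gt_zero)
   then have "mdist ?m f g \<le> r/2" using r by (intro conv) auto
   then have "g \<in> F.mball f r" unfolding F.in_mball unfolding ms using g B f r by auto
   then show False using r g by (auto simp: disjnt_iff simp del: F.in_mball)
  qed
 next
  fix f assume B: "B \<subseteq> cfun X" and *: "\<forall>f\<in>cfun X. (\<forall>e>0. \<exists>g\<in>B. \<forall>x\<in>topspace X. cmod (f x - g x) \<le> e) \<longrightarrow> f \<in> B"
   and f: "f \<in> cfun X - B"
  then obtain e where e: "e > 0" "!!g. g \<in> B ==> \<not> (\<forall>x\<in>topspace X. cmod (f x - g x) \<le> e)" by blast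
  have "disjnt B (F.mball f e)"
   unfolding disjnt_iff
  proof clarify
   fix g assume g: "g \<in> B" "g \<in> F.mball f e"
   then have "mdist ?m f g \<le> e" by (simp del: mspace_cfunspace)
   then show False using small[of f g e] e(2)[OF g(1)] f g B by auto
  qed
  then show "\<exists>r>0. disjnt B (F.mball f r)" using e by blast
 qed
 finally show ?thesis .
qed

lemma compact_space_pointwise_cover:
 assumes X: "compact_space X" and U: "!!x. x \<in> topspace X ==> openin X (U x)"
  "!!x. x \<in> topspace X ==> x \<in> U x"
 obtains J where "finite J" "J \<subseteq> topspace X" "topspace X \<subseteq> \<Union>(U ` J)"
proof -
 have "\<exists>D. finite D \<and> D \<subseteq> U ` topspace X \<and> topspace X \<subseteq> \<Union>D"
  by (rule X[unfolded compact_space_alt, rule_format]) (use U in auto)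
 then show thesis using that by (metis finite_subset_image)
qed

text \<open>Finitely many continuous functions are nearly constant on the members of a suitable partition
 of unity. The tents \<open>max 0 (e - \<Sum>\<bar>f x - f y\<bar>)\<close> built from the functions themselves do it.\<close>

lemma adapted_partition_of_unity:
 fixes F :: "('x => complex) set"
 assumes X: "compact_space X" and fin: "finite F"
  and F: "!!f. f \<in> F ==> continuous_map X euclidean f" and e: "e > 0"
 obtains J :: "'x set" and \<phi> :: "'x => 'x => real" where
  "finite J" "J \<subseteq> topspace X" "!!j. j \<in> J ==> continuous_map X euclidean (\<phi> j)"
  "!!j x. j \<in> J ==> x \<in> topspace X ==> \<phi> j x \<ge> 0"
  "!!x. x \<in> topspace X ==> (\<Sum>j\<in>J. \<phi> j x) = 1"
  "!!f j x. f \<in> F ==> j \<in> J ==> x \<in> topspace X ==> \<phi> j x \<noteq> 0 ==> cmod (f x - f j) \<le> e"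
proof -
 define \<psi> where "\<psi> j x = max 0 (e - (\<Sum>f\<in>F. cmod (f x - f j)))" for j x
 have cont: "continuous_map X euclidean (\<psi> j)" for j
  unfolding \<psi>_def
  by (intro continuous_map_real_max continuous_map_diff continuous_map_sum fin continuous_map_norm)
   (use F in auto)
 have op: "openin X {x\<in>topspace X. \<psi> j x \<in> {0<..}}" for j
  using cont by (intro openin_continuous_map_preimage[of X euclidean]) auto
 have self: "\<psi> x x > 0" for x using e by (simp add: \<psi>_def)
 obtain J where J: "finite J" "J \<subseteq> topspace X"
   "topspace X \<subseteq> \<Union>((\<lambda>j. {x\<in>topspace X. \<psi> j x \<in> {0<..}}) ` J)"
  by (rule compact_space_pointwise_cover[OF X, of "\<lambda>j. {x\<in>topspace X. \<psi> j x \<in> {0<..}}"])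
   (use op self in auto)
 define s where "s x = (\<Sum>j\<in>J. \<psi> j x)" for x
 have nn: "\<psi> j x \<ge> 0" for j x by (simp add: \<psi>_def)
 have spos: "s x > 0" if x: "x \<in> topspace X" for x
 proof -
  obtain j where "j \<in> J" "\<psi> j x > 0" using J(3) x by auto
  then show ?thesis unfolding s_def using J(1) nn by (meson sum_pos2)
 qed
 have conts: "continuous_map X euclidean s"
  unfolding s_def by (intro continuous_map_sum J cont)
 define \<phi> where "\<phi> j x = \<psi> j x / s x" for j x
 show thesis
 proof (rule that[of J \<phi>])
  show "continuous_map X euclidean (\<phi> j)" for j
   unfolding \<phi>_def using spos
   by (intro continuous_map_real_divide cont conts) (metis less_irrefl)
  show "(\<Sum>j\<in>J. \<phi> j x) = 1" if "x \<in> topspace X" for x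
   using spos[OF that] by (simp add: \<phi>_def s_def flip: sum_divide_distrib)
  show "cmod (f x - f j) \<le> e" if "f \<in> F" "\<phi> j x \<noteq> 0" for f j x
  proof -
   have "\<psi> j x \<noteq> 0" using that by (auto simp: \<phi>_def)
   then have "(\<Sum>f\<in>F. cmod (f x - f j)) < e" unfolding \<psi>_def by linarith
   moreover have "cmod (f x - f j) \<le> (\<Sum>f\<in>F. cmod (f x - f j))"
    using that fin by (intro member_le_sum) auto
   ultimately show ?thesis by linarith
  qed
  show "\<phi> j x \<ge> 0" if "x \<in> topspace X" for j x using nn spos[OF that] by (simp add: \<phi>_def)
 qed (use J in auto)
qed

text \<open>A character of \<open>C(X)\<close> is a point evaluation: if it differed from every evaluation, a finite
 sum of functions \<open>\<bar>f - \<omega>(f)\<bar>\<^sup>2\<close> in its kernel would be invertible.\<close>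

lemma character_is_evaluation:
 fixes \<omega> :: "('x => complex) => complex"
 assumes X: "compact_space X"
  and add: "!!f g. f \<in> cfun X ==> g \<in> cfun X ==> \<omega> (cf_add X f g) = \<omega> f + \<omega> g"
  and scale: "!!c f. f \<in> cfun X ==> \<omega> (cf_scale X c f) = c * \<omega> f"
  and mult: "!!f g. f \<in> cfun X ==> g \<in> cfun X ==> \<omega> (cf_mult X f g) = \<omega> f * \<omega> g"
  and one: "\<omega> (cf_one X) = 1"
 obtains x where "x \<in> topspace X" "!!f. f \<in> cfun X ==> \<omega> f = f x"
proof -
 have "\<exists>x\<in>topspace X. \<forall>f\<in>cfun X. \<omega> f = f x"
 proof (rule ccontr)
  assume "\<not> ?thesis"
  then have "\<forall>x\<in>topspace X. \<exists>f. f \<in> cfun X \<and> \<omega> f \<noteq> f x" by auto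
  then obtain F where F: "!!x. x \<in> topspace X ==> F x \<in> cfun X"
    "!!x. x \<in> topspace X ==> \<omega> (F x) \<noteq> F x x" by metis
  define G where "G x = cf_add X (F x) (cf_scale X (- \<omega> (F x)) (cf_one X))" for x
  define H where "H x = cf_mult X (cf_star X (G x)) (G x)" for x
  have G: "G x \<in> cfun X" if "x \<in> topspace X" for x using F that by (simp add: G_def cfun_closed)
  have H: "H x \<in> cfun X" if "x \<in> topspace X" for x using G that by (simp add: H_def cfun_closed)
  have Gchi: "\<omega> (G x) = 0" if "x \<in> topspace X" for x
   using F that by (simp add: G_def cfun_closed add scale one)
  have Hchi: "\<omega> (H x) = 0" if "x \<in> topspace X" for x
   using G that by (simp add: H_def mult Gchi cfun_closed)
  have Hval: "H x y = of_real ((cmod (G x y))\<^sup>2)" if "y \<in> topspace X" for x y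
   using that by (simp add: H_def complex_norm_square[symmetric] mult.commute flip: of_real_power)
  have Gself: "G x x \<noteq> 0" if "x \<in> topspace X" for x
   using F(2)[OF that] that by (auto simp: G_def)
  let ?U = "\<lambda>j. {x\<in>topspace X. G j x \<in> - {0}}"
  have op: "openin X (?U j)" if "j \<in> topspace X" for j
   using G[OF that] by (intro openin_continuous_map_preimage[of X euclidean]) (auto dest: cfun_continuous)
  obtain J where J: "finite J" "J \<subseteq> topspace X" "topspace X \<subseteq> \<Union>(?U ` J)"
   by (rule compact_space_pointwise_cover[OF X, of ?U]) (use op Gself in auto)
  define S where "S I = (\<lambda>x\<in>topspace X. \<Sum>j\<in>I. H j x)" for I
  have S: "S I \<in> cfun X \<and> \<omega> (S I) = 0" if "finite I" "I \<subseteq> topspace X" for I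
   using that
  proof (induction I)
   case empty
   have "S {} = cf_scale X 0 (cf_one X)" by (auto simp: S_def cf_scale_def)
   then show ?case by (simp add: scale cfun_closed)
  next
   case (insert j I)
   have "S (insert j I) = cf_add X (H j) (S I)" using insert by (auto simp: S_def cf_add_def)
   then show ?case using insert by (simp add: H Hchi add cfun_closed)
  qed
  have Snz: "S J x \<noteq> 0" if "x \<in> topspace X" for x
  proof -
   have "x \<in> \<Union>(?U ` J)" using J(3) that by blast
   then obtain j where j: "j \<in> J" "G j x \<noteq> 0" by auto
   have "S J x = of_real (\<Sum>j\<in>J. (cmod (G j x))\<^sup>2)" using that by (simp add: S_def Hval)
   moreover have "(\<Sum>j\<in>J. (cmod (G j x))\<^sup>2) > 0"
    using j J(1) by (intro sum_pos2[of J j]) auto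
   ultimately show ?thesis by (metis less_irrefl of_real_eq_0_iff)
  qed
  define R where "R = (\<lambda>x\<in>topspace X. inverse (S J x))"
  have "continuous_map X euclidean (\<lambda>x. inverse (S J x))"
   using S[OF J(1,2)] Snz by (auto simp: continuous_map_atin cfun_def intro: tendsto_inverse)
  then have R: "R \<in> cfun X" unfolding R_def by (rule restrict_in_cfun)
  have "cf_mult X R (S J) = cf_one X" using Snz by (auto simp: cf_mult_def cf_one_def R_def)
  then show False using mult[OF R, of "S J"] S[OF J(1,2)] one by simp
 qed
 then show thesis using that by blast
qed

section \<open>Positive functionals and the state space\<close>

definition positive_functional :: "'x topology => ('x => complex) set => (('x => complex) => complex) => bool" where
 "positive_functional X A \<phi> \<longleftrightarrow>
   (\<forall>f\<in>A. \<forall>g\<in>A. \<phi> (cf_add X f g) = \<phi> f + \<phi> g) \<and>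
   (\<forall>c. \<forall>f\<in>A. \<phi> (cf_scale X c f) = c * \<phi> f) \<and>
   (\<forall>f\<in>A. (\<forall>x\<in>topspace X. f x \<in> \<real>\<^sub>\<ge>\<^sub>0) \<longrightarrow> \<phi> f \<in> \<real>\<^sub>\<ge>\<^sub>0)"

lemma states_iff:
 "\<phi> \<in> states X A \<longleftrightarrow> \<phi> \<in> extensional A \<and> positive_functional X A \<phi> \<and> \<phi> (cf_one X) = 1"
 by (auto simp: states_def positive_functional_def)

lemma function_systemD:
 assumes "function_system X A"
 shows "A \<subseteq> cfun X" "cf_one X \<in> A"
  "!!f g. f \<in> A ==> g \<in> A ==> cf_add X f g \<in> A" "!!c f. f \<in> A ==> cf_scale X c f \<in> A"
  "!!f. f \<in> A ==> cf_star X f \<in> A" "norm_closed X A"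
 using assms by (auto simp: function_system_def)

lemma function_system_cfun: "compact_space X ==> function_system X (cfun X)"
 by (auto simp: function_system_def cfun_closed norm_closed_iff)

lemma positive_functionalD:
 assumes "positive_functional X A \<phi>"
 shows "!!f g. f \<in> A ==> g \<in> A ==> \<phi> (cf_add X f g) = \<phi> f + \<phi> g"
  "!!c f. f \<in> A ==> \<phi> (cf_scale X c f) = c * \<phi> f"
  "!!f. f \<in> A ==> (!!x. x \<in> topspace X ==> f x \<in> \<real>\<^sub>\<ge>\<^sub>0) ==> \<phi> f \<in> \<real>\<^sub>\<ge>\<^sub>0"
 using assms by (auto simp: positive_functional_def)

lemma positive_functional_real:
 assumes X: "compact_space X" and A: "function_system X A" and \<phi>: "positive_functional X A \<phi>"
  and a: "a \<in> A" "!!x. x \<in> topspace X ==> a x \<in> \<real>"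
 shows "\<phi> a \<in> \<real>"
proof -
 note A' = function_systemD[OF A] and \<phi>' = positive_functionalD[OF \<phi>]
 obtain B where B: "!!x. x \<in> topspace X ==> cmod (a x) \<le> B"
  using cfun_bounded[OF X, of a] a(1) A'(1) by (metis subsetD)
 have 1: "\<phi> (cf_one X) \<in> \<real>\<^sub>\<ge>\<^sub>0" by (intro \<phi>' A') (auto simp: complex_nonneg_Reals_iff)
 have "\<phi> (cf_add X a (cf_scale X (of_real B) (cf_one X))) \<in> \<real>\<^sub>\<ge>\<^sub>0"
 proof (intro \<phi>' A' a)
  fix x assume x: "x \<in> topspace X"
  have "- Re (a x) \<le> B" using B[OF x] abs_Re_le_cmod[of "a x"] by linarith
  then show "cf_add X a (cf_scale X (of_real B) (cf_one X)) x \<in> \<real>\<^sub>\<ge>\<^sub>0"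
   using x a(2)[OF x] by (auto simp: complex_nonneg_Reals_iff complex_is_Real_iff)
 qed
 then have "\<phi> a + of_real B * \<phi> (cf_one X) \<in> \<real>"
  using \<phi>' a A' by (simp add: complex_nonneg_Reals_iff complex_is_Real_iff)
 then show ?thesis using 1 by (simp add: complex_nonneg_Reals_iff complex_is_Real_iff)
qed

lemma positive_functional_star:
 assumes X: "compact_space X" and A: "function_system X A" and \<phi>: "positive_functional X A \<phi>"
  and a: "a \<in> A"
 shows "\<phi> (cf_star X a) = cnj (\<phi> a)"
proof -
 note A' = function_systemD[OF A] and \<phi>' = positive_functionalD[OF \<phi>]
 have "\<phi> (cf_add X a (cf_star X a)) \<in> \<real>"
  by (intro positive_functional_real[OF X A \<phi>] A' a) (auto simp: complex_is_Real_iff)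
 then have 1: "Im (\<phi> a + \<phi> (cf_star X a)) = 0"
  using a A' \<phi>' by (simp add: complex_is_Real_iff)
 have "\<phi> (cf_scale X \<i> (cf_add X a (cf_scale X (-1) (cf_star X a)))) \<in> \<real>"
  by (intro positive_functional_real[OF X A \<phi>] A' a) (auto simp: complex_is_Real_iff)
 then have 2: "Im (\<i> * (\<phi> a - \<phi> (cf_star X a))) = 0"
  using a A' \<phi>' by (simp add: complex_is_Real_iff)
 show ?thesis using 1 2 by (simp add: complex_eq_iff)
qed

lemma positive_functional_Re_nonneg:
 assumes X: "compact_space X" and A: "function_system X A" and \<phi>: "positive_functional X A \<phi>"
  and a: "a \<in> A" "!!x. x \<in> topspace X ==> Re (a x) \<ge> 0"
 shows "Re (\<phi> a) \<ge> 0"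
proof -
 note A' = function_systemD[OF A] and \<phi>' = positive_functionalD[OF \<phi>]
 have "\<phi> (cf_add X a (cf_star X a)) \<in> \<real>\<^sub>\<ge>\<^sub>0"
  by (intro \<phi>' A' a) (auto simp: complex_nonneg_Reals_iff a(2))
 then show ?thesis
  using a A' \<phi>' positive_functional_star[OF X A \<phi> a(1)] by (simp add: complex_nonneg_Reals_iff)
qed

lemma positive_functional_Re_mono:
 assumes X: "compact_space X" and A: "function_system X A" and \<phi>: "positive_functional X A \<phi>"
  and a: "a \<in> A" "b \<in> A" "!!x. x \<in> topspace X ==> Re (a x) \<le> Re (b x)"
 shows "Re (\<phi> a) \<le> Re (\<phi> b)"
proof -
 note A' = function_systemD[OF A] and \<phi>' = positive_functionalD[OF \<phi>]
 have "Re (\<phi> (cf_add X b (cf_scale X (-1) a))) \<ge> 0"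
  by (intro positive_functional_Re_nonneg[OF X A \<phi>] A' a) (auto simp: a(3))
 then show ?thesis using a A' \<phi>' by simp
qed

lemma positive_functional_norm_le:
 assumes X: "compact_space X" and A: "function_system X A" and \<phi>: "positive_functional X A \<phi>"
  and a: "a \<in> A" "!!x. x \<in> topspace X ==> cmod (a x) \<le> B"
 shows "cmod (\<phi> a) \<le> B * Re (\<phi> (cf_one X))"
proof -
 note A' = function_systemD[OF A] and \<phi>' = positive_functionalD[OF \<phi>]
 define u where "u = (if \<phi> a = 0 then 1 else cnj (\<phi> a) / of_real (cmod (\<phi> a)))"
 have u: "cmod u = 1" by (simp add: u_def norm_divide)
 have "u * \<phi> a = of_real (cmod (\<phi> a))"
  by (auto simp: u_def divide_simps complex_norm_square[symmetric] power2_eq_square mult.commute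
    simp flip: of_real_mult)
 then have "cmod (\<phi> a) = Re (\<phi> (cf_scale X u a))" using \<phi>' a by simp
 also have "\<dots> \<le> Re (\<phi> (cf_scale X (of_real B) (cf_one X)))"
 proof (intro positive_functional_Re_mono[OF X A \<phi>] A' a)
  fix x assume x: "x \<in> topspace X"
  have "Re (u * a x) \<le> cmod (u * a x)" by (rule complex_Re_le_cmod)
  also have "\<dots> \<le> B" using a(2)[OF x] u by (simp add: norm_mult)
  finally show "Re (cf_scale X u a x) \<le> Re (cf_scale X (of_real B) (cf_one X) x)" using x by simp
 qed
 finally show ?thesis using \<phi>' A' by simp
qed

lemma state_norm_le:
 assumes "compact_space X" "function_system X A" "\<phi> \<in> states X A"
  and "a \<in> A" "!!x. x \<in> topspace X ==> cmod (a x) \<le> B"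
 shows "cmod (\<phi> a) \<le> B"
 using positive_functional_norm_le[of X A \<phi> a B] assms by (simp add: states_iff)

lemma subtopology_product_eq_top_of_set:
 fixes S :: "('i => 'b::topological_space) set"
 assumes S: "S \<subseteq> extensional I"
 shows "subtopology (product_topology (\<lambda>_. euclidean) I) S = top_of_set S"
  (is "subtopology ?P S = _")
proof -
 have top: "topspace (subtopology ?P S) = S" using S by (auto simp: PiE_def extensional_def)
 have 1: "continuous_map (subtopology ?P S) (top_of_set S) id"
 proof -
  have "continuous_map (subtopology ?P S) euclidean (\<lambda>f. f i)" for i
  proof (cases "i \<in> I")
   case True
   then show ?thesis
    by (intro continuous_map_from_subtopology continuous_map_product_projection[of i I "\<lambda>_. euclidean", simplified])
  next
   case False
   then have eq: "undefined = f i" if "f \<in> topspace (subtopology ?P S)" for f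
    using that S top unfolding extensional_def by auto
   show ?thesis
    by (rule continuous_map_eq[where f = "\<lambda>_. undefined"]) (simp, erule eq)
  qed
  then have "continuous_map (subtopology ?P S) (product_topology (\<lambda>_. euclidean) UNIV) id"
   by (simp add: continuous_map_componentwise_UNIV)
  then show ?thesis
   using top by (simp add: euclidean_product_topology continuous_map_in_subtopology image_subset_iff)
 qed
 have 2: "continuous_map (top_of_set S) (subtopology ?P S) id"
  unfolding continuous_map_in_subtopology continuous_map_componentwise
 proof (intro conjI ballI)
  show "continuous_map (top_of_set S) euclidean (\<lambda>x. id x k)" for k
   using continuous_on_subset[OF continuous_on_product_coordinates[of k] subset_UNIV] by simp
 qed (use S in auto)
 show ?thesis
 proof (rule topology_eq[THEN iffD2], intro allI iffI)
  fix U assume U: "openin (subtopology ?P S) U"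
  then have "U \<subseteq> S" using openin_subset top by blast
  then show "openin (top_of_set S) U"
   using openin_continuous_map_preimage[OF 2 U] by (simp add: Collect_conj_eq Int_absorb1)
 next
  fix U assume U: "openin (top_of_set S) U"
  then have "U \<subseteq> S" using openin_subset by force
  then show "openin (subtopology ?P S) U"
   using openin_continuous_map_preimage[OF 1 U, unfolded top] by (simp add: Collect_conj_eq Int_absorb1)
 qed
qed

lemma state_space_eq_top_of_set: "state_space X A = top_of_set (states X A)"
 unfolding state_space_def by (rule subtopology_product_eq_top_of_set) (auto simp: states_def)

lemma topspace_state_space [simp]: "topspace (state_space X A) = states X A"
 by (simp add: state_space_eq_top_of_set)

lemma Hausdorff_state_space: "Hausdorff_space (state_space X A)"
 by (simp add: state_space_def Hausdorff_space_subtopology Hausdorff_space_product_topology)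

lemma compact_states:
 assumes X: "compact_space X" and A: "function_system X A"
 shows "compact (states X A)"
proof -
 note A' = function_systemD[OF A]
 have "\<exists>B. \<forall>x\<in>topspace X. cmod (a x) \<le> B" if "a \<in> A" for a
  using cfun_bounded[OF X, of a] that A'(1) by (metis subsetD)
 then obtain B where B: "!!a x. a \<in> A ==> x \<in> topspace X ==> cmod (a x) \<le> B a" by metis
 define S :: "_ => complex set" where "S a = (if a \<in> A then cball 0 (B a) else {undefined})" for a
 have "compactin (product_topology (\<lambda>_. euclidean) UNIV) (PiE UNIV S)"
  by (subst compactin_PiE) (auto simp: S_def)
 then have 1: "compact (PiE UNIV S)" by (simp add: euclidean_product_topology)
 have c: "continuous_on UNIV (\<lambda>\<phi> :: ('a => complex) => complex. \<phi> a)" for a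
  by (rule continuous_on_product_coordinates)
 have ne: "closed {\<phi>. (\<phi> a :: complex) \<in> \<real>\<^sub>\<ge>\<^sub>0}" for a :: "'a => complex"
  using closed_vimage[OF closed_nonneg_Reals_complex c] by (simp add: vimage_def)
 have "states X A = {\<phi>. (\<forall>a. a \<notin> A \<longrightarrow> \<phi> a = undefined) \<and>
   (\<forall>f g. f \<in> A \<and> g \<in> A \<longrightarrow> \<phi> (cf_add X f g) = \<phi> f + \<phi> g) \<and>
   (\<forall>c f. f \<in> A \<longrightarrow> \<phi> (cf_scale X c f) = c * \<phi> f) \<and>
   (\<forall>f. f \<in> A \<and> (\<forall>x\<in>topspace X. f x \<in> \<real>\<^sub>\<ge>\<^sub>0) \<longrightarrow> \<phi> f \<in> \<real>\<^sub>\<ge>\<^sub>0) \<and>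
   \<phi> (cf_one X) = 1}"
  unfolding states_def extensional_def by blast
 also have "closed \<dots>"
  by (intro closed_Collect_conj closed_Collect_all closed_Collect_imp open_Collect_const ne
    closed_Collect_eq c continuous_on_add continuous_on_mult continuous_on_const)
 finally have 2: "closed (states X A)" .
 have 3: "states X A \<subseteq> PiE UNIV S"
  using state_norm_le[OF X A] B by (auto simp: S_def states_def extensional_def dist_norm)
 show ?thesis using compact_Int_closed[OF 1 2] 3 by (simp add: Int_absorb1)
qed

lemma compact_state_space:
 "compact_space X ==> function_system X A ==> compact_space (state_space X A)"
 using compact_states[of X A] by (simp add: state_space_eq_top_of_set compact_space_subtopology)

lemma continuous_map_state_eval: "continuous_map (state_space X A) euclidean (\<lambda>\<alpha>. \<alpha> a)"
 using continuous_on_subset[OF continuous_on_product_coordinates[of a] subset_UNIV]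
 by (simp add: state_space_eq_top_of_set)

lemma iota_in_cfun: "iota X A a \<in> cfun (state_space X A)"
 unfolding iota_def by (intro restrict_in_cfun continuous_map_state_eval)

lemma iota_apply [simp]: "\<alpha> \<in> states X A ==> iota X A a \<alpha> = \<alpha> a"
 by (simp add: iota_def)

definition point_state :: "('x => complex) set => 'x => ('x => complex) => complex" where
 "point_state A x = (\<lambda>a\<in>A. a x)"

lemma point_state_in_states:
 "function_system X A ==> x \<in> topspace X ==> point_state A x \<in> states X A"
 by (auto simp: point_state_def states_def function_systemD)

lemma continuous_map_point_state:
 assumes A: "function_system X A"
 shows "continuous_map X (state_space X A) (point_state A)"
proof -
 have "continuous_map X (product_topology (\<lambda>_. euclidean) A) (point_state A)"
  unfolding continuous_map_componentwise using function_systemD(1)[OF A]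
  by (auto simp: point_state_def dest: cfun_continuous)
 then show ?thesis
  unfolding state_space_def continuous_map_in_subtopology
  using point_state_in_states[OF A] by auto
qed

text \<open>If a generating system identified two points, it would lie in the proper C*-subalgebra of
 functions taking equal values there.\<close>

lemma inj_on_point_state:
 assumes X: "compact_space X" "Hausdorff_space X" and A: "function_system X A"
  and gen: "generates_cfun X A"
 shows "inj_on (point_state A) (topspace X)"
proof (rule inj_onI, rule ccontr)
 fix x y assume xy: "x \<in> topspace X" "y \<in> topspace X" "point_state A x = point_state A y" "x \<noteq> y"
 note A' = function_systemD[OF A]
 let ?B = "{f\<in>cfun X. f x = f y}"
 have "norm_closed X ?B"
  unfolding norm_closed_iff[OF X(1)]
 proof (intro conjI ballI impI CollectI)
  fix f assume f: "f \<in> cfun X" "\<forall>e>0. \<exists>g\<in>?B. \<forall>x\<in>topspace X. cmod (f x - g x) \<le> e"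
  have "cmod (f x - f y) \<le> 0 + e" if e: "e > 0" for e
  proof -
   from f(2) e obtain g where g: "g x = g y" "\<forall>x\<in>topspace X. cmod (f x - g x) \<le> e/2"
    by (smt (verit, best) half_gt_zero mem_Collect_eq)
   have "cmod (f x - f y) \<le> cmod (f x - g x) + cmod (f y - g y)"
    using norm_triangle_ineq4[of "f x - g x" "f y - g y"] g(1) by simp
   then show ?thesis using g(2) xy by (smt (verit) field_sum_of_halves)
  qed
  then have "cmod (f x - f y) \<le> 0" by (rule field_le_epsilon)
  then show "f x = f y" by simp
 qed auto
 then have "cstar_subalgebra X ?B"
  unfolding cstar_subalgebra_def using xy by (auto simp: cfun_closed intro!: exI[of _ "cf_one X"])
 moreover have "A \<subseteq> ?B"
 proof
  fix a assume a: "a \<in> A"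
  have "point_state A x a = point_state A y a" using xy(3) by simp
  then show "a \<in> ?B" using a A'(1) by (auto simp: point_state_def)
 qed
 ultimately have sub: "cfun X \<subseteq> ?B" using gen unfolding generates_cfun_def by blast
 have "closedin X {x}" "closedin X {y}" "disjnt {x} {y}"
  using xy X by (auto simp: closedin_Hausdorff_singleton)
 then obtain f where f: "continuous_map X euclideanreal f" "f ` {x} \<subseteq> {0}" "f ` {y} \<subseteq> {1}"
  using Urysohn_lemma_alt[OF compact_Hausdorff_or_regular_imp_normal_space] X by metis
 have "(\<lambda>x\<in>topspace X. complex_of_real (f x)) \<in> cfun X"
  by (intro restrict_in_cfun continuous_map_of_real f)
 with sub have "complex_of_real (f x) = of_real (f y)" using xy(1,2) by auto
 then show False using f by simp
qed

lemma cfun_extend_along_embedding: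
 assumes X: "compact_space X" and K: "compact_space K" "Hausdorff_space K"
  and e: "continuous_map X K e" "inj_on e (topspace X)" and f: "f \<in> cfun X"
 obtains g where "g \<in> cfun K" "!!x. x \<in> topspace X ==> g (e x) = f x"
proof -
 have closed: "closed_map X K e" by (rule continuous_imp_closed_map) fact+
 have "embedding_map X K e"
  by (rule injective_closed_imp_embedding_map[OF e(1) closed e(2)])
 then obtain e' where e': "homeomorphic_maps X (subtopology K (e ` topspace X)) e e'"
  unfolding embedding_map_def homeomorphic_map_maps by blast
 have S: "closedin K (e ` topspace X)" using closed by (simp add: closed_map_def)
 have N: "normal_space K" by (rule compact_Hausdorff_or_regular_imp_normal_space) (use K in auto)
 have ext: "\<exists>g. continuous_map K euclideanreal g \<and> (\<forall>x\<in>topspace X. g (e x) = h x)"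
  if h: "continuous_map X euclideanreal h" for h
 proof -
  have c: "continuous_map (subtopology K (e ` topspace X)) euclideanreal (h \<circ> e')"
   using e' h by (intro continuous_map_compose) (auto simp: homeomorphic_maps_def)
  obtain g where "continuous_map K euclideanreal g" "!!y. y \<in> e ` topspace X ==> g y = (h \<circ> e') y"
   using Tietze_extension_realinterval[OF N S is_interval_univ UNIV_not_empty c subset_UNIV] by metis
  then show ?thesis using e' by (auto simp: homeomorphic_maps_def intro!: exI[of _ g])
 qed
 obtain g1 where g1: "continuous_map K euclideanreal g1" "\<forall>x\<in>topspace X. g1 (e x) = Re (f x)"
  using ext[OF continuous_map_Re[OF cfun_continuous[OF f]]] by blast
 obtain g2 where g2: "continuous_map K euclideanreal g2" "\<forall>x\<in>topspace X. g2 (e x) = Im (f x)"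
  using ext[OF continuous_map_Im[OF cfun_continuous[OF f]]] by blast
 have "(\<lambda>k\<in>topspace K. complex_of_real (g1 k) + \<i> * complex_of_real (g2 k)) \<in> cfun K"
  by (intro restrict_in_cfun continuous_map_add continuous_map_times continuous_map_of_real g1 g2) auto
 then show thesis
  by (rule that) (use g1 g2 e(1) in \<open>auto simp: continuous_map_def complex_eq_iff Pi_def\<close>)
qed

text \<open>The situation of the theorem, with \<open>q\<close> a left inverse of \<^const>\<open>iota\<close> on \<open>A\<close>. Then
 \<open>f \<mapsto> q f x\<close> is a character, hence evaluation at some state \<open>k\<close>, and \<open>k a = q (iota a) x = a x\<close>.\<close>

lemma quotient_eval:
 fixes q :: "((('x => complex) => complex) => complex) => 'x => complex"
 assumes X: "compact_space X" and A: "function_system X A"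
  and q: "star_hom (state_space X A) X q" "!!a. a \<in> A ==> q (iota X A a) = a"
  and f: "f \<in> cfun (state_space X A)" and x: "x \<in> topspace X"
 shows "q f x = f (point_state A x)"
proof -
 let ?K = "state_space X A"
 have one: "iota X A (cf_one X) = cf_one ?K"
  by (auto simp: iota_def cf_one_def restrict_def fun_eq_iff states_def)
 obtain k where k: "k \<in> topspace ?K" "!!f. f \<in> cfun ?K ==> q f x = f k"
 proof (rule character_is_evaluation[OF compact_state_space[OF X A], of "\<lambda>f. q f x"])
  show "q (cf_one ?K) x = 1"
   using q(2)[of "cf_one X"] function_systemD(2)[OF A] x by (simp flip: one)
 qed (use q(1) x in \<open>auto simp: star_hom_def\<close>)
 have "k = point_state A x"
 proof (rule extensionalityI[of _ A])
  fix a assume a: "a \<in> A"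
  show "k a = point_state A x a"
   using k(2)[OF iota_in_cfun, of a] k(1) q(2)[OF a] a by (simp add: point_state_def)
 qed (use k(1) in \<open>auto simp: states_def point_state_def\<close>)
 then show ?thesis using k(2)[OF f] by simp
qed

lemma adjoint_point_eq:
 fixes q :: "((('x => complex) => complex) => complex) => 'x => complex"
 assumes X: "compact_space X" and A: "function_system X A"
  and q: "star_hom (state_space X A) X q" "!!a. a \<in> A ==> q (iota X A a) = a"
  and x: "x \<in> topspace X"
 shows "adjoint_point (state_space X A) q x = point_state A x"
 unfolding adjoint_point_def
proof (rule the_equality)
 show "point_state A x \<in> topspace (state_space X A) \<and>
   (\<forall>f\<in>cfun (state_space X A). q f x = f (point_state A x))"
  using quotient_eval[OF X A q _ x] point_state_in_states[OF A x] by simp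
next
 fix k assume k: "k \<in> topspace (state_space X A) \<and> (\<forall>f\<in>cfun (state_space X A). q f x = f k)"
 show "k = point_state A x"
 proof (rule extensionalityI[of _ A])
  fix a assume a: "a \<in> A"
  have "q (iota X A a) x = iota X A a k" using k iota_in_cfun by blast
  then show "k a = point_state A x a" using k q(2)[OF a] a by (simp add: point_state_def)
 qed (use k in \<open>auto simp: states_def point_state_def\<close>)
qed

section \<open>Regular Borel measures on a compact Hausdorff space\<close>

lemma space_borel_of_top [simp]: "space (borel_of_top X) = topspace X"
 unfolding borel_of_top_def by (rule space_measure_of) (auto dest: openin_subset)

lemma sets_borel_of_top: "sets (borel_of_top X) = sigma_sets (topspace X) {U. openin X U}"
 unfolding borel_of_top_def by (rule sets_measure_of) (auto dest: openin_subset)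

lemma openin_sets:
 assumes "sets \<mu> = sets (borel_of_top X)" "openin X U"
 shows "U \<in> sets \<mu>"
 using assms by (auto simp: sets_borel_of_top)

lemma space_eq_topspace: "sets \<mu> = sets (borel_of_top X) ==> space \<mu> = topspace X"
 using sets_eq_imp_space_eq[of \<mu> "borel_of_top X"] by simp

lemma compactin_sets:
 assumes "Hausdorff_space X" "sets \<mu> = sets (borel_of_top X)" "compactin X C"
 shows "C \<in> sets \<mu>"
proof -
 have "openin X (topspace X - C)" using compactin_imp_closedin[OF assms(1,3)] by blast
 then have "space \<mu> - (topspace X - C) \<in> sets \<mu>" using openin_sets[OF assms(2)] by blast
 moreover have "space \<mu> - (topspace X - C) = C"
  using space_eq_topspace[OF assms(2)] compactin_subset_topspace[OF assms(3)] by auto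
 ultimately show ?thesis by simp
qed

lemma continuous_map_measurable_borel_of_top:
 assumes \<mu>: "sets \<mu> = sets (borel_of_top X)" and f: "continuous_map X Y f"
 shows "f \<in> measurable \<mu> (borel_of_top Y)"
 unfolding borel_of_top_def[of Y]
proof (rule measurable_measure_of)
 show "{U. openin Y U} \<subseteq> Pow (topspace Y)" by (auto dest: openin_subset)
 show "f \<in> space \<mu> \<rightarrow> topspace Y"
  using f by (auto simp: space_eq_topspace[OF \<mu>] continuous_map_def)
 fix U assume "U \<in> {U. openin Y U}"
 then have "openin X {x \<in> topspace X. f x \<in> U}"
  using f openin_continuous_map_preimage by blast
 moreover have "f -` U \<inter> space \<mu> = {x \<in> topspace X. f x \<in> U}"
  by (auto simp: space_eq_topspace[OF \<mu>])
 ultimately show "f -` U \<inter> space \<mu> \<in> sets \<mu>" using openin_sets[OF \<mu>] by simp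
qed

lemma continuous_map_borel_measurable:
 assumes "sets \<mu> = sets (borel_of_top X)" "continuous_map X euclidean f"
 shows "f \<in> borel_measurable \<mu>"
proof -
 have "borel_of_top euclidean = (borel :: 'b measure)"
  by (simp add: borel_of_top_def borel_def)
 then show ?thesis using continuous_map_measurable_borel_of_top[OF assms] by simp
qed

lemma continuous_map_integrable:
 fixes f :: "'x => 'b::{banach, second_countable_topology}"
 assumes X: "compact_space X" and \<mu>: "sets \<mu> = sets (borel_of_top X)" "finite_measure \<mu>"
  and f: "continuous_map X euclidean f"
 shows "integrable \<mu> f"
proof -
 interpret finite_measure \<mu> by fact
 obtain B where "!!x. x \<in> topspace X ==> norm (f x) \<le> B" using continuous_map_bounded[OF X f] by metis
 then show ?thesis
  using continuous_map_borel_measurable[OF \<mu>(1) f] space_eq_topspace[OF \<mu>(1)]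
  by (intro integrable_const_bound[where B = B]) auto
qed

lemma pos_regular_measuresD:
 assumes "\<mu> \<in> pos_regular_measures X"
 shows "sets \<mu> = sets (borel_of_top X)" "finite_measure \<mu>"
 using assms by (auto simp: pos_regular_measures_def)

text \<open>On a compact Hausdorff space a finite Borel measure is regular as soon as each Borel set
 can be squeezed between a compact and an open set of nearly the same measure.\<close>

lemma regular_iff_squeezed:
 assumes X: "compact_space X" "Hausdorff_space X"
  and \<mu>: "sets \<mu> = sets (borel_of_top X)" "finite_measure \<mu>"
 shows "\<mu> \<in> pos_regular_measures X \<longleftrightarrow>
  (\<forall>E\<in>sets \<mu>. \<forall>e>0. \<exists>C U. compactin X C \<and> openin X U \<and> C \<subseteq> E \<and> E \<subseteq> U \<and>
    measure \<mu> U \<le> measure \<mu> C + e)" (is "_ \<longleftrightarrow> ?R")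
proof -
 interpret finite_measure \<mu> by fact
 note op = openin_sets[OF \<mu>(1)] and cp = compactin_sets[OF X(2) \<mu>(1)]
 show ?thesis
 proof
  assume reg: "\<mu> \<in> pos_regular_measures X"
  show ?R
  proof (intro ballI allI impI)
   fix E e assume E: "E \<in> sets \<mu>" and e: "(e::real) > 0"
   let ?\<U> = "{U. openin X U \<and> E \<subseteq> U}" and ?\<C> = "{C. C \<in> sets \<mu> \<and> compactin X C \<and> C \<subseteq> E}"
   have eq: "emeasure \<mu> E = (INF U\<in>?\<U>. emeasure \<mu> U)" "emeasure \<mu> E = (SUP C\<in>?\<C>. emeasure \<mu> C)"
    using reg E unfolding pos_regular_measures_def by blast+
   have "(INF U\<in>?\<U>. emeasure \<mu> U) < ennreal (measure \<mu> E + e/2)"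
    unfolding eq(1)[symmetric] by (simp add: emeasure_eq_measure e ennreal_less_iff)
   then obtain U where U: "openin X U" "E \<subseteq> U" "emeasure \<mu> U < ennreal (measure \<mu> E + e/2)"
    by (auto simp: INF_less_iff)
   then have 1: "measure \<mu> U \<le> measure \<mu> E + e/2"
    using e by (simp add: emeasure_eq_measure ennreal_less_iff del: ennreal_plus)
   have "\<exists>C. compactin X C \<and> C \<subseteq> E \<and> measure \<mu> E - e/2 \<le> measure \<mu> C"
   proof (cases "measure \<mu> E - e/2 < 0")
    case True
    then show ?thesis by (intro exI[of _ "{}"]) auto
   next
    case False
    then have "ennreal (measure \<mu> E - e/2) < (SUP C\<in>?\<C>. emeasure \<mu> C)"
     unfolding eq(2)[symmetric] using e by (simp add: emeasure_eq_measure ennreal_less_iff)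
    then obtain C where "compactin X C" "C \<subseteq> E" "ennreal (measure \<mu> E - e/2) < emeasure \<mu> C"
     by (auto simp: less_SUP_iff)
    then show ?thesis
     using False by (intro exI[of _ C]) (auto simp: emeasure_eq_measure ennreal_less_iff)
   qed
   then show "\<exists>C U. compactin X C \<and> openin X U \<and> C \<subseteq> E \<and> E \<subseteq> U \<and> measure \<mu> U \<le> measure \<mu> C + e"
    using U 1 by (smt (verit) field_sum_of_halves)
  qed
 next
  assume R: ?R
  have "emeasure \<mu> E = (INF U\<in>{U. openin X U \<and> E \<subseteq> U}. emeasure \<mu> U) \<and>
    emeasure \<mu> E = (SUP C\<in>{C. C \<in> sets \<mu> \<and> compactin X C \<and> C \<subseteq> E}. emeasure \<mu> C)"
   if E: "E \<in> sets \<mu>" for E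
  proof (intro conjI antisym INF_greatest SUP_least)
   show "(INF U\<in>{U. openin X U \<and> E \<subseteq> U}. emeasure \<mu> U) \<le> emeasure \<mu> E"
   proof (rule ennreal_le_epsilon)
    fix e :: real assume "e > 0"
    obtain C U where CU: "compactin X C" "openin X U" "C \<subseteq> E" "E \<subseteq> U"
     "measure \<mu> U \<le> measure \<mu> C + e"
     using R[rule_format, OF E \<open>e > 0\<close>] by metis
    have "measure \<mu> C \<le> measure \<mu> E" using CU E by (intro finite_measure_mono) auto
    then have "emeasure \<mu> U \<le> emeasure \<mu> E + ennreal e"
     using CU \<open>e > 0\<close> by (simp add: emeasure_eq_measure flip: ennreal_plus)
    then show "(INF U\<in>{U. openin X U \<and> E \<subseteq> U}. emeasure \<mu> U) \<le> emeasure \<mu> E + ennreal e"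
     using CU by (intro INF_lower2[of U]) auto
   qed
   show "emeasure \<mu> E \<le> (SUP C\<in>{C. C \<in> sets \<mu> \<and> compactin X C \<and> C \<subseteq> E}. emeasure \<mu> C)"
   proof (rule ennreal_le_epsilon)
    fix e :: real assume "e > 0"
    obtain C U where CU: "compactin X C" "openin X U" "C \<subseteq> E" "E \<subseteq> U"
     "measure \<mu> U \<le> measure \<mu> C + e"
     using R[rule_format, OF E \<open>e > 0\<close>] by metis
    have "measure \<mu> E \<le> measure \<mu> U" using CU E op by (intro finite_measure_mono) auto
    then have "emeasure \<mu> E \<le> emeasure \<mu> C + ennreal e"
     using CU \<open>e > 0\<close> by (simp add: emeasure_eq_measure flip: ennreal_plus)
    also have "\<dots> \<le> (SUP C\<in>{C. C \<in> sets \<mu> \<and> compactin X C \<and> C \<subseteq> E}. emeasure \<mu> C) + ennreal e"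
     using CU cp by (intro add_right_mono SUP_upper) auto
    finally show "emeasure \<mu> E \<le> \<dots>" .
   qed
  qed (use E op in \<open>auto intro!: emeasure_mono\<close>)
  then show "\<mu> \<in> pos_regular_measures X" using \<mu> unfolding pos_regular_measures_def by blast
 qed
qed

lemma regular_squeeze:
 assumes "compact_space X" "Hausdorff_space X" "\<mu> \<in> pos_regular_measures X" "E \<in> sets \<mu>" "e > 0"
 obtains C U where "compactin X C" "openin X U" "C \<subseteq> E" "E \<subseteq> U" "measure \<mu> U \<le> measure \<mu> C + e"
 using regular_iff_squeezed[of X \<mu>] assms pos_regular_measuresD[OF assms(3)] by metis

text \<open>Since complements exchange compact and open sets, approximation from one side suffices.\<close>

lemma regularI_compact:
 assumes X: "compact_space X" "Hausdorff_space X"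
  and \<mu>: "sets \<mu> = sets (borel_of_top X)" "finite_measure \<mu>"
  and inner: "!!E e. E \<in> sets \<mu> ==> e > 0 ==> \<exists>C. compactin X C \<and> C \<subseteq> E \<and> measure \<mu> E \<le> measure \<mu> C + e"
 shows "\<mu> \<in> pos_regular_measures X"
 unfolding regular_iff_squeezed[OF X \<mu>]
proof (intro ballI allI impI)
 interpret finite_measure \<mu> by fact
 fix E and e :: real assume E: "E \<in> sets \<mu>" and e: "e > 0"
 note sp = space_eq_topspace[OF \<mu>(1)]
 obtain C where C: "compactin X C" "C \<subseteq> E" "measure \<mu> E \<le> measure \<mu> C + e/2"
  using inner[OF E, of "e/2"] e by auto
 obtain D where D: "compactin X D" "D \<subseteq> space \<mu> - E" "measure \<mu> (space \<mu> - E) \<le> measure \<mu> D + e/2"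
  using inner[of "space \<mu> - E" "e/2"] E e by auto
 have Ds: "D \<in> sets \<mu>" by (rule compactin_sets[OF X(2) \<mu>(1) D(1)])
 have "measure \<mu> (space \<mu> - D) = measure \<mu> (space \<mu>) - measure \<mu> D"
  using Ds by (rule finite_measure_compl)
 moreover have "measure \<mu> (space \<mu> - E) = measure \<mu> (space \<mu>) - measure \<mu> E"
  using E by (rule finite_measure_compl)
 ultimately have "measure \<mu> (space \<mu> - D) \<le> measure \<mu> C + e" using C D by linarith
 moreover have "openin X (topspace X - D)" using compactin_imp_closedin[OF X(2) D(1)] by blast
 moreover have "E \<subseteq> topspace X - D" using D sets.sets_into_space[OF E] sp by auto
 ultimately show "\<exists>C U. compactin X C \<and> openin X U \<and> C \<subseteq> E \<and> E \<subseteq> U \<and> measure \<mu> U \<le> measure \<mu> C + e"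
  using C sp by auto
qed

lemma regular_distr:
 assumes X: "compact_space X" "Hausdorff_space X" and K: "compact_space K" "Hausdorff_space K"
  and \<mu>: "\<mu> \<in> pos_regular_measures X" and e: "continuous_map X K e"
 shows "distr \<mu> (borel_of_top K) e \<in> pos_regular_measures K"
proof (rule regularI_compact[OF K])
 note \<mu>' = pos_regular_measuresD[OF \<mu>]
 interpret finite_measure \<mu> by (rule \<mu>')
 have m: "e \<in> measurable \<mu> (borel_of_top K)"
  by (rule continuous_map_measurable_borel_of_top[OF \<mu>'(1) e])
 show "finite_measure (distr \<mu> (borel_of_top K) e)" by (rule finite_measure_distr[OF m])
 show "sets (distr \<mu> (borel_of_top K) e) = sets (borel_of_top K)" by simp
 fix E and r :: real assume E: "E \<in> sets (distr \<mu> (borel_of_top K) e)" and r: "r > 0"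
 let ?E = "e -` E \<inter> space \<mu>"
 have Es: "?E \<in> sets \<mu>" using E m by (auto intro: measurable_sets)
 obtain C U where C: "compactin X C" "openin X U" "C \<subseteq> ?E" "?E \<subseteq> U" "measure \<mu> U \<le> measure \<mu> C + r"
  using regular_squeeze[OF X \<mu> Es r] .
 have eC: "compactin K (e ` C)" using image_compactin[OF C(1) e] .
 then have eCs: "e ` C \<in> sets (borel_of_top K)" using compactin_sets[OF K(2) refl] by blast
 have "measure \<mu> ?E \<le> measure \<mu> U" using C openin_sets[OF \<mu>'(1)] by (intro finite_measure_mono) auto
 moreover have "measure \<mu> C \<le> measure \<mu> (e -` (e ` C) \<inter> space \<mu>)"
  using C m eCs by (intro finite_measure_mono) (auto intro: measurable_sets)
 ultimately have "measure (distr \<mu> (borel_of_top K) e) E \<le> measure (distr \<mu> (borel_of_top K) e) (e ` C) + r"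
  using C E eCs by (simp add: measure_distr[OF m])
 then show "\<exists>D. compactin K D \<and> D \<subseteq> E \<and>
   measure (distr \<mu> (borel_of_top K) e) E \<le> measure (distr \<mu> (borel_of_top K) e) D + r"
  using eC C(3) by (intro exI[of _ "e ` C"]) auto
qed

lemma Urysohn_compact_open:
 assumes X: "compact_space X" "Hausdorff_space X" and C: "compactin X C" and U: "openin X U" "C \<subseteq> U"
 obtains f where "continuous_map X euclideanreal f" "!!x. x \<in> topspace X ==> 0 \<le> f x \<and> f x \<le> 1"
  "!!x. x \<in> C ==> f x = 1" "!!x. x \<in> topspace X - U ==> f x = 0"
proof -
 have "normal_space X" using X compact_Hausdorff_or_regular_imp_normal_space by blast
 moreover have "closedin X C" by (rule compactin_imp_closedin[OF X(2) C])
 moreover have "closedin X (topspace X - U)" using U by auto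
 ultimately obtain f where f: "continuous_map X (top_of_set {0..1::real}) f"
   "f ` (topspace X - U) \<subseteq> {0}" "f ` C \<subseteq> {1}"
  using Urysohn_lemma[of X "topspace X - U" C 0 1] U(2) by (auto simp: disjnt_def)
 show thesis
  by (rule that[of f]) (use f in \<open>auto simp: continuous_map_in_subtopology image_subset_iff\<close>)
qed

text \<open>By Urysohn the integrals of continuous functions determine the measure of open sets.\<close>

lemma regular_measure_eqI:
 assumes X: "compact_space X" "Hausdorff_space X"
  and \<mu>: "\<mu> \<in> pos_regular_measures X" and \<nu>: "\<nu> \<in> pos_regular_measures X"
  and int: "!!f. f \<in> cfun X ==> (\<integral>x. f x \<partial>\<mu>) = (\<integral>x. f x \<partial>\<nu>)"
 shows "\<mu> = \<nu>"
proof -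
 have half: "measure M1 E \<le> measure M2 E + e"
  if M: "M1 \<in> pos_regular_measures X" "M2 \<in> pos_regular_measures X"
   and int: "!!f. f \<in> cfun X ==> (\<integral>x. f x \<partial>M1) = (\<integral>x. f x \<partial>M2)"
   and E: "E \<in> sets M1" and e: "e > 0" for M1 M2 E and e :: real
 proof -
  note M1 = pos_regular_measuresD[OF M(1)] and M2 = pos_regular_measuresD[OF M(2)]
  interpret M1: finite_measure M1 by (rule M1)
  interpret M2: finite_measure M2 by (rule M2)
  obtain C U where C: "compactin X C" "openin X U" "C \<subseteq> E" "E \<subseteq> U" "measure M1 U \<le> measure M1 C + e/2"
   using regular_squeeze[OF X M(1) E, of "e/2"] e by auto
  have E2: "E \<in> sets M2" using E M1 M2 by simp
  obtain D V where D: "compactin X D" "openin X V" "D \<subseteq> E" "E \<subseteq> V" "measure M2 V \<le> measure M2 D + e/2"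
   using regular_squeeze[OF X M(2) E2, of "e/2"] e by auto
  obtain f where f: "continuous_map X euclideanreal f" "!!x. x \<in> topspace X ==> 0 \<le> f x \<and> f x \<le> 1"
   "!!x. x \<in> C ==> f x = 1" "!!x. x \<in> topspace X - V ==> f x = 0"
   using Urysohn_compact_open[OF X C(1) D(2)] C D by blast
  have "(\<lambda>x\<in>topspace X. complex_of_real (f x)) \<in> cfun X"
   by (intro restrict_in_cfun continuous_map_of_real f)
  note eq = int[OF this]
  have "(\<integral>x. (\<lambda>x\<in>topspace X. complex_of_real (f x)) x \<partial>M1) = (\<integral>x. complex_of_real (f x) \<partial>M1)"
   using space_eq_topspace[OF M1(1)] by (intro Bochner_Integration.integral_cong) auto
  moreover have "(\<integral>x. (\<lambda>x\<in>topspace X. complex_of_real (f x)) x \<partial>M2) = (\<integral>x. complex_of_real (f x) \<partial>M2)"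
   using space_eq_topspace[OF M2(1)] by (intro Bochner_Integration.integral_cong) auto
  ultimately have "complex_of_real (\<integral>x. f x \<partial>M1) = of_real (\<integral>x. f x \<partial>M2)"
   using eq by simp
  then have eq': "(\<integral>x. f x \<partial>M1) = (\<integral>x. f x \<partial>M2)" by simp
  have "measure M1 C = (\<integral>x. indicator C x \<partial>M1)"
   using compactin_sets[OF X(2) M1(1) C(1)] by simp
  also have "\<dots> \<le> (\<integral>x. f x \<partial>M1)"
  proof (rule integral_mono)
   show "integrable M1 (indicat_real C)"
    using compactin_sets[OF X(2) M1(1) C(1)] by (simp add: M1.emeasure_eq_measure)
   show "integrable M1 f" by (rule continuous_map_integrable[OF X(1) M1 f(1)])
   show "indicator C x \<le> f x" if "x \<in> space M1" for x
    using f that space_eq_topspace[OF M1(1)] by (auto simp: indicator_def)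
  qed
  also have "\<dots> = (\<integral>x. f x \<partial>M2)" by (rule eq')
  also have "\<dots> \<le> (\<integral>x. indicator V x \<partial>M2)"
  proof (rule integral_mono)
   show "integrable M2 (indicat_real V)"
    using openin_sets[OF M2(1) D(2)] by (simp add: M2.emeasure_eq_measure)
   show "integrable M2 f" by (rule continuous_map_integrable[OF X(1) M2 f(1)])
   show "f x \<le> indicator V x" if "x \<in> space M2" for x
    using f that space_eq_topspace[OF M2(1)] by (auto simp: indicator_def)
  qed
  also have "\<dots> = measure M2 V" using openin_sets[OF M2(1) D(2)] by simp
  finally have "measure M1 C \<le> measure M2 V" .
  moreover have "measure M1 E \<le> measure M1 U"
   using C openin_sets[OF M1(1)] by (intro M1.finite_measure_mono) auto
  moreover have "measure M2 D \<le> measure M2 E"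
   using D E2 by (intro M2.finite_measure_mono) auto
  ultimately show ?thesis using C D by linarith
 qed
 note \<mu>' = pos_regular_measuresD[OF \<mu>] and \<nu>' = pos_regular_measuresD[OF \<nu>]
 show ?thesis
 proof (rule measure_eqI)
  show "sets \<mu> = sets \<nu>" using \<mu>' \<nu>' by simp
  fix E assume E: "E \<in> sets \<mu>"
  have "measure \<mu> E \<le> measure \<nu> E"
   by (rule field_le_epsilon) (use half[OF \<mu> \<nu> int E] in auto)
  moreover have "measure \<nu> E \<le> measure \<mu> E"
   by (rule field_le_epsilon) (use half[OF \<nu> \<mu> int[symmetric]] E \<mu>' \<nu>' in auto)
  ultimately show "emeasure \<mu> E = emeasure \<nu> E"
   using finite_measure.emeasure_eq_measure[OF \<mu>'(2)] finite_measure.emeasure_eq_measure[OF \<nu>'(2)]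
   by simp
 qed
qed

section \<open>The Riesz representation theorem for measures\<close>

locale radon_functional =
 fixes Z :: "'z topology" and I :: "('z => real) => real"
 assumes compact: "compact_space Z" and Hausdorff: "Hausdorff_space Z"
  and add: "!!f g. continuous_map Z euclidean f ==> continuous_map Z euclidean g ==>
     I (\<lambda>x. f x + g x) = I f + I g"
  and scale: "!!c f. continuous_map Z euclidean f ==> I (\<lambda>x. c * f x) = c * I f"
  and pos: "!!f. continuous_map Z euclidean f ==> (!!x. x \<in> topspace Z ==> f x \<ge> 0) ==> I f \<ge> 0"
begin

lemma mono:
 assumes f: "continuous_map Z euclidean f" and g: "continuous_map Z euclidean g"
  and le: "!!x. x \<in> topspace Z ==> f x \<le> g x"
 shows "I f \<le> I g"
proof -
 have d: "continuous_map Z euclidean (\<lambda>x. g x - f x)" by (intro continuous_map_diff f g)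
 have "I (\<lambda>x. f x + (g x - f x)) = I f + I (\<lambda>x. g x - f x)" by (rule add[OF f d])
 moreover have "I (\<lambda>x. g x - f x) \<ge> 0" using le by (intro pos d) auto
 ultimately show ?thesis by simp
qed

lemma cong:
 assumes "continuous_map Z euclidean f" "continuous_map Z euclidean g"
  "!!x. x \<in> topspace Z ==> f x = g x"
 shows "I f = I g"
 using mono[of f g] mono[of g f] assms by (simp add: antisym)

lemma const: "I (\<lambda>x. c) = c * I (\<lambda>x. 1)"
 using scale[of "\<lambda>x. 1" c] by simp

lemma sum:
 assumes "finite J" "!!j. j \<in> J ==> continuous_map Z euclidean (f j)"
 shows "I (\<lambda>x. \<Sum>j\<in>J. f j x) = (\<Sum>j\<in>J. I (f j))"
 using assms
proof (induction J)
 case empty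
 then show ?case using const[of 0] by simp
next
 case (insert a J)
 then show ?case by (simp add: add continuous_map_sum)
qed

definition above :: "'z set => ('z => real) set" where
 "above C = {f. continuous_map Z euclidean f \<and> (\<forall>x\<in>topspace Z. f x \<ge> 0) \<and> (\<forall>x\<in>C \<inter> topspace Z. f x \<ge> 1)}"

text \<open>The content of a compact set, from which the measure of open sets is obtained by inner and
 that of all sets by outer approximation.\<close>

definition content :: "'z set => real" where
 "content C = (INF f\<in>above C. I f)"

definition inner_content :: "'z set => ennreal" where
 "inner_content U = (SUP C\<in>{C. compactin Z C \<and> C \<subseteq> U}. ennreal (content C))"

definition outer_content :: "'z set => ennreal" where
 "outer_content E = (INF U\<in>{U. openin Z U \<and> E \<subseteq> U}. inner_content U)"

lemma one_above [simp]: "(\<lambda>x. 1) \<in> above C" by (simp add: above_def)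

lemma above_nonempty [simp]: "above C \<noteq> {}"
 using one_above[of C] by blast

lemma above_bdd: "bdd_below (I ` above C)"
 by (rule bdd_belowI2[of _ 0]) (auto simp: above_def intro: pos)

lemma content_le: "f \<in> above C ==> content C \<le> I f"
 unfolding content_def by (rule cINF_lower[OF above_bdd])

lemma content_nonneg: "content C \<ge> 0"
 unfolding content_def by (rule cINF_greatest) (simp, auto simp: above_def intro!: pos)

lemma content_approx:
 assumes "e > 0"
 obtains f where "f \<in> above C" "I f < content C + e"
proof -
 have "(INF f\<in>above C. I f) < content C + e" using assms by (simp add: content_def)
 then show thesis
  using that one_above[of C] by (subst (asm) cINF_less_iff[OF _ above_bdd]) auto
qed

lemma content_le_total: "content C \<le> I (\<lambda>x. 1)"
 by (rule content_le) simp

lemma content_Un_le: "content (C \<union> D) \<le> content C + content D"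
proof (rule field_le_epsilon)
 fix e :: real assume "e > 0"
 then obtain f g where f: "f \<in> above C" "I f < content C + e/2" and g: "g \<in> above D" "I g < content D + e/2"
  by (meson content_approx half_gt_zero)
 have "(\<lambda>x. f x + g x) \<in> above (C \<union> D)"
  unfolding above_def
 proof (intro CollectI conjI ballI)
  fix x assume x: "x \<in> (C \<union> D) \<inter> topspace Z"
  then have "f x \<ge> 0" "g x \<ge> 0" "f x \<ge> 1 \<or> g x \<ge> 1" using f g by (auto simp: above_def)
  then show "f x + g x \<ge> 1" by auto
 qed (use f g in \<open>auto simp: above_def intro: continuous_map_add\<close>)
 then have "content (C \<union> D) \<le> I f + I g"
  using content_le[of "\<lambda>x. f x + g x"] add[of f g] f g by (auto simp: above_def)
 then show "content (C \<union> D) \<le> content C + content D + e" using f g by linarith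
qed

lemma content_Un_disjoint:
 assumes C: "compactin Z C" and D: "compactin Z D" and disj: "C \<inter> D = {}"
 shows "content C + content D \<le> content (C \<union> D)"
proof (rule field_le_epsilon)
 fix e :: real assume "e > 0"
 then obtain f where f: "f \<in> above (C \<union> D)" "I f < content (C \<union> D) + e"
  using content_approx by metis
 have "openin Z (topspace Z - D)" "C \<subseteq> topspace Z - D"
  using compactin_imp_closedin[OF Hausdorff D] compactin_subset_topspace[OF C] disj by auto
 then obtain h where h: "continuous_map Z euclideanreal h" "!!x. x \<in> topspace Z ==> 0 \<le> h x \<and> h x \<le> 1"
  "!!x. x \<in> C ==> h x = 1" "!!x. x \<in> topspace Z - (topspace Z - D) ==> h x = 0"
  using Urysohn_compact_open[OF compact Hausdorff C] by metis
 have cf: "continuous_map Z euclidean f" using f by (simp add: above_def)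
 have 1: "(\<lambda>x. f x * h x) \<in> above C"
  using f h by (auto simp: above_def intro: continuous_map_times)
 have 2: "(\<lambda>x. f x * (1 - h x)) \<in> above D"
  unfolding above_def
 proof (intro CollectI conjI ballI)
  show "continuous_map Z euclideanreal (\<lambda>x. f x * (1 - h x))"
   by (intro continuous_map_times continuous_map_diff cf h) auto
 qed (use f h in \<open>auto simp: above_def\<close>)
 have "content C + content D \<le> I (\<lambda>x. f x * h x) + I (\<lambda>x. f x * (1 - h x))"
  using content_le[OF 1] content_le[OF 2] by simp
 also have "\<dots> = I (\<lambda>x. f x * h x + f x * (1 - h x))"
  using 1 2 by (intro add[symmetric]) (auto simp: above_def)
 also have "(\<lambda>x. f x * h x + f x * (1 - h x)) = f" by (auto simp: algebra_simps)
 finally show "content C + content D \<le> content (C \<union> D) + e" using f by linarith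
qed

lemma inner_content_upper: "compactin Z C ==> C \<subseteq> U ==> ennreal (content C) \<le> inner_content U"
 unfolding inner_content_def by (intro SUP_upper) auto

lemma inner_content_le_total: "inner_content U \<le> ennreal (I (\<lambda>x. 1))"
 unfolding inner_content_def by (intro SUP_least ennreal_leI content_le_total)

lemma inner_content_mono: "U \<subseteq> V ==> inner_content U \<le> inner_content V"
 unfolding inner_content_def by (intro SUP_subset_mono) auto

lemma inner_content_empty: "inner_content {} = 0"
proof -
 have "content {} \<le> 0" using content_le[of "\<lambda>x. 0" "{}"] const[of 0] by (simp add: above_def)
 then show ?thesis using content_nonneg[of "{}"]
  by (auto simp: inner_content_def intro!: antisym SUP_least)
qed

lemma inner_content_Un_le:
 assumes U: "openin Z U" and V: "openin Z V"
 shows "inner_content (U \<union> V) \<le> inner_content U + inner_content V"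
 unfolding inner_content_def[of "U \<union> V"]
proof (rule SUP_least, clarify)
 fix C assume C: "compactin Z C" "C \<subseteq> U \<union> V"
 note Cc = compactin_imp_closedin[OF Hausdorff C(1)]
 have CU: "closedin Z (C - U)" and CV: "closedin Z (C - V)" using U V Cc by (auto intro: closedin_diff)
 have "normal_space Z" using compact Hausdorff compact_Hausdorff_or_regular_imp_normal_space by blast
 moreover have "disjnt (C - U) (C - V)" using C by (auto simp: disjnt_def)
 ultimately obtain G H where G: "openin Z G" "openin Z H" "C - U \<subseteq> G" "C - V \<subseteq> H" "disjnt G H"
  using CU CV unfolding normal_space_def by metis
 have K1: "compactin Z (C - G)" and K2: "compactin Z (C - H)"
  using G Cc compact by (auto intro!: closedin_compact_space closedin_diff)
 have "content C \<le> content (C - G) + content (C - H)"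
  using content_Un_le[of "C - G" "C - H"] G(5) by (simp add: disjnt_def flip: Diff_Int)
 then have "ennreal (content C) \<le> ennreal (content (C - G)) + ennreal (content (C - H))"
  by (simp add: content_nonneg flip: ennreal_plus)
 also have "\<dots> \<le> inner_content U + inner_content V"
  using G K1 K2 by (intro add_mono inner_content_upper) auto
 finally show "ennreal (content C) \<le> inner_content U + inner_content V" .
qed

lemma inner_content_UN_finite:
 assumes "!!i::nat. openin Z (U i)"
 shows "inner_content (\<Union>i<n. U i) \<le> (\<Sum>i<n. inner_content (U i))"
proof (induction n)
 case 0
 then show ?case by (simp add: inner_content_empty)
next
 case (Suc n)
 have "(\<Union>i<Suc n. U i) = (\<Union>i<n. U i) \<union> U n" by (auto simp: less_Suc_eq)
 then have "inner_content (\<Union>i<Suc n. U i) \<le> inner_content (\<Union>i<n. U i) + inner_content (U n)"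
  using assms by (auto intro!: inner_content_Un_le openin_Union)
 then show ?case using Suc by (auto intro: order_trans add_right_mono)
qed

lemma inner_content_UN:
 assumes U: "!!i::nat. openin Z (U i)"
 shows "inner_content (\<Union>i. U i) \<le> (\<Sum>i. inner_content (U i))"
 unfolding inner_content_def[of "\<Union>i. U i"]
proof (rule SUP_least, clarify)
 fix C assume C: "compactin Z C" "C \<subseteq> (\<Union>i. U i)"
 then obtain D where D: "finite D" "D \<subseteq> range U" "C \<subseteq> \<Union>D"
  using U unfolding compactin_def by (metis (no_types, lifting) rangeE)
 then obtain J where J: "finite J" "D = U ` J" by (metis finite_subset_image top_greatest)
 obtain n where n: "J \<subseteq> {..<n}" using J(1) finite_nat_iff_bounded by blast
 have "C \<subseteq> (\<Union>i<n. U i)" using D J n by blast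
 then have "ennreal (content C) \<le> inner_content (\<Union>i<n. U i)"
  by (rule inner_content_upper[OF C(1)])
 also have "\<dots> \<le> (\<Sum>i<n. inner_content (U i))" by (rule inner_content_UN_finite[OF U])
 also have "\<dots> \<le> (\<Sum>i. inner_content (U i))" by (rule sum_le_suminf) auto
 finally show "ennreal (content C) \<le> (\<Sum>i. inner_content (U i))" .
qed

lemma outer_content_open: "openin Z U ==> outer_content U = inner_content U"
 unfolding outer_content_def by (intro antisym INF_greatest INF_lower inner_content_mono) auto

lemma outer_content_mono: "E \<subseteq> F ==> outer_content E \<le> outer_content F"
 unfolding outer_content_def by (intro INF_superset_mono) auto

lemma outer_content_finite: "E \<subseteq> topspace Z ==> outer_content E < \<infinity>"
proof -
 assume "E \<subseteq> topspace Z"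
 then have "outer_content E \<le> inner_content (topspace Z)"
  unfolding outer_content_def by (intro INF_lower) auto
 also have "\<dots> < \<infinity>" using inner_content_le_total[of "topspace Z"] by (simp add: le_less_trans)
 finally show ?thesis .
qed

lemma outer_content_approx:
 assumes "E \<subseteq> topspace Z" "e > 0"
 obtains U where "openin Z U" "E \<subseteq> U" "inner_content U \<le> outer_content E + ennreal e"
proof -
 have "(INF U\<in>{U. openin Z U \<and> E \<subseteq> U}. inner_content U) < outer_content E + ennreal e"
  using outer_content_finite[OF assms(1)] assms(2) unfolding outer_content_def[symmetric]
  by (simp add: ennreal_add_left_cancel_less[of _ 0, simplified])
 then show thesis using that by (auto simp: INF_less_iff less_imp_le)
qed

lemma outer_measure_space_outer_content: "outer_measure_space (Pow (topspace Z)) outer_content"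
 unfolding outer_measure_space_def
proof (intro conjI)
 show "positive (Pow (topspace Z)) outer_content"
  using outer_content_open[of "{}"] by (simp add: positive_def inner_content_empty)
 show "increasing (Pow (topspace Z)) outer_content"
  by (auto simp: increasing_def intro: outer_content_mono)
 show "countably_subadditive (Pow (topspace Z)) outer_content"
  unfolding countably_subadditive_def
 proof (intro allI impI)
  fix E :: "nat => 'z set" assume E: "range E \<subseteq> Pow (topspace Z)"
  show "outer_content (\<Union>i. E i) \<le> (\<Sum>i. outer_content (E i))"
  proof (rule ennreal_le_epsilon)
   fix e :: real assume e: "e > 0"
   have "\<exists>U. openin Z U \<and> E i \<subseteq> U \<and> inner_content U \<le> outer_content (E i) + ennreal (e * (1/2)^Suc i)" for i
    using outer_content_approx[of "E i" "e * (1/2)^Suc i"] E e by (metis UNIV_I image_subset_iff mult_pos_pos Pow_iff zero_less_power half_gt_zero zero_less_one)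
   then obtain U where U: "!!i. openin Z (U i)" "!!i. E i \<subseteq> U i"
     "!!i. inner_content (U i) \<le> outer_content (E i) + ennreal (e * (1/2)^Suc i)" by metis
   have "outer_content (\<Union>i. E i) \<le> outer_content (\<Union>i. U i)"
    using U(2) by (intro outer_content_mono) blast
   also have "\<dots> = inner_content (\<Union>i. U i)" using U(1) by (intro outer_content_open) auto
   also have "\<dots> \<le> (\<Sum>i. inner_content (U i))" by (rule inner_content_UN[OF U(1)])
   also have "\<dots> \<le> (\<Sum>i. outer_content (E i) + ennreal (e * (1/2)^Suc i))"
    by (intro suminf_le U) auto
   also have "\<dots> = (\<Sum>i. outer_content (E i)) + (\<Sum>i. ennreal (e * (1/2)^Suc i))"
    by (intro suminf_add[symmetric]) auto
   also have "(\<Sum>i. ennreal (e * (1/2)^Suc i)) = ennreal e"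
    using e power_half_series sums_mult[OF power_half_series, of e]
    by (intro suminf_ennreal_eq) (auto simp del: power_Suc)
   finally show "outer_content (\<Union>i. E i) \<le> (\<Sum>i. outer_content (E i)) + ennreal e" .
  qed
 qed
qed

text \<open>Open sets split the outer content: exhaust \<open>W \<inter> U\<close> by a compact \<open>C\<close>, then \<open>W - C\<close> by a
 compact \<open>D\<close>; these are disjoint and lie in \<open>W\<close>.\<close>

lemma open_split:
 assumes U: "openin Z U" and W: "openin Z W"
 shows "outer_content (W \<inter> U) + outer_content (W - U) \<le> outer_content W"
proof -
 have WU: "openin Z (W \<inter> U)" using U W by blast
 have "inner_content (W \<inter> U) + outer_content (W - U) \<le> inner_content W"
  unfolding inner_content_def[of "W \<inter> U"]
 proof (subst ennreal_SUP_add_left[symmetric])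
  show "{C. compactin Z C \<and> C \<subseteq> W \<inter> U} \<noteq> {}" by (auto intro: exI[of _ "{}"])
  show "(SUP C\<in>{C. compactin Z C \<and> C \<subseteq> W \<inter> U}. ennreal (content C) + outer_content (W - U)) \<le> inner_content W"
  proof (rule SUP_least, clarify)
   fix C assume C: "compactin Z C" "C \<subseteq> W \<inter> U"
   have WC: "openin Z (W - C)" using W compactin_imp_closedin[OF Hausdorff C(1)] by blast
   have "outer_content (W - U) \<le> inner_content (W - C)"
    using outer_content_mono[of "W - U" "W - C"] outer_content_open[OF WC] C by auto
   then have "ennreal (content C) + outer_content (W - U) \<le> ennreal (content C) + inner_content (W - C)"
    by (rule add_left_mono)
   also have "\<dots> = (SUP D\<in>{D. compactin Z D \<and> D \<subseteq> W - C}. ennreal (content C) + ennreal (content D))"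
    unfolding inner_content_def by (subst ennreal_SUP_add_right) (auto intro: exI[of _ "{}"])
   also have "\<dots> \<le> inner_content W"
   proof (rule SUP_least, clarify)
    fix D assume D: "compactin Z D" "D \<subseteq> W - C"
    have "ennreal (content C) + ennreal (content D) \<le> ennreal (content (C \<union> D))"
     using content_Un_disjoint[OF C(1) D(1)] D by (auto simp: content_nonneg simp flip: ennreal_plus)
    also have "\<dots> \<le> inner_content W"
     using C D by (intro inner_content_upper compactin_Un) auto
    finally show "ennreal (content C) + ennreal (content D) \<le> inner_content W" .
   qed
   finally show "ennreal (content C) + outer_content (W - U) \<le> inner_content W" .
  qed
 qed
 then show ?thesis by (simp add: outer_content_open WU W)
qed

lemma openin_lambda_system:
 assumes U: "openin Z U"
 shows "U \<in> lambda_system (topspace Z) (Pow (topspace Z)) outer_content"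
 unfolding lambda_system_def
proof (intro CollectI conjI ballI)
 show "U \<in> Pow (topspace Z)" using openin_subset[OF U] by simp
 fix E assume E: "E \<in> Pow (topspace Z)"
 show "outer_content (U \<inter> E) + outer_content ((topspace Z - U) \<inter> E) = outer_content E"
 proof (rule antisym)
  show "outer_content (U \<inter> E) + outer_content ((topspace Z - U) \<inter> E) \<le> outer_content E"
  proof (rule ennreal_le_epsilon)
   fix e :: real assume "e > 0"
   then obtain W where W: "openin Z W" "E \<subseteq> W" "inner_content W \<le> outer_content E + ennreal e"
    using outer_content_approx E by (metis Pow_iff)
   have "outer_content (U \<inter> E) + outer_content ((topspace Z - U) \<inter> E) \<le>
     outer_content (W \<inter> U) + outer_content (W - U)"
    using W by (intro add_mono outer_content_mono) auto
   also have "\<dots> \<le> inner_content W" using open_split[OF U W(1)] outer_content_open[OF W(1)] by simp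
   finally show "outer_content (U \<inter> E) + outer_content ((topspace Z - U) \<inter> E) \<le> outer_content E + ennreal e"
    using W(3) by (rule order_trans)
  qed
  have "subadditive (Pow (topspace Z)) outer_content"
   using outer_measure_space_outer_content unfolding outer_measure_space_def
   by (intro ring_of_sets.countably_subadditive_subadditive) (auto intro: algebra.axioms algebra_Pow sigma_algebra_Pow sigma_algebra.axioms)
  moreover have "U \<inter> E \<union> (topspace Z - U) \<inter> E = E" using E by auto
  ultimately show "outer_content E \<le> outer_content (U \<inter> E) + outer_content ((topspace Z - U) \<inter> E)"
   using subadditiveD[of "Pow (topspace Z)" outer_content "U \<inter> E" "(topspace Z - U) \<inter> E"] E by auto
 qed
qed

definition radon_measure :: "'z measure" where
 "radon_measure = measure_of (topspace Z) {U. openin Z U} outer_content"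

lemma sets_radon_measure: "sets radon_measure = sets (borel_of_top Z)"
proof -
 have "{U. openin Z U} \<subseteq> Pow (topspace Z)" by (auto dest: openin_subset)
 then show ?thesis by (simp add: radon_measure_def sets_borel_of_top)
qed

lemma emeasure_radon_measure:
 assumes "E \<in> sets radon_measure"
 shows "emeasure radon_measure E = outer_content E"
proof -
 let ?L = "lambda_system (topspace Z) (Pow (topspace Z)) outer_content"
 interpret P: sigma_algebra "topspace Z" "Pow (topspace Z)" by (rule sigma_algebra_Pow)
 have L: "measure_space (topspace Z) ?L outer_content"
  by (rule P.caratheodory_lemma[OF outer_measure_space_outer_content])
 then have sub: "sets radon_measure \<subseteq> ?L"
  unfolding sets_radon_measure sets_borel_of_top
  using openin_lambda_system unfolding measure_space_def by (intro sigma_algebra.sigma_sets_subset) auto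
 show ?thesis
 proof (rule emeasure_measure_of[OF radon_measure_def])
  show "positive (sets radon_measure) outer_content"
   using L by (simp add: measure_space_def positive_def)
  show "countably_additive (sets radon_measure) outer_content"
   using L sub unfolding measure_space_def countably_additive_def
   by (meson order_trans subsetD)
 qed (use assms in \<open>auto dest: openin_subset\<close>)
qed

lemma emeasure_radon_measure_open:
 "openin Z U ==> emeasure radon_measure U = inner_content U"
 using emeasure_radon_measure openin_sets[OF sets_radon_measure] outer_content_open by simp

lemma emeasure_radon_measure_total: "emeasure radon_measure (topspace Z) = ennreal (I (\<lambda>x. 1))"
proof -
 have "I (\<lambda>x. 1) \<le> content (topspace Z)"
  unfolding content_def by (rule cINF_greatest) (simp, auto simp: above_def intro!: mono)
 then have "ennreal (I (\<lambda>x. 1)) \<le> inner_content (topspace Z)"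
  using inner_content_upper[of "topspace Z" "topspace Z"] compact
  by (meson compact_space_def ennreal_leI order_refl order_trans)
 then show ?thesis
  using inner_content_le_total[of "topspace Z"] by (simp add: emeasure_radon_measure_open antisym)
qed

lemma finite_radon_measure: "finite_measure radon_measure"
 using emeasure_radon_measure_total space_eq_topspace[OF sets_radon_measure]
 by (intro finite_measureI) simp

lemma measure_radon_measure_total: "measure radon_measure (topspace Z) = I (\<lambda>x. 1)"
 using emeasure_radon_measure_total pos[of "\<lambda>x. 1"] by (simp add: measure_def)

lemma radon_measure_regular: "radon_measure \<in> pos_regular_measures Z"
proof (rule regularI_compact[OF compact Hausdorff sets_radon_measure finite_radon_measure])
 interpret finite_measure radon_measure by (rule finite_radon_measure)
 note sp = space_eq_topspace[OF sets_radon_measure]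
 fix E and e :: real assume E: "E \<in> sets radon_measure" and e: "e > 0"
 have E': "topspace Z - E \<in> sets radon_measure" using E by (simp flip: sp)
 obtain U where U: "openin Z U" "topspace Z - E \<subseteq> U" "inner_content U \<le> outer_content (topspace Z - E) + ennreal e"
  using outer_content_approx[of "topspace Z - E" e] e by auto
 have "emeasure radon_measure U \<le> emeasure radon_measure (topspace Z - E) + ennreal e"
  using U(3) by (simp add: emeasure_radon_measure_open U(1) emeasure_radon_measure[OF E'])
 then have "measure radon_measure U \<le> measure radon_measure (topspace Z - E) + e"
  using e by (simp add: emeasure_eq_measure flip: ennreal_plus)
 moreover have "measure radon_measure (topspace Z - U) = measure radon_measure (topspace Z) - measure radon_measure U"
  using finite_measure_compl[OF openin_sets[OF sets_radon_measure U(1)]] sp by simp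
 moreover have "measure radon_measure (topspace Z - E) = measure radon_measure (topspace Z) - measure radon_measure E"
  using finite_measure_compl[OF E] sp by simp
 moreover have "compactin Z (topspace Z - U)"
  using U(1) by (intro closedin_compact_space[OF compact]) auto
 moreover have "topspace Z - U \<subseteq> E" using U(2) by auto
 ultimately show "\<exists>C. compactin Z C \<and> C \<subseteq> E \<and> measure radon_measure E \<le> measure radon_measure C + e"
  by (intro exI[of _ "topspace Z - U"]) auto
qed

lemma le_measure_support:
 assumes g: "continuous_map Z euclidean g" "!!x. x \<in> topspace Z ==> 0 \<le> g x \<and> g x \<le> 1"
 shows "I g \<le> measure radon_measure {x\<in>topspace Z. g x > 0}" (is "_ \<le> measure _ ?U")
proof -
 interpret finite_measure radon_measure by (rule finite_radon_measure)
 have U: "openin Z ?U"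
  using openin_continuous_map_preimage[OF g(1), of "{0<..}"] by simp
 have one: "I (\<lambda>x. 1) \<ge> 0" by (rule pos) auto
 have *: "I g \<le> measure radon_measure ?U + e * I (\<lambda>x. 1)" if e: "e > 0" for e
 proof -
  let ?C = "{x\<in>topspace Z. g x \<ge> e}"
  have "closedin Z ?C"
   using closedin_continuous_map_preimage[OF g(1), of "{e..}"] by simp
  then have C: "compactin Z ?C" by (rule closedin_compact_space[OF compact])
  have "I g \<le> content ?C + e * I (\<lambda>x. 1)"
  proof (rule field_le_epsilon)
   fix d :: real assume "d > 0"
   then obtain f where f: "f \<in> above ?C" "I f < content ?C + d" by (rule content_approx)
   have "I g \<le> I (\<lambda>x. f x + e * 1)"
   proof (rule mono)
    fix x assume x: "x \<in> topspace Z"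
    then show "g x \<le> f x + e * 1"
     using f(1) g(2)[OF x] e by (cases "g x \<ge> e") (force simp: above_def)+
   qed (use f g in \<open>auto simp: above_def intro!: continuous_map_add\<close>)
   also have "\<dots> = I f + e * I (\<lambda>x. 1)" using f const[of e] by (subst add) (auto simp: above_def)
   finally show "I g \<le> content ?C + e * I (\<lambda>x. 1) + d" using f(2) by linarith
  qed
  moreover have "ennreal (content ?C) \<le> emeasure radon_measure ?U"
   unfolding emeasure_radon_measure_open[OF U] using e by (intro inner_content_upper C) auto
  then have "content ?C \<le> measure radon_measure ?U" by (simp add: emeasure_eq_measure)
  ultimately show ?thesis by simp
 qed
 show ?thesis
 proof (rule field_le_epsilon)
  fix d :: real assume d: "d > 0"
  have "d / (I (\<lambda>x. 1) + 1) * I (\<lambda>x. 1) \<le> d"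
   using d one by (simp add: divide_simps algebra_simps)
  then show "I g \<le> measure radon_measure ?U + d"
   using *[of "d / (I (\<lambda>x. 1) + 1)"] d one by (smt (verit) divide_pos_pos)
 qed
qed

lemma sum_clamp:
 fixes t :: real
 assumes "t \<ge> 0"
 shows "(\<Sum>j<n. min (max (t - real j) 0) 1) = min t (real n)"
 using assms by (induction n) auto

text \<open>Slice \<open>f\<close> horizontally into \<open>n\<close> layers of height \<open>1/n\<close>. Each layer is at most \<open>1/n\<close> times
 the measure of its support, and the supports add up to at most \<open>n f + 1\<close>.\<close>

lemma le_integral_unit:
 assumes f: "continuous_map Z euclidean f" "!!x. x \<in> topspace Z ==> 0 \<le> f x \<and> f x \<le> 1"
 shows "I f \<le> (\<integral>x. f x \<partial>radon_measure)"
proof -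
 interpret finite_measure radon_measure by (rule finite_radon_measure)
 note sp = space_eq_topspace[OF sets_radon_measure]
 let ?m = "measure radon_measure (topspace Z)"
 have intf: "integrable radon_measure f"
  by (rule continuous_map_integrable[OF compact sets_radon_measure finite_radon_measure f(1)])
 have layer: "real n * I f \<le> real n * (\<integral>x. f x \<partial>radon_measure) + ?m" for n :: nat
 proof -
  define g where "g j x = min (max (real n * f x - real j) 0) 1" for j x
  have g: "continuous_map Z euclidean (g j)" for j
   unfolding g_def by (intro continuous_map_real_min continuous_map_real_max continuous_map_diff
     continuous_map_times f) auto
  have sum_g: "(\<Sum>j<n. g j x) = real n * f x" if "x \<in> topspace Z" for x
   using sum_clamp[of "real n * f x" n] f(2)[OF that] by (simp add: g_def mult_left_le)
  let ?S = "\<lambda>j. {x\<in>topspace Z. g j x > 0}"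
  have S: "?S j \<in> sets radon_measure" for j
   using openin_continuous_map_preimage[OF g, of "{0<..}" j] openin_sets[OF sets_radon_measure] by simp
  have "real n * I f = I (\<lambda>x. \<Sum>j<n. g j x)"
   unfolding scale[OF f(1), symmetric]
   by (rule cong) (use sum_g g f in \<open>auto intro!: continuous_map_sum continuous_map_times\<close>)
  also have "\<dots> = (\<Sum>j<n. I (g j))" by (rule sum) (use g in auto)
  also have "\<dots> \<le> (\<Sum>j<n. measure radon_measure (?S j))"
   by (intro sum_mono le_measure_support g) (auto simp: g_def)
  also have "\<dots> = (\<Sum>j<n. (\<integral>x. indicator (?S j) x \<partial>radon_measure))"
   using S by (intro sum.cong) auto
  also have "\<dots> = (\<integral>x. (\<Sum>j<n. indicator (?S j) x) \<partial>radon_measure)"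
   using S by (subst Bochner_Integration.integral_sum) (auto simp: emeasure_eq_measure)
  also have "\<dots> \<le> (\<integral>x. real n * f x + 1 \<partial>radon_measure)"
  proof (rule integral_mono)
   show "integrable radon_measure (\<lambda>x. \<Sum>j<n. indicat_real (?S j) x)"
    using S by (intro Bochner_Integration.integrable_sum) (auto simp: emeasure_eq_measure)
   show "integrable radon_measure (\<lambda>x. real n * f x + 1)" using intf by simp
   fix x assume "x \<in> space radon_measure"
   then have x: "x \<in> topspace Z" using sp by simp
   let ?t = "real n * f x"
   have t: "?t \<ge> 0" using f(2)[OF x] by simp
   have "(\<Sum>j<n. indicat_real (?S j) x) \<le> (\<Sum>j<n. min (max (?t + 1 - real j) 0) 1)"
    by (intro sum_mono) (auto simp: indicator_def g_def)
   also have "\<dots> = min (?t + 1) (real n)" using t by (intro sum_clamp) auto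
   finally show "(\<Sum>j<n. indicat_real (?S j) x) \<le> ?t + 1" by linarith
  qed
  also have "\<dots> = real n * (\<integral>x. f x \<partial>radon_measure) + ?m"
   using intf by (simp add: sp)
  finally show ?thesis .
 qed
 show ?thesis
 proof (rule field_le_epsilon)
  fix e :: real assume e: "e > 0"
  obtain n :: nat where n: "real n * e > ?m" using reals_Archimedean3[OF e] by blast
  then have "real n > 0" using e measure_nonneg[of radon_measure "topspace Z"]
   by (metis less_le_trans not_less of_nat_0_less_iff gr0I mult_zero_left of_nat_0)
  have "real n * I f \<le> real n * ((\<integral>x. f x \<partial>radon_measure) + e)"
   using layer[of n] n by (simp add: algebra_simps)
  then show "I f \<le> (\<integral>x. f x \<partial>radon_measure) + e" using \<open>real n > 0\<close> by simp
 qed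
qed

lemma le_integral:
 assumes f: "continuous_map Z euclidean f"
 shows "I f \<le> (\<integral>x. f x \<partial>radon_measure)"
proof -
 interpret finite_measure radon_measure by (rule finite_radon_measure)
 note sp = space_eq_topspace[OF sets_radon_measure]
 obtain B where B: "B \<ge> 0" "!!x. x \<in> topspace Z ==> norm (f x) \<le> B"
  by (rule continuous_map_bounded[OF compact f]) (rule that)
 define r where "r = 1 / (2 * B + 1)"
 have r: "r > 0" using B by (simp add: r_def)
 have intf: "integrable radon_measure f"
  by (rule continuous_map_integrable[OF compact sets_radon_measure finite_radon_measure f])
 have c: "continuous_map Z euclidean (\<lambda>x. r * f x)" by (intro continuous_map_times f) auto
 have "I (\<lambda>x. r * f x + r * B) \<le> (\<integral>x. r * f x + r * B \<partial>radon_measure)"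
 proof (rule le_integral_unit)
  show "continuous_map Z euclideanreal (\<lambda>x. r * f x + r * B)" by (intro continuous_map_add c) auto
  fix x assume x: "x \<in> topspace Z"
  have "0 \<le> r * (f x + B)" using B(2)[OF x] r by (intro mult_nonneg_nonneg) auto
  moreover have "r * (f x + B) \<le> r * (2 * B + 1)" using B(2)[OF x] r by (intro mult_left_mono) auto
  moreover have "r * (2 * B + 1) = 1" using B(1) by (simp add: r_def)
  ultimately show "0 \<le> r * f x + r * B \<and> r * f x + r * B \<le> 1" by (simp add: algebra_simps)
 qed
 moreover have "I (\<lambda>x. r * f x + r * B) = r * I f + r * B * I (\<lambda>x. 1)"
  using add[OF c, of "\<lambda>x. r * B"] scale[OF f, of r] const[of "r * B"] by simp
 moreover have "(\<integral>x. r * f x + r * B \<partial>radon_measure) = r * (\<integral>x. f x \<partial>radon_measure) + r * B * I (\<lambda>x. 1)"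
  using intf measure_radon_measure_total by (simp add: sp)
 ultimately show ?thesis using r by simp
qed

lemma integral_radon_measure:
 assumes f: "continuous_map Z euclidean f"
 shows "(\<integral>x. f x \<partial>radon_measure) = I f"
proof (rule antisym)
 have "I (\<lambda>x. - 1 * f x) \<le> (\<integral>x. - 1 * f x \<partial>radon_measure)"
  by (rule le_integral) (intro continuous_map_times f, auto)
 then show "(\<integral>x. f x \<partial>radon_measure) \<le> I f" using scale[OF f, of "-1"] by simp
qed (rule le_integral[OF f])

end

theorem Riesz_representation_measure:
 assumes Z: "compact_space Z" "Hausdorff_space Z" and \<phi>: "positive_functional Z (cfun Z) \<phi>"
 obtains \<nu> where "\<nu> \<in> pos_regular_measures Z" "!!f. f \<in> cfun Z ==> (\<integral>x. f x \<partial>\<nu>) = \<phi> f"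
proof -
 note A = function_system_cfun[OF Z(1)] and \<phi>' = positive_functionalD[OF \<phi>]
 define emb where "emb f = (\<lambda>x\<in>topspace Z. complex_of_real (f x))" for f
 define I where "I f = Re (\<phi> (emb f))" for f
 have emb: "emb f \<in> cfun Z" if "continuous_map Z euclidean f" for f
  unfolding emb_def by (intro restrict_in_cfun continuous_map_of_real that)
 have emb_add: "emb (\<lambda>x. f x + g x) = cf_add Z (emb f) (emb g)" for f g
  by (auto simp: emb_def cf_add_def)
 have emb_scale: "emb (\<lambda>x. c * f x) = cf_scale Z (of_real c) (emb f)" for c f
  by (auto simp: emb_def cf_scale_def)
 interpret radon_functional Z I
 proof
  show "I f \<ge> 0" if "continuous_map Z euclidean f" "!!x. x \<in> topspace Z ==> f x \<ge> 0" for f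
   unfolding I_def using that by (intro positive_functional_Re_nonneg[OF Z(1) A \<phi>] emb) (auto simp: emb_def)
 qed (use Z emb in \<open>auto simp: I_def emb_add emb_scale \<phi>'\<close>)
 have "(\<integral>x. f x \<partial>radon_measure) = \<phi> f" if f: "f \<in> cfun Z" for f
 proof -
  note cf = continuous_map_Re[OF cfun_continuous[OF f]] continuous_map_Im[OF cfun_continuous[OF f]]
  have real: "\<phi> (emb g) = of_real (I g)" if "continuous_map Z euclidean g" for g
   using positive_functional_real[OF Z(1) A \<phi> emb[OF that]] by (auto simp: emb_def I_def complex_is_Real_iff complex_eq_iff)
  have "f = cf_add Z (emb (\<lambda>x. Re (f x))) (cf_scale Z \<i> (emb (\<lambda>x. Im (f x))))"
   by (rule cfun_eqI[OF f]) (use emb[OF cf(1)] emb[OF cf(2)] in \<open>auto simp: cfun_closed\<close>, simp add: emb_def complex_eq_iff)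
  then have "\<phi> f = of_real (I (\<lambda>x. Re (f x))) + \<i> * of_real (I (\<lambda>x. Im (f x)))"
   using \<phi>' emb cf by (metis cf_scale_in real)
  also have "\<dots> = (\<integral>x. f x \<partial>radon_measure)"
   using continuous_map_integrable[OF Z(1) sets_radon_measure finite_radon_measure cfun_continuous[OF f]]
   by (simp add: integral_radon_measure[OF cf(1), symmetric] integral_radon_measure[OF cf(2), symmetric] complex_eq_iff)
  finally show ?thesis by simp
 qed
 then show thesis using that radon_measure_regular by blast
qed

section \<open>Hilbert spaces\<close>

text \<open>The discriminant argument behind every Cauchy-Schwarz inequality below.\<close>

lemma complex_discriminant:
 fixes z :: complex and p r :: real
 assumes "!!c. 0 \<le> p + 2 * Re (c * z) + (cmod c)\<^sup>2 * r" and "0 \<le> r"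
 shows "(cmod z)\<^sup>2 \<le> p * r"
proof (cases "r = 0")
 case True
 have "z = 0"
 proof (rule ccontr)
  assume z: "z \<noteq> 0"
  let ?s = "(p + 1) / (2 * (cmod z)\<^sup>2)"
  have "0 \<le> p + 2 * Re ((- of_real ?s * cnj z) * z)" using assms(1)[of "- of_real ?s * cnj z"] True by simp
  also have "(- of_real ?s * cnj z) * z = - of_real (?s * (cmod z)\<^sup>2)"
   using complex_norm_square[of z] by (simp add: mult.commute)
  finally have "0 \<le> p - 2 * (?s * (cmod z)\<^sup>2)" by (simp del: of_real_mult of_real_divide)
  then show False using z by (simp add: field_simps)
 qed
 then show ?thesis using True by simp
next
 case False
 then have r: "r > 0" using assms(2) by simp
 have "0 \<le> p + 2 * Re ((- of_real (1/r) * cnj z) * z) + (cmod (- of_real (1/r) * cnj z))\<^sup>2 * r"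
  by (rule assms(1))
 also have "(- of_real (1/r) * cnj z) * z = - of_real ((cmod z)\<^sup>2 / r)"
  using complex_norm_square[of z] by (simp add: mult.commute)
 also have "(cmod (- of_real (1/r) * cnj z))\<^sup>2 * r = (cmod z)\<^sup>2 / r"
  using r by (simp add: norm_mult power2_eq_square norm_divide)
 finally have "0 \<le> p - (cmod z)\<^sup>2 / r" by (simp del: of_real_divide)
 then show ?thesis using r by (simp add: field_simps)
qed

context hilbert_space
begin

abbreviation sub :: "'h => 'h => 'h" where
 "sub x y \<equiv> hadd H x (hscale H (-1) y)"

lemmas closed [simp] = zero_closed add_closed scale_closed

lemma inner_add_right:
 "x \<in> hcarrier H ==> y \<in> hcarrier H ==> z \<in> hcarrier H ==>
  hinner H x (hadd H y z) = hinner H x y + hinner H x z"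
 using inner_commute[of "hadd H y z" x] inner_commute[of y x] inner_commute[of z x] by (simp add: inner_add)

lemma inner_scale_right:
 "x \<in> hcarrier H ==> y \<in> hcarrier H ==> hinner H x (hscale H c y) = cnj c * hinner H x y"
 using inner_commute[of "hscale H c y" x] inner_commute[of y x] by (simp add: inner_scale)

lemmas inner_simps = inner_add inner_scale inner_add_right inner_scale_right

lemma scale_zero: "x \<in> hcarrier H ==> hscale H 0 x = hzero H"
 by (rule inner_definite) (auto simp: inner_scale)

lemma inner_zero_left [simp]: "y \<in> hcarrier H ==> hinner H (hzero H) y = 0"
 using inner_scale[of "hzero H" y 0] by (simp add: scale_zero)

lemma inner_zero_right [simp]: "y \<in> hcarrier H ==> hinner H y (hzero H) = 0"
 using inner_scale_right[of y "hzero H" 0] by (simp add: scale_zero)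

lemma norm_sq: "x \<in> hcarrier H ==> (hnorm H x)\<^sup>2 = Re (hinner H x x)"
 using inner_nonneg[of x] by (simp add: hnorm_def complex_nonneg_Reals_iff)

lemma inner_self: "x \<in> hcarrier H ==> hinner H x x = of_real ((hnorm H x)\<^sup>2)"
 using inner_nonneg[of x] by (simp add: norm_sq complex_nonneg_Reals_iff complex_eq_iff)

lemma norm_nonneg [simp]: "x \<in> hcarrier H ==> hnorm H x \<ge> 0"
 using inner_nonneg[of x] by (simp add: hnorm_def complex_nonneg_Reals_iff)

lemma norm_zero [simp]: "hnorm H (hzero H) = 0"
 by (simp add: hnorm_def)

lemma eq_if_sub_null:
 assumes x: "x \<in> hcarrier H" and y: "y \<in> hcarrier H" and 0: "hinner H (sub x y) (sub x y) = 0"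
 shows "x = y"
proof -
 have "sub x y = hzero H" using inner_definite[OF _ 0] x y by simp
 then have "hadd H (sub x y) y = y" using add_zero[OF y] add_commute[of "hzero H" y] y by simp
 moreover have "hadd H (sub x y) y = x"
  using x y add_neg[OF y] add_commute[of "hscale H (-1) y" y] add_zero[OF x] by (simp add: add_assoc)
 ultimately show ?thesis by simp
qed

lemma eqI_inner:
 assumes "x \<in> hcarrier H" "y \<in> hcarrier H" "!!z. z \<in> hcarrier H ==> hinner H x z = hinner H y z"
 shows "x = y"
 using assms by (intro eq_if_sub_null) (auto simp: inner_simps)

lemma eqI_inner_right:
 assumes "x \<in> hcarrier H" "y \<in> hcarrier H" "!!z. z \<in> hcarrier H ==> hinner H z x = hinner H z y"
 shows "x = y"
 using assms inner_commute by (intro eqI_inner) metis+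

lemma norm_sq_add:
 assumes "x \<in> hcarrier H" "y \<in> hcarrier H"
 shows "(hnorm H (hadd H x y))\<^sup>2 = (hnorm H x)\<^sup>2 + 2 * Re (hinner H x y) + (hnorm H y)\<^sup>2"
 using assms inner_commute[of x y] by (simp add: norm_sq inner_simps)

lemma norm_scale: "x \<in> hcarrier H ==> hnorm H (hscale H c x) = cmod c * hnorm H x"
proof -
 assume x: "x \<in> hcarrier H"
 have "(hnorm H (hscale H c x))\<^sup>2 = Re ((c * cnj c) * hinner H x x)"
  using x by (simp add: norm_sq inner_simps algebra_simps)
 also have "c * cnj c = of_real ((cmod c)\<^sup>2)" by (rule complex_norm_square[symmetric])
 finally have "(hnorm H (hscale H c x))\<^sup>2 = (cmod c * hnorm H x)\<^sup>2"
  using x by (simp add: norm_sq power_mult_distrib del: of_real_power)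
 then show ?thesis using x by (simp add: power2_eq_iff_nonneg)
qed

lemma Cauchy_Schwarz:
 assumes x: "x \<in> hcarrier H" and y: "y \<in> hcarrier H"
 shows "cmod (hinner H x y) \<le> hnorm H x * hnorm H y"
proof -
 have sq: "(cmod (hinner H y x))\<^sup>2 \<le> (hnorm H x)\<^sup>2 * (hnorm H y)\<^sup>2"
 proof (rule complex_discriminant)
  fix c
  have "0 \<le> (hnorm H (hadd H x (hscale H c y)))\<^sup>2" by simp
  also have "\<dots> = (hnorm H x)\<^sup>2 + 2 * Re (c * hinner H y x) + (cmod c)\<^sup>2 * (hnorm H y)\<^sup>2"
   using x y inner_commute[of x y]
   by (simp add: norm_sq_add norm_scale power_mult_distrib inner_simps)
  finally show "0 \<le> (hnorm H x)\<^sup>2 + 2 * Re (c * hinner H y x) + (cmod c)\<^sup>2 * (hnorm H y)\<^sup>2" .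
 qed simp
 have "cmod (hinner H y x) \<le> hnorm H x * hnorm H y"
  by (rule power2_le_imp_le) (use sq x y in \<open>auto simp: power_mult_distrib\<close>)
 then show ?thesis using inner_commute[of y x] x y by simp
qed

lemma dist_sq:
 assumes "x \<in> hcarrier H" "y \<in> hcarrier H"
 shows "(hdist H x y)\<^sup>2 = (hnorm H x)\<^sup>2 - 2 * Re (hinner H x y) + (hnorm H y)\<^sup>2"
 using assms by (simp add: hdist_def norm_sq_add norm_scale inner_simps)

lemma dist_nonneg [simp]: "x \<in> hcarrier H ==> y \<in> hcarrier H ==> hdist H x y \<ge> 0"
 by (simp add: hdist_def)

lemma dist_commute: "x \<in> hcarrier H ==> y \<in> hcarrier H ==> hdist H x y = hdist H y x"
 by (rule power2_eq_iff_nonneg[THEN iffD1]) (auto simp: dist_sq inner_commute[of x y])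

lemma triangle:
 assumes "x \<in> hcarrier H" "y \<in> hcarrier H"
 shows "hnorm H (hadd H x y) \<le> hnorm H x + hnorm H y"
proof -
 have "Re (hinner H x y) \<le> hnorm H x * hnorm H y"
  by (rule order_trans[OF complex_Re_le_cmod Cauchy_Schwarz[OF assms]])
 then have sq: "(hnorm H (hadd H x y))\<^sup>2 \<le> (hnorm H x + hnorm H y)\<^sup>2"
  using assms by (simp add: norm_sq_add power2_sum)
 show ?thesis by (rule power2_le_imp_le[OF sq]) (use assms in auto)
qed

lemma dist_triangle:
 assumes x: "x \<in> hcarrier H" and y: "y \<in> hcarrier H" and z: "z \<in> hcarrier H"
 shows "hdist H x z \<le> hdist H x y + hdist H y z"
proof -
 have "sub x z = hadd H (sub x y) (sub y z)"
  using x y z by (intro eqI_inner) (auto simp: inner_simps)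
 then show ?thesis using triangle[of "sub x y" "sub y z"] x y z by (simp add: hdist_def)
qed

lemma inner_diff_le:
 assumes "x \<in> hcarrier H" "y \<in> hcarrier H" "z \<in> hcarrier H"
 shows "cmod (hinner H x z - hinner H y z) \<le> hdist H x y * hnorm H z"
 using Cauchy_Schwarz[of "sub x y" z] assms by (simp add: inner_simps hdist_def)

lemma dist_zero: "x \<in> hcarrier H ==> hdist H x (hzero H) = hnorm H x"
 by (rule power2_eq_iff_nonneg[THEN iffD1]) (auto simp: dist_sq)

lemma norm_diff_le:
 assumes x: "x \<in> hcarrier H" and y: "y \<in> hcarrier H"
 shows "\<bar>hnorm H x - hnorm H y\<bar> \<le> hdist H x y"
 using dist_triangle[OF x y zero_closed] dist_triangle[OF y x zero_closed] dist_commute[OF x y]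
 unfolding dist_zero[OF x] dist_zero[OF y] by linarith

lemma tendsto_norm:
 assumes "!!n. s n \<in> hcarrier H" "l \<in> hcarrier H" "(\<lambda>n. hdist H (s n) l) \<longlonglongrightarrow> 0"
 shows "(\<lambda>n. hnorm H (s n)) \<longlonglongrightarrow> hnorm H l"
proof (rule LIM_zero_cancel, rule tendsto_rabs_zero_cancel, rule tendsto_sandwich[OF _ _ tendsto_const assms(3)])
 show "\<forall>\<^sub>F n in sequentially. \<bar>hnorm H (s n) - hnorm H l\<bar> \<le> hdist H (s n) l"
  using norm_diff_le assms by simp
qed simp

lemma tendsto_inner:
 assumes s: "!!n. s n \<in> hcarrier H" "l \<in> hcarrier H" "(\<lambda>n. hdist H (s n) l) \<longlonglongrightarrow> 0"
  and t: "!!n. t n \<in> hcarrier H" "m \<in> hcarrier H" "(\<lambda>n. hdist H (t n) m) \<longlonglongrightarrow> 0"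
 shows "(\<lambda>n. hinner H (s n) (t n)) \<longlonglongrightarrow> hinner H l m"
proof (rule LIM_zero_cancel, rule tendsto_norm_zero_cancel, rule tendsto_sandwich[OF _ _ tendsto_const])
 show "\<forall>\<^sub>F n in sequentially. cmod (hinner H (s n) (t n) - hinner H l m)
   \<le> hdist H (s n) l * hnorm H (t n) + hdist H (t n) m * hnorm H l"
 proof (rule always_eventually, rule allI)
  fix n
  have "cmod (hinner H (s n) (t n) - hinner H l (t n)) \<le> hdist H (s n) l * hnorm H (t n)"
   by (rule inner_diff_le) (use s t in auto)
  moreover have "cmod (hinner H (t n) l - hinner H m l) \<le> hdist H (t n) m * hnorm H l"
   by (rule inner_diff_le) (use s t in auto)
  moreover have "cmod (hinner H l (t n) - hinner H l m) = cmod (hinner H (t n) l - hinner H m l)"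
   using inner_commute[OF t(1) s(2), of n] inner_commute[OF t(2) s(2)] s t
   by (metis complex_cnj_diff complex_mod_cnj)
  ultimately show "cmod (hinner H (s n) (t n) - hinner H l m)
   \<le> hdist H (s n) l * hnorm H (t n) + hdist H (t n) m * hnorm H l"
   using norm_triangle_ineq[of "hinner H (s n) (t n) - hinner H l (t n)" "hinner H l (t n) - hinner H l m"]
   by simp
 qed
 show "(\<lambda>n. hdist H (s n) l * hnorm H (t n) + hdist H (t n) m * hnorm H l) \<longlonglongrightarrow> 0"
  using tendsto_add[OF tendsto_mult[OF s(3) tendsto_norm[OF t]] tendsto_mult[OF t(3) tendsto_const[of "hnorm H l"]]]
  by simp
qed simp

text \<open>The representing vector minimises \<open>\<parallel>x\<parallel>\<^sup>2 - 2 Re (F x)\<close>; minimising sequences are Cauchy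
 by the parallelogram law.\<close>

lemma Riesz_representation:
 assumes add: "!!x y. x \<in> hcarrier H ==> y \<in> hcarrier H ==> F (hadd H x y) = F x + F y"
  and scale: "!!c x. x \<in> hcarrier H ==> F (hscale H c x) = c * F x"
  and bound: "!!x. x \<in> hcarrier H ==> cmod (F x) \<le> B * hnorm H x"
 obtains z where "z \<in> hcarrier H" "!!x. x \<in> hcarrier H ==> F x = hinner H x z"
proof -
 define J where "J x = (hnorm H x)\<^sup>2 - 2 * Re (F x)" for x
 have J_lower: "J x \<ge> - B\<^sup>2" if x: "x \<in> hcarrier H" for x
 proof -
  have "Re (F x) \<le> B * hnorm H x" by (rule order_trans[OF complex_Re_le_cmod bound[OF x]])
  moreover have "0 \<le> (hnorm H x - B)\<^sup>2" by simp
  ultimately show ?thesis by (simp add: J_def power2_diff algebra_simps)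
 qed
 have bdd: "bdd_below (J ` hcarrier H)" by (rule bdd_belowI2[OF J_lower])
 define m where "m = (INF x\<in>hcarrier H. J x)"
 have m_le: "m \<le> J x" if "x \<in> hcarrier H" for x unfolding m_def by (rule cINF_lower[OF bdd that])
 have "\<exists>x\<in>hcarrier H. J x < m + inverse (real (Suc n))" for n
 proof -
  have "(INF x\<in>hcarrier H. J x) < m + inverse (real (Suc n))" by (simp add: m_def)
  moreover have "hcarrier H \<noteq> {}" using zero_closed by blast
  ultimately show ?thesis by (simp add: cINF_less_iff[OF _ bdd])
 qed
 then obtain s where s: "!!n. s n \<in> hcarrier H" "!!n. J (s n) < m + inverse (real (Suc n))" by metis
 have para: "(hdist H x y)\<^sup>2 \<le> 2 * J x + 2 * J y - 4 * m" if x: "x \<in> hcarrier H" and y: "y \<in> hcarrier H" for x y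
 proof -
  have "m \<le> J (hscale H (1/2) (hadd H x y))" using x y by (intro m_le) auto
  also have "\<dots> = ((hnorm H x)\<^sup>2 + 2 * Re (hinner H x y) + (hnorm H y)\<^sup>2) / 4 - Re (F x + F y)"
   using x y by (simp add: J_def norm_scale power_mult_distrib norm_sq_add scale add power_divide add_divide_distrib)
  finally show ?thesis unfolding dist_sq[OF x y] J_def plus_complex.sel by (simp add: field_simps)
 qed
 have "\<exists>l\<in>hcarrier H. (\<lambda>n. hdist H (s n) l) \<longlonglongrightarrow> 0"
 proof (rule complete[OF s(1)])
  fix e :: real assume e: "e > 0"
  then obtain N where N: "inverse (real (Suc N)) < e\<^sup>2 / 4" using reals_Archimedean[of "e\<^sup>2/4"] by auto
  have "hdist H (s i) (s j) < e" if ij: "i \<ge> N" "j \<ge> N" for i j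
  proof -
   have "inverse (real (Suc i)) \<le> inverse (real (Suc N))" "inverse (real (Suc j)) \<le> inverse (real (Suc N))"
    using ij by (auto intro!: le_imp_inverse_le)
   then have sq: "(hdist H (s i) (s j))\<^sup>2 < e\<^sup>2"
    using para[OF s(1) s(1), of i j] s(2)[of i] s(2)[of j] N by linarith
   show ?thesis by (rule power2_less_imp_less[OF sq]) (use e in auto)
  qed
  then show "\<exists>N. \<forall>m\<ge>N. \<forall>n\<ge>N. hdist H (s m) (s n) < e" by blast
 qed
 then obtain z where z: "z \<in> hcarrier H" "(\<lambda>n. hdist H (s n) z) \<longlonglongrightarrow> 0" by blast
 have Fdiff: "F x - F y = F (sub x y)" if "x \<in> hcarrier H" "y \<in> hcarrier H" for x y
  using that by (simp add: add scale)
 have "(\<lambda>n. F (s n)) \<longlonglongrightarrow> F z"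
 proof (rule LIM_zero_cancel, rule tendsto_norm_zero_cancel, rule tendsto_sandwich[OF _ _ tendsto_const])
  show "(\<lambda>n. B * hdist H (s n) z) \<longlonglongrightarrow> 0" using tendsto_mult[OF tendsto_const z(2), of B] by simp
  show "\<forall>\<^sub>F n in sequentially. cmod (F (s n) - F z) \<le> B * hdist H (s n) z"
   using bound s z by (simp add: Fdiff hdist_def)
 qed simp
 then have "(\<lambda>n. J (s n)) \<longlonglongrightarrow> J z"
  unfolding J_def using tendsto_norm[OF s(1) z] by (intro tendsto_intros) auto
 moreover have "(\<lambda>n. m + inverse (real (Suc n))) \<longlonglongrightarrow> m + 0"
  by (intro tendsto_intros LIMSEQ_inverse_real_of_nat)
 ultimately have Jz: "J z \<le> m"
  using s(2) by (intro LIMSEQ_le[of "\<lambda>n. J (s n)" _ "\<lambda>n. m + inverse (real (Suc n))"]) (auto intro: less_imp_le)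
 have "F x = hinner H x z" if x: "x \<in> hcarrier H" for x
 proof -
  have "(cmod (hinner H x z - F x))\<^sup>2 \<le> 0 * (hnorm H x)\<^sup>2"
  proof (rule complex_discriminant)
   fix c
   have "J z \<le> J (hadd H z (hscale H c x))" using Jz m_le[of "hadd H z (hscale H c x)"] x z by simp
   also have "\<dots> = J z + 2 * Re (c * (hinner H x z - F x)) + (cmod c)\<^sup>2 * (hnorm H x)\<^sup>2"
    using x z inner_commute[of z x]
    by (simp add: J_def norm_sq_add norm_scale power_mult_distrib add scale inner_simps right_diff_distrib)
   finally show "0 \<le> 0 + 2 * Re (c * (hinner H x z - F x)) + (cmod c)\<^sup>2 * (hnorm H x)\<^sup>2" by simp
  qed simp
  then show ?thesis by simp
 qed
 then show thesis using z that by blast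
qed

lemma operator_of_form:
 assumes add1: "!!x x' y. x \<in> hcarrier H ==> x' \<in> hcarrier H ==> y \<in> hcarrier H ==> b (hadd H x x') y = b x y + b x' y"
  and scale1: "!!c x y. x \<in> hcarrier H ==> y \<in> hcarrier H ==> b (hscale H c x) y = c * b x y"
  and add2: "!!x y y'. x \<in> hcarrier H ==> y \<in> hcarrier H ==> y' \<in> hcarrier H ==> b x (hadd H y y') = b x y + b x y'"
  and scale2: "!!c x y. x \<in> hcarrier H ==> y \<in> hcarrier H ==> b x (hscale H c y) = cnj c * b x y"
  and bound: "!!x y. x \<in> hcarrier H ==> y \<in> hcarrier H ==> cmod (b x y) \<le> B * hnorm H x * hnorm H y"
 obtains T where "T \<in> bops H" "!!x y. x \<in> hcarrier H ==> y \<in> hcarrier H ==> hinner H (T x) y = b x y"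
proof -
 have "\<exists>z. z \<in> hcarrier H \<and> (\<forall>y\<in>hcarrier H. hinner H z y = b x y)" if x: "x \<in> hcarrier H" for x
 proof -
  obtain z where z: "z \<in> hcarrier H" "!!y. y \<in> hcarrier H ==> cnj (b x y) = hinner H y z"
   by (rule Riesz_representation[of "\<lambda>y. cnj (b x y)" "B * hnorm H x"])
    (use x in \<open>auto simp: add2 scale2 bound\<close>)
  then show ?thesis using inner_commute by (metis complex_cnj_cnj)
 qed
 then obtain T0 where T0: "!!x. x \<in> hcarrier H ==> T0 x \<in> hcarrier H"
   "!!x y. x \<in> hcarrier H ==> y \<in> hcarrier H ==> hinner H (T0 x) y = b x y" by metis
 let ?T = "restrict T0 (hcarrier H)"
 have "hlinear H H ?T"
  unfolding hlinear_def
 proof (intro conjI ballI allI)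
  show "?T (hadd H x y) = hadd H (?T x) (?T y)" if "x \<in> hcarrier H" "y \<in> hcarrier H" for x y
   using that T0 by (intro eqI_inner) (auto simp: inner_simps add1)
  show "?T (hscale H c x) = hscale H c (?T x)" if "x \<in> hcarrier H" for x c
   using that T0 by (intro eqI_inner) (auto simp: inner_simps scale1)
 qed (use T0 in auto)
 moreover have "hnorm H (?T x) \<le> B * hnorm H x" if x: "x \<in> hcarrier H" for x
 proof (cases "hnorm H (T0 x) = 0")
  case True
  have "0 \<le> B * hnorm H x"
  proof (cases "hnorm H x = 0")
   case False
   have "0 \<le> B * hnorm H x * hnorm H x" by (rule order_trans[OF norm_ge_zero bound[OF x x]])
   then show ?thesis using False norm_nonneg[OF x] by (simp add: zero_le_mult_iff)
  qed simp
  then show ?thesis using True x by simp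
 next
  case False
  have "(hnorm H (T0 x))\<^sup>2 \<le> B * hnorm H x * hnorm H (T0 x)"
   using bound[OF x T0(1)[OF x]] T0 x by (simp add: norm_sq order_trans[OF complex_Re_le_cmod])
  then show ?thesis using False norm_nonneg[OF T0(1)[OF x]] x by (simp add: power2_eq_square)
 qed
 ultimately have "?T \<in> bops H" unfolding bops_def by blast
 then show thesis by (rule that) (use T0 in auto)
qed

end

lemma hadjoint_eqI:
 assumes H: "hilbert_space H" and "y \<in> hcarrier L" "z \<in> hcarrier H"
  and "!!x. x \<in> hcarrier H ==> hinner L (T x) y = hinner H x z"
 shows "hadjoint H L T y = z"
proof -
 interpret H: hilbert_space H by fact
 have "(THE z. z \<in> hcarrier H \<and> (\<forall>x\<in>hcarrier H. hinner L (T x) y = hinner H x z)) = z"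
 proof (rule the_equality)
  fix z' assume "z' \<in> hcarrier H \<and> (\<forall>x\<in>hcarrier H. hinner L (T x) y = hinner H x z')"
  then show "z' = z" using assms by (intro H.eqI_inner_right) auto
 qed (use assms in auto)
 then show ?thesis using assms by (simp add: hadjoint_def)
qed

lemma hadjoint_inner:
 assumes H: "hilbert_space H" and L: "hilbert_space L" and T: "hlinear H L T"
  and B: "!!x. x \<in> hcarrier H ==> hnorm L (T x) \<le> B * hnorm H x" and y: "y \<in> hcarrier L"
 shows "hadjoint H L T y \<in> hcarrier H"
  and "x \<in> hcarrier H ==> hinner L (T x) y = hinner H x (hadjoint H L T y)"
proof -
 interpret H: hilbert_space H by fact
 interpret L: hilbert_space L by fact
 have T': "T x \<in> hcarrier L" if "x \<in> hcarrier H" for x using T that by (auto simp: hlinear_def)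
 obtain z where z: "z \<in> hcarrier H" "!!x. x \<in> hcarrier H ==> hinner L (T x) y = hinner H x z"
 proof (rule H.Riesz_representation[of "\<lambda>x. hinner L (T x) y" "B * hnorm L y"])
  fix x assume x: "x \<in> hcarrier H"
  have "cmod (hinner L (T x) y) \<le> hnorm L (T x) * hnorm L y" using L.Cauchy_Schwarz T' x y by blast
  also have "\<dots> \<le> B * hnorm H x * hnorm L y" using B x y by (intro mult_right_mono) auto
  finally show "cmod (hinner L (T x) y) \<le> B * hnorm L y * hnorm H x" by (simp add: mult_ac)
 qed (use T T' y in \<open>auto simp: hlinear_def L.inner_simps\<close>)
 have "hadjoint H L T y = z" by (rule hadjoint_eqI[OF H y z])
 then show "hadjoint H L T y \<in> hcarrier H"
  "x \<in> hcarrier H ==> hinner L (T x) y = hinner H x (hadjoint H L T y)" using z by auto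
qed

text \<open>Preservation of inner products forces linearity, since \<open>\<parallel>V (x + y) - (V x + V y)\<parallel>\<^sup>2\<close>
 expands into inner products.\<close>

lemma hisometryI:
 assumes H: "hilbert_space H" and L: "hilbert_space L" and V: "V \<in> hcarrier H \<rightarrow>\<^sub>E hcarrier L"
  and inner: "!!x y. x \<in> hcarrier H ==> y \<in> hcarrier H ==> hinner L (V x) (V y) = hinner H x y"
 shows "hisometry H L V"
proof -
 interpret H: hilbert_space H by fact
 interpret L: hilbert_space L by fact
 have V': "V x \<in> hcarrier L" if "x \<in> hcarrier H" for x using V that by auto
 have "V (hadd H x y) = hadd L (V x) (V y)" if "x \<in> hcarrier H" "y \<in> hcarrier H" for x y
  using that V' by (intro L.eq_if_sub_null) (auto simp: L.inner_simps inner H.inner_simps)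
 moreover have "V (hscale H c x) = hscale L c (V x)" if "x \<in> hcarrier H" for c x
  using that V' by (intro L.eq_if_sub_null) (auto simp: L.inner_simps inner H.inner_simps)
 ultimately show ?thesis using V inner by (simp add: hisometry_def hlinear_def hnorm_def)
qed

lemma hisometry_inner:
 assumes H: "hilbert_space H" and L: "hilbert_space L" and V: "hisometry H L V"
  and x: "x \<in> hcarrier H" and y: "y \<in> hcarrier H"
 shows "hinner L (V x) (V y) = hinner H x y"
proof -
 interpret H: hilbert_space H by fact
 interpret L: hilbert_space L by fact
 have V': "!!x. x \<in> hcarrier H ==> V x \<in> hcarrier L"
  "!!x y. x \<in> hcarrier H ==> y \<in> hcarrier H ==> V (hadd H x y) = hadd L (V x) (V y)"
  "!!c x. x \<in> hcarrier H ==> V (hscale H c x) = hscale L c (V x)"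
  "!!x. x \<in> hcarrier H ==> hnorm L (V x) = hnorm H x"
  using V by (auto simp: hisometry_def hlinear_def)
 have Re: "Re (hinner L (V x) (V y)) = Re (hinner H x y)" if "x \<in> hcarrier H" "y \<in> hcarrier H" for x y
  using H.norm_sq_add[OF that] L.norm_sq_add[OF V'(1) V'(1), OF that] that
  by (simp add: V'(4) flip: V'(2))
 have "Re (\<i> * hinner L (V x) (V y)) = Re (\<i> * hinner H x y)"
  using Re[of "hscale H \<i> x" y] x y V' by (simp add: L.inner_simps H.inner_simps)
 then show ?thesis using Re[OF x y] by (simp add: complex_eq_iff)
qed

lemma extend_isometry:
 assumes H: "hilbert_space H" and L: "hilbert_space L"
  and S: "S \<subseteq> hcarrier H" "!!x e. x \<in> hcarrier H ==> e > 0 ==> \<exists>y\<in>S. hdist H y x < e"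
  and T: "!!x. x \<in> S ==> T x \<in> hcarrier L"
  and inner: "!!x y. x \<in> S ==> y \<in> S ==> hinner L (T x) (T y) = hinner H x y"
 obtains V where "hisometry H L V" "!!x. x \<in> S ==> V x = T x"
proof -
 interpret H: hilbert_space H by fact
 interpret L: hilbert_space L by fact
 have dist: "hdist L (T x) (T y) = hdist H x y" if "x \<in> S" "y \<in> S" for x y
 proof -
  have "(hdist L (T x) (T y))\<^sup>2 = (hdist H x y)\<^sup>2"
   using that S T inner by (simp add: subset_eq L.dist_sq H.dist_sq H.norm_sq L.norm_sq)
  then show ?thesis using that S T by (simp add: subset_eq power2_eq_iff_nonneg)
 qed
 have ex: "\<exists>s y. (\<forall>n. s n \<in> S) \<and> (\<lambda>n. hdist H (s n) x) \<longlonglongrightarrow> 0 \<and> y \<in> hcarrier L \<and> (\<lambda>n. hdist L (T (s n)) y) \<longlonglongrightarrow> 0"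
  if x: "x \<in> hcarrier H" for x
 proof -
  have "\<exists>y\<in>S. hdist H y x < inverse (real (Suc n))" for n using S(2)[OF x] by simp
  then obtain s where s: "!!n. s n \<in> S" "!!n. hdist H (s n) x < inverse (real (Suc n))" by metis
  have sH: "s n \<in> hcarrier H" for n using s S by blast
  have lim: "(\<lambda>n. hdist H (s n) x) \<longlonglongrightarrow> 0"
   by (rule tendsto_sandwich[OF _ _ tendsto_const LIMSEQ_inverse_real_of_nat])
    (use s(2) sH x in \<open>auto intro!: always_eventually less_imp_le\<close>)
  have "\<exists>y\<in>hcarrier L. (\<lambda>n. hdist L (T (s n)) y) \<longlonglongrightarrow> 0"
  proof (rule L.complete)
   show "T (s n) \<in> hcarrier L" for n using s T by blast
   fix e :: real assume "e > 0"
   then obtain N where N: "!!n. n \<ge> N ==> hdist H (s n) x < e / 2"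
    using order_tendstoD(2)[OF lim, of "e/2"] by (auto simp: eventually_sequentially)
   have "hdist L (T (s i)) (T (s j)) < e" if "i \<ge> N" "j \<ge> N" for i j
    using dist[OF s(1) s(1), of i j] H.dist_triangle[OF sH x sH, of i j] N that
     H.dist_commute[OF x sH, of j] by (smt (verit) field_sum_of_halves)
   then show "\<exists>N. \<forall>m\<ge>N. \<forall>n\<ge>N. hdist L (T (s m)) (T (s n)) < e" by blast
  qed
  then show ?thesis using s lim by blast
 qed
 have "\<exists>s y. \<forall>x\<in>hcarrier H. (\<forall>n. s x n \<in> S) \<and> (\<lambda>n. hdist H (s x n) x) \<longlonglongrightarrow> 0 \<and>
   y x \<in> hcarrier L \<and> (\<lambda>n. hdist L (T (s x n)) (y x)) \<longlonglongrightarrow> 0"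
  using bchoice[of "hcarrier H"] ex by metis
 then obtain s V where sV: "!!x n. x \<in> hcarrier H ==> s x n \<in> S"
   "!!x. x \<in> hcarrier H ==> (\<lambda>n. hdist H (s x n) x) \<longlonglongrightarrow> 0"
   "!!x. x \<in> hcarrier H ==> V x \<in> hcarrier L"
   "!!x. x \<in> hcarrier H ==> (\<lambda>n. hdist L (T (s x n)) (V x)) \<longlonglongrightarrow> 0" by metis
 have sH: "s x n \<in> hcarrier H" "T (s x n) \<in> hcarrier L" if "x \<in> hcarrier H" for x n
  using sV(1)[OF that] S T by auto
 have innerV: "hinner L (V x) (V y) = hinner H x y" if "x \<in> hcarrier H" "y \<in> hcarrier H" for x y
 proof (rule LIMSEQ_unique)
  show "(\<lambda>n. hinner L (T (s x n)) (T (s y n))) \<longlonglongrightarrow> hinner L (V x) (V y)"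
   by (rule L.tendsto_inner) (use that sV sH in auto)
  have "(\<lambda>n. hinner H (s x n) (s y n)) \<longlonglongrightarrow> hinner H x y"
   by (rule H.tendsto_inner) (use that sV sH in auto)
  then show "(\<lambda>n. hinner L (T (s x n)) (T (s y n))) \<longlonglongrightarrow> hinner H x y"
   using inner sV that by simp
 qed
 have eqT: "V x = T x" if x: "x \<in> S" for x
 proof -
  have xH: "x \<in> hcarrier H" using x S by blast
  have "hinner L (V x) (T x) = hinner H x x"
  proof (rule LIMSEQ_unique)
   show "(\<lambda>n. hinner L (T (s x n)) (T x)) \<longlonglongrightarrow> hinner L (V x) (T x)"
    by (rule L.tendsto_inner) (use sV sH x xH T in \<open>auto simp: hdist_def L.add_neg\<close>)
   have "(\<lambda>n. hinner H (s x n) x) \<longlonglongrightarrow> hinner H x x"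
    by (rule H.tendsto_inner) (use sV sH x xH in \<open>auto simp: hdist_def H.add_neg\<close>)
   then show "(\<lambda>n. hinner L (T (s x n)) (T x)) \<longlonglongrightarrow> hinner H x x"
    using inner sV x xH by simp
  qed
  then show ?thesis
   using sV(3)[OF xH] T[OF x] innerV[OF xH xH] inner[OF x x] L.inner_commute[of "V x" "T x"] H.inner_commute[OF xH xH]
   by (intro L.eq_if_sub_null) (auto simp: L.inner_simps)
 qed
 have "hisometry H L (restrict V (hcarrier H))"
  by (rule hisometryI[OF H L]) (use sV innerV in auto)
 then show thesis by (rule that) (use eqT S in auto)
qed

section \<open>Representations of function algebras\<close>

lemma linear_into_bopsD:
 assumes "linear_into_bops X H \<Phi>"
 shows "!!f. f \<in> cfun X ==> \<Phi> f \<in> bops H"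
  "!!f h. f \<in> cfun X ==> h \<in> hcarrier H ==> \<Phi> f h \<in> hcarrier H"
  "!!f g h. f \<in> cfun X ==> g \<in> cfun X ==> h \<in> hcarrier H ==> \<Phi> (cf_add X f g) h = hadd H (\<Phi> f h) (\<Phi> g h)"
  "!!c f h. f \<in> cfun X ==> h \<in> hcarrier H ==> \<Phi> (cf_scale X c f) h = hscale H c (\<Phi> f h)"
  "!!f g h. f \<in> cfun X ==> g \<in> hcarrier H ==> h \<in> hcarrier H ==> \<Phi> f (hadd H g h) = hadd H (\<Phi> f g) (\<Phi> f h)"
  "!!f c h. f \<in> cfun X ==> h \<in> hcarrier H ==> \<Phi> f (hscale H c h) = hscale H c (\<Phi> f h)"
 using assms unfolding linear_into_bops_def bops_def hlinear_def
 by (auto simp: PiE_def Pi_def)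

lemma bops_adjoint:
 assumes H: "hilbert_space H" and T: "T \<in> bops H" and x: "x \<in> hcarrier H" and y: "y \<in> hcarrier H"
 shows "hinner H (T x) y = hinner H x (hadjoint H H T y)" "hadjoint H H T y \<in> hcarrier H"
proof -
 obtain B where B: "!!x. x \<in> hcarrier H ==> hnorm H (T x) \<le> B * hnorm H x" and l: "hlinear H H T"
  using T by (auto simp: bops_def)
 show "hinner H (T x) y = hinner H x (hadjoint H H T y)" "hadjoint H H T y \<in> hcarrier H"
  using hadjoint_inner[OF H H l B y] x by auto
qed

lemma star_repD:
 assumes H: "hilbert_space H" and \<pi>: "star_rep X H \<pi>"
 shows "linear_into_bops X H \<pi>"
  "!!f g h. f \<in> cfun X ==> g \<in> cfun X ==> h \<in> hcarrier H ==> \<pi> (cf_mult X f g) h = \<pi> f (\<pi> g h)"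
  "!!f x y. f \<in> cfun X ==> x \<in> hcarrier H ==> y \<in> hcarrier H ==> hinner H (\<pi> f x) y = hinner H x (\<pi> (cf_star X f) y)"
proof -
 show l: "linear_into_bops X H \<pi>" using \<pi> by (simp add: star_rep_def)
 show "\<pi> (cf_mult X f g) h = \<pi> f (\<pi> g h)" if "f \<in> cfun X" "g \<in> cfun X" "h \<in> hcarrier H" for f g h
  using \<pi> that by (simp add: star_rep_def compose_def)
 show "hinner H (\<pi> f x) y = hinner H x (\<pi> (cf_star X f) y)" if "f \<in> cfun X" "x \<in> hcarrier H" "y \<in> hcarrier H" for f x y
  using bops_adjoint(1)[OF H linear_into_bopsD(1)[OF l that(1)] that(2,3)] \<pi> that by (simp add: star_rep_def)
qed

text \<open>A family of maps with \<open>\<pi> (f\<^sup>*)\<close> formally adjoint to \<open>\<pi> f\<close> consists of linear maps, so a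
 representation can be recognised from inner products alone.\<close>

lemma star_repI:
 assumes H: "hilbert_space H"
  and ext: "\<pi> \<in> cfun X \<rightarrow>\<^sub>E (hcarrier H \<rightarrow>\<^sub>E hcarrier H)"
  and bound: "!!f. f \<in> cfun X ==> \<exists>B. \<forall>h\<in>hcarrier H. hnorm H (\<pi> f h) \<le> B * hnorm H h"
  and add: "!!f g h. f \<in> cfun X ==> g \<in> cfun X ==> h \<in> hcarrier H ==> \<pi> (cf_add X f g) h = hadd H (\<pi> f h) (\<pi> g h)"
  and scale: "!!c f h. f \<in> cfun X ==> h \<in> hcarrier H ==> \<pi> (cf_scale X c f) h = hscale H c (\<pi> f h)"
  and mult: "!!f g h. f \<in> cfun X ==> g \<in> cfun X ==> h \<in> hcarrier H ==> \<pi> (cf_mult X f g) h = \<pi> f (\<pi> g h)"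
  and adj: "!!f x y. f \<in> cfun X ==> x \<in> hcarrier H ==> y \<in> hcarrier H ==> hinner H (\<pi> f x) y = hinner H x (\<pi> (cf_star X f) y)"
 shows "star_rep X H \<pi>"
proof -
 interpret H: hilbert_space H by fact
 have cl: "\<pi> f h \<in> hcarrier H" if "f \<in> cfun X" "h \<in> hcarrier H" for f h using ext that by (auto simp: PiE_def Pi_def)
 have ex: "\<pi> f \<in> extensional (hcarrier H)" if "f \<in> cfun X" for f using ext that by (auto simp: PiE_def Pi_def)
 have op: "\<pi> f \<in> bops H" if f: "f \<in> cfun X" for f
 proof -
  have "\<pi> f (hadd H x y) = hadd H (\<pi> f x) (\<pi> f y)" if "x \<in> hcarrier H" "y \<in> hcarrier H" for x y
   using f that cl cf_star_in[OF f] by (intro H.eqI_inner) (auto simp: adj H.inner_add)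
  moreover have "\<pi> f (hscale H c x) = hscale H c (\<pi> f x)" if "x \<in> hcarrier H" for x c
   using f that cl cf_star_in[OF f] by (intro H.eqI_inner) (auto simp: adj H.inner_scale)
  moreover have "\<pi> f \<in> hcarrier H \<rightarrow>\<^sub>E hcarrier H" using ext f by (rule PiE_mem)
  ultimately show ?thesis using bound[OF f] by (simp add: bops_def hlinear_def)
 qed
 have pext: "\<pi> \<in> extensional (cfun X)" using ext by (simp add: PiE_def)
 show ?thesis
  unfolding star_rep_def linear_into_bops_def
 proof (intro conjI ballI allI)
  show "\<pi> \<in> cfun X \<rightarrow>\<^sub>E bops H" using op pext by (auto simp: PiE_def)
  show "\<pi> (cf_add X f g) = (\<lambda>h\<in>hcarrier H. hadd H (\<pi> f h) (\<pi> g h))" if "f \<in> cfun X" "g \<in> cfun X" for f g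
   by (rule extensionalityI[OF ex restrict_extensional]) (use that in \<open>auto simp: add cfun_closed\<close>)
  show "\<pi> (cf_scale X c f) = (\<lambda>h\<in>hcarrier H. hscale H c (\<pi> f h))" if "f \<in> cfun X" for c f
   by (rule extensionalityI[OF ex restrict_extensional]) (use that in \<open>auto simp: scale cfun_closed\<close>)
  show "\<pi> (cf_mult X f g) = compose (hcarrier H) (\<pi> f) (\<pi> g)" if "f \<in> cfun X" "g \<in> cfun X" for f g
   unfolding compose_def
   by (rule extensionalityI[OF ex restrict_extensional]) (use that in \<open>auto simp: mult cfun_closed\<close>)
  show "\<pi> (cf_star X f) = hadjoint H H (\<pi> f)" if f: "f \<in> cfun X" for f
  proof (rule extensionalityI[OF ex[OF cf_star_in[OF f]]])
   show "hadjoint H H (\<pi> f) \<in> extensional (hcarrier H)" by (simp add: hadjoint_def)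
   fix y assume "y \<in> hcarrier H"
   then show "\<pi> (cf_star X f) y = hadjoint H H (\<pi> f) y"
    using f cl cf_star_in[OF f] by (intro hadjoint_eqI[OF H, symmetric]) (auto simp: adj)
  qed
 qed
qed

section \<open>The Hilbert space of square-integrable functions and its multiplication representation\<close>

lemma sq_integrableD:
 assumes "f \<in> sq_integrable M"
 shows "f \<in> borel_measurable M" "integrable M (\<lambda>x. (cmod (f x))\<^sup>2)"
 using assms by (auto simp: sq_integrable_def)

lemma sq_integrable_dominated:
 assumes f: "f \<in> borel_measurable M" and g: "integrable M g"
  and le: "!!x. x \<in> space M ==> (cmod (f x))\<^sup>2 \<le> g x"
 shows "f \<in> sq_integrable M"
proof -
 have "integrable M (\<lambda>x. (cmod (f x))\<^sup>2)"
  by (rule Bochner_Integration.integrable_bound[OF g])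
   (use f le in \<open>auto intro!: AE_I2 order_trans[OF _ abs_ge_self]\<close>)
 then show ?thesis using f by (simp add: sq_integrable_def)
qed

lemma cmod_add_sq_le: "(cmod (a + b))\<^sup>2 \<le> 2 * (cmod a)\<^sup>2 + 2 * (cmod b)\<^sup>2"
proof -
 have "(cmod (a + b))\<^sup>2 \<le> (cmod a + cmod b)\<^sup>2" by (intro power_mono norm_triangle_ineq) auto
 moreover have "0 \<le> (cmod a - cmod b)\<^sup>2" by simp
 ultimately show ?thesis unfolding power2_sum power2_diff by linarith
qed

lemma sq_integrable_add:
 assumes "f \<in> sq_integrable M" "g \<in> sq_integrable M"
 shows "(\<lambda>x. f x + g x) \<in> sq_integrable M"
 using assms cmod_add_sq_le
 by (intro sq_integrable_dominated[where g = "\<lambda>x. 2 * (cmod (f x))\<^sup>2 + 2 * (cmod (g x))\<^sup>2"])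
  (auto simp: sq_integrable_def)

lemma sq_integrable_scale:
 assumes "f \<in> sq_integrable M"
 shows "(\<lambda>x. c * f x) \<in> sq_integrable M"
 using assms
 by (intro sq_integrable_dominated[where g = "\<lambda>x. (cmod c)\<^sup>2 * (cmod (f x))\<^sup>2"])
  (auto simp: sq_integrable_def norm_mult power_mult_distrib)

lemma sq_integrable_diff:
 assumes "f \<in> sq_integrable M" "g \<in> sq_integrable M"
 shows "(\<lambda>x. f x - g x) \<in> sq_integrable M"
 using sq_integrable_add[OF assms(1) sq_integrable_scale[OF assms(2), of "-1"]] by simp

lemma sq_integrable_times_bounded:
 assumes f: "f \<in> borel_measurable M" "!!x. x \<in> space M ==> cmod (f x) \<le> B" and h: "h \<in> sq_integrable M"
 shows "(\<lambda>x. f x * h x) \<in> sq_integrable M"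
proof (rule sq_integrable_dominated[where g = "\<lambda>x. B\<^sup>2 * (cmod (h x))\<^sup>2"])
 show "(cmod (f x * h x))\<^sup>2 \<le> B\<^sup>2 * (cmod (h x))\<^sup>2" if "x \<in> space M" for x
  using f(2)[OF that] by (simp add: norm_mult power_mult_distrib mult_right_mono power_mono)
qed (use f h in \<open>auto dest: sq_integrableD\<close>)

lemma sq_integrable_product:
 assumes "f \<in> sq_integrable M" "g \<in> sq_integrable M"
 shows "integrable M (\<lambda>x. f x * cnj (g x))"
proof (rule Bochner_Integration.integrable_bound[of M "\<lambda>x. (cmod (f x))\<^sup>2 + (cmod (g x))\<^sup>2"])
 note f = sq_integrableD[OF assms(1)] and g = sq_integrableD[OF assms(2)]
 show "integrable M (\<lambda>x. (cmod (f x))\<^sup>2 + (cmod (g x))\<^sup>2)" using f g by simp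
 have "(\<lambda>x. cnj (g x)) \<in> borel_measurable M"
  using measurable_compose[OF g(1), of cnj borel]
  by (simp add: borel_measurable_continuous_onI continuous_on_cnj continuous_on_id)
 then show "(\<lambda>x. f x * cnj (g x)) \<in> borel_measurable M" using f by simp
 have "cmod (f x * cnj (g x)) \<le> (cmod (f x))\<^sup>2 + (cmod (g x))\<^sup>2" for x
  unfolding norm_mult complex_mod_cnj
  using sum_squares_bound[of "cmod (f x)" "cmod (g x)"] mult_nonneg_nonneg[OF norm_ge_zero[of "f x"] norm_ge_zero[of "g x"]]
  by linarith
 then show "AE x in M. norm (f x * cnj (g x)) \<le> norm ((cmod (f x))\<^sup>2 + (cmod (g x))\<^sup>2)"
  by (auto intro!: AE_I2 order_trans[OF _ abs_ge_self])
qed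

lemma equiv_ae_rel: "equiv (sq_integrable M) (ae_rel M)"
 unfolding equiv_def
proof (intro conjI)
 show "trans (ae_rel M)"
  unfolding trans_def ae_rel_def by (auto elim: eventually_elim2)
qed (auto simp: refl_on_def sym_def ae_rel_def eq_commute)

lemma l2_class_eq_iff:
 assumes "f \<in> sq_integrable M" "g \<in> sq_integrable M"
 shows "l2_class M f = l2_class M g \<longleftrightarrow> (AE x in M. f x = g x)"
 using eq_equiv_class_iff[OF equiv_ae_rel[of M] assms] assms by (simp add: l2_class_def ae_rel_def)

lemma l2_class_in: "f \<in> sq_integrable M ==> l2_class M f \<in> hcarrier (L2 M)"
 by (simp add: L2_def l2_class_def quotientI)

lemma l2_rep:
 assumes "f \<in> sq_integrable M"
 shows "l2_rep (l2_class M f) \<in> sq_integrable M" "AE x in M. l2_rep (l2_class M f) x = f x"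
proof -
 have "f \<in> l2_class M f" using assms by (simp add: l2_class_def ae_rel_def)
 then have "l2_rep (l2_class M f) \<in> l2_class M f" unfolding l2_rep_def by (rule someI[of "\<lambda>g. g \<in> l2_class M f"])
 then show "l2_rep (l2_class M f) \<in> sq_integrable M" "AE x in M. l2_rep (l2_class M f) x = f x"
  by (auto simp: l2_class_def ae_rel_def)
qed

lemma L2_carrierE:
 assumes "u \<in> hcarrier (L2 M)"
 obtains f where "f \<in> sq_integrable M" "u = l2_class M f"
 using assms by (auto simp: L2_def l2_class_def elim: quotientE)

lemma L2_zero: "hzero (L2 M) = l2_class M (\<lambda>x. 0)"
 by (simp add: L2_def)

lemma L2_add:
 assumes "f \<in> sq_integrable M" "g \<in> sq_integrable M"
 shows "hadd (L2 M) (l2_class M f) (l2_class M g) = l2_class M (\<lambda>x. f x + g x)"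
proof -
 have "AE x in M. l2_rep (l2_class M f) x + l2_rep (l2_class M g) x = f x + g x"
  using l2_rep(2)[OF assms(1)] l2_rep(2)[OF assms(2)] by eventually_elim simp
 then show ?thesis
  using assms by (simp add: L2_def l2_class_eq_iff sq_integrable_add l2_rep)
qed

lemma L2_scale:
 assumes "f \<in> sq_integrable M"
 shows "hscale (L2 M) c (l2_class M f) = l2_class M (\<lambda>x. c * f x)"
proof -
 have "AE x in M. c * l2_rep (l2_class M f) x = c * f x"
  using l2_rep(2)[OF assms(1)] by eventually_elim simp
 then show ?thesis using assms by (simp add: L2_def l2_class_eq_iff sq_integrable_scale l2_rep)
qed

lemma L2_inner:
 assumes "f \<in> sq_integrable M" "g \<in> sq_integrable M"
 shows "hinner (L2 M) (l2_class M f) (l2_class M g) = (\<integral>x. f x * cnj (g x) \<partial>M)"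
proof -
 have *: "AE x in M. l2_rep (l2_class M f) x * cnj (l2_rep (l2_class M g) x) = f x * cnj (g x)"
  using l2_rep(2)[OF assms(1)] l2_rep(2)[OF assms(2)] by eventually_elim simp
 have "(\<integral>x. l2_rep (l2_class M f) x * cnj (l2_rep (l2_class M g) x) \<partial>M) = (\<integral>x. f x * cnj (g x) \<partial>M)"
  by (rule integral_cong_AE)
   (use assms l2_rep * in \<open>auto intro!: borel_measurable_integrable sq_integrable_product\<close>)
 then show ?thesis by (simp add: L2_def)
qed

lemma L2_inner_self:
 assumes "f \<in> sq_integrable M"
 shows "hinner (L2 M) (l2_class M f) (l2_class M f) = of_real (\<integral>x. (cmod (f x))\<^sup>2 \<partial>M)"
 unfolding L2_inner[OF assms assms] by (simp flip: complex_norm_square of_real_power)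

lemma L2_dist:
 assumes "f \<in> sq_integrable M" "g \<in> sq_integrable M"
 shows "hdist (L2 M) (l2_class M f) (l2_class M g) = sqrt (\<integral>x. (cmod (f x - g x))\<^sup>2 \<partial>M)"
proof -
 have "hadd (L2 M) (l2_class M f) (hscale (L2 M) (- 1) (l2_class M g)) = l2_class M (\<lambda>x. f x - g x)"
  using L2_add[OF assms(1) sq_integrable_scale[OF assms(2), of "-1"]] L2_scale[OF assms(2), of "-1"] by simp
 then show ?thesis
  using L2_inner_self[OF sq_integrable_diff[OF assms]] by (simp add: hdist_def hnorm_def)
qed

text \<open>Riesz-Fischer. Along a subsequence with \<open>\<parallel>s\<^sub>i\<^sub>+\<^sub>1 - s\<^sub>i\<parallel>\<^sup>2 \<le> 4\<^sup>-\<^sup>i\<close> the increments are summable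
 in mean, hence almost everywhere; Fatou turns pointwise into mean square convergence.\<close>

lemma L2_Cauchy_limit:
 fixes s :: "nat => 'x => complex"
 assumes M: "finite_measure M" and s: "!!n. s n \<in> sq_integrable M"
  and Cauchy: "!!e. e > 0 ==> \<exists>N. \<forall>m\<ge>N. \<forall>n\<ge>N. (\<integral>x. (cmod (s m x - s n x))\<^sup>2 \<partial>M) < e"
 obtains l where "l \<in> sq_integrable M" "!!e. e > 0 ==> \<exists>N. \<forall>n\<ge>N. (\<integral>x. (cmod (s n x - l x))\<^sup>2 \<partial>M) \<le> e"
proof -
 interpret finite_measure M by fact
 have sm: "s n \<in> borel_measurable M" for n using s sq_integrableD by blast
 have dif: "integrable M (\<lambda>x. (cmod (s m x - s n x))\<^sup>2)" for m n
  using sq_integrableD(2)[OF sq_integrable_diff[OF s s]] .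
 have "\<forall>i. \<exists>N. \<forall>m\<ge>N. \<forall>n\<ge>N. (\<integral>x. (cmod (s m x - s n x))\<^sup>2 \<partial>M) < (1/4)^i"
  using Cauchy by simp
 then obtain N where N: "!!i m n. m \<ge> N i ==> n \<ge> N i ==> (\<integral>x. (cmod (s m x - s n x))\<^sup>2 \<partial>M) < (1/4)^i"
  by metis
 define k where "k i = (\<Sum>j\<le>i. N j) + i" for i
 have kN: "k i \<ge> N i" for i unfolding k_def by (simp add: member_le_sum trans_le_add1)
 have kS: "k (Suc i) \<ge> N i" for i using kN[of i] by (simp add: k_def)
 have ki: "k i \<ge> i" for i by (simp add: k_def)
 define d where "d i x = s (k (Suc i)) x - s (k i) x" for i x
 have dm: "d i \<in> borel_measurable M" for i unfolding d_def using sm by simp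
 have d1: "integrable M (\<lambda>x. cmod (d i x)) \<and> (\<integral>x. cmod (d i x) \<partial>M) \<le> (1/2)^i * (1 + measure M (space M))" for i
 proof -
  have le: "cmod (d i x) \<le> 2^i * (cmod (d i x))\<^sup>2 + (1/2)^i" for x
  proof (cases "cmod (d i x) \<le> (1/2)^i")
   case True
   then show ?thesis by (simp add: add_increasing)
  next
   case False
   have "(2::real)^i * (1/2)^i = 1" by (simp flip: power_mult_distrib)
   then have "1 \<le> 2^i * cmod (d i x)" using False
    by (metis less_eq_real_def mult_left_mono not_le zero_le_numeral zero_le_power)
   then have "cmod (d i x) * 1 \<le> cmod (d i x) * (2^i * cmod (d i x))" by (intro mult_left_mono) auto
   then have "cmod (d i x) \<le> 2^i * (cmod (d i x))\<^sup>2" by (simp add: power2_eq_square mult_ac)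
   then show ?thesis by (simp add: add_increasing2)
  qed
  have sq: "integrable M (\<lambda>x. (cmod (d i x))\<^sup>2)" unfolding d_def by (rule dif)
  then have I: "integrable M (\<lambda>x. 2^i * (cmod (d i x))\<^sup>2 + (1/2)^i)" by simp
  have J: "integrable M (\<lambda>x. cmod (d i x))"
   by (rule Bochner_Integration.integrable_bound[OF I]) (use dm le in \<open>auto intro!: AE_I2 order_trans[OF _ abs_ge_self]\<close>)
  have "(\<integral>x. cmod (d i x) \<partial>M) \<le> (\<integral>x. 2^i * (cmod (d i x))\<^sup>2 + (1/2)^i \<partial>M)"
   by (rule integral_mono[OF J I le])
  also have "\<dots> = 2^i * (\<integral>x. (cmod (d i x))\<^sup>2 \<partial>M) + (1/2)^i * measure M (space M)"
   using sq by simp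
  also have "\<dots> \<le> 2^i * (1/4)^i + (1/2)^i * measure M (space M)"
   unfolding d_def using N[OF kS kN] by (intro add_mono mult_left_mono less_imp_le) auto
  also have "(2::real)^i * (1/4)^i = (1/2)^i" by (simp flip: power_mult_distrib)
  finally show ?thesis using J by (simp add: algebra_simps)
 qed
 have "(\<integral>\<^sup>+ x. (\<Sum>i. ennreal (cmod (d i x))) \<partial>M) = (\<Sum>i. (\<integral>\<^sup>+ x. ennreal (cmod (d i x)) \<partial>M))"
  using dm by (intro nn_integral_suminf) auto
 also have "\<dots> = (\<Sum>i. ennreal (\<integral>x. cmod (d i x) \<partial>M))"
  using d1 by (intro suminf_cong nn_integral_eq_integral) auto
 also have "\<dots> \<le> (\<Sum>i. ennreal ((1/2)^i * (1 + measure M (space M))))"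
  using d1 by (intro suminf_le ennreal_leI) auto
 also have "\<dots> = ennreal (\<Sum>i. (1/2)^i * (1 + measure M (space M)))"
  by (rule suminf_ennreal2) (auto intro!: summable_mult2 summable_geometric)
 also have "\<dots> < \<infinity>" by simp
 finally have fin: "(\<integral>\<^sup>+ x. (\<Sum>i. ennreal (cmod (d i x))) \<partial>M) \<noteq> \<infinity>" by simp
 have "AE x in M. (\<Sum>i. ennreal (cmod (d i x))) \<noteq> \<infinity>"
  using dm fin by (intro nn_integral_PInf_AE) auto
 then have conv: "AE x in M. convergent (\<lambda>i. s (k i) x)"
 proof eventually_elim
  fix x assume x: "(\<Sum>i. ennreal (cmod (d i x))) \<noteq> \<infinity>"
  have "summable (\<lambda>i. cmod (d i x))"
   using x by (intro summable_suminf_not_top) auto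
  then have "summable (\<lambda>i. d i x)" by (rule summable_norm_cancel)
  then have c: "convergent (\<lambda>n. \<Sum>i<n. d i x)" by (simp add: summable_iff_convergent)
  have "(\<Sum>i<n. d i x) = s (k n) x - s (k 0) x" for n
   unfolding d_def by (rule sum_lessThan_telescope)
  then have eq: "(\<lambda>n. s (k n) x) = (\<lambda>n. (\<Sum>i<n. d i x) + s (k 0) x)" by auto
  show "convergent (\<lambda>i. s (k i) x)" unfolding eq by (intro convergent_add c convergent_const)
 qed
 define l where "l x = lim (\<lambda>i. s (k i) x)" for x
 have lm: "l \<in> borel_measurable M"
  unfolding l_def using sm by (rule borel_measurable_lim_metric)
 have Fatou: "(\<integral>\<^sup>+ x. ennreal ((cmod (s n x - l x))\<^sup>2) \<partial>M) \<le> ennreal ((1/4)^i)" if n: "n \<ge> N i" for n i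
 proof -
  have "AE x in M. ennreal ((cmod (s n x - l x))\<^sup>2) = liminf (\<lambda>j. ennreal ((cmod (s n x - s (k j) x))\<^sup>2))"
   using conv
  proof eventually_elim
   fix x assume "convergent (\<lambda>i. s (k i) x)"
   then have "(\<lambda>i. s (k i) x) \<longlonglongrightarrow> l x" by (simp add: l_def convergent_LIMSEQ_iff)
   then have "(\<lambda>j. ennreal ((cmod (s n x - s (k j) x))\<^sup>2)) \<longlonglongrightarrow> ennreal ((cmod (s n x - l x))\<^sup>2)"
    by (intro tendsto_intros tendsto_ennrealI)
   then show "ennreal ((cmod (s n x - l x))\<^sup>2) = liminf (\<lambda>j. ennreal ((cmod (s n x - s (k j) x))\<^sup>2))"
    by (rule lim_imp_Liminf[OF sequentially_bot, symmetric])
  qed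
  then have "(\<integral>\<^sup>+ x. ennreal ((cmod (s n x - l x))\<^sup>2) \<partial>M) =
    (\<integral>\<^sup>+ x. liminf (\<lambda>j. ennreal ((cmod (s n x - s (k j) x))\<^sup>2)) \<partial>M)"
   by (rule nn_integral_cong_AE)
  also have "\<dots> \<le> liminf (\<lambda>j. (\<integral>\<^sup>+ x. ennreal ((cmod (s n x - s (k j) x))\<^sup>2) \<partial>M))"
   using sm by (intro nn_integral_liminf) auto
  also have "\<dots> \<le> limsup (\<lambda>j. (\<integral>\<^sup>+ x. ennreal ((cmod (s n x - s (k j) x))\<^sup>2) \<partial>M))"
   by (rule Liminf_le_Limsup) simp
  also have "\<dots> \<le> ennreal ((1/4)^i)"
  proof (rule Limsup_bounded)
   show "\<forall>\<^sub>F j in sequentially. (\<integral>\<^sup>+ x. ennreal ((cmod (s n x - s (k j) x))\<^sup>2) \<partial>M) \<le> ennreal ((1/4)^i)"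
    unfolding eventually_sequentially
   proof (intro exI[of _ "N i"] allI impI)
    fix j assume "j \<ge> N i"
    then have "k j \<ge> N i" using ki[of j] by simp
    then have "(\<integral>x. (cmod (s n x - s (k j) x))\<^sup>2 \<partial>M) \<le> (1/4)^i" using N[OF n] less_imp_le by blast
    then show "(\<integral>\<^sup>+ x. ennreal ((cmod (s n x - s (k j) x))\<^sup>2) \<partial>M) \<le> ennreal ((1/4)^i)"
     by (subst nn_integral_eq_integral[OF dif]) (auto intro: ennreal_leI)
   qed
  qed
  finally show ?thesis .
 qed
 have diffsq: "(\<lambda>x. s n x - l x) \<in> sq_integrable M" if "n \<ge> N i" for n i
  unfolding sq_integrable_def
  using Fatou[OF that] sm lm by (auto intro!: integrableI_bounded simp: le_less_trans)
 have "l \<in> sq_integrable M"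
  using sq_integrable_diff[OF s diffsq[of 0 "N 0"], of "N 0"] by simp
 moreover have "\<exists>N. \<forall>n\<ge>N. (\<integral>x. (cmod (s n x - l x))\<^sup>2 \<partial>M) \<le> e" if e: "e > 0" for e
 proof -
  obtain i where i: "(1/4::real)^i < e" using real_arch_pow_inv[OF e, of "1/4"] by auto
  have "(\<integral>x. (cmod (s n x - l x))\<^sup>2 \<partial>M) \<le> e" if n: "n \<ge> N i" for n
  proof -
   have "ennreal (\<integral>x. (cmod (s n x - l x))\<^sup>2 \<partial>M) \<le> ennreal ((1/4)^i)"
    using Fatou[OF n] sq_integrableD(2)[OF diffsq[OF n]] by (subst (asm) nn_integral_eq_integral) auto
   then show ?thesis using i by simp
  qed
  then show ?thesis by blast
 qed
 ultimately show thesis using that by blast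
qed

lemma hilbert_space_L2:
 assumes M: "finite_measure M"
 shows "hilbert_space (L2 M)"
proof
 have z: "(\<lambda>x. 0) \<in> sq_integrable M" by (simp add: sq_integrable_def)
 note cl = z sq_integrable_add sq_integrable_scale
 note ops = L2_zero L2_add L2_scale cl l2_class_in
 note E = L2_carrierE[of _ M]
 show "hzero (L2 M) \<in> hcarrier (L2 M)" by (simp add: ops)
 show "hadd (L2 M) x y \<in> hcarrier (L2 M)" if "x \<in> hcarrier (L2 M)" "y \<in> hcarrier (L2 M)" for x y
  using that by (auto elim!: E simp: ops)
 show "hscale (L2 M) c x \<in> hcarrier (L2 M)" if "x \<in> hcarrier (L2 M)" for x c
  using that by (auto elim!: E simp: ops)
 show "hadd (L2 M) (hadd (L2 M) x y) z = hadd (L2 M) x (hadd (L2 M) y z)"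
  if "x \<in> hcarrier (L2 M)" "y \<in> hcarrier (L2 M)" "z \<in> hcarrier (L2 M)" for x y z
  using that by (auto elim!: E simp: ops add.assoc)
 show "hadd (L2 M) x y = hadd (L2 M) y x"
  if "x \<in> hcarrier (L2 M)" "y \<in> hcarrier (L2 M)" for x y
  using that by (auto elim!: E simp: ops add.commute)
 show "hadd (L2 M) x (hzero (L2 M)) = x" if "x \<in> hcarrier (L2 M)" for x
  using that by (auto elim!: E simp: ops)
 show "hadd (L2 M) x (hscale (L2 M) (- 1) x) = hzero (L2 M)" if "x \<in> hcarrier (L2 M)" for x
  using that sq_integrable_scale[of _ M "-1"] by (auto elim!: E simp: ops)
 show "hscale (L2 M) 1 x = x" if "x \<in> hcarrier (L2 M)" for x
  using that by (auto elim!: E simp: ops)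
 show "hscale (L2 M) c (hscale (L2 M) d x) = hscale (L2 M) (c * d) x" if "x \<in> hcarrier (L2 M)" for x c d
  using that by (auto elim!: E simp: ops mult.assoc)
 show "hscale (L2 M) c (hadd (L2 M) x y) = hadd (L2 M) (hscale (L2 M) c x) (hscale (L2 M) c y)"
  if "x \<in> hcarrier (L2 M)" "y \<in> hcarrier (L2 M)" for x y c
  using that by (auto elim!: E simp: ops distrib_left)
 show "hscale (L2 M) (c + d) x = hadd (L2 M) (hscale (L2 M) c x) (hscale (L2 M) d x)"
  if "x \<in> hcarrier (L2 M)" for x c d
  using that by (auto elim!: E simp: ops distrib_right)
 show "hinner (L2 M) (hadd (L2 M) x y) z = hinner (L2 M) x z + hinner (L2 M) y z"
  if "x \<in> hcarrier (L2 M)" "y \<in> hcarrier (L2 M)" "z \<in> hcarrier (L2 M)" for x y z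
  using that by (auto elim!: E simp: ops L2_inner distrib_right sq_integrable_product)
 show "hinner (L2 M) (hscale (L2 M) c x) y = c * hinner (L2 M) x y"
  if "x \<in> hcarrier (L2 M)" "y \<in> hcarrier (L2 M)" for x y c
  using that by (auto elim!: E simp: ops L2_inner mult.assoc)
 show "hinner (L2 M) y x = cnj (hinner (L2 M) x y)"
  if "x \<in> hcarrier (L2 M)" "y \<in> hcarrier (L2 M)" for x y
  using that(1)
 proof (rule E)
  fix f assume f: "f \<in> sq_integrable M" "x = l2_class M f"
  from that(2) obtain g where g: "g \<in> sq_integrable M" "y = l2_class M g" by (rule E)
  have "(\<integral>x. g x * cnj (f x) \<partial>M) = (\<integral>x. cnj (f x * cnj (g x)) \<partial>M)" by (simp add: mult.commute)
  also have "\<dots> = cnj (\<integral>x. f x * cnj (g x) \<partial>M)" by (rule Bochner_Integration.integral_cnj)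
  finally show ?thesis using f g by (simp only: L2_inner)
 qed
 show "hinner (L2 M) x x \<in> \<real>\<^sub>\<ge>\<^sub>0" if "x \<in> hcarrier (L2 M)" for x
  using that by (auto elim!: E simp: L2_inner_self)
 show "x = hzero (L2 M)" if x: "x \<in> hcarrier (L2 M)" "hinner (L2 M) x x = 0" for x
 proof -
  obtain f where f: "f \<in> sq_integrable M" "x = l2_class M f" using E[OF x(1)] .
  have "(\<integral>x. (cmod (f x))\<^sup>2 \<partial>M) = 0" using x f by (simp add: L2_inner_self)
  then have "AE x in M. f x = 0"
   using integral_nonneg_eq_0_iff_AE[OF sq_integrableD(2)[OF f(1)]] by simp
  then show ?thesis using f z by (simp add: L2_zero l2_class_eq_iff)
 qed
 fix s :: "nat => ('a => complex) set"
 assume s: "!!n. s n \<in> hcarrier (L2 M)"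
  and C: "!!e. e > 0 ==> \<exists>N. \<forall>m\<ge>N. \<forall>n\<ge>N. hdist (L2 M) (s m) (s n) < e"
 have "\<forall>n. \<exists>f. f \<in> sq_integrable M \<and> s n = l2_class M f" using E[OF s] by metis
 then obtain f where f: "!!n. f n \<in> sq_integrable M" "!!n. s n = l2_class M (f n)" by metis
 have CC: "\<exists>N. \<forall>m\<ge>N. \<forall>n\<ge>N. (\<integral>x. (cmod (f m x - f n x))\<^sup>2 \<partial>M) < e" if "e > 0" for e
 proof -
  obtain N where "\<forall>m\<ge>N. \<forall>n\<ge>N. hdist (L2 M) (s m) (s n) < sqrt e" using C[of "sqrt e"] \<open>e > 0\<close> by auto
  then show ?thesis by (auto simp: f L2_dist)
 qed
 obtain l where l: "l \<in> sq_integrable M" "!!e. e > 0 ==> \<exists>N. \<forall>n\<ge>N. (\<integral>x. (cmod (f n x - l x))\<^sup>2 \<partial>M) \<le> e"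
  using L2_Cauchy_limit[OF M f(1) CC] by metis
 have "(\<lambda>n. hdist (L2 M) (s n) (l2_class M l)) \<longlonglongrightarrow> 0"
 proof (rule LIMSEQ_I)
  fix r :: real assume r: "r > 0"
  then obtain N where N: "\<forall>n\<ge>N. (\<integral>x. (cmod (f n x - l x))\<^sup>2 \<partial>M) \<le> (r/2)\<^sup>2" using l(2)[of "(r/2)\<^sup>2"] by auto
  have "norm (hdist (L2 M) (s n) (l2_class M l) - 0) < r" if "n \<ge> N" for n
  proof -
   have "hdist (L2 M) (s n) (l2_class M l) \<le> r/2"
    unfolding f(2) L2_dist[OF f(1) l(1)] using N that r by (intro real_le_lsqrt) auto
   moreover have "hdist (L2 M) (s n) (l2_class M l) \<ge> 0" by (simp add: f L2_dist l)
   ultimately show ?thesis using r by simp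
  qed
  then show "\<exists>no. \<forall>n\<ge>no. norm (hdist (L2 M) (s n) (l2_class M l) - 0) < r" by blast
 qed
 then show "\<exists>l\<in>hcarrier (L2 M). (\<lambda>n. hdist (L2 M) (s n) l) \<longlonglongrightarrow> 0"
  using l2_class_in[OF l(1)] by blast
qed

context
 fixes X :: "'x topology" and \<mu> :: "'x measure"
 assumes X: "compact_space X" and \<mu>: "sets \<mu> = sets (borel_of_top X)" "finite_measure \<mu>"
begin

lemma cfun_measurable: "f \<in> cfun X ==> f \<in> borel_measurable \<mu>"
 using continuous_map_borel_measurable[OF \<mu>(1) cfun_continuous] .

lemma cfun_times_sq_integrable:
 assumes "f \<in> cfun X" "h \<in> sq_integrable \<mu>"
 shows "(\<lambda>x. f x * h x) \<in> sq_integrable \<mu>"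
proof -
 obtain B where "!!x. x \<in> topspace X ==> cmod (f x) \<le> B" using cfun_bounded[OF X assms(1)] by metis
 then show ?thesis
  using sq_integrable_times_bounded[OF cfun_measurable[OF assms(1)] _ assms(2)] space_eq_topspace[OF \<mu>(1)] by metis
qed

lemma cfun_sq_integrable: "f \<in> cfun X ==> f \<in> sq_integrable \<mu>"
proof -
 interpret finite_measure \<mu> by (rule \<mu>)
 assume "f \<in> cfun X"
 moreover have "(\<lambda>x. 1) \<in> sq_integrable \<mu>" by (simp add: sq_integrable_def)
 ultimately show ?thesis using cfun_times_sq_integrable[of f "\<lambda>x. 1"] by simp
qed

lemma l2_class_cong:
 assumes "f \<in> sq_integrable \<mu>" "g \<in> borel_measurable \<mu>" "!!x. x \<in> topspace X ==> f x = g x"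
 shows "l2_class \<mu> f = l2_class \<mu> g"
proof -
 note sp = space_eq_topspace[OF \<mu>(1)]
 have "integrable \<mu> (\<lambda>x. (cmod (g x))\<^sup>2) = integrable \<mu> (\<lambda>x. (cmod (f x))\<^sup>2)"
  using assms(3) sp by (intro Bochner_Integration.integrable_cong) auto
 then have "g \<in> sq_integrable \<mu>" using assms by (simp add: sq_integrable_def)
 then show ?thesis using assms sp by (auto simp: l2_class_eq_iff)
qed

lemma gns_rep_apply:
 assumes "f \<in> cfun X" "h \<in> sq_integrable \<mu>"
 shows "gns_rep X \<mu> f (l2_class \<mu> h) = l2_class \<mu> (\<lambda>x. f x * h x)"
proof -
 have "AE x in \<mu>. f x * l2_rep (l2_class \<mu> h) x = f x * h x"
  using l2_rep(2)[OF assms(2)] by eventually_elim simp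
 then show ?thesis
  using assms l2_rep[OF assms(2)]
  by (simp add: gns_rep_def l2_class_in l2_class_eq_iff cfun_times_sq_integrable)
qed

lemma gns_rep_cfun:
 assumes "f \<in> cfun X" "g \<in> cfun X"
 shows "gns_rep X \<mu> f (l2_class \<mu> g) = l2_class \<mu> (cf_mult X f g)"
 unfolding gns_rep_apply[OF assms(1) cfun_sq_integrable[OF assms(2)]]
 by (rule l2_class_cong) (use assms in \<open>auto intro: cfun_times_sq_integrable cfun_sq_integrable cfun_measurable cfun_closed\<close>)

lemma L2_inner_cfun:
 assumes "f \<in> cfun X" "g \<in> cfun X"
 shows "hinner (L2 \<mu>) (l2_class \<mu> f) (l2_class \<mu> g) = (\<integral>x. cf_mult X f (cf_star X g) x \<partial>\<mu>)"
 unfolding L2_inner[OF assms[THEN cfun_sq_integrable]]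
 by (rule Bochner_Integration.integral_cong) (auto simp: space_eq_topspace[OF \<mu>(1)])

lemma star_rep_gns_rep: "star_rep X (L2 \<mu>) (gns_rep X \<mu>)"
proof (rule star_repI[OF hilbert_space_L2[OF \<mu>(2)]])
 note cl = cfun_times_sq_integrable cfun_sq_integrable cfun_closed sq_integrable_add sq_integrable_scale
 note E = L2_carrierE[of _ \<mu>]
 note meas = sq_integrableD(1)[OF cfun_times_sq_integrable]
 show "gns_rep X \<mu> \<in> cfun X \<rightarrow>\<^sub>E hcarrier (L2 \<mu>) \<rightarrow>\<^sub>E hcarrier (L2 \<mu>)"
 proof (intro PiE_I)
  show "gns_rep X \<mu> f u \<in> hcarrier (L2 \<mu>)" if "f \<in> cfun X" "u \<in> hcarrier (L2 \<mu>)" for f u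
   using that by (auto elim!: E simp: gns_rep_apply cl l2_class_in)
 qed (auto simp: gns_rep_def)
 show "\<exists>B. \<forall>h\<in>hcarrier (L2 \<mu>). hnorm (L2 \<mu>) (gns_rep X \<mu> f h) \<le> B * hnorm (L2 \<mu>) h" if f: "f \<in> cfun X" for f
 proof -
  obtain B where B: "B \<ge> 0" "!!x. x \<in> topspace X ==> cmod (f x) \<le> B" using cfun_bounded[OF X f] by metis
  have "hnorm (L2 \<mu>) (gns_rep X \<mu> f u) \<le> B * hnorm (L2 \<mu>) u" if u: "u \<in> hcarrier (L2 \<mu>)" for u
  proof -
   obtain h where h: "h \<in> sq_integrable \<mu>" "u = l2_class \<mu> h" using E[OF u] .
   have "(\<integral>x. (cmod (f x * h x))\<^sup>2 \<partial>\<mu>) \<le> (\<integral>x. B\<^sup>2 * (cmod (h x))\<^sup>2 \<partial>\<mu>)"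
   proof (rule integral_mono)
    show "(cmod (f x * h x))\<^sup>2 \<le> B\<^sup>2 * (cmod (h x))\<^sup>2" if "x \<in> space \<mu>" for x
     using B that space_eq_topspace[OF \<mu>(1)] by (simp add: norm_mult power_mult_distrib mult_right_mono power_mono)
   qed (use sq_integrableD(2)[OF h(1)] sq_integrableD(2)[OF cfun_times_sq_integrable[OF f h(1)]] in auto)
   also have "\<dots> = B\<^sup>2 * (\<integral>x. (cmod (h x))\<^sup>2 \<partial>\<mu>)" by simp
   finally have "sqrt (\<integral>x. (cmod (f x * h x))\<^sup>2 \<partial>\<mu>) \<le> B * sqrt (\<integral>x. (cmod (h x))\<^sup>2 \<partial>\<mu>)"
    using B(1) by (metis real_sqrt_le_mono real_sqrt_mult real_sqrt_unique)
   then show ?thesis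
    using h f by (simp add: hnorm_def gns_rep_apply L2_inner_self cl)
  qed
  then show ?thesis by blast
 qed
 show "gns_rep X \<mu> (cf_add X f g) u = hadd (L2 \<mu>) (gns_rep X \<mu> f u) (gns_rep X \<mu> g u)"
  if "f \<in> cfun X" "g \<in> cfun X" "u \<in> hcarrier (L2 \<mu>)" for f g u
  using that(3)
 proof (rule E)
  fix h assume h: "h \<in> sq_integrable \<mu>" "u = l2_class \<mu> h"
  show ?thesis unfolding h(2) using that(1,2) h(1)
   by (simp add: gns_rep_apply L2_add cl, intro l2_class_cong)
    (auto intro: cl meas borel_measurable_add simp: distrib_right)
 qed
 show "gns_rep X \<mu> (cf_scale X c f) u = hscale (L2 \<mu>) c (gns_rep X \<mu> f u)"
  if "f \<in> cfun X" "u \<in> hcarrier (L2 \<mu>)" for c f u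
  using that(2)
 proof (rule E)
  fix h assume h: "h \<in> sq_integrable \<mu>" "u = l2_class \<mu> h"
  show ?thesis unfolding h(2) using that(1) h(1)
   by (simp add: gns_rep_apply L2_scale cl, intro l2_class_cong)
    (auto intro: cl meas borel_measurable_times simp: mult.assoc)
 qed
 show "gns_rep X \<mu> (cf_mult X f g) u = gns_rep X \<mu> f (gns_rep X \<mu> g u)"
  if "f \<in> cfun X" "g \<in> cfun X" "u \<in> hcarrier (L2 \<mu>)" for f g u
  using that(3)
 proof (rule E)
  fix h assume h: "h \<in> sq_integrable \<mu>" "u = l2_class \<mu> h"
  show ?thesis unfolding h(2) using that(1,2) h(1)
   by (simp add: gns_rep_apply cl, intro l2_class_cong)
    (auto intro: cl meas simp: mult.assoc)
 qed
 show "hinner (L2 \<mu>) (gns_rep X \<mu> f u) v = hinner (L2 \<mu>) u (gns_rep X \<mu> (cf_star X f) v)"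
  if "f \<in> cfun X" "u \<in> hcarrier (L2 \<mu>)" "v \<in> hcarrier (L2 \<mu>)" for f u v
  using that(2)
 proof (rule E)
  fix h assume h: "h \<in> sq_integrable \<mu>" "u = l2_class \<mu> h"
  from that(3) obtain h' where h': "h' \<in> sq_integrable \<mu>" "v = l2_class \<mu> h'" by (rule E)
  show ?thesis unfolding h(2) h'(2) using that(1) h(1) h'(1)
   by (simp add: gns_rep_apply cl L2_inner)
    (intro Bochner_Integration.integral_cong, auto simp: space_eq_topspace[OF \<mu>(1)] mult_ac)
 qed
qed

end

text \<open>Continuous functions are dense in the space of square-integrable ones: for indicators this is
 regularity and Urysohn's lemma, and simple functions are dense.\<close>

lemma cfun_dense_L2:
 assumes X: "compact_space X" "Hausdorff_space X" and \<mu>: "\<mu> \<in> pos_regular_measures X"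
  and u: "u \<in> hcarrier (L2 \<mu>)" and e: "e > 0"
 shows "\<exists>v\<in>l2_class \<mu> ` cfun X. hdist (L2 \<mu>) v u < e"
proof -
 note \<mu>' = pos_regular_measuresD[OF \<mu>]
 interpret finite_measure \<mu> by (rule \<mu>')
 note sp = space_eq_topspace[OF \<mu>'(1)]
 note cfsq = cfun_sq_integrable[OF X(1) \<mu>']
 define D where "D = {f \<in> sq_integrable \<mu>. \<forall>e>0. \<exists>g\<in>cfun X. (\<integral>x. (cmod (g x - f x))\<^sup>2 \<partial>\<mu>) \<le> e}"
 have D_D: "\<exists>g\<in>cfun X. (\<integral>x. (cmod (g x - f x))\<^sup>2 \<partial>\<mu>) \<le> e" if "f \<in> D" "e > 0" for f and e :: real
  using that by (simp add: D_def)
 have D_near: "f \<in> D" if f: "f \<in> sq_integrable \<mu>"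
  and near: "!!e. e > 0 ==> \<exists>g\<in>D. (\<integral>x. (cmod (g x - f x))\<^sup>2 \<partial>\<mu>) \<le> e" for f
  unfolding D_def
 proof (intro CollectI conjI f allI impI)
  fix e :: real assume "e > 0"
  then have e4: "e/4 > 0" by simp
  obtain g where g: "g \<in> D" "(\<integral>x. (cmod (g x - f x))\<^sup>2 \<partial>\<mu>) \<le> e/4" using near[OF e4] by blast
  obtain h where h: "h \<in> cfun X" "(\<integral>x. (cmod (h x - g x))\<^sup>2 \<partial>\<mu>) \<le> e/4" using D_D[OF g(1) e4] by blast
  have gs: "g \<in> sq_integrable \<mu>" using g by (simp add: D_def)
  note I1 = sq_integrableD(2)[OF sq_integrable_diff[OF cfsq[OF h(1)] gs]]
   and I2 = sq_integrableD(2)[OF sq_integrable_diff[OF gs f]]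
  have "(\<integral>x. (cmod (h x - f x))\<^sup>2 \<partial>\<mu>) \<le> (\<integral>x. 2 * (cmod (h x - g x))\<^sup>2 + 2 * (cmod (g x - f x))\<^sup>2 \<partial>\<mu>)"
  proof (rule integral_mono)
   show "integrable \<mu> (\<lambda>x. (cmod (h x - f x))\<^sup>2)"
    by (rule sq_integrableD(2)[OF sq_integrable_diff[OF cfsq[OF h(1)] f]])
   show "(cmod (h x - f x))\<^sup>2 \<le> 2 * (cmod (h x - g x))\<^sup>2 + 2 * (cmod (g x - f x))\<^sup>2" for x
    using cmod_add_sq_le[of "h x - g x" "g x - f x"] by simp
  qed (use I1 I2 in auto)
  also have "\<dots> \<le> e" using g h I1 I2 by simp
  finally show "\<exists>g\<in>cfun X. (\<integral>x. (cmod (g x - f x))\<^sup>2 \<partial>\<mu>) \<le> e" using h(1) by blast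
 qed
 have D_add: "(\<lambda>x. f x + g x) \<in> D" if fg: "f \<in> D" "g \<in> D" for f g
  unfolding D_def
 proof (intro CollectI conjI allI impI)
  have fs: "f \<in> sq_integrable \<mu>" "g \<in> sq_integrable \<mu>" using fg by (auto simp: D_def)
  then show s: "(\<lambda>x. f x + g x) \<in> sq_integrable \<mu>" by (rule sq_integrable_add)
  fix e :: real assume "e > 0"
  then have e4: "e/4 > 0" by simp
  obtain f' where f': "f' \<in> cfun X" "(\<integral>x. (cmod (f' x - f x))\<^sup>2 \<partial>\<mu>) \<le> e/4" using D_D[OF fg(1) e4] by blast
  obtain g' where g': "g' \<in> cfun X" "(\<integral>x. (cmod (g' x - g x))\<^sup>2 \<partial>\<mu>) \<le> e/4" using D_D[OF fg(2) e4] by blast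
  note I1 = sq_integrableD(2)[OF sq_integrable_diff[OF cfsq[OF f'(1)] fs(1)]]
   and I2 = sq_integrableD(2)[OF sq_integrable_diff[OF cfsq[OF g'(1)] fs(2)]]
  have "(\<integral>x. (cmod (cf_add X f' g' x - (f x + g x)))\<^sup>2 \<partial>\<mu>) \<le> (\<integral>x. 2 * (cmod (f' x - f x))\<^sup>2 + 2 * (cmod (g' x - g x))\<^sup>2 \<partial>\<mu>)"
  proof (rule integral_mono)
   show "integrable \<mu> (\<lambda>x. (cmod (cf_add X f' g' x - (f x + g x)))\<^sup>2)"
    by (rule sq_integrableD(2)[OF sq_integrable_diff[OF cfsq[OF cf_add_in] s]]) (use f' g' in auto)
   show "(cmod (cf_add X f' g' x - (f x + g x)))\<^sup>2 \<le> 2 * (cmod (f' x - f x))\<^sup>2 + 2 * (cmod (g' x - g x))\<^sup>2"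
    if "x \<in> space \<mu>" for x
    using cmod_add_sq_le[of "f' x - f x" "g' x - g x"] that sp by (simp add: algebra_simps)
  qed (use I1 I2 in auto)
  also have "\<dots> \<le> e" using f' g' I1 I2 by simp
  finally show "\<exists>h\<in>cfun X. (\<integral>x. (cmod (h x - (f x + g x)))\<^sup>2 \<partial>\<mu>) \<le> e"
   using cf_add_in[OF f'(1) g'(1)] by blast
 qed
 have D_indicator: "(\<lambda>x. c * indicator E x) \<in> D" if E: "E \<in> sets \<mu>" for c E
  unfolding D_def
 proof (intro CollectI conjI allI impI)
  have Es: "(\<lambda>x. indicator E x :: complex) \<in> sq_integrable \<mu>"
   by (rule sq_integrable_dominated[where g = "\<lambda>x. 1"]) (use E in \<open>auto simp: indicator_def\<close>)
  then show s: "(\<lambda>x. c * indicator E x) \<in> sq_integrable \<mu>" by (rule sq_integrable_scale)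
  fix e :: real assume e: "e > 0"
  define r where "r = e / ((cmod c)\<^sup>2 + 1)"
  have c: "(cmod c)\<^sup>2 + 1 > 0" by (simp add: add_nonneg_pos)
  have r: "r > 0" "(cmod c)\<^sup>2 * r \<le> e"
   using e c by (auto simp: r_def pos_divide_le_eq algebra_simps)
  obtain C U where CU: "compactin X C" "openin X U" "C \<subseteq> E" "E \<subseteq> U" "measure \<mu> U \<le> measure \<mu> C + r"
   using regular_squeeze[OF X \<mu> E r(1)] .
  have "C \<subseteq> U" using CU by blast
  then obtain f where f: "continuous_map X euclideanreal f" "!!x. x \<in> topspace X ==> 0 \<le> f x \<and> f x \<le> 1"
   "!!x. x \<in> C ==> f x = 1" "!!x. x \<in> topspace X - U ==> f x = 0"
   using Urysohn_compact_open[OF X CU(1,2)] by metis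
  define g where "g = (\<lambda>x\<in>topspace X. c * complex_of_real (f x))"
  have g: "g \<in> cfun X"
   unfolding g_def by (intro restrict_in_cfun continuous_map_times continuous_map_of_real f) auto
  have Us: "U - C \<in> sets \<mu>"
   using openin_sets[OF \<mu>'(1) CU(2)] compactin_sets[OF X(2) \<mu>'(1) CU(1)] by blast
  have "(\<integral>x. (cmod (g x - c * indicator E x))\<^sup>2 \<partial>\<mu>) \<le> (\<integral>x. (cmod c)\<^sup>2 * indicator (U - C) x \<partial>\<mu>)"
  proof (rule integral_mono)
   show "integrable \<mu> (\<lambda>x. (cmod (g x - c * indicator E x))\<^sup>2)"
    by (rule sq_integrableD(2)[OF sq_integrable_diff[OF cfsq[OF g] s]])
   show "integrable \<mu> (\<lambda>x. (cmod c)\<^sup>2 * indicat_real (U - C) x)" using Us by (simp add: emeasure_eq_measure)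
   fix x assume "x \<in> space \<mu>"
   then have x: "x \<in> topspace X" using sp by simp
   have gx: "g x - c * indicator E x = c * of_real (f x - indicator E x)"
    using x by (simp add: g_def algebra_simps indicator_def)
   have "\<bar>f x - indicator E x\<bar> \<le> indicator (U - C) x"
    using f(2)[OF x] f(3)[of x] f(4)[of x] CU x by (auto simp: indicator_def)
   then have "(f x - indicator E x)\<^sup>2 \<le> (indicator (U - C) x)\<^sup>2"
    by (subst abs_le_square_iff[symmetric]) (simp add: indicator_def)
   also have "\<dots> = (indicator (U - C) x :: real)" by (simp add: indicator_def)
   finally show "(cmod (g x - c * indicator E x))\<^sup>2 \<le> (cmod c)\<^sup>2 * indicat_real (U - C) x"
    unfolding gx norm_mult norm_of_real power_mult_distrib power2_abs by (intro mult_left_mono) auto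
  qed
  also have "\<dots> = (cmod c)\<^sup>2 * (measure \<mu> U - measure \<mu> C)"
   using Us finite_measure_Diff[of U C] openin_sets[OF \<mu>'(1) CU(2)] compactin_sets[OF X(2) \<mu>'(1) CU(1)] \<open>C \<subseteq> U\<close> by simp
  also have "\<dots> \<le> (cmod c)\<^sup>2 * r" using CU by (intro mult_left_mono) auto
  finally show "\<exists>g\<in>cfun X. (\<integral>x. (cmod (g x - c * indicator E x))\<^sup>2 \<partial>\<mu>) \<le> e" using g r by force
 qed
 have zero: "(\<lambda>x. 0) \<in> D" using D_indicator[of "{}" 0] by simp
 have D_simple: "f \<in> D" if f: "simple_function \<mu> f" for f
 proof -
  have sets: "f -` {y} \<inter> space \<mu> \<in> sets \<mu>" for y using simple_functionD(2)[OF f] .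
  have *: "(\<lambda>x. \<Sum>y\<in>Y. y * indicator (f -` {y} \<inter> space \<mu>) x) \<in> D" if "finite Y" for Y
   using that
  proof (induction Y)
   case (insert y Y)
   show ?case
    unfolding sum.insert[OF insert.hyps] by (rule D_add[OF D_indicator[OF sets] insert.IH])
  qed (simp add: zero)
  let ?g = "\<lambda>x. \<Sum>y\<in>f ` space \<mu>. y * indicator (f -` {y} \<inter> space \<mu>) x"
  have g: "?g \<in> D" using *[OF simple_functionD(1)[OF f]] .
  have eq: "f x = ?g x" if "x \<in> space \<mu>" for x
  proof -
   have "?g x = (\<Sum>y\<in>f ` space \<mu>. if y = f x then y else 0)"
    using that by (intro sum.cong) (auto simp: indicator_def)
   then show ?thesis using that simple_functionD(1)[OF f] by simp
  qed
  have fm: "f \<in> borel_measurable \<mu>" using f by (rule borel_measurable_simple_function)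
  have int: "(\<integral>x. (cmod (?g x - f x))\<^sup>2 \<partial>\<mu>) = (\<integral>x. 0 \<partial>\<mu>)"
   by (rule Bochner_Integration.integral_cong) (auto simp: eq[symmetric])
  have "integrable \<mu> (\<lambda>x. (cmod (f x))\<^sup>2) = integrable \<mu> (\<lambda>x. (cmod (?g x))\<^sup>2)"
   by (rule Bochner_Integration.integrable_cong) (auto simp: eq[symmetric])
  then have "f \<in> sq_integrable \<mu>" using g fm by (simp add: D_def sq_integrable_def)
  then show ?thesis by (rule D_near) (use g int in \<open>auto intro!: bexI[OF _ g]\<close>)
 qed
 obtain f where f: "f \<in> sq_integrable \<mu>" "u = l2_class \<mu> f" using L2_carrierE[OF u] .
 note fm = sq_integrableD[OF f(1)]
 have "f \<in> D"
 proof (rule D_near[OF f(1)])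
  fix e :: real assume e: "e > 0"
  obtain F where F: "!!i. simple_function \<mu> (F i)" "!!x. x \<in> space \<mu> ==> (\<lambda>i. F i x) \<longlonglongrightarrow> f x"
    "!!i x. x \<in> space \<mu> ==> dist (F i x) 0 \<le> 2 * dist (f x) 0"
   using borel_measurable_implies_sequence_metric[OF fm(1), of 0] by metis
  have FM: "F i \<in> borel_measurable \<mu>" for i by (rule borel_measurable_simple_function[OF F(1)])
  have "(\<lambda>i. (\<integral>x. (cmod (F i x - f x))\<^sup>2 \<partial>\<mu>)) \<longlonglongrightarrow> (\<integral>x. 0 \<partial>\<mu>)"
  proof (rule integral_dominated_convergence[where w = "\<lambda>x. 10 * (cmod (f x))\<^sup>2"])
   show "AE x in \<mu>. (\<lambda>i. (cmod (F i x - f x))\<^sup>2) \<longlonglongrightarrow> 0"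
   proof (rule AE_I2)
    fix x assume "x \<in> space \<mu>"
    from tendsto_power[OF tendsto_norm[OF tendsto_diff[OF F(2)[OF this] tendsto_const[of "f x"]]], of 2]
    show "(\<lambda>i. (cmod (F i x - f x))\<^sup>2) \<longlonglongrightarrow> 0" by simp
   qed
   show "AE x in \<mu>. norm ((cmod (F i x - f x))\<^sup>2) \<le> 10 * (cmod (f x))\<^sup>2" for i
   proof (rule AE_I2)
    fix x assume x: "x \<in> space \<mu>"
    have "(cmod (F i x))\<^sup>2 \<le> (2 * cmod (f x))\<^sup>2" using F(3)[OF x, of i] by (intro power_mono) auto
    then show "norm ((cmod (F i x - f x))\<^sup>2) \<le> 10 * (cmod (f x))\<^sup>2"
     using cmod_add_sq_le[of "F i x" "- f x"] by (simp add: power_mult_distrib)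
   qed
  qed (use fm FM in auto)
  then obtain i where "(\<integral>x. (cmod (F i x - f x))\<^sup>2 \<partial>\<mu>) < e"
   using order_tendstoD(2)[of _ 0 sequentially e] e by (auto simp: eventually_sequentially)
  then show "\<exists>g\<in>D. (\<integral>x. (cmod (g x - f x))\<^sup>2 \<partial>\<mu>) \<le> e" using D_simple[OF F(1)] by (auto intro: less_imp_le)
 qed
 then obtain g where g: "g \<in> cfun X" "(\<integral>x. (cmod (g x - f x))\<^sup>2 \<partial>\<mu>) \<le> (e/2)\<^sup>2"
  using D_D[of f "(e/2)\<^sup>2"] e by auto
 have "hdist (L2 \<mu>) (l2_class \<mu> g) u \<le> e/2"
  unfolding f(2) L2_dist[OF cfsq[OF g(1)] f(1)] using g e by (intro real_le_lsqrt) auto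
 then show ?thesis using g e by (intro bexI[of _ "l2_class \<mu> g"]) auto
qed

section \<open>Continuous affine functions on the state space\<close>

lemma positive_functional_sum:
 assumes \<phi>: "positive_functional X (cfun X) \<phi>" and J: "finite J" "!!j. j \<in> J ==> g j \<in> cfun X"
 shows "\<phi> (\<lambda>x\<in>topspace X. \<Sum>j\<in>J. g j x) = (\<Sum>j\<in>J. \<phi> (g j))" "(\<lambda>x\<in>topspace X. \<Sum>j\<in>J. g j x) \<in> cfun X"
proof -
 define S where "S J = (\<lambda>x\<in>topspace X. \<Sum>j\<in>J. g j x)" for J
 have "\<phi> (S J) = (\<Sum>j\<in>J. \<phi> (g j)) \<and> S J \<in> cfun X"
  using J
 proof (induction J)
  case empty
  have "S {} = cf_scale X 0 (cf_one X)" by (auto simp: S_def cf_scale_def)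
  then show ?case by (simp add: positive_functionalD[OF \<phi>] cf_scale_in)
 next
  case (insert a J)
  have "S (insert a J) = cf_add X (g a) (S J)"
   using insert by (auto simp: S_def cf_add_def)
  then show ?case using insert by (simp add: positive_functionalD[OF \<phi>] cf_add_in)
 qed
 then show "\<phi> (\<lambda>x\<in>topspace X. \<Sum>j\<in>J. g j x) = (\<Sum>j\<in>J. \<phi> (g j))" "(\<lambda>x\<in>topspace X. \<Sum>j\<in>J. g j x) \<in> cfun X"
  by (auto simp: S_def)
qed

lemma convex_states:
 assumes A: "function_system X A" and \<alpha>: "\<alpha> \<in> states X A" and \<beta>: "\<beta> \<in> states X A" and t: "t \<in> {0..1}"
 shows "(\<lambda>a\<in>A. of_real t * \<alpha> a + of_real (1 - t) * \<beta> a) \<in> states X A"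
proof -
 note A' = function_systemD[OF A]
 have sc: "of_real r * z \<in> \<real>\<^sub>\<ge>\<^sub>0" if "r \<ge> 0" "z \<in> \<real>\<^sub>\<ge>\<^sub>0" for r :: real and z :: complex
  using that by (simp add: complex_nonneg_Reals_iff)
 have nn: "of_real t * z + of_real (1 - t) * z' \<in> \<real>\<^sub>\<ge>\<^sub>0" if "z \<in> \<real>\<^sub>\<ge>\<^sub>0" "z' \<in> \<real>\<^sub>\<ge>\<^sub>0" for z z' :: complex
  by (intro nonneg_Reals_add_I sc) (use t that in auto)
 show ?thesis
  unfolding states_def
 proof (intro CollectI conjI ballI allI impI)
  fix f assume f: "f \<in> A" "\<forall>x\<in>topspace X. f x \<in> \<real>\<^sub>\<ge>\<^sub>0"
  then have "\<alpha> f \<in> \<real>\<^sub>\<ge>\<^sub>0" "\<beta> f \<in> \<real>\<^sub>\<ge>\<^sub>0" using \<alpha> \<beta> by (auto simp: states_def)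
  then show "(\<lambda>a\<in>A. of_real t * \<alpha> a + of_real (1 - t) * \<beta> a) f \<in> \<real>\<^sub>\<ge>\<^sub>0"
   using nn f(1) by (simp del: of_real_diff)
 qed (use \<alpha> \<beta> A' in \<open>auto simp: states_def algebra_simps\<close>)
qed

lemma affine_finite_combination:
 assumes A: "function_system X A" and f: "f \<in> affine_cfun A (state_space X A)"
  and J: "finite J" "J \<noteq> {}" "!!j. j \<in> J ==> k j \<in> states X A"
  and w: "!!j. j \<in> J ==> w j \<ge> 0" "(\<Sum>j\<in>J. w j) = (1::real)"
 shows "(\<lambda>a\<in>A. \<Sum>j\<in>J. of_real (w j) * k j a) \<in> states X A \<and>
  f (\<lambda>a\<in>A. \<Sum>j\<in>J. of_real (w j) * k j a) = (\<Sum>j\<in>J. of_real (w j) * f (k j))"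
 using J w
proof (induction J arbitrary: w rule: finite_ne_induct)
 case (singleton j)
 have "(\<lambda>a\<in>A. k j a) = k j"
  using singleton by (intro extensionalityI[of _ A]) (auto simp: states_def)
 then show ?case using singleton by simp
next
 case (insert j J)
 have aff: "f (\<lambda>a\<in>A. of_real t * \<alpha> a + of_real (1 - t) * \<beta> a) = of_real t * f \<alpha> + of_real (1 - t) * f \<beta>"
  if "\<alpha> \<in> states X A" "\<beta> \<in> states X A" "t \<in> {0..1}" for \<alpha> \<beta> t
  using f that by (simp add: affine_cfun_def)
 have kj: "k j \<in> states X A" using insert.prems by simp
 have sum: "w j + (\<Sum>i\<in>J. w i) = 1" using insert by simp
 have nn: "(\<Sum>i\<in>J. w i) \<ge> 0" using insert.prems by (intro sum_nonneg) auto
 have wj: "w j \<in> {0..1}" using sum nn insert.prems(2)[of j] by simp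
 show ?case
 proof (cases "w j = 1")
  case True
  then have "(\<Sum>i\<in>J. w i) = 0" using sum by simp
  then have "w i = 0" if "i \<in> J" for i
   using that insert.hyps(1) insert.prems(2) by (simp add: sum_nonneg_eq_0_iff)
  then have z: "(\<Sum>i\<in>J. of_real (w i) * c i) = (0::complex)" for c by simp
  have "(\<lambda>a\<in>A. k j a) = k j" using kj by (intro extensionalityI[of _ A]) (auto simp: states_def)
  then show ?thesis using insert.hyps True kj by (simp add: z)
 next
  case False
  define r where "r = 1 - w j"
  have r: "r > 0" using False wj by (simp add: r_def)
  define v where "v i = w i / r" for i
  define \<beta> where "\<beta> = (\<lambda>a\<in>A. \<Sum>i\<in>J. of_real (v i) * k i a)"
  have IH: "\<beta> \<in> states X A" "f \<beta> = (\<Sum>i\<in>J. of_real (v i) * f (k i))"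
  proof -
   have "!!i. i \<in> J ==> k i \<in> states X A" "!!i. i \<in> J ==> v i \<ge> 0" "sum v J = 1"
    using insert.prems r sum by (auto simp: v_def r_def simp flip: sum_divide_distrib)
   from insert.IH[OF this] show "\<beta> \<in> states X A" "f \<beta> = (\<Sum>i\<in>J. of_real (v i) * f (k i))"
    unfolding \<beta>_def by blast+
  qed
  have rv: "of_real (1 - w j) * (\<Sum>i\<in>J. of_real (v i) * c i) = (\<Sum>i\<in>J. of_real (w i) * c i)" for c :: "_ => complex"
  proof -
   have "of_real (1 - w j) * (of_real (v i) * c i) = of_real (w i) * c i" for i
    using r by (simp add: v_def r_def[symmetric] flip: of_real_mult of_real_diff)
   then show ?thesis unfolding sum_distrib_left by (intro sum.cong refl)
  qed
  have "(\<lambda>a\<in>A. of_real (w j) * k j a + of_real (1 - w j) * \<beta> a) = (\<lambda>a\<in>A. \<Sum>i\<in>insert j J. of_real (w i) * k i a)"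
   using insert.hyps by (auto simp: \<beta>_def rv simp del: of_real_diff)
  then show ?thesis
   using convex_states[OF A kj IH(1) wj] aff[OF kj IH(1) wj] insert.hyps by (simp add: IH(2) rv del: of_real_diff restrict_apply)
 qed
qed

text \<open>A state of \<open>C(X)\<close> is a limit of convex combinations of point evaluations, taken at the points
 of an adapted partition of unity with the masses of its members as weights. Hence it respects
 every continuous affine function on the state space of \<open>A\<close>.\<close>

lemma affine_barycentre:
 assumes X: "compact_space X" and A: "function_system X A" and f: "f \<in> affine_cfun A (state_space X A)"
  and \<phi>: "positive_functional X (cfun X) \<phi>" "\<phi> (cf_one X) = 1"
 shows "\<phi> (\<lambda>x\<in>topspace X. f (point_state A x)) = f (\<lambda>a\<in>A. \<phi> a)"
proof -
 note A' = function_systemD[OF A] and \<phi>' = positive_functionalD[OF \<phi>(1)] and F = function_system_cfun[OF X]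
 let ?K = "state_space X A" and ?k = "\<lambda>a\<in>A. \<phi> a" and ?g = "\<lambda>x\<in>topspace X. f (point_state A x)"
 have cf: "continuous_map ?K euclidean f" using f by (simp add: affine_cfun_def cfun_continuous)
 have g: "?g \<in> cfun X"
  using continuous_map_compose[OF continuous_map_point_state[OF A] cf] by (intro restrict_in_cfun) (simp add: o_def)
 have k: "?k \<in> states X A"
  using A' \<phi>' \<phi>(2) unfolding states_def by (auto simp: subset_eq)
 have "cmod (\<phi> ?g - f ?k) \<le> 0 + 2 * e" if e: "e > 0" for e
 proof -
  have "openin ?K {\<alpha> \<in> topspace ?K. f \<alpha> \<in> ball (f ?k) e}"
   by (rule openin_continuous_map_preimage[OF cf]) simp
  from this[unfolded state_space_def openin_subtopology]
  obtain W where W0: "openin (product_topology (\<lambda>_. euclidean) A) W \<and>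
    {\<alpha> \<in> topspace ?K. f \<alpha> \<in> ball (f ?k) e} = W \<inter> states X A"
   unfolding state_space_def by (rule exE)
  note W = conjunct1[OF W0] conjunct2[OF W0]
  have "?k \<in> {\<alpha> \<in> topspace ?K. f \<alpha> \<in> ball (f ?k) e}" using k e by simp
  then have "?k \<in> W" unfolding W(2) by (rule IntD1)
  from W(1)[unfolded openin_product_topology_alt topspace_euclidean open_openin[symmetric], rule_format, OF this]
  obtain U where U0: "finite {a \<in> A. U a \<noteq> UNIV} \<and> (\<forall>a\<in>A. open (U a)) \<and> ?k \<in> PiE A U \<and> PiE A U \<subseteq> W"
   by (rule exE)
  note U = conjunct1[OF U0] U0[THEN conjunct2, THEN conjunct1, rule_format]
   U0[THEN conjunct2, THEN conjunct2, THEN conjunct1] U0[THEN conjunct2, THEN conjunct2, THEN conjunct2]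
  let ?F = "{a \<in> A. U a \<noteq> UNIV}"
  have "\<forall>a\<in>?F. \<exists>d>0. ball (\<phi> a) d \<subseteq> U a"
   using U(2,3) by (auto simp: PiE_def Pi_def open_contains_ball)
  from bchoice[OF this] obtain d where d0: "\<forall>a\<in>?F. d a > 0 \<and> ball (\<phi> a) (d a) \<subseteq> U a"
   by (rule exE)
  note d = d0[rule_format]
  define r where "r = Min (insert e ((\<lambda>a. d a / 2) ` ?F))"
  have r: "r > 0" "r \<le> e" "!!a. a \<in> ?F ==> r < d a"
  proof -
   show "r > 0" "r \<le> e" unfolding r_def using U(1) d e by auto
   fix a assume a: "a \<in> ?F"
   then have "r \<le> d a / 2" unfolding r_def using U(1) by (intro Min_le) auto
   then show "r < d a" using d[OF a] by simp
  qed
  have cF: "continuous_map X euclidean h" if "h \<in> insert ?g ?F" for h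
   using that g A'(1) by (auto dest: cfun_continuous)
  have finF: "finite (insert ?g ?F)" using U(1) by simp
  obtain J and \<psi> :: "'a => 'a => real" where J: "finite J" "J \<subseteq> topspace X"
   "!!j. j \<in> J ==> continuous_map X euclidean (\<psi> j)"
   "!!j x. j \<in> J ==> x \<in> topspace X ==> \<psi> j x \<ge> 0"
   "!!x. x \<in> topspace X ==> (\<Sum>j\<in>J. \<psi> j x) = 1"
   "!!h j x. h \<in> insert ?g ?F ==> j \<in> J ==> x \<in> topspace X ==> \<psi> j x \<noteq> 0 ==> cmod (h x - h j) \<le> r"
   by (rule adapted_partition_of_unity[OF X finF cF r(1)]) (assumption, rule that)
  define G where "G j = (\<lambda>x\<in>topspace X. complex_of_real (\<psi> j x))" for j
  have G: "G j \<in> cfun X" if "j \<in> J" for j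
   unfolding G_def by (intro restrict_in_cfun continuous_map_of_real J(3) that)
  define w where "w j = Re (\<phi> (G j))" for j
  have Gw: "\<phi> (G j) = of_real (w j)" "w j \<ge> 0" if j: "j \<in> J" for j
  proof -
   have "\<phi> (G j) \<in> \<real>\<^sub>\<ge>\<^sub>0" using j J(4) by (intro \<phi>'(3) G) (auto simp: G_def)
   then show "\<phi> (G j) = of_real (w j)" "w j \<ge> 0" by (auto simp: w_def complex_nonneg_Reals_iff complex_eq_iff)
  qed
  have approx: "cmod (\<phi> h - (\<Sum>j\<in>J. of_real (w j) * h j)) \<le> r" if h: "h \<in> insert ?g ?F" "h \<in> cfun X" for h
  proof -
   let ?T = "\<lambda>j. cf_mult X (G j) (cf_add X h (cf_scale X (- h j) (cf_one X)))"
   have split: "\<phi> (?T j) = \<phi> (cf_mult X (G j) h) - of_real (w j) * h j" if j: "j \<in> J" for j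
   proof -
    have "?T j = cf_add X (cf_mult X (G j) h) (cf_scale X (- h j) (G j))"
     by (auto simp: cf_mult_def cf_add_def cf_scale_def cf_one_def algebra_simps)
    then show ?thesis using G[OF j] h(2) by (simp add: \<phi>' cfun_closed Gw[OF j] mult.commute)
   qed
   have T: "?T j \<in> cfun X" if "j \<in> J" for j using G[OF that] h by (simp add: cfun_closed)
   have "(\<Sum>j\<in>J. \<phi> (cf_mult X (G j) h)) = \<phi> (\<lambda>x\<in>topspace X. \<Sum>j\<in>J. cf_mult X (G j) h x)"
    by (rule positive_functional_sum(1)[OF \<phi>(1) J(1), symmetric]) (use G h in \<open>auto intro: cfun_closed\<close>)
   also have "(\<lambda>x\<in>topspace X. \<Sum>j\<in>J. cf_mult X (G j) h x) = h"
   proof (rule cfun_eqI[OF _ h(2)])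
    show "(\<lambda>x\<in>topspace X. \<Sum>j\<in>J. cf_mult X (G j) h x) \<in> cfun X"
     by (rule positive_functional_sum(2)[OF \<phi>(1) J(1)]) (use G h in \<open>auto intro: cfun_closed\<close>)
    fix x assume x: "x \<in> topspace X"
    have "(\<Sum>j\<in>J. of_real (\<psi> j x) * h x) = of_real (\<Sum>j\<in>J. \<psi> j x) * h x" by (simp add: sum_distrib_right)
    then show "(\<lambda>x\<in>topspace X. \<Sum>j\<in>J. cf_mult X (G j) h x) x = h x" using x J(5)[OF x] by (simp add: G_def)
   qed
   finally have "\<phi> h - (\<Sum>j\<in>J. of_real (w j) * h j) = (\<Sum>j\<in>J. \<phi> (?T j))"
    by (simp add: split sum_subtractf)
   also have "\<dots> = \<phi> (\<lambda>x\<in>topspace X. \<Sum>j\<in>J. ?T j x)"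
    by (rule positive_functional_sum(1)[OF \<phi>(1) J(1) T, symmetric])
   also have "cmod \<dots> \<le> r * Re (\<phi> (cf_one X))"
   proof (rule positive_functional_norm_le[OF X F \<phi>(1)])
    show "(\<lambda>x\<in>topspace X. \<Sum>j\<in>J. ?T j x) \<in> cfun X" by (rule positive_functional_sum(2)[OF \<phi>(1) J(1) T])
    fix x assume x: "x \<in> topspace X"
    have "cmod (\<Sum>j\<in>J. ?T j x) \<le> (\<Sum>j\<in>J. \<psi> j x * r)"
    proof (rule sum_norm_le)
     fix j assume j: "j \<in> J"
     show "cmod (?T j x) \<le> \<psi> j x * r"
      using x J(4)[OF j x] J(6)[OF h(1) j x] by (cases "\<psi> j x = 0") (auto simp: G_def norm_mult intro: mult_left_mono)
    qed
    also have "\<dots> = r" using J(5)[OF x] by (simp flip: sum_distrib_right)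
    finally show "cmod ((\<lambda>x\<in>topspace X. \<Sum>j\<in>J. ?T j x) x) \<le> r" using x by simp
   qed
   finally show ?thesis using \<phi>(2) by simp
  qed
  have sum1: "(\<Sum>j\<in>J. w j) = 1"
  proof -
   have "(\<Sum>j\<in>J. \<phi> (G j)) = \<phi> (\<lambda>x\<in>topspace X. \<Sum>j\<in>J. G j x)"
    by (rule positive_functional_sum(1)[OF \<phi>(1) J(1) G, symmetric])
   also have "(\<lambda>x\<in>topspace X. \<Sum>j\<in>J. G j x) = cf_one X"
    using J(5) by (auto simp: cf_one_def G_def simp flip: of_real_sum)
   finally have "complex_of_real (\<Sum>j\<in>J. w j) = 1" using Gw(1) \<phi>(2) by simp
   then show ?thesis by (metis of_real_eq_1_iff)
  qed
  then have Jne: "J \<noteq> {}" by auto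
  let ?k' = "\<lambda>a\<in>A. \<Sum>j\<in>J. of_real (w j) * point_state A j a"
  have k': "?k' \<in> states X A" "f ?k' = (\<Sum>j\<in>J. of_real (w j) * f (point_state A j))"
   using affine_finite_combination[OF A f J(1) Jne, of "point_state A" w] point_state_in_states[OF A] J(2) Gw(2) sum1
   by (auto simp: subset_eq)
  have near: "cmod (\<phi> a - ?k' a) \<le> r" if a: "a \<in> ?F" for a
   using approx[of a] a A'(1) by (auto simp: point_state_def)
  have "?k' \<in> PiE A U"
  proof (rule PiE_I)
   fix a assume a: "a \<in> A"
   show "?k' a \<in> U a"
   proof (cases "U a = UNIV")
    case False
    then have aF: "a \<in> ?F" using a by simp
    then have "?k' a \<in> ball (\<phi> a) (d a)" using near[OF aF] r(3)[OF aF] by (simp only: mem_ball dist_norm)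
    then show ?thesis using d[OF aF] by blast
   qed simp
  qed simp
  then have "?k' \<in> W \<inter> states X A" using U(4) k'(1) by blast
  then have "dist (f ?k) (f ?k') < e" unfolding W(2)[symmetric] by simp
  then have 1: "cmod (f ?k' - f ?k) < e" by (simp add: dist_norm norm_minus_commute)
  have "(\<Sum>j\<in>J. of_real (w j) * ?g j) = f ?k'" unfolding k'(2) using J(2) by (intro sum.cong) auto
  then have "cmod (\<phi> ?g - f ?k') \<le> r" using approx[OF _ g] by simp
  then show ?thesis
   using norm_triangle_ineq[of "\<phi> ?g - f ?k'" "f ?k' - f ?k"] 1 r(2) by simp
 qed
 then have "cmod (\<phi> ?g - f ?k) \<le> 0 + e" if "e > 0" for e using that[THEN half_gt_zero] by fastforce
 then have "cmod (\<phi> ?g - f ?k) \<le> 0" by (rule field_le_epsilon)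
 then show ?thesis by simp
qed

text \<open>Positive functionals that agree on \<open>A\<close> are the same multiple of states with the same barycentre.\<close>

lemma affine_determined_on_system:
 assumes X: "compact_space X" and A: "function_system X A" and f: "f \<in> affine_cfun A (state_space X A)"
  and \<phi>: "positive_functional X (cfun X) \<phi>" and \<psi>: "positive_functional X (cfun X) \<psi>"
  and eq: "!!a. a \<in> A ==> \<phi> a = \<psi> a"
 shows "\<phi> (\<lambda>x\<in>topspace X. f (point_state A x)) = \<psi> (\<lambda>x\<in>topspace X. f (point_state A x))"
proof -
 note A' = function_systemD[OF A] and F = function_system_cfun[OF X]
 let ?g = "\<lambda>x\<in>topspace X. f (point_state A x)"
 have cf: "continuous_map (state_space X A) euclidean f" using f by (simp add: affine_cfun_def cfun_continuous)
 have g: "?g \<in> cfun X"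
  using continuous_map_compose[OF continuous_map_point_state[OF A] cf] by (intro restrict_in_cfun) (simp add: o_def)
 obtain B where B: "!!x. x \<in> topspace X ==> cmod (?g x) \<le> B" by (rule cfun_bounded[OF X g]) (rule that)
 have nn: "\<phi> (cf_one X) \<in> \<real>\<^sub>\<ge>\<^sub>0" by (rule positive_functionalD(3)[OF \<phi>]) auto
 define m where "m = Re (\<phi> (cf_one X))"
 have m: "\<phi> (cf_one X) = of_real m" "\<psi> (cf_one X) = of_real m" "m \<ge> 0"
  using nn eq[OF A'(2)] by (auto simp: m_def complex_nonneg_Reals_iff complex_eq_iff)
 show ?thesis
 proof (cases "m = 0")
  case True
  have "cmod (\<phi> ?g) \<le> B * Re (\<phi> (cf_one X))" "cmod (\<psi> ?g) \<le> B * Re (\<psi> (cf_one X))"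
   by (rule positive_functional_norm_le[OF X F \<phi> g B] positive_functional_norm_le[OF X F \<psi> g B]; assumption)+
  then show ?thesis using True m by simp
 next
  case False
  then have mp: "m > 0" using m by simp
  have "?g \<in> cfun X ==> \<theta> ?g / of_real m = f (\<lambda>a\<in>A. \<theta> a / of_real m)"
   if \<theta>: "positive_functional X (cfun X) \<theta>" "\<theta> (cf_one X) = of_real m" for \<theta>
  proof -
   have sc: "z / of_real m \<in> \<real>\<^sub>\<ge>\<^sub>0" if "z \<in> \<real>\<^sub>\<ge>\<^sub>0" for z :: complex
    using that mp by (simp add: complex_nonneg_Reals_iff)
   have "positive_functional X (cfun X) (\<lambda>a. \<theta> a / of_real m)"
    unfolding positive_functional_def using positive_functionalD[OF \<theta>(1)] sc by (simp add: add_divide_distrib)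
   moreover have "\<theta> (cf_one X) / of_real m = 1" using mp \<theta>(2) by simp
   ultimately show ?thesis by (rule affine_barycentre[OF X A f])
  qed
  note * = this[OF _ _ g]
  have eqf: "(\<lambda>a\<in>A. \<phi> a / of_real m) = (\<lambda>a\<in>A. \<psi> a / of_real m)" using eq by (auto simp: restrict_def)
  have "\<phi> ?g / of_real m = f (\<lambda>a\<in>A. \<phi> a / of_real m)" by (rule *[OF \<phi> m(1)])
  also have "\<dots> = f (\<lambda>a\<in>A. \<psi> a / of_real m)" by (simp only: eqf)
  also have "\<dots> = \<psi> ?g / of_real m" by (rule *[OF \<psi> m(2), symmetric])
  finally show ?thesis using mp by (simp del: restrict_apply)
 qed
qed

section \<open>The Hilbert space of a positive semidefinite kernel\<close>

text \<open>Lists of pairs stand for formal linear combinations. The Hilbert space consists of functions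
 on the index set: a vector \<open>x\<close> is recorded as \<open>d \<mapsto> \<langle>x, e\<^sub>d\<rangle>\<close>, so that its linear structure is
 pointwise and only the inner product has to be built by completion.\<close>

locale psd_kernel =
 fixes D :: "'d set" and \<kappa> :: "'d => 'd => complex"
 assumes hermitian: "!!d d'. d \<in> D ==> d' \<in> D ==> \<kappa> d' d = cnj (\<kappa> d d')"
  and psd: "!!l :: (complex \<times> 'd) list. snd ` set l \<subseteq> D ==>
     0 \<le> Re (\<Sum>p\<leftarrow>l. \<Sum>q\<leftarrow>l. fst p * cnj (fst q) * \<kappa> (snd p) (snd q))"
begin

definition form :: "(complex \<times> 'd) list => (complex \<times> 'd) list => complex" where
 "form l m = (\<Sum>p\<leftarrow>l. \<Sum>q\<leftarrow>m. fst p * cnj (fst q) * \<kappa> (snd p) (snd q))"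

definition comb :: "(complex \<times> 'd) list => bool" where
 "comb l \<longleftrightarrow> snd ` set l \<subseteq> D"

definition smult :: "complex => (complex \<times> 'd) list => (complex \<times> 'd) list" where
 "smult a l = map (\<lambda>p. (a * fst p, snd p)) l"

abbreviation diff :: "(complex \<times> 'd) list => (complex \<times> 'd) list => (complex \<times> 'd) list" where
 "diff l m \<equiv> l @ smult (-1) m"

definition lnorm :: "(complex \<times> 'd) list => real" where
 "lnorm l = sqrt (Re (form l l))"

lemma comb_simps [simp]:
 "comb []" "comb (l @ m) \<longleftrightarrow> comb l \<and> comb m" "comb (smult a l) \<longleftrightarrow> comb l"
 "comb [(c, d)] \<longleftrightarrow> d \<in> D"
 by (auto simp: comb_def smult_def image_image)

lemma form_simps [simp]:
 "form [] m = 0" "form l [] = 0"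
 "form (l @ l') m = form l m + form l' m" "form l (m @ m') = form l m + form l m'"
 "form (smult a l) m = a * form l m" "form l (smult a m) = cnj a * form l m"
 by (simp_all add: form_def smult_def sum_list_addf sum_list_const_mult o_def mult_ac flip: sum_list_const_mult)

lemma form_commute: "comb l ==> comb m ==> form m l = cnj (form l m)"
proof (induction l)
 case (Cons p l)
 have single: "form m [p] = cnj (form [p] m)" if "comb m" "snd p \<in> D" for m
  using that(1)
 proof (induction m)
  case (Cons q m)
  then have "\<kappa> (snd q) (snd p) = cnj (\<kappa> (snd p) (snd q))"
   using that(2) by (intro hermitian) (auto simp: comb_def)
  then show ?case using Cons by (simp add: form_def comb_def mult_ac)
 qed (simp add: form_def)
 have "form m (p # l) = form m [p] + form m l" "form (p # l) m = form [p] m + form l m"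
  using form_simps(4)[of m "[p]" l] form_simps(3)[of "[p]" l m] by simp_all
 then show ?case using Cons single by (auto simp: comb_def)
qed simp

lemma form_self: "comb l ==> form l l = of_real ((lnorm l)\<^sup>2)" "comb l ==> 0 \<le> Re (form l l)"
proof -
 assume l: "comb l"
 show nn: "0 \<le> Re (form l l)" using psd[of l] l by (simp add: form_def comb_def)
 have "Im (form l l) = 0" using arg_cong[OF form_commute[OF l l], of Im] by simp
 then show "form l l = of_real ((lnorm l)\<^sup>2)" using nn by (simp add: lnorm_def complex_eq_iff)
qed

lemma lnorm_nonneg [simp]: "comb l ==> lnorm l \<ge> 0"
 using form_self(2) by (simp add: lnorm_def)

lemma form_Cauchy_Schwarz:
 assumes l: "comb l" and m: "comb m"
 shows "cmod (form l m) \<le> lnorm l * lnorm m"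
proof -
 have sq: "(cmod (form m l))\<^sup>2 \<le> (lnorm l)\<^sup>2 * (lnorm m)\<^sup>2"
 proof (rule complex_discriminant)
  fix c
  have "0 \<le> Re (form (l @ smult c m) (l @ smult c m))" using l m by (intro form_self) simp
  also have "\<dots> = (lnorm l)\<^sup>2 + 2 * Re (c * form m l) + Re ((c * cnj c) * form m m)"
   using l m form_commute[OF l m] form_self[OF l] by (simp add: algebra_simps)
  also have "c * cnj c = of_real ((cmod c)\<^sup>2)" by (rule complex_norm_square[symmetric])
  also have "Re (of_real ((cmod c)\<^sup>2) * form m m) = (cmod c)\<^sup>2 * (lnorm m)\<^sup>2"
   using form_self(1)[OF m] by (simp del: of_real_power)
  finally show "0 \<le> (lnorm l)\<^sup>2 + 2 * Re (c * form m l) + (cmod c)\<^sup>2 * (lnorm m)\<^sup>2" .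
 qed simp
 have "cmod (form m l) \<le> lnorm l * lnorm m"
  by (rule power2_le_imp_le) (use sq l m in \<open>auto simp: power_mult_distrib\<close>)
 then show ?thesis using form_commute[OF m l] by simp
qed

lemma lnorm_sq: "comb l ==> (lnorm l)\<^sup>2 = Re (form l l)"
 using form_self[of l] by (simp add: lnorm_def)

lemma lnorm_append_le:
 assumes l: "comb l" and m: "comb m"
 shows "lnorm (l @ m) \<le> lnorm l + lnorm m"
proof -
 have "Re (form l m) \<le> lnorm l * lnorm m"
  by (rule order_trans[OF complex_Re_le_cmod form_Cauchy_Schwarz[OF l m]])
 then have sq: "(lnorm (l @ m))\<^sup>2 \<le> (lnorm l + lnorm m)\<^sup>2"
  using l m form_commute[OF l m] by (simp add: lnorm_sq power2_sum)
 show ?thesis by (rule power2_le_imp_le[OF sq]) (use l m in auto)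
qed

lemma lnorm_cong:
 assumes eq: "!!n. comb n ==> form l n = form m n" and l: "comb l" and m: "comb m"
 shows "lnorm l = lnorm m"
proof -
 have "form l l = cnj (form l m)" using eq[OF l] form_commute[OF l m] by simp
 also have "\<dots> = form m m" using eq[OF m] form_commute[OF m m] by simp
 finally show ?thesis by (simp add: lnorm_def)
qed

lemma lnorm_diff_triangle:
 assumes "comb l" "comb m" "comb n"
 shows "lnorm (diff l n) \<le> lnorm (diff l m) + lnorm (diff m n)"
 using lnorm_append_le[of "diff l m" "diff m n"] assms
  lnorm_cong[of "diff l n" "diff l m @ diff m n"] by simp

text \<open>\<open>repr e \<phi>\<close>: the Cauchy sequence \<open>e\<close> of combinations converges to the vector \<open>\<phi>\<close>.\<close>

definition Cauchy_comb :: "(nat => (complex \<times> 'd) list) => bool" where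
 "Cauchy_comb e \<longleftrightarrow> (\<forall>n. comb (e n)) \<and> (\<forall>r>0. \<exists>N. \<forall>m\<ge>N. \<forall>n\<ge>N. lnorm (diff (e m) (e n)) < r)"

definition repr :: "(nat => (complex \<times> 'd) list) => ('d => complex) => bool" where
 "repr e \<phi> \<longleftrightarrow> Cauchy_comb e \<and> (\<forall>d\<in>D. (\<lambda>n. form (e n) [(1, d)]) \<longlonglongrightarrow> \<phi> d)"

definition vec :: "(complex \<times> 'd) list => 'd => complex" where
 "vec l = (\<lambda>d\<in>D. form l [(1, d)])"

lemma Cauchy_comb_bounded:
 assumes e: "Cauchy_comb e"
 obtains B where "B > 0" "!!n. lnorm (e n) \<le> B"
proof -
 have c: "comb (e n)" for n using e by (simp add: Cauchy_comb_def)
 obtain N where N: "!!m n. m \<ge> N ==> n \<ge> N ==> lnorm (diff (e m) (e n)) < 1"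
  using e unfolding Cauchy_comb_def by (metis zero_less_one)
 have tail: "lnorm (e n) \<le> lnorm (e N) + 1" if "n \<ge> N" for n
  using lnorm_diff_triangle[OF c c comb_simps(1), of n N] N[OF that, of N] by (simp add: smult_def)
 let ?B = "(\<Sum>i<N. lnorm (e i)) + lnorm (e N) + 1"
 have sn: "0 \<le> (\<Sum>i<N. lnorm (e i))" using c by (intro sum_nonneg) auto
 have "lnorm (e n) \<le> ?B" for n
 proof (cases "n \<ge> N")
  case True
  then show ?thesis using tail[OF True] sn by linarith
 next
  case False
  have "lnorm (e n) \<le> (\<Sum>i<N. lnorm (e i))" using False c by (intro member_le_sum) auto
  then show ?thesis using lnorm_nonneg[OF c, of N] by linarith
 qed
 moreover have "?B > 0" using sn lnorm_nonneg[OF c, of N] by linarith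
 ultimately show thesis using that by blast
qed

lemma Cauchy_comb_diff:
 assumes e: "Cauchy_comb e" and e': "Cauchy_comb e'"
 shows "Cauchy_comb (\<lambda>n. diff (e n) (e' n))" "Cauchy_comb (\<lambda>n. e n @ e' n)" "Cauchy_comb (\<lambda>n. smult c (e n))"
proof -
 have c: "comb (e n)" "comb (e' n)" for n using e e' by (simp_all add: Cauchy_comb_def)
 have sm: "Cauchy_comb (\<lambda>n. smult c (e n))" if e: "Cauchy_comb e" for c e
  unfolding Cauchy_comb_def
 proof (intro conjI allI impI)
  have ce: "comb (e n)" for n using e by (simp add: Cauchy_comb_def)
  then show "comb (smult c (e n))" for n by simp
  fix r :: real assume "r > 0"
  then have "r / (cmod c + 1) > 0" by (simp add: add_nonneg_pos)
  then obtain N where N: "!!m n. m \<ge> N ==> n \<ge> N ==> lnorm (diff (e m) (e n)) < r / (cmod c + 1)"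
   using e unfolding Cauchy_comb_def by metis
  have "lnorm (diff (smult c (e m)) (smult c (e n))) < r" if "m \<ge> N" "n \<ge> N" for m n
  proof -
   have "form (diff (smult c (e m)) (smult c (e n))) (diff (smult c (e m)) (smult c (e n)))
     = (c * cnj c) * form (diff (e m) (e n)) (diff (e m) (e n))" by (simp add: algebra_simps)
   also have "\<dots> = of_real ((cmod c * lnorm (diff (e m) (e n)))\<^sup>2)"
    using form_self(1)[of "diff (e m) (e n)"] ce
    by (simp only: comb_simps complex_norm_square[symmetric] power_mult_distrib of_real_mult)
   finally have "lnorm (diff (smult c (e m)) (smult c (e n))) = cmod c * lnorm (diff (e m) (e n))"
    using ce unfolding lnorm_def[of "diff (smult c (e m)) (smult c (e n))"] by (simp only: Re_complex_of_real) simp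
   also have "\<dots> \<le> (cmod c + 1) * lnorm (diff (e m) (e n))" using ce by (intro mult_right_mono) auto
   also have "\<dots> < r" using N[OF that] by (simp add: pos_less_divide_eq add_nonneg_pos mult.commute)
   finally show ?thesis .
  qed
  then show "\<exists>N. \<forall>m\<ge>N. \<forall>n\<ge>N. lnorm (diff (smult c (e m)) (smult c (e n))) < r" by blast
 qed
 have ap: "Cauchy_comb (\<lambda>n. e n @ e' n)" if e: "Cauchy_comb e" and e': "Cauchy_comb e'" for e e'
  unfolding Cauchy_comb_def
 proof (intro conjI allI impI)
  have ce: "comb (e n)" "comb (e' n)" for n using e e' by (simp_all add: Cauchy_comb_def)
  then show "comb (e n @ e' n)" for n by simp
  fix r :: real assume "r > 0"
  then have "r / 2 > 0" by simp
  then obtain N N' where N: "!!m n. m \<ge> N ==> n \<ge> N ==> lnorm (diff (e m) (e n)) < r / 2"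
   "!!m n. m \<ge> N' ==> n \<ge> N' ==> lnorm (diff (e' m) (e' n)) < r / 2"
   using e e' unfolding Cauchy_comb_def by metis
  have "lnorm (diff (e m @ e' m) (e n @ e' n)) < r" if "m \<ge> max N N'" "n \<ge> max N N'" for m n
  proof -
   have "lnorm (diff (e m @ e' m) (e n @ e' n)) = lnorm (diff (e m) (e n) @ diff (e' m) (e' n))"
    using ce by (intro lnorm_cong) (auto simp: algebra_simps)
   also have "\<dots> \<le> lnorm (diff (e m) (e n)) + lnorm (diff (e' m) (e' n))"
    using ce by (intro lnorm_append_le) auto
   finally show ?thesis using N(1)[of m n] N(2)[of m n] that by simp
  qed
  then show "\<exists>N. \<forall>m\<ge>N. \<forall>n\<ge>N. lnorm (diff (e m @ e' m) (e n @ e' n)) < r" by blast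
 qed
 show "Cauchy_comb (\<lambda>n. smult c (e n))" by (rule sm[OF e])
 show "Cauchy_comb (\<lambda>n. e n @ e' n)" by (rule ap[OF e e'])
 show "Cauchy_comb (\<lambda>n. diff (e n) (e' n))" by (rule ap[OF e sm[OF e']])
qed

lemma form_convergent:
 assumes e: "Cauchy_comb e" and e': "Cauchy_comb e'"
 shows "convergent (\<lambda>n. form (e n) (e' n))"
proof -
 have c: "comb (e n)" "comb (e' n)" for n using e e' by (simp_all add: Cauchy_comb_def)
 obtain B where B: "B > 0" "!!n. lnorm (e n) \<le> B" by (rule Cauchy_comb_bounded[OF e]) (rule that)
 obtain B' where B': "B' > 0" "!!n. lnorm (e' n) \<le> B'" by (rule Cauchy_comb_bounded[OF e']) (rule that)
 have "Cauchy (\<lambda>n. form (e n) (e' n))"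
 proof (rule metric_CauchyI)
  fix r :: real assume "r > 0"
  then have r: "r / (2 * B') > 0" "r / (2 * B) > 0" using B B' by auto
  obtain N where N: "!!m n. m \<ge> N ==> n \<ge> N ==> lnorm (diff (e m) (e n)) < r / (2 * B')"
   using e r unfolding Cauchy_comb_def by metis
  obtain N' where N': "!!m n. m \<ge> N' ==> n \<ge> N' ==> lnorm (diff (e' m) (e' n)) < r / (2 * B)"
   using e' r unfolding Cauchy_comb_def by metis
  have "dist (form (e m) (e' m)) (form (e n) (e' n)) < r" if "m \<ge> max N N'" "n \<ge> max N N'" for m n
  proof -
   have "form (e m) (e' m) - form (e n) (e' n) = form (diff (e m) (e n)) (e' m) + form (e n) (diff (e' m) (e' n))"
    by simp
   then have "dist (form (e m) (e' m)) (form (e n) (e' n)) \<le>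
     cmod (form (diff (e m) (e n)) (e' m)) + cmod (form (e n) (diff (e' m) (e' n)))"
    unfolding dist_norm by (simp only: norm_triangle_ineq)
   also have "\<dots> \<le> lnorm (diff (e m) (e n)) * lnorm (e' m) + lnorm (e n) * lnorm (diff (e' m) (e' n))"
    using c by (intro add_mono form_Cauchy_Schwarz) auto
   also have "\<dots> \<le> lnorm (diff (e m) (e n)) * B' + B * lnorm (diff (e' m) (e' n))"
    using c B B' by (intro add_mono mult_left_mono mult_right_mono) auto
   also have "\<dots> < r / (2 * B') * B' + B * (r / (2 * B))"
    using N[of m n] N'[of m n] that B B' by (intro add_strict_mono mult_strict_right_mono mult_strict_left_mono) auto
   also have "\<dots> = r" using B B' by simp
   finally show ?thesis .
  qed
  then show "\<exists>M. \<forall>m\<ge>M. \<forall>n\<ge>M. dist (form (e m) (e' m)) (form (e n) (e' n)) < r" by blast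
 qed
 then show ?thesis by (rule Cauchy_convergent)
qed

lemma form_tendsto_zero:
 assumes z: "!!d. d \<in> D ==> (\<lambda>n. form (z n) [(1, d)]) \<longlonglongrightarrow> 0" and m: "comb m"
 shows "(\<lambda>n. form (z n) m) \<longlonglongrightarrow> 0"
 using m
proof (induction m)
 case (Cons p m)
 have d: "snd p \<in> D" "comb m" using Cons.prems by (auto simp: comb_def)
 have "form (z n) (p # m) = cnj (fst p) * form (z n) [(1, snd p)] + form (z n) m" for n
  using form_simps(4)[of "z n" "smult (fst p) [(1, snd p)]" m] form_simps(6)[of "z n" "fst p" "[(1, snd p)]"]
  by (simp add: smult_def)
 moreover have "(\<lambda>n. cnj (fst p) * form (z n) [(1, snd p)] + form (z n) m) \<longlonglongrightarrow> cnj (fst p) * 0 + 0"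
  by (intro tendsto_intros z d Cons.IH)
 ultimately show ?case by simp
qed simp

text \<open>A Cauchy sequence that converges weakly to \<open>0\<close> converges to \<open>0\<close>, hence inner products of
 limits do not depend on the approximating sequences.\<close>

lemma weakly_null_Cauchy:
 assumes z: "repr z (\<lambda>d. 0)"
 shows "(\<lambda>n. lnorm (z n)) \<longlonglongrightarrow> 0"
proof -
 have Cz: "Cauchy_comb z" and c: "comb (z n)" for n using z by (auto simp: repr_def Cauchy_comb_def)
 obtain B where B: "B > 0" "!!n. lnorm (z n) \<le> B" by (rule Cauchy_comb_bounded[OF Cz]) (rule that)
 have "(\<lambda>n. (lnorm (z n))\<^sup>2) \<longlonglongrightarrow> 0"
 proof (rule LIMSEQ_I)
  fix r :: real assume r: "r > 0"
  then have "r / (2 * B) > 0" using B by simp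
  then obtain N where N: "!!m n. m \<ge> N ==> n \<ge> N ==> lnorm (diff (z m) (z n)) < r / (2 * B)"
   using Cz unfolding Cauchy_comb_def by metis
  have "(\<lambda>n. form (z n) (z N)) \<longlonglongrightarrow> 0" by (rule form_tendsto_zero[OF _ c]) (use z in \<open>simp add: repr_def\<close>)
  then have "\<exists>M. \<forall>n\<ge>M. norm (form (z n) (z N) - 0) < r / 2" by (rule LIMSEQ_D) (use r in simp)
  then obtain M where M: "!!n. n \<ge> M ==> cmod (form (z n) (z N)) < r / 2" by auto
  have "(lnorm (z n))\<^sup>2 < r" if "n \<ge> max N M" for n
  proof -
   have "form (z n) (z n) = form (z n) (z N) + form (z n) (diff (z n) (z N))" by simp
   then have "(lnorm (z n))\<^sup>2 \<le> cmod (form (z n) (z N)) + cmod (form (z n) (diff (z n) (z N)))"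
    unfolding lnorm_sq[OF c] by (metis complex_Re_le_cmod norm_triangle_ineq order_trans)
   also have "cmod (form (z n) (diff (z n) (z N))) \<le> lnorm (z n) * lnorm (diff (z n) (z N))"
    using c by (intro form_Cauchy_Schwarz) auto
   also have "\<dots> \<le> B * (r / (2 * B))"
    using N[of n N] that B c by (intro mult_mono) (auto intro: less_imp_le)
   also have "\<dots> = r / 2" using B by simp
   finally show ?thesis using M[of n] that by simp
  qed
  then show "\<exists>no. \<forall>n\<ge>no. norm ((lnorm (z n))\<^sup>2 - 0) < r" by (auto intro!: exI[of _ "max N M"])
 qed
 then have "(\<lambda>n. sqrt ((lnorm (z n))\<^sup>2)) \<longlonglongrightarrow> sqrt 0" by (rule tendsto_real_sqrt)
 then show ?thesis using c by simp
qed

definition hcar :: "('d => complex) set" where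
 "hcar = {\<phi> \<in> extensional D. \<exists>e. repr e \<phi>}"

definition approximant :: "('d => complex) => nat => (complex \<times> 'd) list" where
 "approximant \<phi> = (SOME e. repr e \<phi>)"

definition kernel_hspace :: "('d => complex) hspace" where
 "kernel_hspace = \<lparr>hcarrier = hcar, hzero = (\<lambda>d\<in>D. 0), hadd = (\<lambda>\<phi> \<psi>. \<lambda>d\<in>D. \<phi> d + \<psi> d),
   hscale = (\<lambda>c \<phi>. \<lambda>d\<in>D. c * \<phi> d),
   hinner = (\<lambda>\<phi> \<psi>. lim (\<lambda>n. form (approximant \<phi> n) (approximant \<psi> n)))\<rparr>"

lemma repr_cong: "(!!d. d \<in> D ==> \<phi> d = \<psi> d) ==> repr e \<phi> = repr e \<psi>"
 by (simp add: repr_def)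

lemma repr_add: "repr e \<phi> ==> repr e' \<psi> ==> repr (\<lambda>n. e n @ e' n) (\<lambda>d. \<phi> d + \<psi> d)"
 by (auto simp: repr_def Cauchy_comb_diff intro: tendsto_add)

lemma repr_scale: "repr e \<phi> ==> repr (\<lambda>n. smult c (e n)) (\<lambda>d. c * \<phi> d)"
 by (auto simp: repr_def Cauchy_comb_diff intro: tendsto_mult)

lemma repr_vec: "comb l ==> repr (\<lambda>n. l) (vec l)"
proof -
 assume l: "comb l"
 have "lnorm (diff l l) = 0" using l by (simp add: lnorm_def)
 then show ?thesis using l by (simp add: repr_def Cauchy_comb_def vec_def)
qed

lemma repr_approximant: "\<phi> \<in> hcar ==> repr (approximant \<phi>) \<phi>"
 unfolding approximant_def by (rule someI_ex[of "\<lambda>e. repr e \<phi>"]) (simp add: hcar_def)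

lemma repr_unique:
 assumes e: "repr e \<phi>" and e': "repr e' \<phi>"
 shows "(\<lambda>n. lnorm (diff (e n) (e' n))) \<longlonglongrightarrow> 0"
proof (rule weakly_null_Cauchy)
 have "repr (\<lambda>n. diff (e n) (e' n)) (\<lambda>d. \<phi> d + (-1) * \<phi> d)" by (rule repr_add[OF e repr_scale[OF e']])
 then show "repr (\<lambda>n. diff (e n) (e' n)) (\<lambda>d. 0)" by simp
qed

lemma inner_limit:
 assumes \<phi>: "\<phi> \<in> hcar" "repr e \<phi>" and \<psi>: "\<psi> \<in> hcar" "repr e' \<psi>"
 shows "(\<lambda>n. form (e n) (e' n)) \<longlonglongrightarrow> hinner kernel_hspace \<phi> \<psi>"
proof -
 let ?a = "approximant \<phi>" and ?b = "approximant \<psi>"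
 have r: "repr ?a \<phi>" "repr ?b \<psi>" by (rule repr_approximant[OF \<phi>(1)], rule repr_approximant[OF \<psi>(1)])
 have C: "Cauchy_comb e" "Cauchy_comb e'" "Cauchy_comb ?a" "Cauchy_comb ?b" using \<phi> \<psi> r by (auto simp: repr_def)
 have c: "comb (e n)" "comb (e' n)" "comb (?a n)" "comb (?b n)" for n using C by (simp_all add: Cauchy_comb_def)
 obtain B where B: "B > 0" "!!n. lnorm (?a n) \<le> B" by (rule Cauchy_comb_bounded[OF C(3)]) (rule that)
 obtain B' where B': "B' > 0" "!!n. lnorm (e' n) \<le> B'" by (rule Cauchy_comb_bounded[OF C(2)]) (rule that)
 have "(\<lambda>n. form (?a n) (?b n)) \<longlonglongrightarrow> lim (\<lambda>n. form (?a n) (?b n))"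
  using form_convergent[OF C(3,4)] by (simp add: convergent_LIMSEQ_iff)
 then have 1: "(\<lambda>n. form (?a n) (?b n)) \<longlonglongrightarrow> hinner kernel_hspace \<phi> \<psi>" by (simp add: kernel_hspace_def)
 have "(\<lambda>n. form (e n) (e' n) - form (?a n) (?b n)) \<longlonglongrightarrow> 0"
 proof (rule tendsto_norm_zero_cancel, rule tendsto_sandwich[OF _ _ tendsto_const])
  show "\<forall>\<^sub>F n in sequentially. norm (form (e n) (e' n) - form (?a n) (?b n)) \<le>
    lnorm (diff (e n) (?a n)) * B' + B * lnorm (diff (e' n) (?b n))"
  proof (rule always_eventually, rule allI)
   fix n
   have "form (e n) (e' n) - form (?a n) (?b n) = form (diff (e n) (?a n)) (e' n) + form (?a n) (diff (e' n) (?b n))"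
    by simp
   then have "norm (form (e n) (e' n) - form (?a n) (?b n)) \<le>
     cmod (form (diff (e n) (?a n)) (e' n)) + cmod (form (?a n) (diff (e' n) (?b n)))"
    by (simp only: norm_triangle_ineq)
   also have "\<dots> \<le> lnorm (diff (e n) (?a n)) * lnorm (e' n) + lnorm (?a n) * lnorm (diff (e' n) (?b n))"
    using c by (intro add_mono form_Cauchy_Schwarz) auto
   also have "\<dots> \<le> lnorm (diff (e n) (?a n)) * B' + B * lnorm (diff (e' n) (?b n))"
    using c B B' by (intro add_mono mult_left_mono mult_right_mono) auto
   finally show "norm (form (e n) (e' n) - form (?a n) (?b n)) \<le>
    lnorm (diff (e n) (?a n)) * B' + B * lnorm (diff (e' n) (?b n))" .
  qed
  show "(\<lambda>n. lnorm (diff (e n) (?a n)) * B' + B * lnorm (diff (e' n) (?b n))) \<longlonglongrightarrow> 0"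
   using tendsto_add[OF tendsto_mult[OF repr_unique[OF \<phi>(2) r(1)] tendsto_const[of B']]
     tendsto_mult[OF tendsto_const[of B] repr_unique[OF \<psi>(2) r(2)]]] by simp
 qed simp
 from tendsto_add[OF this 1] show ?thesis by simp
qed

lemma kernel_hspace_simps [simp]:
 "hcarrier kernel_hspace = hcar" "hzero kernel_hspace = (\<lambda>d\<in>D. 0)"
 "hadd kernel_hspace \<phi> \<psi> = (\<lambda>d\<in>D. \<phi> d + \<psi> d)" "hscale kernel_hspace c \<phi> = (\<lambda>d\<in>D. c * \<phi> d)"
 by (simp_all add: kernel_hspace_def)

lemma hcarI: "\<phi> \<in> extensional D ==> repr e \<phi> ==> \<phi> \<in> hcar"
 by (auto simp: hcar_def)

lemma repr_add': "repr e \<phi> ==> repr e' \<psi> ==> repr (\<lambda>n. e n @ e' n) (\<lambda>d\<in>D. \<phi> d + \<psi> d)"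
 using repr_add[of e \<phi> e' \<psi>] by (subst repr_cong[of _ "\<lambda>d. \<phi> d + \<psi> d"]) auto

lemma repr_scale': "repr e \<phi> ==> repr (\<lambda>n. smult c (e n)) (\<lambda>d\<in>D. c * \<phi> d)"
 using repr_scale[of e \<phi> c] by (subst repr_cong[of _ "\<lambda>d. c * \<phi> d"]) auto

lemma vec_in [simp]: "comb l ==> vec l \<in> hcar"
 by (rule hcarI[OF _ repr_vec]) (auto simp: vec_def)

lemma hadd_in: "\<phi> \<in> hcar ==> \<psi> \<in> hcar ==> (\<lambda>d\<in>D. \<phi> d + \<psi> d) \<in> hcar"
 by (rule hcarI[OF _ repr_add'[OF repr_approximant repr_approximant]]) auto

lemma hscale_in: "\<phi> \<in> hcar ==> (\<lambda>d\<in>D. c * \<phi> d) \<in> hcar"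
 by (rule hcarI[OF _ repr_scale'[OF repr_approximant]]) auto

lemma inner_vec: "comb l ==> comb m ==> hinner kernel_hspace (vec l) (vec m) = form l m"
 using inner_limit[OF vec_in repr_vec vec_in repr_vec, of l m] by (simp add: LIMSEQ_const_iff)

lemma dist_limit:
 assumes \<phi>: "\<phi> \<in> hcar" "repr e \<phi>" and \<psi>: "\<psi> \<in> hcar" "repr e' \<psi>"
 shows "(\<lambda>n. lnorm (diff (e n) (e' n))) \<longlonglongrightarrow> hdist kernel_hspace \<phi> \<psi>"
proof -
 let ?d = "\<lambda>d\<in>D. \<phi> d + (\<lambda>d\<in>D. (-1) * \<psi> d) d"
 have r: "repr (\<lambda>n. diff (e n) (e' n)) ?d" by (rule repr_add'[OF \<phi>(2) repr_scale'[OF \<psi>(2)]])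
 have d: "?d \<in> hcar" by (rule hcarI[OF _ r]) simp
 have "(\<lambda>n. sqrt (Re (form (diff (e n) (e' n)) (diff (e n) (e' n))))) \<longlonglongrightarrow> sqrt (Re (hinner kernel_hspace ?d ?d))"
  by (intro tendsto_real_sqrt tendsto_Re inner_limit[OF d r d r])
 then show ?thesis unfolding lnorm_def hdist_def hnorm_def kernel_hspace_simps .
qed

lemma kernel_dist_triangle:
 assumes "\<phi> \<in> hcar" "\<psi> \<in> hcar" "\<theta> \<in> hcar"
 shows "hdist kernel_hspace \<phi> \<theta> \<le> hdist kernel_hspace \<phi> \<psi> + hdist kernel_hspace \<psi> \<theta>"
proof (rule LIMSEQ_le)
 note r = repr_approximant[OF assms(1)] repr_approximant[OF assms(2)] repr_approximant[OF assms(3)]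
 have c: "comb (approximant \<phi> n)" "comb (approximant \<psi> n)" "comb (approximant \<theta> n)" for n
  using r by (auto simp: repr_def Cauchy_comb_def)
 show "(\<lambda>n. lnorm (diff (approximant \<phi> n) (approximant \<theta> n))) \<longlonglongrightarrow> hdist kernel_hspace \<phi> \<theta>"
  by (rule dist_limit) (use assms r in auto)
 show "(\<lambda>n. lnorm (diff (approximant \<phi> n) (approximant \<psi> n)) + lnorm (diff (approximant \<psi> n) (approximant \<theta> n)))
   \<longlonglongrightarrow> hdist kernel_hspace \<phi> \<psi> + hdist kernel_hspace \<psi> \<theta>"
  by (intro tendsto_add dist_limit) (use assms r in auto)
 show "\<exists>N. \<forall>n\<ge>N. lnorm (diff (approximant \<phi> n) (approximant \<theta> n)) \<le>
   lnorm (diff (approximant \<phi> n) (approximant \<psi> n)) + lnorm (diff (approximant \<psi> n) (approximant \<theta> n))"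
  using lnorm_diff_triangle[OF c] by blast
qed

lemma repr_dist:
 assumes \<phi>: "\<phi> \<in> hcar" "repr e \<phi>" and r: "r > 0"
 shows "\<exists>N. \<forall>n\<ge>N. hdist kernel_hspace \<phi> (vec (e n)) \<le> r \<and> hdist kernel_hspace (vec (e n)) \<phi> \<le> r"
proof -
 have c: "comb (e n)" for n using \<phi> by (auto simp: repr_def Cauchy_comb_def)
 obtain N where N: "!!m n. m \<ge> N ==> n \<ge> N ==> lnorm (diff (e m) (e n)) < r"
  using \<phi>(2) r unfolding repr_def Cauchy_comb_def by metis
 have "hdist kernel_hspace \<phi> (vec (e n)) \<le> r" if n: "n \<ge> N" for n
  by (rule LIMSEQ_le_const2[OF dist_limit[OF \<phi> vec_in[OF c] repr_vec[OF c], of n]])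
   (use N n in \<open>auto intro!: exI[of _ N] less_imp_le\<close>)
 moreover have "hdist kernel_hspace (vec (e n)) \<phi> \<le> r" if n: "n \<ge> N" for n
  by (rule LIMSEQ_le_const2[OF dist_limit[OF vec_in[OF c] repr_vec[OF c] \<phi>, of n]])
   (use N n in \<open>auto intro!: exI[of _ N] less_imp_le\<close>)
 ultimately show ?thesis by blast
qed

lemma dist_vec: "comb l ==> comb m ==> hdist kernel_hspace (vec l) (vec m) = lnorm (diff l m)"
 using dist_limit[OF vec_in repr_vec vec_in repr_vec, of l m] by (simp add: LIMSEQ_const_iff)

lemma kernel_complete:
 assumes s: "!!n. s n \<in> hcar"
  and C: "!!r. r > 0 ==> \<exists>N. \<forall>m\<ge>N. \<forall>n\<ge>N. hdist kernel_hspace (s m) (s n) < r"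
 shows "\<exists>l\<in>hcar. (\<lambda>n. hdist kernel_hspace (s n) l) \<longlonglongrightarrow> 0"
proof -
 have "\<exists>l. comb l \<and> hdist kernel_hspace (s n) (vec l) \<le> inverse (real (Suc n)) \<and>
   hdist kernel_hspace (vec l) (s n) \<le> inverse (real (Suc n))" for n
 proof -
  note r = repr_approximant[OF s, of n]
  have "comb (approximant (s n) k)" for k using r by (auto simp: repr_def Cauchy_comb_def)
  then show ?thesis using repr_dist[OF s r, of "inverse (real (Suc n))"] by auto
 qed
 then obtain l where l: "!!n. comb (l n)" "!!n. hdist kernel_hspace (s n) (vec (l n)) \<le> inverse (real (Suc n))"
   "!!n. hdist kernel_hspace (vec (l n)) (s n) \<le> inverse (real (Suc n))" by metis
 have Cl: "Cauchy_comb l"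
  unfolding Cauchy_comb_def
 proof (intro conjI allI impI l(1))
  fix r :: real assume "r > 0"
  then have r: "r/3 > 0" by simp
  obtain N where N: "!!m n. m \<ge> N ==> n \<ge> N ==> hdist kernel_hspace (s m) (s n) < r/3" using C[OF r] by metis
  obtain M where M: "inverse (real (Suc M)) < r/3" using reals_Archimedean[OF r] by auto
  have "lnorm (diff (l m) (l n)) < r" if mn: "m \<ge> max N M" "n \<ge> max N M" for m n
  proof -
   have i: "inverse (real (Suc m)) \<le> inverse (real (Suc M))" "inverse (real (Suc n)) \<le> inverse (real (Suc M))"
    using mn by (auto intro!: le_imp_inverse_le)
   have "lnorm (diff (l m) (l n)) = hdist kernel_hspace (vec (l m)) (vec (l n))" using l by (simp add: dist_vec)
   also have "\<dots> \<le> hdist kernel_hspace (vec (l m)) (s m) + hdist kernel_hspace (s m) (vec (l n))"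
    using l s by (intro kernel_dist_triangle) auto
   finally have "lnorm (diff (l m) (l n)) \<le> hdist kernel_hspace (vec (l m)) (s m) + hdist kernel_hspace (s m) (vec (l n))" .
   moreover have "hdist kernel_hspace (s m) (vec (l n)) \<le> hdist kernel_hspace (s m) (s n) + hdist kernel_hspace (s n) (vec (l n))"
    using l s by (intro kernel_dist_triangle) auto
   moreover have "hdist kernel_hspace (s m) (s n) < r/3" using N mn by simp
   ultimately show ?thesis using l(3)[of m] l(2)[of n] i M by linarith
  qed
  then show "\<exists>N. \<forall>m\<ge>N. \<forall>n\<ge>N. lnorm (diff (l m) (l n)) < r" by blast
 qed
 define \<phi> where "\<phi> = (\<lambda>d\<in>D. lim (\<lambda>n. form (l n) [(1, d)]))"
 have "(\<lambda>n. form (l n) [(1, d)]) \<longlonglongrightarrow> \<phi> d" if d: "d \<in> D" for d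
 proof -
  have "Cauchy_comb (\<lambda>n. [(1, d)])" using repr_vec[of "[(1, d)]"] d by (simp add: repr_def)
  from form_convergent[OF Cl this] show ?thesis using d by (simp add: \<phi>_def convergent_LIMSEQ_iff)
 qed
 then have r: "repr l \<phi>" using Cl by (simp add: repr_def)
 have \<phi>: "\<phi> \<in> hcar" by (rule hcarI[OF _ r]) (simp add: \<phi>_def)
 have "(\<lambda>n. hdist kernel_hspace (s n) \<phi>) \<longlonglongrightarrow> 0"
 proof (rule tendsto_sandwich[OF _ _ tendsto_const])
  show "\<forall>\<^sub>F n in sequentially. 0 \<le> hdist kernel_hspace (s n) \<phi>"
   using LIMSEQ_le_const[OF dist_limit[OF s repr_approximant[OF s] \<phi> r]] lnorm_nonneg l(1) repr_approximant[OF s]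
   by (auto simp: repr_def Cauchy_comb_def)
  show "\<forall>\<^sub>F n in sequentially. hdist kernel_hspace (s n) \<phi> \<le> inverse (real (Suc n)) + hdist kernel_hspace (vec (l n)) \<phi>"
  proof (rule always_eventually, rule allI)
   fix n
   show "hdist kernel_hspace (s n) \<phi> \<le> inverse (real (Suc n)) + hdist kernel_hspace (vec (l n)) \<phi>"
    using kernel_dist_triangle[OF s vec_in[OF l(1)] \<phi>, of n n] l(2)[of n] by linarith
  qed
  have "(\<lambda>n. hdist kernel_hspace (vec (l n)) \<phi>) \<longlonglongrightarrow> 0"
  proof (rule LIMSEQ_I)
   fix e :: real assume "e > 0"
   then obtain N where N: "\<forall>n\<ge>N. hdist kernel_hspace (vec (l n)) \<phi> \<le> e/2" using repr_dist[OF \<phi> r, of "e/2"] by auto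
   have "0 \<le> hdist kernel_hspace (vec (l n)) \<phi>" for n
    by (rule LIMSEQ_le_const[OF dist_limit[OF vec_in[OF l(1)] repr_vec[OF l(1)] \<phi> r]]) (use l(1) in auto)
   then show "\<exists>N. \<forall>n\<ge>N. norm (hdist kernel_hspace (vec (l n)) \<phi> - 0) < e"
    using N \<open>e > 0\<close> by (intro exI[of _ N]) fastforce
  qed
  from tendsto_add[OF LIMSEQ_inverse_real_of_nat this]
  show "(\<lambda>n. inverse (real (Suc n)) + hdist kernel_hspace (vec (l n)) \<phi>) \<longlonglongrightarrow> 0" by simp
 qed
 then show ?thesis using \<phi> by blast
qed

lemma hilbert_space_kernel: "hilbert_space kernel_hspace"
proof
 note rA = repr_approximant and L = LIMSEQ_unique[OF inner_limit]
 have c: "comb (approximant \<phi> n)" if "\<phi> \<in> hcar" for \<phi> n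
  using rA[OF that] by (auto simp: repr_def Cauchy_comb_def)
 have ext: "\<phi> \<in> extensional D" if "\<phi> \<in> hcar" for \<phi> using that by (simp add: hcar_def)
 show "hzero kernel_hspace \<in> hcarrier kernel_hspace"
  using vec_in[of "[]"] by (simp add: vec_def)
 show "hadd kernel_hspace x (hzero kernel_hspace) = x" if "x \<in> hcarrier kernel_hspace" for x
  using that ext by (auto intro!: extensionalityI[of _ D])
 show "hscale kernel_hspace 1 x = x" if "x \<in> hcarrier kernel_hspace" for x
  using that ext by (auto intro!: extensionalityI[of _ D])
 show "hinner kernel_hspace (hadd kernel_hspace x y) z = hinner kernel_hspace x z + hinner kernel_hspace y z"
  if "x \<in> hcarrier kernel_hspace" "y \<in> hcarrier kernel_hspace" "z \<in> hcarrier kernel_hspace" for x y z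
 proof (rule LIMSEQ_unique)
  show "(\<lambda>n. form (approximant x n @ approximant y n) (approximant z n)) \<longlonglongrightarrow> hinner kernel_hspace (hadd kernel_hspace x y) z"
   using that by (intro inner_limit) (auto intro: rA repr_add' hadd_in)
  have "(\<lambda>n. form (approximant x n) (approximant z n) + form (approximant y n) (approximant z n))
    \<longlonglongrightarrow> hinner kernel_hspace x z + hinner kernel_hspace y z"
   using that by (intro tendsto_add inner_limit) (auto intro: rA)
  then show "(\<lambda>n. form (approximant x n @ approximant y n) (approximant z n)) \<longlonglongrightarrow> hinner kernel_hspace x z + hinner kernel_hspace y z"
   by simp
 qed
 show "hinner kernel_hspace (hscale kernel_hspace a x) y = a * hinner kernel_hspace x y"
  if "x \<in> hcarrier kernel_hspace" "y \<in> hcarrier kernel_hspace" for a x y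
 proof (rule LIMSEQ_unique)
  show "(\<lambda>n. form (smult a (approximant x n)) (approximant y n)) \<longlonglongrightarrow> hinner kernel_hspace (hscale kernel_hspace a x) y"
   using that by (intro inner_limit) (auto intro: rA repr_scale' hscale_in)
  have "(\<lambda>n. a * form (approximant x n) (approximant y n)) \<longlonglongrightarrow> a * hinner kernel_hspace x y"
   using that by (intro tendsto_mult tendsto_const inner_limit) (auto intro: rA)
  then show "(\<lambda>n. form (smult a (approximant x n)) (approximant y n)) \<longlonglongrightarrow> a * hinner kernel_hspace x y"
   by simp
 qed
 show "hinner kernel_hspace y x = cnj (hinner kernel_hspace x y)"
  if "x \<in> hcarrier kernel_hspace" "y \<in> hcarrier kernel_hspace" for x y
 proof (rule LIMSEQ_unique)
  show "(\<lambda>n. form (approximant y n) (approximant x n)) \<longlonglongrightarrow> hinner kernel_hspace y x"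
   using that by (intro inner_limit) (auto intro: rA)
  have "(\<lambda>n. cnj (form (approximant x n) (approximant y n))) \<longlonglongrightarrow> cnj (hinner kernel_hspace x y)"
   using that by (intro tendsto_cnj inner_limit) (auto intro: rA)
  then show "(\<lambda>n. form (approximant y n) (approximant x n)) \<longlonglongrightarrow> cnj (hinner kernel_hspace x y)"
   using that c by (simp add: form_commute[of "approximant x _" "approximant y _"])
 qed
 have self: "(\<lambda>n. form (approximant x n) (approximant x n)) \<longlonglongrightarrow> hinner kernel_hspace x x"
  if "x \<in> hcar" for x
  using that by (intro inner_limit) (auto intro: rA)
 show "hinner kernel_hspace x x \<in> \<real>\<^sub>\<ge>\<^sub>0" if "x \<in> hcarrier kernel_hspace" for x
  by (rule closed_sequentially[OF closed_nonneg_Reals_complex _ self])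
   (use that c form_self(1) in auto)
 show "x = hzero kernel_hspace" if x: "x \<in> hcarrier kernel_hspace" "hinner kernel_hspace x x = 0" for x
 proof (rule extensionalityI[of _ D])
  fix d assume d: "d \<in> D"
  have xc: "x \<in> hcar" using x by simp
  have "(\<lambda>n. sqrt (Re (form (approximant x n) (approximant x n)))) \<longlonglongrightarrow> sqrt (Re 0)"
   using self[OF xc] x(2) by (intro tendsto_real_sqrt tendsto_Re) simp
  then have lim: "(\<lambda>n. lnorm (approximant x n) * lnorm [(1, d)]) \<longlonglongrightarrow> 0"
   using tendsto_mult[OF _ tendsto_const[of "lnorm [(1, d)]"]] by (fastforce simp: lnorm_def)
  have "(\<lambda>n. form (approximant x n) [(1, d)]) \<longlonglongrightarrow> 0"
   by (rule tendsto_norm_zero_cancel, rule tendsto_sandwich[OF _ _ tendsto_const lim])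
    (use form_Cauchy_Schwarz[OF c[OF xc]] d in auto)
  moreover have "(\<lambda>n. form (approximant x n) [(1, d)]) \<longlonglongrightarrow> x d" using rA[OF xc] d by (simp add: repr_def)
  ultimately have "x d = 0" by (rule LIMSEQ_unique[rotated])
  then show "x d = hzero kernel_hspace d" using d by simp
 qed (use x ext in auto)
 show "\<exists>l\<in>hcarrier kernel_hspace. (\<lambda>n. hdist kernel_hspace (s n) l) \<longlonglongrightarrow> 0"
  if "!!n. s n \<in> hcarrier kernel_hspace"
   "!!e. e > 0 ==> \<exists>N. \<forall>m\<ge>N. \<forall>n\<ge>N. hdist kernel_hspace (s m) (s n) < e" for s
  using kernel_complete[of s] that by simp
 show "hadd kernel_hspace x y \<in> hcarrier kernel_hspace"
  if "x \<in> hcarrier kernel_hspace" "y \<in> hcarrier kernel_hspace" for x y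
  using that hadd_in[of x y] by (simp del: restrict_apply)
 show "hscale kernel_hspace c x \<in> hcarrier kernel_hspace" if "x \<in> hcarrier kernel_hspace" for x c
  using that hscale_in[of x c] by (simp del: restrict_apply)
qed (auto simp: restrict_def fun_eq_iff algebra_simps)

lemma inner_vec_right:
 assumes \<phi>: "\<phi> \<in> hcar" and d: "d \<in> D"
 shows "hinner kernel_hspace \<phi> (vec [(1, d)]) = \<phi> d"
proof (rule LIMSEQ_unique)
 have c: "comb [(1, d)]" using d by simp
 show "(\<lambda>n. form (approximant \<phi> n) [(1, d)]) \<longlonglongrightarrow> hinner kernel_hspace \<phi> (vec [(1, d)])"
  by (rule inner_limit[OF \<phi> repr_approximant[OF \<phi>] vec_in[OF c] repr_vec[OF c]])
 show "(\<lambda>n. form (approximant \<phi> n) [(1, d)]) \<longlonglongrightarrow> \<phi> d"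
  using repr_approximant[OF \<phi>] d by (simp add: repr_def)
qed

text \<open>Maps \<open>m\<close>, \<open>n\<close> of the index set that are adjoint with respect to the kernel induce mutually
 adjoint operators.\<close>

definition lift :: "('d => 'd) => ('d => complex) => 'd => complex" where
 "lift n \<phi> = (\<lambda>d\<in>D. \<phi> (n d))"

lemma repr_lift:
 assumes m: "!!d. d \<in> D ==> m d \<in> D" and n: "!!d. d \<in> D ==> n d \<in> D"
  and adj: "!!d d'. d \<in> D ==> d' \<in> D ==> \<kappa> (m d) d' = \<kappa> d (n d')"
  and bound: "!!l. comb l ==> lnorm (map (apsnd m) l) \<le> B * lnorm l" and B: "B \<ge> 0"
  and r: "repr e \<phi>"
 shows "repr (\<lambda>k. map (apsnd m) (e k)) (lift n \<phi>)"
proof -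
 let ?f = "\<lambda>k. map (apsnd m) (e k)"
 have c: "comb (e k)" for k using r by (auto simp: repr_def Cauchy_comb_def)
 have cm: "comb (map (apsnd m) l)" if "comb l" for l using that m by (auto simp: comb_def)
 have shift: "form (map (apsnd m) l) [(1, d)] = form l [(1, n d)]" if "comb l" "d \<in> D" for l d
  using that by (induction l) (auto simp: form_def comb_def adj)
 have diff: "diff (map (apsnd m) l) (map (apsnd m) l') = map (apsnd m) (diff l l')" for l l'
  by (simp add: smult_def o_def)
 have C: "Cauchy_comb ?f"
  unfolding Cauchy_comb_def
 proof (intro conjI allI impI)
  show "comb (?f k)" for k by (rule cm[OF c])
  fix t :: real assume "t > 0"
  then have "t / (B + 1) > 0" using B by simp
  then obtain N where N: "!!i j. i \<ge> N ==> j \<ge> N ==> lnorm (diff (e i) (e j)) < t / (B + 1)"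
   using r unfolding repr_def Cauchy_comb_def by metis
  have "lnorm (diff (?f i) (?f j)) < t" if "i \<ge> N" "j \<ge> N" for i j
  proof -
   have "lnorm (diff (?f i) (?f j)) \<le> B * lnorm (diff (e i) (e j))" unfolding diff using c by (intro bound) simp
   also have "\<dots> \<le> (B + 1) * lnorm (diff (e i) (e j))" using c by (intro mult_right_mono) auto
   also have "\<dots> < t" using N[OF that] B by (simp add: pos_less_divide_eq mult.commute)
   finally show ?thesis .
  qed
  then show "\<exists>N. \<forall>i\<ge>N. \<forall>j\<ge>N. lnorm (diff (?f i) (?f j)) < t" by blast
 qed
 have "(\<lambda>k. form (?f k) [(1, d)]) \<longlonglongrightarrow> lift n \<phi> d" if d: "d \<in> D" for d
  using r n[OF d] d unfolding shift[OF c d] by (simp add: repr_def lift_def)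
 then show ?thesis using C by (simp add: repr_def)
qed

lemma lift_bounded:
 assumes m: "!!d. d \<in> D ==> m d \<in> D" and n: "!!d. d \<in> D ==> n d \<in> D"
  and adj: "!!d d'. d \<in> D ==> d' \<in> D ==> \<kappa> (m d) d' = \<kappa> d (n d')"
  and bound: "!!l. comb l ==> lnorm (map (apsnd m) l) \<le> B * lnorm l" and B: "B \<ge> 0"
  and \<phi>: "\<phi> \<in> hcar"
 shows "lift n \<phi> \<in> hcar" "hnorm kernel_hspace (lift n \<phi>) \<le> B * hnorm kernel_hspace \<phi>"
proof -
 let ?e = "approximant \<phi>"
 have r: "repr ?e \<phi>" by (rule repr_approximant[OF \<phi>])
 have c: "comb (?e k)" for k using r by (auto simp: repr_def Cauchy_comb_def)
 have r': "repr (\<lambda>k. map (apsnd m) (?e k)) (lift n \<phi>)" by (rule repr_lift[OF m n adj bound B r])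
 show l: "lift n \<phi> \<in> hcar" by (rule hcarI[OF _ r']) (simp add: lift_def)
 have "(\<lambda>k. lnorm (map (apsnd m) (?e k))) \<longlonglongrightarrow> hnorm kernel_hspace (lift n \<phi>)"
  unfolding lnorm_def hnorm_def by (intro tendsto_real_sqrt tendsto_Re inner_limit l r')
 moreover have "(\<lambda>k. B * lnorm (?e k)) \<longlonglongrightarrow> B * hnorm kernel_hspace \<phi>"
  unfolding lnorm_def hnorm_def by (intro tendsto_mult tendsto_const tendsto_real_sqrt tendsto_Re inner_limit \<phi> r)
 ultimately show "hnorm kernel_hspace (lift n \<phi>) \<le> B * hnorm kernel_hspace \<phi>"
  by (rule LIMSEQ_le) (use bound[OF c] in blast)
qed

lemma lift_adjoint:
 assumes m: "!!d. d \<in> D ==> m d \<in> D" and n: "!!d. d \<in> D ==> n d \<in> D"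
  and adj: "!!d d'. d \<in> D ==> d' \<in> D ==> \<kappa> (m d) d' = \<kappa> d (n d')"
  and bound: "!!l. comb l ==> lnorm (map (apsnd m) l) \<le> B * lnorm l"
   "!!l. comb l ==> lnorm (map (apsnd n) l) \<le> B * lnorm l" and B: "B \<ge> 0"
  and \<phi>: "\<phi> \<in> hcar" and \<psi>: "\<psi> \<in> hcar"
 shows "hinner kernel_hspace (lift n \<phi>) \<psi> = hinner kernel_hspace \<phi> (lift m \<psi>)"
proof -
 have adj': "\<kappa> (n d) d' = \<kappa> d (m d')" if "d \<in> D" "d' \<in> D" for d d'
  using that adj[OF that(2,1)] hermitian[OF m[OF that(2)] that(1)] hermitian[OF that(2) n[OF that(1)]] by simp
 let ?e = "approximant \<phi>" and ?e' = "approximant \<psi>"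
 have r: "repr ?e \<phi>" "repr ?e' \<psi>" using \<phi> \<psi> by (auto intro: repr_approximant)
 have c: "comb (?e k)" "comb (?e' k)" for k using r by (auto simp: repr_def Cauchy_comb_def)
 have single: "form [(fst p, m (snd p))] l' = form [p] (map (apsnd n) l')" if "snd p \<in> D" "comb l'" for p l'
  using that by (induction l') (auto simp: form_def comb_def adj)
 have "form (map (apsnd m) l) l' = form l (map (apsnd n) l')" if "comb l" "comb l'" for l l'
  using that(1)
 proof (induction l)
  case (Cons p l)
  have "form (map (apsnd m) (p # l)) l' = form [(fst p, m (snd p))] l' + form (map (apsnd m) l) l'"
   using form_simps(3)[of "[(fst p, m (snd p))]" "map (apsnd m) l" l'] by (simp add: apsnd_def map_prod_def split_beta)
  moreover have "form (p # l) (map (apsnd n) l') = form [p] (map (apsnd n) l') + form l (map (apsnd n) l')"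
   using form_simps(3)[of "[p]" l "map (apsnd n) l'"] by simp
  ultimately show ?case using Cons single[OF _ that(2), of p] by (simp add: comb_def)
 qed simp
 then have eq: "form (map (apsnd m) (?e k)) (?e' k) = form (?e k) (map (apsnd n) (?e' k))" for k using c by blast
 have "(\<lambda>k. form (map (apsnd m) (?e k)) (?e' k)) \<longlonglongrightarrow> hinner kernel_hspace (lift n \<phi>) \<psi>"
  by (rule inner_limit[OF lift_bounded(1)[OF m n adj bound(1) B \<phi>] repr_lift[OF m n adj bound(1) B r(1)] \<psi> r(2)])
 moreover have "(\<lambda>k. form (?e k) (map (apsnd n) (?e' k))) \<longlonglongrightarrow> hinner kernel_hspace \<phi> (lift m \<psi>)"
  by (rule inner_limit[OF \<phi> r(1) lift_bounded(1)[OF n m adj' bound(2) B \<psi>] repr_lift[OF n m adj' bound(2) B r(2)]])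
 ultimately show ?thesis unfolding eq by (rule LIMSEQ_unique)
qed

end

lemma (in psd_kernel) hcar_linear:
 assumes \<phi>: "\<phi> \<in> hcar" and d: "d \<in> D" "d1 \<in> D" "d2 \<in> D"
  and eq: "!!d'. d' \<in> D ==> \<kappa> d' d = a * \<kappa> d' d1 + b * \<kappa> d' d2"
 shows "\<phi> d = a * \<phi> d1 + b * \<phi> d2"
proof (rule LIMSEQ_unique)
 let ?e = "approximant \<phi>"
 have r: "repr ?e \<phi>" by (rule repr_approximant[OF \<phi>])
 have c: "comb (?e n)" for n using r by (simp add: repr_def Cauchy_comb_def)
 have "form l [(1, d)] = a * form l [(1, d1)] + b * form l [(1, d2)]" if "comb l" for l
  using that by (induction l) (auto simp: form_def comb_def eq algebra_simps)
 then have "form (?e n) [(1, d)] = a * form (?e n) [(1, d1)] + b * form (?e n) [(1, d2)]" for n using c by blast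
 moreover have "(\<lambda>n. a * form (?e n) [(1, d1)] + b * form (?e n) [(1, d2)]) \<longlonglongrightarrow> a * \<phi> d1 + b * \<phi> d2"
  using r d by (intro tendsto_intros) (auto simp: repr_def)
 ultimately show "(\<lambda>n. form (?e n) [(1, d)]) \<longlonglongrightarrow> a * \<phi> d1 + b * \<phi> d2" by simp
 show "(\<lambda>n. form (?e n) [(1, d)]) \<longlonglongrightarrow> \<phi> d" using r d by (simp add: repr_def)
qed

section \<open>Completely positive maps and their dilations\<close>

context hilbert_space
begin

primrec hsum :: "(nat => 'h) => nat => 'h" where
 "hsum w 0 = hzero H"
| "hsum w (Suc n) = hadd H (hsum w n) (w n)"

lemma hsum_in: "(!!i. i < n ==> w i \<in> hcarrier H) ==> hsum w n \<in> hcarrier H"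
 by (induction n) (auto intro: zero_closed add_closed)

lemma inner_hsum:
 assumes "!!i. i < n ==> w i \<in> hcarrier H" "y \<in> hcarrier H"
 shows "hinner H (hsum w n) y = (\<Sum>i<n. hinner H (w i) y)"
 using assms(1)
proof (induction n)
 case (Suc n)
 then have "hsum w n \<in> hcarrier H" "w n \<in> hcarrier H" by (auto intro: hsum_in)
 then show ?case using Suc assms(2) by (simp add: inner_add)
qed (simp add: inner_simps assms(2))

lemma gram_sum_nonneg:
 assumes w: "!!i. i < (n::nat) ==> w i \<in> hcarrier H"
 shows "(\<Sum>i<n. \<Sum>j<n. hinner H (w j) (w i)) \<in> \<real>\<^sub>\<ge>\<^sub>0"
proof -
 have s: "hsum w n \<in> hcarrier H" by (rule hsum_in[OF w])
 have "hinner H (hsum w n) (hsum w n) = (\<Sum>j<n. hinner H (w j) (hsum w n))" by (rule inner_hsum[OF w s])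
 also have "\<dots> = (\<Sum>j<n. cnj (\<Sum>i<n. hinner H (w i) (w j)))"
  using inner_hsum[OF w] inner_commute[OF s] w by (intro sum.cong) auto
 also have "\<dots> = (\<Sum>j<n. \<Sum>i<n. hinner H (w j) (w i))"
  by (simp, intro sum.cong refl, rule inner_commute[symmetric]) (use w in auto)
 also have "\<dots> = (\<Sum>i<n. \<Sum>j<n. hinner H (w j) (w i))" by (rule sum.swap)
 finally show ?thesis using inner_nonneg[OF s] by simp
qed

lemma polarization:
 assumes S: "hlinear H H S" and T: "hlinear H H T"
  and eq: "!!u. u \<in> hcarrier H ==> hinner H (S u) u = hinner H (T u) u"
  and x: "x \<in> hcarrier H" and y: "y \<in> hcarrier H"
 shows "hinner H (S x) y = hinner H (T x) y"
proof -
 define d where "d u v = hinner H (S u) v - hinner H (T u) v" for u v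
 have "d (hadd H x (hscale H c y)) (hadd H x (hscale H c y)) = d x x + cnj c * d x y + c * d y x + c * cnj c * d y y" for c
  using S T x y by (simp add: d_def hlinear_def PiE_def Pi_def inner_simps algebra_simps)
 then have "cnj c * d x y + c * d y x = 0" for c using eq x y by (simp add: d_def)
 from this[of 1] this[of \<i>] show ?thesis by (simp add: d_def complex_eq_iff)
qed

lemma bops_eq_on_dense:
 assumes T: "T \<in> bops H" and T': "T' \<in> bops H" and S: "S \<subseteq> hcarrier H"
  and dense: "!!x e. x \<in> hcarrier H ==> e > 0 ==> \<exists>y\<in>S. hdist H y x < e"
  and eq: "!!x. x \<in> S ==> T x = T' x"
 shows "T = T'"
proof -
 have lin: "hlinear H H T" "hlinear H H T'" using T T' by (auto simp: bops_def)
 have Td: "\<exists>B>0. \<forall>x\<in>hcarrier H. \<forall>y\<in>hcarrier H. hdist H (T x) (T y) \<le> B * hdist H x y"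
  if TB: "T \<in> bops H" for T
 proof -
  obtain B where B: "!!x. x \<in> hcarrier H ==> hnorm H (T x) \<le> B * hnorm H x" and l: "hlinear H H T"
   using TB by (auto simp: bops_def)
  have "hdist H (T x) (T y) \<le> (\<bar>B\<bar> + 1) * hdist H x y" if "x \<in> hcarrier H" "y \<in> hcarrier H" for x y
  proof -
   have "sub (T x) (T y) = T (sub x y)" using l that by (simp add: hlinear_def)
   then have "hdist H (T x) (T y) \<le> B * hdist H x y" using B[of "sub x y"] that by (simp add: hdist_def)
   also have "\<dots> \<le> (\<bar>B\<bar> + 1) * hdist H x y" using that by (intro mult_right_mono) auto
   finally show ?thesis .
  qed
  then show ?thesis by (intro exI[of _ "\<bar>B\<bar> + 1"]) auto
 qed
 obtain B where B: "B > 0" "!!x y. x \<in> hcarrier H ==> y \<in> hcarrier H ==> hdist H (T x) (T y) \<le> B * hdist H x y"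
  using Td[OF T] by metis
 obtain C where C: "C > 0" "!!x y. x \<in> hcarrier H ==> y \<in> hcarrier H ==> hdist H (T' x) (T' y) \<le> C * hdist H x y"
  using Td[OF T'] by metis
 show ?thesis
 proof (rule extensionalityI[of _ "hcarrier H"])
  show "T \<in> extensional (hcarrier H)" "T' \<in> extensional (hcarrier H)" using lin by (auto simp: hlinear_def PiE_def)
  fix x assume x: "x \<in> hcarrier H"
  have Tx: "T x \<in> hcarrier H" "T' x \<in> hcarrier H" using lin x by (auto simp: hlinear_def)
  have "hdist H (T x) (T' x) \<le> 0 + e" if e: "e > 0" for e
  proof -
   have "e / (B + C) > 0" using e B C by simp
   then obtain y where y: "y \<in> S" "hdist H y x < e / (B + C)" using dense[OF x] by metis
   have yH: "y \<in> hcarrier H" using y S by blast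
   have Ty: "T y \<in> hcarrier H" using lin yH by (auto simp: hlinear_def)
   have "hdist H (T x) (T' x) \<le> hdist H (T x) (T y) + hdist H (T y) (T' x)"
    by (rule dist_triangle[OF Tx(1) Ty Tx(2)])
   also have "\<dots> \<le> B * hdist H y x + C * hdist H y x"
    using B(2)[OF x yH] C(2)[OF yH x] dist_commute[OF x yH] by (intro add_mono) (auto simp: eq[OF y(1)])
   also have "\<dots> = (B + C) * hdist H y x" by (simp add: algebra_simps)
   also have "\<dots> < e" using y B C by (simp add: pos_less_divide_eq mult.commute)
   finally show ?thesis by simp
  qed
  then have "hdist H (T x) (T' x) \<le> 0" by (rule field_le_epsilon)
  then have "hnorm H (sub (T x) (T' x)) = 0"
   unfolding hdist_def by (rule antisym) (rule norm_nonneg, simp add: Tx)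
  then show "T x = T' x" using Tx by (intro eq_if_sub_null) (auto simp: inner_self)
 qed
qed

end

lemma linear_into_bops_inner_sum:
 assumes H: "hilbert_space H" and \<Phi>: "linear_into_bops X H \<Phi>" and J: "finite J"
  and f: "!!k. k \<in> J ==> f k \<in> cfun X" and u: "u \<in> hcarrier H" and v: "v \<in> hcarrier H"
 shows "(\<lambda>x\<in>topspace X. \<Sum>k\<in>J. f k x) \<in> cfun X \<and>
  hinner H (\<Phi> (\<lambda>x\<in>topspace X. \<Sum>k\<in>J. f k x) u) v = (\<Sum>k\<in>J. hinner H (\<Phi> (f k) u) v)"
proof -
 interpret hilbert_space H by fact
 note \<Phi>' = linear_into_bopsD[OF \<Phi>]
 define S where "S J = (\<lambda>x\<in>topspace X. \<Sum>k\<in>J. f k x)" for J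
 have "S J \<in> cfun X \<and> hinner H (\<Phi> (S J) u) v = (\<Sum>k\<in>J. hinner H (\<Phi> (f k) u) v)"
  using J f
 proof (induction J)
  case empty
  have "S {} = cf_scale X 0 (cf_one X)" by (auto simp: S_def cf_scale_def)
  then show ?case using u v \<Phi>' by (simp add: cf_scale_in inner_scale)
 next
  case (insert a J)
  have "S (insert a J) = cf_add X (f a) (S J)" using insert by (auto simp: S_def cf_add_def)
  then show ?case using insert u v \<Phi>' by (simp add: cf_add_in inner_add)
 qed
 then show ?thesis by (simp add: S_def)
qed

lemma sum_in_nonneg_Reals: "(!!k. k \<in> S ==> f k \<in> \<real>\<^sub>\<ge>\<^sub>0) ==> sum f S \<in> (\<real>\<^sub>\<ge>\<^sub>0 :: complex set)"
 by (auto simp: complex_nonneg_Reals_iff intro!: sum_nonneg sum.neutral)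

text \<open>A positive matrix is a sum of matrices with entries \<open>f\<^sub>i\<^sup>* f\<^sub>j\<close>, one for each row of its factor.\<close>

lemma completely_positiveI:
 assumes H: "hilbert_space H" and lin: "linear_into_bops X H \<Phi>"
  and pos: "!!(n :: nat) f h. (!!i. i < n ==> f i \<in> cfun X) ==> (!!i. i < n ==> h i \<in> hcarrier H) ==>
   (\<Sum>i<n. \<Sum>j<n. hinner H (\<Phi> (cf_mult X (cf_star X (f i)) (f j)) (h j)) (h i)) \<in> \<real>\<^sub>\<ge>\<^sub>0"
 shows "completely_positive X H \<Phi>"
 unfolding completely_positive_def
proof (intro conjI allI impI lin)
 fix n F assume "matrix_pos X n F"
 then have "\<exists>c. (\<forall>i<n. \<forall>j<n. c i j \<in> cfun X) \<and>
   (\<forall>i<n. \<forall>j<n. F i j = (\<lambda>x\<in>topspace X. \<Sum>k<n. cnj (c k i x) * c k j x))" by (simp only: matrix_pos_def)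
 then obtain c where c': "(\<forall>i<n. \<forall>j<n. c i j \<in> cfun X) \<and>
   (\<forall>i<n. \<forall>j<n. F i j = (\<lambda>x\<in>topspace X. \<Sum>k<n. cnj (c k i x) * c k j x))" by (rule exE)
 have c: "c i j \<in> cfun X" "F i j = (\<lambda>x\<in>topspace X. \<Sum>k<n. cnj (c k i x) * c k j x)" if "i < n" "j < n" for i j
  using c' that by blast+
 show "op_matrix_pos H n (\<lambda>i j. \<Phi> (F i j))"
  unfolding op_matrix_pos_def
 proof (intro allI impI)
  fix h assume h: "\<forall>i<n. h i \<in> hcarrier H"
  let ?t = "\<lambda>i j k. hinner H (\<Phi> (cf_mult X (cf_star X (c k i)) (c k j)) (h j)) (h i)"
  have "hinner H (\<Phi> (F i j) (h j)) (h i) = (\<Sum>k<n. ?t i j k)" if ij: "i < n" "j < n" for i j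
  proof -
   let ?f = "\<lambda>k. cf_mult X (cf_star X (c k i)) (c k j)"
   have F: "F i j = (\<lambda>x\<in>topspace X. \<Sum>k<n. ?f k x)" using c(2)[OF ij] by auto
   show ?thesis
    unfolding F using linear_into_bops_inner_sum[OF H lin finite_lessThan, of n ?f "h j" "h i"] c(1) ij h
    by (auto intro: cfun_closed)
  qed
  then have "(\<Sum>i<n. \<Sum>j<n. hinner H (\<Phi> (F i j) (h j)) (h i)) = (\<Sum>i<n. \<Sum>j<n. \<Sum>k<n. ?t i j k)" by simp
  also have "\<dots> = (\<Sum>i<n. \<Sum>k<n. \<Sum>j<n. ?t i j k)" by (intro sum.cong refl sum.swap)
  also have "\<dots> = (\<Sum>k<n. \<Sum>i<n. \<Sum>j<n. ?t i j k)" by (rule sum.swap)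
  also have "\<dots> \<in> \<real>\<^sub>\<ge>\<^sub>0"
  proof (rule sum_in_nonneg_Reals)
   fix k assume "k \<in> {..<n}"
   then show "(\<Sum>i<n. \<Sum>j<n. ?t i j k) \<in> \<real>\<^sub>\<ge>\<^sub>0" by (intro pos[of n "c k" h]) (use c h in auto)
  qed
  finally show "(\<Sum>i<n. \<Sum>j<n. hinner H (\<Phi> (F i j) (h j)) (h i)) \<in> \<real>\<^sub>\<ge>\<^sub>0" .
 qed
qed

lemma star_rep_completely_positive:
 assumes H: "hilbert_space H" and \<pi>: "star_rep X H \<pi>"
 shows "completely_positive X H \<pi>"
proof (rule completely_positiveI[OF H])
 interpret hilbert_space H by fact
 note \<pi>' = star_repD[OF H \<pi>]
 note lin = linear_into_bopsD[OF \<pi>'(1)]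
 show "linear_into_bops X H \<pi>" by (rule \<pi>')
 fix n :: nat and f h
 assume f: "!!i. i < n ==> f i \<in> cfun X" and h: "!!i. i < n ==> h i \<in> hcarrier H"
 have "hinner H (\<pi> (cf_mult X (cf_star X (f i)) (f j)) (h j)) (h i) = hinner H (\<pi> (f j) (h j)) (\<pi> (f i) (h i))"
  if ij: "i < n" "j < n" for i j
 proof -
  have "cf_star X (cf_star X (f i)) = f i" by (rule cfun_eqI) (use f ij in \<open>auto simp: cfun_closed\<close>)
  then show ?thesis
   using f[OF ij(1)] f[OF ij(2)] h[OF ij(1)] h[OF ij(2)] lin(2) \<pi>'(3)[of "cf_star X (f i)" "\<pi> (f j) (h j)" "h i"]
   by (simp add: \<pi>'(2) cf_star_in)
 qed
 then have "(\<Sum>i<n. \<Sum>j<n. hinner H (\<pi> (cf_mult X (cf_star X (f i)) (f j)) (h j)) (h i)) =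
  (\<Sum>i<n. \<Sum>j<n. hinner H (\<pi> (f j) (h j)) (\<pi> (f i) (h i)))" by simp
 also have "\<dots> \<in> \<real>\<^sub>\<ge>\<^sub>0" by (rule gram_sum_nonneg) (use lin(2) f h in auto)
 finally show "(\<Sum>i<n. \<Sum>j<n. hinner H (\<pi> (cf_mult X (cf_star X (f i)) (f j)) (h j)) (h i)) \<in> \<real>\<^sub>\<ge>\<^sub>0" .
qed

lemma completely_positive_vector_functional:
 assumes H: "hilbert_space H" and \<Phi>: "completely_positive X H \<Phi>" and u: "u \<in> hcarrier H"
 shows "positive_functional X (cfun X) (\<lambda>f. hinner H (\<Phi> f u) u)"
 unfolding positive_functional_def
proof (intro conjI ballI allI impI)
 interpret hilbert_space H by fact
 have "linear_into_bops X H \<Phi>" using \<Phi> by (simp add: completely_positive_def)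
 note lin = linear_into_bopsD[OF this]
 fix f assume f: "f \<in> cfun X"
 show "hinner H (\<Phi> (cf_scale X c f) u) u = c * hinner H (\<Phi> f u) u" for c using f u by (simp add: lin inner_simps)
 show "hinner H (\<Phi> (cf_add X f g) u) u = hinner H (\<Phi> f u) u + hinner H (\<Phi> g u) u" if "g \<in> cfun X" for g
  using f u that by (simp add: lin inner_simps)
 assume pos: "\<forall>x\<in>topspace X. f x \<in> \<real>\<^sub>\<ge>\<^sub>0"
 define c where "c = (\<lambda>x\<in>topspace X. complex_of_real (sqrt (Re (f x))))"
 have c: "c \<in> cfun X"
  unfolding c_def using cfun_continuous[OF f]
  by (intro restrict_in_cfun continuous_map_of_real continuous_map_sqrt continuous_map_Re)
 have cc: "f x = cnj (c x) * c x" if "x \<in> topspace X" for x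
  using pos that by (simp add: c_def complex_nonneg_Reals_iff complex_eq_iff)
 have "matrix_pos X 1 (\<lambda>i j. f)"
  unfolding matrix_pos_def
 proof (intro exI[of _ "\<lambda>i j. c"] conjI allI impI)
  show "f = (\<lambda>x\<in>topspace X. \<Sum>k<(1::nat). cnj (c x) * c x)"
   by (rule extensionalityI[of _ "topspace X"]) (use f cc in \<open>auto simp: cfun_def\<close>)
 qed (rule c)
 then have "op_matrix_pos H 1 (\<lambda>i j. \<Phi> f)" using \<Phi> unfolding completely_positive_def by blast
 then show "hinner H (\<Phi> f u) u \<in> \<real>\<^sub>\<ge>\<^sub>0" unfolding op_matrix_pos_def by (elim allE[of _ "\<lambda>i. u"]) (simp add: u)
qed


lemma completely_positive_gram:
 fixes l :: "(complex \<times> ('x => complex) \<times> 'h) list"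
 assumes H: "hilbert_space H" and \<Phi>: "completely_positive X H \<Phi>"
  and l: "!!p. p \<in> set l ==> fst (snd p) \<in> cfun X \<and> snd (snd p) \<in> hcarrier H"
 shows "(\<Sum>p\<leftarrow>l. \<Sum>r\<leftarrow>l. fst p * cnj (fst r) *
   hinner H (\<Phi> (cf_mult X (cf_star X (fst (snd r))) (fst (snd p))) (snd (snd p))) (snd (snd r))) \<in> \<real>\<^sub>\<ge>\<^sub>0"
proof -
 interpret hilbert_space H by fact
 note lin = linear_into_bopsD[OF \<Phi>[unfolded completely_positive_def, THEN conjunct1]]
 let ?n = "length l"
 define f where "f i = fst (snd (l ! i))" for i
 define u where "u i = hscale H (fst (l ! i)) (snd (snd (l ! i)))" for i
 define c where "c k i = (if k = 0 then f i else cf_scale X 0 (f i))" for k i :: nat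
 define F where "F i j = cf_mult X (cf_star X (f i)) (f j)" for i j
 have f: "f i \<in> cfun X" if "i < ?n" for i using l that by (simp add: f_def)
 have u: "u i \<in> hcarrier H" if "i < ?n" for i using l that by (simp add: u_def)
 have "matrix_pos X ?n F"
  unfolding matrix_pos_def
 proof (intro exI[of _ c] conjI allI impI)
  show "c i j \<in> cfun X" if "i < ?n" "j < ?n" for i j using f that by (simp add: c_def cf_scale_in)
  fix i j assume ij: "i < ?n" "j < ?n"
  have "(\<Sum>k<?n. cnj (c k i x) * c k j x) = cnj (f i x) * f j x" if x: "x \<in> topspace X" for x
  proof -
   have "(\<Sum>k<?n. cnj (c k i x) * c k j x) = (\<Sum>k<?n. if k = 0 then cnj (f i x) * f j x else 0)"
    using x by (intro sum.cong) (auto simp: c_def)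
   also have "\<dots> = cnj (f i x) * f j x" using ij by (subst sum.delta) auto
   finally show ?thesis .
  qed
  then show "F i j = (\<lambda>x\<in>topspace X. \<Sum>k<?n. cnj (c k i x) * c k j x)"
   by (auto simp: F_def cf_mult_def cf_star_def)
 qed
 then have "op_matrix_pos H ?n (\<lambda>i j. \<Phi> (F i j))" using \<Phi> by (simp add: completely_positive_def)
 then have "(\<Sum>i<?n. \<Sum>j<?n. hinner H (\<Phi> (F i j) (u j)) (u i)) \<in> \<real>\<^sub>\<ge>\<^sub>0" using u by (simp add: op_matrix_pos_def)
 also have "(\<Sum>i<?n. \<Sum>j<?n. hinner H (\<Phi> (F i j) (u j)) (u i)) = (\<Sum>j<?n. \<Sum>i<?n. hinner H (\<Phi> (F i j) (u j)) (u i))"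
  by (rule sum.swap)
 also have "\<dots> = (\<Sum>j<?n. \<Sum>i<?n. fst (l ! j) * cnj (fst (l ! i)) *
   hinner H (\<Phi> (cf_mult X (cf_star X (fst (snd (l ! i)))) (fst (snd (l ! j)))) (snd (snd (l ! j)))) (snd (snd (l ! i))))"
 proof (intro sum.cong refl)
  fix j i assume "j \<in> {..<?n}" "i \<in> {..<?n}"
  then have ij: "F i j \<in> cfun X" "snd (snd (l ! i)) \<in> hcarrier H" "snd (snd (l ! j)) \<in> hcarrier H"
   using f l by (auto simp: F_def cfun_closed)
  then show "hinner H (\<Phi> (F i j) (u j)) (u i) = fst (l ! j) * cnj (fst (l ! i)) *
   hinner H (\<Phi> (cf_mult X (cf_star X (fst (snd (l ! i)))) (fst (snd (l ! j)))) (snd (snd (l ! j)))) (snd (snd (l ! i)))"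
   using lin(2)[OF ij(1,3)]
   by (simp add: u_def lin(6)[OF ij(1)] inner_simps) (simp add: F_def f_def)
 qed
 also have "\<dots> = (\<Sum>p\<leftarrow>l. \<Sum>r\<leftarrow>l. fst p * cnj (fst r) *
   hinner H (\<Phi> (cf_mult X (cf_star X (fst (snd r))) (fst (snd p))) (snd (snd p))) (snd (snd r)))"
  by (simp add: sum_list_sum_nth atLeast0LessThan)
 finally show ?thesis .
qed

text \<open>Stinespring's theorem. The dilation space is that of the kernel
 \<open>\<langle>\<Phi>(g\<^sup>* f) u, v\<rangle>\<close> on pairs \<open>(f, u)\<close>; boundedness of multiplication by \<open>f\<close> comes from writing
 \<open>B\<^sup>2 - \<bar>f\<bar>\<^sup>2\<close> as a square.\<close>

theorem Stinespring:
 fixes H :: "'h hspace" and X :: "'x topology"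
 assumes X: "compact_space X" and H: "hilbert_space H" and \<Phi>: "completely_positive X H \<Phi>"
  and unital: "!!u. u \<in> hcarrier H ==> \<Phi> (cf_one X) u = u"
 obtains L :: "(('x => complex) \<times> 'h => complex) hspace" and \<rho> V where
  "hilbert_space L" "star_rep X L \<rho>" "hisometry H L V"
  "!!f u v. f \<in> cfun X ==> u \<in> hcarrier H ==> v \<in> hcarrier H ==> hinner L (\<rho> f (V u)) (V v) = hinner H (\<Phi> f u) v"
proof -
 interpret H: hilbert_space H by fact
 note lin = linear_into_bopsD[OF \<Phi>[unfolded completely_positive_def, THEN conjunct1]]
 define D where "D = cfun X \<times> hcarrier H"
 define \<kappa> where "\<kappa> d d' = hinner H (\<Phi> (cf_mult X (cf_star X (fst d')) (fst d)) (snd d)) (snd d')" for d d'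
 have gram: "(\<Sum>p\<leftarrow>l. \<Sum>r\<leftarrow>l. fst p * cnj (fst r) * \<kappa> (snd p) (snd r)) \<in> \<real>\<^sub>\<ge>\<^sub>0" if "snd ` set l \<subseteq> D" for l
  unfolding \<kappa>_def by (rule completely_positive_gram[OF H \<Phi>]) (use that in \<open>force simp: D_def\<close>)
 interpret psd_kernel D \<kappa>
 proof
  show "0 \<le> Re (\<Sum>p\<leftarrow>l. \<Sum>r\<leftarrow>l. fst p * cnj (fst r) * \<kappa> (snd p) (snd r))" if "snd ` set l \<subseteq> D" for l
   using gram[OF that] by (simp add: complex_nonneg_Reals_iff)
  fix d d' assume d: "d \<in> D" "d' \<in> D"
  have re: "Im (\<kappa> d d) = 0" "Im (\<kappa> d' d') = 0"
   using gram[of "[(1, d)]"] gram[of "[(1, d')]"] d by (auto simp: complex_nonneg_Reals_iff)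
  have "Im (\<kappa> d d' + \<kappa> d' d) = 0" "Im (\<i> * \<kappa> d d' - \<i> * \<kappa> d' d) = 0"
   using gram[of "[(1, d), (1, d')]"] gram[of "[(\<i>, d), (1, d')]"] d re by (auto simp: complex_nonneg_Reals_iff)
  then show "\<kappa> d' d = cnj (\<kappa> d d')" by (simp add: complex_eq_iff)
 qed
 define m where "m F d = (cf_mult X F (fst d), snd d)" for F :: "'x => complex" and d :: "('x => complex) \<times> 'h"
 have mD: "m F d \<in> D" if "F \<in> cfun X" "d \<in> D" for F d using that by (auto simp: m_def D_def cfun_closed)
 have star: "cf_star X (cf_star X F) = F" if "F \<in> cfun X" for F
  by (rule cfun_eqI) (use that in \<open>auto simp: cfun_closed\<close>)
 have adj: "\<kappa> (m F d) d' = \<kappa> d (m (cf_star X F) d')" if F: "F \<in> cfun X" for F d d'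
 proof -
  have "cf_mult X (cf_star X (fst d')) (cf_mult X F (fst d)) = cf_mult X (cf_star X (cf_mult X (cf_star X F) (fst d'))) (fst d)"
   by (auto simp: cf_mult_def cf_star_def)
  then show ?thesis by (simp add: \<kappa>_def m_def)
 qed
 have "\<forall>F\<in>cfun X. \<exists>B. B \<ge> 0 \<and> (\<forall>l. comb l \<longrightarrow> lnorm (map (apsnd (m F)) l) \<le> B * lnorm l) \<and>
  (\<forall>l. comb l \<longrightarrow> lnorm (map (apsnd (m (cf_star X F))) l) \<le> B * lnorm l)"
 proof
  fix F assume F: "F \<in> cfun X"
  have "\<exists>B. B \<ge> 0 \<and> (\<forall>G\<in>{F, cf_star X F}. \<forall>l. comb l \<longrightarrow> lnorm (map (apsnd (m G)) l) \<le> B * lnorm l)"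
 proof -
  obtain B where B: "B \<ge> 0" "!!x. x \<in> topspace X ==> cmod (F x) \<le> B"
   by (rule cfun_bounded[OF X F]) (rule that)
  have "lnorm (map (apsnd (m G)) l) \<le> B * lnorm l" if G: "G \<in> cfun X" "!!x. x \<in> topspace X ==> cmod (G x) \<le> B" and l: "comb l" for G l
  proof -
   define h where "h = (\<lambda>x\<in>topspace X. complex_of_real (sqrt (B\<^sup>2 - (cmod (G x))\<^sup>2)))"
   have "continuous_map X euclidean (\<lambda>x. sqrt (B\<^sup>2 - (cmod (G x))\<^sup>2))"
    using cfun_continuous[OF G(1)] by (intro continuous_map_sqrt continuous_map_diff continuous_map_real_pow continuous_map_norm) auto
   then have h: "h \<in> cfun X" unfolding h_def by (intro restrict_in_cfun continuous_map_of_real)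
   have hh: "cnj (h x) * h x = of_real (B\<^sup>2) - cnj (G x) * G x" if "x \<in> topspace X" for x
   proof -
    have "cnj (h x) * h x = of_real ((sqrt (B\<^sup>2 - (cmod (G x))\<^sup>2))\<^sup>2)"
     using that by (simp add: h_def power2_eq_square del: real_sqrt_mult_self real_sqrt_abs2)
    also have "(sqrt (B\<^sup>2 - (cmod (G x))\<^sup>2))\<^sup>2 = B\<^sup>2 - (cmod (G x))\<^sup>2"
     using G(2)[OF that] B(1) by (simp add: power_mono)
    finally show ?thesis using complex_norm_square[of "G x"] by (simp add: mult.commute)
   qed
   have \<kappa>h: "\<kappa> (m h d) (m h d') = of_real (B\<^sup>2) * \<kappa> d d' - \<kappa> (m G d) (m G d')" if "d \<in> D" "d' \<in> D" for d d'
   proof -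
    let ?P = "cf_mult X (cf_star X (fst d')) (fst d)"
    let ?Q = "cf_mult X (cf_star X (fst (m G d'))) (fst (m G d))"
    have P: "?P \<in> cfun X" "?Q \<in> cfun X" using that G by (auto simp: D_def m_def cfun_closed)
    have "cf_mult X (cf_star X (fst (m h d'))) (fst (m h d)) = cf_add X (cf_scale X (of_real (B\<^sup>2)) ?P) (cf_scale X (-1) ?Q)"
    proof (rule cfun_eqI)
     fix x assume x: "x \<in> topspace X"
     have "cnj (h x * fst d' x) * (h x * fst d x) = (cnj (h x) * h x) * (cnj (fst d' x) * fst d x)" by simp
     also have "\<dots> = (of_real (B\<^sup>2) - cnj (G x) * G x) * (cnj (fst d' x) * fst d x)" by (simp only: hh[OF x])
     finally show "cf_mult X (cf_star X (fst (m h d'))) (fst (m h d)) x = cf_add X (cf_scale X (of_real (B\<^sup>2)) ?P) (cf_scale X (-1) ?Q) x"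
      using x by (simp add: m_def algebra_simps)
    qed (use P that h in \<open>auto simp: D_def m_def cfun_closed\<close>)
    then show ?thesis using P that lin(2)[OF P(1), of "snd d"] lin(2)[OF P(2), of "snd d"] unfolding \<kappa>_def
     by (simp add: lin(3,4) cfun_closed H.inner_simps m_def D_def mem_Times_iff del: of_real_power)
   qed
   have F1: "form (map (apsnd (m K)) l) (map (apsnd (m K)) l') = (\<Sum>p\<leftarrow>l. \<Sum>r\<leftarrow>l'. fst p * cnj (fst r) * \<kappa> (m K (snd p)) (m K (snd r)))" for K l l'
    by (simp add: form_def o_def)
   have "form (map (apsnd (m h)) l) (map (apsnd (m h)) l') = of_real (B\<^sup>2) * form l l' - form (map (apsnd (m G)) l) (map (apsnd (m G)) l')"
    if "comb l" "comb l'" for l l'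
   proof -
    have "(\<Sum>p\<leftarrow>l. \<Sum>r\<leftarrow>l'. fst p * cnj (fst r) * \<kappa> (m h (snd p)) (m h (snd r))) =
     (\<Sum>p\<leftarrow>l. \<Sum>r\<leftarrow>l'. of_real (B\<^sup>2) * (fst p * cnj (fst r) * \<kappa> (snd p) (snd r)) - fst p * cnj (fst r) * \<kappa> (m G (snd p)) (m G (snd r)))"
     using that by (intro arg_cong[where f = sum_list] map_cong refl) (auto simp: comb_def \<kappa>h image_subset_iff algebra_simps)
    then show ?thesis
     unfolding F1 by (simp add: form_def sum_list_subtractf sum_list_const_mult)
   qed
   from this[OF l l] have "Re (form (map (apsnd (m h)) l) (map (apsnd (m h)) l)) =
     B\<^sup>2 * Re (form l l) - Re (form (map (apsnd (m G)) l) (map (apsnd (m G)) l))" by simp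
   moreover have cm: "comb (map (apsnd (m K)) l)" if "K \<in> cfun X" for K
    using l mD[OF that] by (auto simp: comb_def)
   ultimately have sq: "(lnorm (map (apsnd (m G)) l))\<^sup>2 \<le> (B * lnorm l)\<^sup>2"
    using form_self(2)[OF cm[OF h]] l by (simp add: lnorm_sq cm[OF G(1)] power_mult_distrib)
   show ?thesis by (rule power2_le_imp_le[OF sq]) (use B l in auto)
  qed
  then show ?thesis using B F by (intro exI[of _ B]) (auto simp: cfun_closed)
 qed
  then show "\<exists>B. B \<ge> 0 \<and> (\<forall>l. comb l \<longrightarrow> lnorm (map (apsnd (m F)) l) \<le> B * lnorm l) \<and>
   (\<forall>l. comb l \<longrightarrow> lnorm (map (apsnd (m (cf_star X F))) l) \<le> B * lnorm l)" by simp
 qed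
 from bchoice[OF this] obtain N where N: "\<forall>F\<in>cfun X. N F \<ge> 0 \<and> (\<forall>l. comb l \<longrightarrow> lnorm (map (apsnd (m F)) l) \<le> N F * lnorm l) \<and>
  (\<forall>l. comb l \<longrightarrow> lnorm (map (apsnd (m (cf_star X F))) l) \<le> N F * lnorm l)" by (rule exE)
 have bound: "N F \<ge> 0" "!!l. comb l ==> lnorm (map (apsnd (m F)) l) \<le> N F * lnorm l"
  "!!l. comb l ==> lnorm (map (apsnd (m (cf_star X F))) l) \<le> N F * lnorm l" if "F \<in> cfun X" for F
  using N that by auto
 define \<rho> where "\<rho> = (\<lambda>F\<in>cfun X. \<lambda>\<phi>\<in>hcar. lift (m (cf_star X F)) \<phi>)"
 have \<rho>_in: "lift (m (cf_star X F)) \<phi> \<in> hcar" if "F \<in> cfun X" "\<phi> \<in> hcar" for F \<phi>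
  by (rule lift_bounded(1)[OF mD mD adj bound(2,1) that(2)]) (use that in \<open>auto simp: cfun_closed\<close>)
 have L: "hilbert_space kernel_hspace" by (rule hilbert_space_kernel)
 have ext: "\<phi> \<in> extensional D" if "\<phi> \<in> hcar" for \<phi> using that by (simp add: hcar_def)
 have \<rho>: "star_rep X kernel_hspace \<rho>"
 proof (rule star_repI[OF L])
  show "\<rho> \<in> cfun X \<rightarrow>\<^sub>E hcarrier kernel_hspace \<rightarrow>\<^sub>E hcarrier kernel_hspace"
   using \<rho>_in by (auto simp: \<rho>_def)
  show "\<exists>B. \<forall>h\<in>hcarrier kernel_hspace. hnorm kernel_hspace (\<rho> F h) \<le> B * hnorm kernel_hspace h" if F: "F \<in> cfun X" for F
  proof -
   have "hnorm kernel_hspace (lift (m (cf_star X F)) \<phi>) \<le> N F * hnorm kernel_hspace \<phi>" if "\<phi> \<in> hcar" for \<phi>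
    by (rule lift_bounded(2)[OF mD mD adj bound(2,1) that]) (use F in \<open>auto simp: cfun_closed\<close>)
   then show ?thesis using F by (intro exI[of _ "N F"]) (simp add: \<rho>_def)
  qed
  show "\<rho> (cf_add X F G) \<phi> = hadd kernel_hspace (\<rho> F \<phi>) (\<rho> G \<phi>)"
   if FG: "F \<in> cfun X" "G \<in> cfun X" and "\<phi> \<in> hcarrier kernel_hspace" for F G \<phi>
  proof -
   have \<phi>: "\<phi> \<in> hcar" using that by simp
   have "\<phi> (m (cf_star X (cf_add X F G)) d) = 1 * \<phi> (m (cf_star X F) d) + 1 * \<phi> (m (cf_star X G) d)" if d: "d \<in> D" for d
   proof (rule hcar_linear[OF \<phi>])
    fix d' assume d': "d' \<in> D"
    have "\<kappa> (m (cf_add X F G) d') d = \<kappa> (m F d') d + \<kappa> (m G d') d"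
    proof -
     have P: "cf_mult X (cf_star X (fst d)) (cf_mult X F (fst d')) \<in> cfun X" "cf_mult X (cf_star X (fst d)) (cf_mult X G (fst d')) \<in> cfun X"
      using FG d d' by (auto simp: D_def cfun_closed)
     have "cf_mult X (cf_star X (fst d)) (cf_mult X (cf_add X F G) (fst d')) =
      cf_add X (cf_mult X (cf_star X (fst d)) (cf_mult X F (fst d'))) (cf_mult X (cf_star X (fst d)) (cf_mult X G (fst d')))"
      by (auto simp: cf_mult_def cf_add_def algebra_simps)
     then show ?thesis using P d d' lin(2)[OF P(1), of "snd d'"] lin(2)[OF P(2), of "snd d'"]
      by (simp add: \<kappa>_def m_def lin(3) H.inner_add D_def mem_Times_iff)
    qed
    then show "\<kappa> d' (m (cf_star X (cf_add X F G)) d) = 1 * \<kappa> d' (m (cf_star X F) d) + 1 * \<kappa> d' (m (cf_star X G) d)"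
     using FG by (simp add: adj cfun_closed)
   qed (use FG d in \<open>auto intro!: mD cfun_closed\<close>)
   then show ?thesis using FG \<phi> by (auto simp: \<rho>_def lift_def cfun_closed restrict_def fun_eq_iff)
  qed
  show "\<rho> (cf_scale X c F) \<phi> = hscale kernel_hspace c (\<rho> F \<phi>)"
   if F: "F \<in> cfun X" and "\<phi> \<in> hcarrier kernel_hspace" for c F \<phi>
  proof -
   have \<phi>: "\<phi> \<in> hcar" using that by simp
   have "\<phi> (m (cf_star X (cf_scale X c F)) d) = c * \<phi> (m (cf_star X F) d) + 0 * \<phi> (m (cf_star X F) d)" if d: "d \<in> D" for d
   proof (rule hcar_linear[OF \<phi>])
    fix d' assume d': "d' \<in> D"
    have "\<kappa> (m (cf_scale X c F) d') d = c * \<kappa> (m F d') d"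
    proof -
     have P: "cf_mult X (cf_star X (fst d)) (cf_mult X F (fst d')) \<in> cfun X"
      using F d d' by (auto simp: D_def cfun_closed)
     have "cf_mult X (cf_star X (fst d)) (cf_mult X (cf_scale X c F) (fst d')) =
      cf_scale X c (cf_mult X (cf_star X (fst d)) (cf_mult X F (fst d')))"
      by (auto simp: cf_mult_def cf_scale_def)
     then show ?thesis using P d d' lin(2)[OF P, of "snd d'"]
      by (simp add: \<kappa>_def m_def lin(4) H.inner_scale D_def mem_Times_iff)
    qed
    then show "\<kappa> d' (m (cf_star X (cf_scale X c F)) d) = c * \<kappa> d' (m (cf_star X F) d) + 0 * \<kappa> d' (m (cf_star X F) d)"
     using F by (simp add: adj cfun_closed)
   qed (use F d in \<open>auto intro!: mD cfun_closed\<close>)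
   then show ?thesis using F \<phi> by (auto simp: \<rho>_def lift_def cfun_closed restrict_def fun_eq_iff)
  qed
  show "\<rho> (cf_mult X F G) \<phi> = \<rho> F (\<rho> G \<phi>)"
   if FG: "F \<in> cfun X" "G \<in> cfun X" and "\<phi> \<in> hcarrier kernel_hspace" for F G \<phi>
  proof -
   have \<phi>: "\<phi> \<in> hcar" using that by simp
   have "m (cf_star X (cf_mult X F G)) d = m (cf_star X G) (m (cf_star X F) d)" for d
    by (auto simp: m_def cf_mult_def cf_star_def)
   moreover have "m (cf_star X F) d \<in> D" if "d \<in> D" for d using FG that by (intro mD cfun_closed)
   ultimately show ?thesis using FG \<phi> \<rho>_in by (auto simp: \<rho>_def lift_def cfun_closed restrict_def fun_eq_iff)
  qed
  show "hinner kernel_hspace (\<rho> F \<phi>) \<psi> = hinner kernel_hspace \<phi> (\<rho> (cf_star X F) \<psi>)"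
   if F: "F \<in> cfun X" and "\<phi> \<in> hcarrier kernel_hspace" "\<psi> \<in> hcarrier kernel_hspace" for F \<phi> \<psi>
  proof -
   have \<phi>: "\<phi> \<in> hcar" "\<psi> \<in> hcar" using that by auto
   have "hinner kernel_hspace (lift (m (cf_star X F)) \<phi>) \<psi> = hinner kernel_hspace \<phi> (lift (m F) \<psi>)"
    by (rule lift_adjoint[OF mD mD adj bound(2,3,1) \<phi>]) (use F in \<open>auto simp: cfun_closed\<close>)
   then show ?thesis using F \<phi> by (simp add: \<rho>_def cfun_closed star)
  qed
 qed
 define V where "V = (\<lambda>u\<in>hcarrier H. vec [(1, (cf_one X, u))])"
 have oneD: "(cf_one X, u) \<in> D" if "u \<in> hcarrier H" for u using that by (simp add: D_def)
 have one_mult: "cf_mult X (cf_star X (cf_one X)) f = f" if "f \<in> cfun X" for f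
  by (rule cfun_eqI) (use that in \<open>auto simp: cfun_closed\<close>)
 have V: "hisometry H kernel_hspace V"
 proof (rule hisometryI[OF H L])
  show "V \<in> hcarrier H \<rightarrow>\<^sub>E hcarrier kernel_hspace" using oneD by (auto simp: V_def)
  show "hinner kernel_hspace (V u) (V v) = hinner H u v" if "u \<in> hcarrier H" "v \<in> hcarrier H" for u v
   using that oneD inner_vec[of "[(1, (cf_one X, u))]" "[(1, (cf_one X, v))]"]
   by (simp add: V_def form_def \<kappa>_def one_mult unital)
 qed
 have "hinner kernel_hspace (\<rho> f (V u)) (V v) = hinner H (\<Phi> f u) v"
  if f: "f \<in> cfun X" and u: "u \<in> hcarrier H" and v: "v \<in> hcarrier H" for f u v
 proof -
  have "\<rho> f (V u) = lift (m (cf_star X f)) (vec [(1, (cf_one X, u))])"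
   using f u oneD[OF u] by (simp add: \<rho>_def V_def)
  then have "hinner kernel_hspace (\<rho> f (V u)) (V v) = lift (m (cf_star X f)) (vec [(1, (cf_one X, u))]) (cf_one X, v)"
   using inner_vec_right[OF \<rho>_in[OF f vec_in] oneD[OF v], of "[(1, (cf_one X, u))]"] oneD[OF u] v by (simp add: V_def)
  also have "\<dots> = \<kappa> (cf_one X, u) (m (cf_star X f) (cf_one X, v))"
   using oneD[OF v] mD[OF cf_star_in[OF f] oneD[OF v]] by (simp add: lift_def vec_def form_def)
  also have "\<dots> = \<kappa> (m f (cf_one X, u)) (cf_one X, v)" using adj[OF f] by simp
  also have "cf_mult X f (cf_one X) = f" by (rule cfun_eqI) (use f in \<open>auto simp: cfun_closed\<close>)
  then have "\<kappa> (m f (cf_one X, u)) (cf_one X, v) = hinner H (\<Phi> f u) v"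
   using f by (simp add: \<kappa>_def m_def one_mult)
  finally show ?thesis .
 qed
 with L \<rho> V show thesis by (rule that)
qed

section \<open>Copies of Hilbert spaces and the dilation order\<close>

definition hcopy :: "('h => 'u) => 'h hspace => 'u hspace" where
 "hcopy j H = (let i = inv_into (hcarrier H) j in
   \<lparr>hcarrier = j ` hcarrier H, hzero = j (hzero H), hadd = (\<lambda>x y. j (hadd H (i x) (i y))),
   hscale = (\<lambda>c x. j (hscale H c (i x))), hinner = (\<lambda>x y. hinner H (i x) (i y))\<rparr>)"

context
 fixes H :: "'h hspace" and j :: "'h => 'u"
 assumes H: "hilbert_space H" and j: "inj_on j (hcarrier H)"
begin

interpretation H: hilbert_space H by fact

lemma hcarrier_hcopy: "hcarrier (hcopy j H) = j ` hcarrier H"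
 by (simp add: hcopy_def Let_def)

lemma hcopy_apply:
 assumes "x \<in> hcarrier H" "y \<in> hcarrier H"
 shows "hadd (hcopy j H) (j x) (j y) = j (hadd H x y)" "hscale (hcopy j H) c (j x) = j (hscale H c x)"
  "hinner (hcopy j H) (j x) (j y) = hinner H x y" "hnorm (hcopy j H) (j x) = hnorm H x"
  "hdist (hcopy j H) (j x) (j y) = hdist H x y"
 using assms j by (simp_all add: hcopy_def Let_def hnorm_def hdist_def)

lemma hilbert_space_hcopy: "hilbert_space (hcopy j H)"
proof
 note car = hcarrier_hcopy and ap = hcopy_apply
 show "hzero (hcopy j H) \<in> hcarrier (hcopy j H)" by (simp add: hcopy_def Let_def)
 have z: "hzero (hcopy j H) = j (hzero H)" by (simp add: hcopy_def Let_def)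
 fix x y w :: 'u and c d
 assume "x \<in> hcarrier (hcopy j H)" then obtain x' where x: "x = j x'" "x' \<in> hcarrier H" by (auto simp: car)
 show "hscale (hcopy j H) c x \<in> hcarrier (hcopy j H)" "hadd (hcopy j H) x (hzero (hcopy j H)) = x"
  "hscale (hcopy j H) c (hscale (hcopy j H) d x) = hscale (hcopy j H) (c * d) x"
  "hscale (hcopy j H) 1 x = x" "hadd (hcopy j H) x (hscale (hcopy j H) (-1) x) = hzero (hcopy j H)"
  "hscale (hcopy j H) (c + d) x = hadd (hcopy j H) (hscale (hcopy j H) c x) (hscale (hcopy j H) d x)"
  "hinner (hcopy j H) x x \<in> \<real>\<^sub>\<ge>\<^sub>0"
  using x by (auto simp: car ap z H.add_zero H.scale_scale H.scale_one H.add_neg H.scale_add_left H.inner_nonneg)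
 show "x = hzero (hcopy j H)" if "hinner (hcopy j H) x x = 0"
  using that x H.inner_definite by (simp add: z ap)
 assume "y \<in> hcarrier (hcopy j H)" then obtain y' where y: "y = j y'" "y' \<in> hcarrier H" by (auto simp: car)
 show "hadd (hcopy j H) x y \<in> hcarrier (hcopy j H)" using x y by (simp add: car ap)
 show "hadd (hcopy j H) x y = hadd (hcopy j H) y x" using x y by (simp add: ap H.add_commute)
 show "hscale (hcopy j H) c (hadd (hcopy j H) x y) = hadd (hcopy j H) (hscale (hcopy j H) c x) (hscale (hcopy j H) c y)"
  using x y by (simp add: ap H.scale_add_right)
 show "hinner (hcopy j H) (hscale (hcopy j H) c x) y = c * hinner (hcopy j H) x y"
  using x y by (simp add: ap H.inner_scale)
 show "hinner (hcopy j H) y x = cnj (hinner (hcopy j H) x y)"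
  using x y H.inner_commute[of x' y'] by (simp add: ap)
 assume "w \<in> hcarrier (hcopy j H)" then obtain w' where w: "w = j w'" "w' \<in> hcarrier H" by (auto simp: car)
 show "hadd (hcopy j H) (hadd (hcopy j H) x y) w = hadd (hcopy j H) x (hadd (hcopy j H) y w)"
  "hinner (hcopy j H) (hadd (hcopy j H) x y) w = hinner (hcopy j H) x w + hinner (hcopy j H) y w"
  using x y w by (simp_all add: ap H.add_assoc H.inner_add)
next
 fix s :: "nat => 'u"
 assume s: "!!n. s n \<in> hcarrier (hcopy j H)"
  and C: "!!e. e > 0 ==> \<exists>N. \<forall>m\<ge>N. \<forall>n\<ge>N. hdist (hcopy j H) (s m) (s n) < e"
 define t where "t n = inv_into (hcarrier H) j (s n)" for n
 have t: "t n \<in> hcarrier H" "s n = j (t n)" for n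
  using s[of n] by (auto simp: t_def hcarrier_hcopy inv_into_into f_inv_into_f)
 have "\<exists>l\<in>hcarrier H. (\<lambda>n. hdist H (t n) l) \<longlonglongrightarrow> 0"
  by (rule H.complete[OF t(1)]) (use C in \<open>simp add: t(2) hcopy_apply t(1)\<close>)
 then obtain l where l: "l \<in> hcarrier H" "(\<lambda>n. hdist H (t n) l) \<longlonglongrightarrow> 0" by blast
 then show "\<exists>l\<in>hcarrier (hcopy j H). (\<lambda>n. hdist (hcopy j H) (s n) l) \<longlonglongrightarrow> 0"
  by (intro bexI[of _ "j l"]) (simp_all add: t hcopy_apply hcarrier_hcopy)
qed

lemma star_rep_hcopy:
 assumes q: "star_hom K X q" and \<rho>: "star_rep X H \<rho>"
 shows "star_rep K (hcopy j H) (\<lambda>f\<in>cfun K. \<lambda>y\<in>j ` hcarrier H. j (\<rho> (q f) (inv_into (hcarrier H) j y)))"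
  (is "star_rep K _ ?\<sigma>")
proof (rule star_repI[OF hilbert_space_hcopy])
 note \<rho>' = star_repD[OF H \<rho>]
 note lin = linear_into_bopsD[OF \<rho>'(1)]
 have q': "!!f. f \<in> cfun K ==> q f \<in> cfun X"
  "!!f g. f \<in> cfun K ==> g \<in> cfun K ==> q (cf_add K f g) = cf_add X (q f) (q g)"
  "!!f c. f \<in> cfun K ==> q (cf_scale K c f) = cf_scale X c (q f)"
  "!!f g. f \<in> cfun K ==> g \<in> cfun K ==> q (cf_mult K f g) = cf_mult X (q f) (q g)"
  "!!f. f \<in> cfun K ==> q (cf_star K f) = cf_star X (q f)"
  using q by (auto simp: star_hom_def)
 have cl: "\<rho> (q f) x \<in> hcarrier H" if "f \<in> cfun K" "x \<in> hcarrier H" for f x using that lin(2) q'(1) by blast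
 show "?\<sigma> \<in> cfun K \<rightarrow>\<^sub>E hcarrier (hcopy j H) \<rightarrow>\<^sub>E hcarrier (hcopy j H)"
  using cl j by (auto simp: hcarrier_hcopy)
 have s: "?\<sigma> f (j x) = j (\<rho> (q f) x)" if "f \<in> cfun K" "x \<in> hcarrier H" for f x
  using that j by simp
 note simps = s hcopy_apply cl cfun_closed q' lin(3,4) \<rho>'(2)
 show "\<exists>B. \<forall>h\<in>hcarrier (hcopy j H). hnorm (hcopy j H) (?\<sigma> f h) \<le> B * hnorm (hcopy j H) h" if f: "f \<in> cfun K" for f
 proof -
  have "\<rho> (q f) \<in> bops H" using lin(1) q'(1) f by blast
  then have "\<exists>B. \<forall>h\<in>hcarrier H. hnorm H (\<rho> (q f) h) \<le> B * hnorm H h" by (simp add: bops_def)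
  then obtain B where B: "\<forall>h\<in>hcarrier H. hnorm H (\<rho> (q f) h) \<le> B * hnorm H h" by (rule exE)
  have "hnorm (hcopy j H) (?\<sigma> f (j h)) \<le> B * hnorm (hcopy j H) (j h)" if "h \<in> hcarrier H" for h
   unfolding s[OF f that] using B that f by (simp add: hcopy_apply cl)
  then show ?thesis unfolding hcarrier_hcopy by blast
 qed
 fix f g c x y
 assume f: "f \<in> cfun K" and "x \<in> hcarrier (hcopy j H)"
 then obtain x' where x: "x = j x'" "x' \<in> hcarrier H" by (auto simp: hcarrier_hcopy)
 show "?\<sigma> (cf_scale K c f) x = hscale (hcopy j H) c (?\<sigma> f x)"
  unfolding x(1) s[OF f x(2)] s[OF cf_scale_in[OF f] x(2)] using f x by (simp add: hcopy_apply cl q' lin(4))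
 show "?\<sigma> (cf_add K f g) x = hadd (hcopy j H) (?\<sigma> f x) (?\<sigma> g x)" if g: "g \<in> cfun K"
  unfolding x(1) s[OF f x(2)] s[OF g x(2)] s[OF cf_add_in[OF f g] x(2)]
  using f g x by (simp add: hcopy_apply cl q' lin(3))
 show "?\<sigma> (cf_mult K f g) x = ?\<sigma> f (?\<sigma> g x)" if g: "g \<in> cfun K"
  unfolding x(1) s[OF g x(2)] s[OF f cl[OF g x(2)]] s[OF cf_mult_in[OF f g] x(2)]
  using f g x by (simp add: q' \<rho>'(2))
 assume "y \<in> hcarrier (hcopy j H)"
 then obtain y' where y: "y = j y'" "y' \<in> hcarrier H" by (auto simp: hcarrier_hcopy)
 show "hinner (hcopy j H) (?\<sigma> f x) y = hinner (hcopy j H) x (?\<sigma> (cf_star K f) y)"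
  unfolding x(1) y(1) s[OF f x(2)] s[OF cf_star_in[OF f] y(2)]
  using f x y lin(2)[OF cf_star_in[OF q'(1)[OF f]] y(2)] by (simp add: hcopy_apply cl q' \<rho>'(3))
qed

end

text \<open>An instance of the dilation order may be exhibited in any Hilbert spaces that inject into the
 given universe, and with representations of \<open>C(X)\<close> composed with a homomorphism \<open>C(K) \<rightarrow> C(X)\<close>.\<close>

lemma dilation_leI:
 fixes H :: "'h hspace" and L :: "'l hspace" and j :: "'h => 'u" and j' :: "'l => 'u"
 assumes q: "star_hom K X q" and H: "hilbert_space H" and L: "hilbert_space L"
  and j: "inj_on j (hcarrier H)" and j': "inj_on j' (hcarrier L)"
  and \<pi>: "star_rep X H \<pi>" and \<rho>: "star_rep X L \<rho>" and V: "hisometry H L V" and \<xi>: "\<xi> \<in> hcarrier H"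
  and \<mu>: "!!f. f \<in> cfun K ==> (\<integral>x. f x \<partial>\<mu>) = hinner H (\<pi> (q f) \<xi>) \<xi>"
  and \<nu>: "!!f. f \<in> cfun K ==> (\<integral>x. f x \<partial>\<nu>) = hinner L (\<rho> (q f) (V \<xi>)) (V \<xi>)"
  and dil: "!!a u v. a \<in> affine_cfun I K ==> u \<in> hcarrier H ==> v \<in> hcarrier H ==>
   hinner L (\<rho> (q a) (V u)) (V v) = hinner H (\<pi> (q a) u) v"
 shows "dilation_le TYPE('u) I K \<mu> \<nu>"
proof -
 define \<pi>' where "\<pi>' = (\<lambda>f\<in>cfun K. \<lambda>y\<in>j ` hcarrier H. j (\<pi> (q f) (inv_into (hcarrier H) j y)))"
 define \<rho>' where "\<rho>' = (\<lambda>f\<in>cfun K. \<lambda>y\<in>j' ` hcarrier L. j' (\<rho> (q f) (inv_into (hcarrier L) j' y)))"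
 define V' where "V' = (\<lambda>y\<in>j ` hcarrier H. j' (V (inv_into (hcarrier H) j y)))"
 note H' = hcarrier_hcopy[OF H j] and L' = hcarrier_hcopy[OF L j']
 note HA = hcopy_apply[OF H j] and LA = hcopy_apply[OF L j']
 have q': "q f \<in> cfun X" if "f \<in> cfun K" for f using q that by (simp add: star_hom_def)
 have VL: "V u \<in> hcarrier L" if "u \<in> hcarrier H" for u using V that by (auto simp: hisometry_def hlinear_def)
 have \<pi>cl: "\<pi> (q f) u \<in> hcarrier H" if "f \<in> cfun K" "u \<in> hcarrier H" for f u
  by (rule linear_into_bopsD(2)[OF star_repD(1)[OF H \<pi>] q'[OF that(1)] that(2)])
 have \<rho>cl: "\<rho> (q f) u \<in> hcarrier L" if "f \<in> cfun K" "u \<in> hcarrier L" for f u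
  by (rule linear_into_bopsD(2)[OF star_repD(1)[OF L \<rho>] q'[OF that(1)] that(2)])
 have \<pi>j: "\<pi>' f (j u) = j (\<pi> (q f) u)" if "f \<in> cfun K" "u \<in> hcarrier H" for f u
  using that j by (simp add: \<pi>'_def)
 have \<rho>j: "\<rho>' f (j' u) = j' (\<rho> (q f) u)" if "f \<in> cfun K" "u \<in> hcarrier L" for f u
  using that j' by (simp add: \<rho>'_def)
 have Vj: "V' (j u) = j' (V u)" if "u \<in> hcarrier H" for u using that j by (simp add: V'_def)
 have Vin: "hinner L (V u) (V v) = hinner H u v" if "u \<in> hcarrier H" "v \<in> hcarrier H" for u v
  by (rule hisometry_inner[OF H L V that])
 have rep: "represents K \<mu> \<pi>' (hcopy j H) (j \<xi>)"
  unfolding represents_def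
  using hilbert_space_hcopy[OF H j] star_rep_hcopy[OF H j q \<pi>] \<xi>
  by (simp add: H' \<mu> \<pi>j HA \<pi>cl flip: \<pi>'_def)
 have rep': "represents K \<nu> \<rho>' (hcopy j' L) (j' (V \<xi>))"
  unfolding represents_def
  using hilbert_space_hcopy[OF L j'] star_rep_hcopy[OF L j' q \<rho>] VL[OF \<xi>]
  by (simp add: L' \<nu> \<rho>j LA \<rho>cl flip: \<rho>'_def)
 have iso: "hisometry (hcopy j H) (hcopy j' L) V'"
 proof (rule hisometryI[OF hilbert_space_hcopy[OF H j] hilbert_space_hcopy[OF L j']])
  show "V' \<in> hcarrier (hcopy j H) \<rightarrow>\<^sub>E hcarrier (hcopy j' L)"
   using VL j by (auto simp: V'_def H' L')
  fix x y assume "x \<in> hcarrier (hcopy j H)" "y \<in> hcarrier (hcopy j H)"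
  then obtain u v where "x = j u" "y = j v" "u \<in> hcarrier H" "v \<in> hcarrier H" by (auto simp: H')
  then show "hinner (hcopy j' L) (V' x) (V' y) = hinner (hcopy j H) x y"
   by (simp add: Vj HA LA VL Vin)
 qed
 have "\<pi>' a = (\<lambda>h\<in>hcarrier (hcopy j H). hadjoint (hcopy j H) (hcopy j' L) V' (\<rho>' a (V' h)))"
  if a: "a \<in> affine_cfun I K" for a
 proof (rule extensionalityI[of _ "hcarrier (hcopy j H)"])
  have aK: "a \<in> cfun K" using a by (simp add: affine_cfun_def)
  show "\<pi>' a \<in> extensional (hcarrier (hcopy j H))" using aK by (simp add: \<pi>'_def H')
  fix x assume "x \<in> hcarrier (hcopy j H)"
  then obtain u where u: "x = j u" "u \<in> hcarrier H" by (auto simp: H')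
  have "hadjoint (hcopy j H) (hcopy j' L) V' (\<rho>' a (V' (j u))) = \<pi>' a (j u)"
  proof (rule hadjoint_eqI[OF hilbert_space_hcopy[OF H j]])
   show "\<rho>' a (V' (j u)) \<in> hcarrier (hcopy j' L)" using u aK by (simp add: Vj \<rho>j VL \<rho>cl L')
   show "\<pi>' a (j u) \<in> hcarrier (hcopy j H)" using u aK by (simp add: \<pi>j \<pi>cl H')
   fix y assume "y \<in> hcarrier (hcopy j H)"
   then obtain v where v: "y = j v" "v \<in> hcarrier H" by (auto simp: H')
   have "hinner L (V v) (\<rho> (q a) (V u)) = cnj (hinner L (\<rho> (q a) (V u)) (V v))"
    by (rule hilbert_space.inner_commute[OF L]) (use u v aK VL \<rho>cl in auto)
   also have "\<dots> = hinner H v (\<pi> (q a) u)"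
    unfolding dil[OF a u(2) v(2)]
    by (rule hilbert_space.inner_commute[OF H, symmetric]) (use u v aK \<pi>cl in auto)
   finally show "hinner (hcopy j' L) (V' y) (\<rho>' a (V' (j u))) = hinner (hcopy j H) y (\<pi>' a (j u))"
    using u v aK by (simp add: Vj \<rho>j \<pi>j HA LA VL \<pi>cl \<rho>cl)
  qed
  then show "\<pi>' a x = (\<lambda>h\<in>hcarrier (hcopy j H). hadjoint (hcopy j H) (hcopy j' L) V' (\<rho>' a (V' h))) x"
   using u by (simp add: H')
 qed simp
 then have "dilated_by I K \<pi>' (hcopy j H) (j \<xi>) \<rho>' (hcopy j' L) (j' (V \<xi>))"
  unfolding dilated_by_def using iso Vj[OF \<xi>] by (intro exI[of _ V'] conjI ballI) auto
 with rep rep' show ?thesis unfolding dilation_le_def by blast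
qed

lemma dilated_byD:
 assumes d: "dilated_by I K \<pi> H \<xi> \<sigma> L \<eta>" and H: "hilbert_space H" and \<sigma>: "star_rep K L \<sigma>" and L: "hilbert_space L"
 obtains V where "hisometry H L V" "\<eta> = V \<xi>"
  "!!a u v. a \<in> affine_cfun I K ==> u \<in> hcarrier H ==> v \<in> hcarrier H ==>
   hinner L (\<sigma> a (V u)) (V v) = hinner H (\<pi> a u) v"
proof -
 interpret H: hilbert_space H by fact
 interpret L: hilbert_space L by fact
 obtain V where V: "hisometry H L V" "\<eta> = V \<xi>"
  and eq: "!!a. a \<in> affine_cfun I K ==> \<pi> a = (\<lambda>h\<in>hcarrier H. hadjoint H L V (\<sigma> a (V h)))"
  using d unfolding dilated_by_def by blast
 have VL: "V u \<in> hcarrier L" if "u \<in> hcarrier H" for u using V that by (auto simp: hisometry_def hlinear_def)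
 have lin: "hlinear H L V" and B: "hnorm L (V u) \<le> 1 * hnorm H u" if "u \<in> hcarrier H" for u
  using V that by (auto simp: hisometry_def)
 have "hinner L (\<sigma> a (V u)) (V v) = hinner H (\<pi> a u) v"
  if a: "a \<in> affine_cfun I K" and u: "u \<in> hcarrier H" and v: "v \<in> hcarrier H" for a u v
 proof -
  have s: "\<sigma> a (V u) \<in> hcarrier L"
   using linear_into_bopsD(2)[OF star_repD(1)[OF L \<sigma>]] a VL[OF u] by (simp add: affine_cfun_def)
  have "hinner L (\<sigma> a (V u)) (V v) = cnj (hinner L (V v) (\<sigma> a (V u)))" by (rule L.inner_commute[OF VL[OF v] s])
  also have "\<dots> = cnj (hinner H v (hadjoint H L V (\<sigma> a (V u))))"
   using hadjoint_inner(2)[OF H L lin[OF v] B s v] by simp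
  also have "\<dots> = hinner H (hadjoint H L V (\<sigma> a (V u))) v"
   by (rule H.inner_commute[symmetric]) (rule v, rule hadjoint_inner(1)[OF H L lin[OF v] B s])
  finally show ?thesis using u by (simp add: eq[OF a])
 qed
 with V show thesis by (rule that)
qed

section \<open>Maximal measures have the unique extension property\<close>

lemma integral_pushforward:
 fixes q :: "((('x => complex) => complex) => complex) => 'x => complex"
 assumes X: "compact_space X" and A: "function_system X A" and \<mu>: "\<mu> \<in> pos_regular_measures X"
  and q: "star_hom (state_space X A) X q" "!!a. a \<in> A ==> q (iota X A a) = a"
 defines "\<nu> \<equiv> distr \<mu> (borel_of_top (state_space X A)) (adjoint_point (state_space X A) q)"
 shows "\<nu> = distr \<mu> (borel_of_top (state_space X A)) (point_state A)"
  and "f \<in> cfun (state_space X A) ==> (\<integral>x. f x \<partial>\<nu>) = (\<integral>x. q f x \<partial>\<mu>)"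
proof -
 note \<mu>' = pos_regular_measuresD[OF \<mu>]
 note sp = space_eq_topspace[OF \<mu>'(1)]
 show eq: "\<nu> = distr \<mu> (borel_of_top (state_space X A)) (point_state A)"
  unfolding \<nu>_def using adjoint_point_eq[OF X A q] sp by (intro distr_cong) auto
 assume f: "f \<in> cfun (state_space X A)"
 have m: "point_state A \<in> measurable \<mu> (borel_of_top (state_space X A))"
  by (rule continuous_map_measurable_borel_of_top[OF \<mu>'(1) continuous_map_point_state[OF A]])
 have "f \<in> borel_measurable (borel_of_top (state_space X A))"
  by (rule continuous_map_borel_measurable[OF _ cfun_continuous[OF f]]) simp
 then have "(\<integral>x. f x \<partial>\<nu>) = (\<integral>x. f (point_state A x) \<partial>\<mu>)" unfolding eq by (rule integral_distr[OF m])
 also have "\<dots> = (\<integral>x. q f x \<partial>\<mu>)"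
  using quotient_eval[OF X A q f] sp by (intro Bochner_Integration.integral_cong) auto
 finally show "(\<integral>x. f x \<partial>\<nu>) = (\<integral>x. q f x \<partial>\<mu>)" .
qed

lemma gns_rep_one:
 assumes X: "compact_space X" and \<mu>: "sets \<mu> = sets (borel_of_top X)" "finite_measure \<mu>" and u: "u \<in> hcarrier (L2 \<mu>)"
 shows "gns_rep X \<mu> (cf_one X) u = u"
proof -
 obtain h where h: "h \<in> sq_integrable \<mu>" "u = l2_class \<mu> h" by (rule L2_carrierE[OF u])
 have "l2_class \<mu> (\<lambda>x. cf_one X x * h x) = l2_class \<mu> h"
  by (rule l2_class_cong[OF X \<mu>]) (use h cfun_times_sq_integrable[OF X \<mu> cf_one_in h(1)] in \<open>auto simp: sq_integrable_def\<close>)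
 then show ?thesis using h by (simp add: gns_rep_apply[OF X \<mu>])
qed

lemma norm_l2_class_le:
 assumes X: "compact_space X" and \<mu>: "sets \<mu> = sets (borel_of_top X)" "finite_measure \<mu>"
  and f: "f \<in> cfun X" and B: "B \<ge> 0" "!!x. x \<in> topspace X ==> cmod (f x) \<le> B"
 shows "hnorm (L2 \<mu>) (l2_class \<mu> f) \<le> B * sqrt (measure \<mu> (space \<mu>))"
proof -
 interpret finite_measure \<mu> by fact
 have fs: "f \<in> sq_integrable \<mu>" by (rule cfun_sq_integrable[OF X \<mu> f])
 have "(\<integral>x. (cmod (f x))\<^sup>2 \<partial>\<mu>) \<le> (\<integral>x. B\<^sup>2 \<partial>\<mu>)"
  using fs B space_eq_topspace[OF \<mu>(1)]
  by (intro integral_mono) (auto simp: sq_integrable_def intro!: power_mono)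
 then have "sqrt (\<integral>x. (cmod (f x))\<^sup>2 \<partial>\<mu>) \<le> sqrt (B\<^sup>2 * measure \<mu> (space \<mu>))" by (simp add: mult.commute)
 then show ?thesis using B L2_inner_self[OF fs] by (simp add: hnorm_def real_sqrt_mult)
qed

text \<open>Let \<open>\<rho>\<close> be a Stinespring dilation of \<open>\<Phi>\<close> along \<open>V\<close>. If \<open>\<Phi>(f)1 = [f]\<close>, then \<open>\<rho>(f)V1\<close> and \<open>V[f]\<close> have
 the same norm and an inner product equal to its square, so they agree, and hence
 \<open>\<Phi>(g f)1 = \<Phi>(g)[f]\<close> for every \<open>g\<close>. For \<open>g \<in> A\<close> this is \<open>[g f]\<close>: the functions with
 \<open>\<Phi>(f)1 = [f]\<close> are stable under multiplication by \<open>A\<close>, hence by the algebra that \<open>A\<close> generates.\<close>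

lemma vector_state_determines_extension:
 assumes X: "compact_space X" "Hausdorff_space X" and A: "function_system X A" and gen: "generates_cfun X A"
  and \<mu>: "\<mu> \<in> pos_regular_measures X" and \<Phi>: "linear_into_bops X (L2 \<mu>) \<Phi>"
  and ext: "!!a. a \<in> A ==> \<Phi> a = gns_rep X \<mu> a"
  and L: "hilbert_space L" and \<rho>: "star_rep X L \<rho>" and V: "hisometry (L2 \<mu>) L V"
  and dil: "!!f u v. f \<in> cfun X ==> u \<in> hcarrier (L2 \<mu>) ==> v \<in> hcarrier (L2 \<mu>) ==>
   hinner L (\<rho> f (V u)) (V v) = hinner (L2 \<mu>) (\<Phi> f u) v"
  and state: "!!f. f \<in> cfun X ==>
   hinner (L2 \<mu>) (\<Phi> f (l2_class \<mu> (cf_one X))) (l2_class \<mu> (cf_one X)) = (\<integral>x. f x \<partial>\<mu>)"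
 shows "\<Phi> = gns_rep X \<mu>"
proof -
 note A' = function_systemD[OF A]
 note \<mu>' = pos_regular_measuresD(1,2)[OF \<mu>]
 define H where "H = L2 \<mu>"
 define cl where "cl f = l2_class \<mu> f" for f
 define e where "e = cl (cf_one X)"
 have HH: "hilbert_space H" unfolding H_def by (rule hilbert_space_L2[OF \<mu>'(2)])
 interpret H: hilbert_space H by (rule HH)
 interpret L: hilbert_space L by (rule L)
 note gns = star_rep_gns_rep[OF X(1) \<mu>', folded H_def]
 note gns_lin = linear_into_bopsD[OF star_repD(1)[OF HH gns]]
 note lin = linear_into_bopsD[OF \<Phi>[folded H_def]]
 note \<rho>lin = linear_into_bopsD[OF star_repD(1)[OF L \<rho>]] and \<rho>' = star_repD(2,3)[OF L \<rho>]
 have cl_in: "cl f \<in> hcarrier H" if "f \<in> cfun X" for f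
  unfolding cl_def H_def by (rule l2_class_in[OF cfun_sq_integrable[OF X(1) \<mu>' that]])
 have e: "e \<in> hcarrier H" unfolding e_def by (rule cl_in) simp
 have gcl: "gns_rep X \<mu> g (cl f) = cl (cf_mult X g f)" if "g \<in> cfun X" "f \<in> cfun X" for g f
  unfolding cl_def by (rule gns_rep_cfun[OF X(1) \<mu>' that])
 have one: "cf_mult X f (cf_one X) = f" if "f \<in> cfun X" for f
  by (rule cfun_eqI) (use that in \<open>auto simp: cfun_closed\<close>)
 have gne: "gns_rep X \<mu> f e = cl f" if "f \<in> cfun X" for f
  unfolding e_def gcl[OF that cf_one_in] one[OF that] ..
 have inn: "hinner H (cl f) (cl g) = (\<integral>x. cf_mult X f (cf_star X g) x \<partial>\<mu>)" if "f \<in> cfun X" "g \<in> cfun X" for f g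
  unfolding cl_def H_def by (rule L2_inner_cfun[OF X(1) \<mu>' that])
 have VL: "V u \<in> hcarrier L" if "u \<in> hcarrier H" for u
  using V that unfolding H_def by (auto simp: hisometry_def hlinear_def)
 note dil' = dil[folded H_def]
 note Vin = hisometry_inner[OF HH L V[folded H_def]]
 have \<rho>norm: "hinner L (\<rho> f (V e)) (\<rho> f (V e)) = hinner H (cl f) (cl f)" if f: "f \<in> cfun X" for f
 proof -
  have ff: "cf_mult X (cf_star X f) f \<in> cfun X" using f by (simp add: cfun_closed)
  have "hinner L (\<rho> f (V e)) (\<rho> f (V e)) = hinner L (\<rho> (cf_star X f) (\<rho> f (V e))) (V e)"
   using \<rho>'(2)[OF cf_star_in[OF f] \<rho>lin(2)[OF f VL[OF e]] VL[OF e]] cfun_eqI[of "cf_star X (cf_star X f)" X f] f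
   by (simp add: cfun_closed)
  also have "\<dots> = hinner H (\<Phi> (cf_mult X (cf_star X f) f) e) e"
   using \<rho>'(1)[OF cf_star_in[OF f] f VL[OF e]] dil'[OF ff e e] by simp
  also have "\<dots> = (\<integral>x. cf_mult X (cf_star X f) f x \<partial>\<mu>)"
   using state[OF ff] by (simp add: H_def e_def cl_def)
  also have "cf_mult X (cf_star X f) f = cf_mult X f (cf_star X f)" by (auto simp: cf_mult_def)
  finally show ?thesis by (simp add: inn[OF f f])
 qed
 define B where "B = {f \<in> cfun X. \<Phi> f e = cl f}"
 have B_mult: "\<Phi> (cf_mult X g f) e = \<Phi> g (cl f)" if f: "f \<in> B" and g: "g \<in> cfun X" for f g
 proof -
  have f': "f \<in> cfun X" "\<Phi> f e = cl f" using f by (auto simp: B_def)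
  have in_L: "\<rho> f (V e) \<in> hcarrier L" "V (cl f) \<in> hcarrier L"
   using \<rho>lin(2) VL f' e cl_in by auto
  have 1: "hinner L (\<rho> f (V e)) (V (cl f)) = hinner H (cl f) (cl f)"
   using dil'[OF f'(1) e cl_in[OF f'(1)]] f' by simp
  have 2: "hinner L (V (cl f)) (\<rho> f (V e)) = hinner H (cl f) (cl f)"
   using L.inner_commute[OF in_L] 1 H.inner_commute[OF cl_in cl_in, OF f'(1) f'(1)] by simp
  have eq: "\<rho> f (V e) = V (cl f)"
   by (rule L.eq_if_sub_null[OF in_L])
    (use in_L in \<open>simp add: L.inner_simps \<rho>norm[OF f'(1)] 1 2 Vin[OF cl_in cl_in] f'\<close>)
  show ?thesis
  proof (rule H.eqI_inner)
   show "\<Phi> (cf_mult X g f) e \<in> hcarrier H" "\<Phi> g (cl f) \<in> hcarrier H"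
    using lin(2) f' g e cl_in by (auto simp: cfun_closed)
   fix v assume v: "v \<in> hcarrier H"
   have "hinner H (\<Phi> (cf_mult X g f) e) v = hinner L (\<rho> (cf_mult X g f) (V e)) (V v)"
    using dil'[OF cf_mult_in[OF g f'(1)] e v] by simp
   also have "\<rho> (cf_mult X g f) (V e) = \<rho> g (V (cl f))"
    using \<rho>'(1)[OF g f'(1) VL[OF e]] eq by simp
   also have "hinner L (\<rho> g (V (cl f))) (V v) = hinner H (\<Phi> g (cl f)) v"
    by (rule dil'[OF g cl_in[OF f'(1)] v])
   finally show "hinner H (\<Phi> (cf_mult X g f) e) v = hinner H (\<Phi> g (cl f)) v" .
  qed
 qed
 have B_A: "cf_mult X a f \<in> B" if "a \<in> A" "f \<in> B" for a f
  using B_mult[OF that(2), of a] gcl[of a f] ext[OF that(1)] that A'(1) by (auto simp: B_def cfun_closed)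
 have cl_e: "cl f = gns_rep X \<mu> f e" if "f \<in> cfun X" for f using gne[OF that] by simp
 have B_add: "cf_add X f g \<in> B" if "f \<in> B" "g \<in> B" for f g
  using that e gns_lin(3)[of f g e] lin(3)[of f g e] by (auto simp: B_def cl_e cfun_closed)
 have B_scale: "cf_scale X c f \<in> B" if "f \<in> B" for c f
  using that e gns_lin(4)[of f e c] lin(4)[of f e c] by (auto simp: B_def cl_e cfun_closed)
 have B_closed: "f \<in> B"
  if f: "f \<in> cfun X" and near: "!!r. r > 0 ==> \<exists>g\<in>B. \<forall>x\<in>topspace X. cmod (f x - g x) \<le> r" for f
 proof -
  have "\<Phi> f e = cl f"
  proof (rule H.eqI_inner)
   show c: "\<Phi> f e \<in> hcarrier H" "cl f \<in> hcarrier H" using lin(2) f e cl_in by auto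
   fix v assume v: "v \<in> hcarrier H"
   define M where "M = sqrt (measure \<mu> (space \<mu>)) * hnorm H v"
   have M: "M \<ge> 0" using v by (simp add: M_def)
   have "cmod (hinner H (\<Phi> f e) v - hinner H (cl f) v) \<le> 0 + t" if t: "t > 0" for t
   proof -
    define r where "r = t / (2 * (M + 1))"
    have r: "r > 0" using t M by (simp add: r_def)
    obtain g where g: "g \<in> B" "!!x. x \<in> topspace X ==> cmod (f x - g x) \<le> r" using near[OF r] by blast
    then have g': "g \<in> cfun X" "\<Phi> g e = cl g" by (auto simp: B_def)
    define k where "k = cf_add X f (cf_scale X (-1) g)"
    have k: "k \<in> cfun X" using f g' by (simp add: k_def cfun_closed)
    have f_eq: "f = cf_add X k g"
     by (rule cfun_eqI) (use f g' k in \<open>auto simp: k_def cfun_closed\<close>)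
    have nk: "hnorm H (cl k) * hnorm H v \<le> r * M"
    proof -
     have "hnorm H (cl k) \<le> r * sqrt (measure \<mu> (space \<mu>))"
      unfolding H_def cl_def by (rule norm_l2_class_le[OF X(1) \<mu>' k]) (use r g in \<open>auto simp: k_def\<close>)
     from mult_right_mono[OF this, of "hnorm H v"] v show ?thesis by (simp add: M_def mult.assoc)
    qed
    have \<Phi>k: "\<Phi> k e \<in> hcarrier H" using lin(2)[OF k e] .
    have "hinner H (\<Phi> f e) v - hinner H (cl f) v = hinner H (\<Phi> k e) v - hinner H (cl k) v"
     unfolding f_eq using k g' e v cl_in lin(2)[OF k e] gns_lin(2)[OF k e] lin(3)[OF k g'(1) e] gns_lin(3)[OF k g'(1) e]
     by (simp add: cl_e[OF cf_add_in[OF k g'(1)]] gne H.inner_add)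
    also have "cmod \<dots> \<le> cmod (hinner H (\<Phi> k e) v) + cmod (hinner H (cl k) v)" by (rule norm_triangle_ineq4)
    also have "cmod (hinner H (\<Phi> k e) v) \<le> hnorm L (\<rho> k (V e)) * hnorm L (V v)"
     using L.Cauchy_Schwarz[OF \<rho>lin(2)[OF k VL[OF e]] VL[OF v]] dil'[OF k e v] by simp
    also have "\<dots> = hnorm H (cl k) * hnorm H v" using \<rho>norm[OF k] Vin[OF v v] by (simp add: hnorm_def)
    also have "cmod (hinner H (cl k) v) \<le> hnorm H (cl k) * hnorm H v" by (rule H.Cauchy_Schwarz[OF cl_in[OF k] v])
    finally have "cmod (hinner H (\<Phi> f e) v - hinner H (cl f) v) \<le> 2 * (r * M)" using nk by (simp add: mult.commute[of "hnorm H v"])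
    also have "\<dots> \<le> 2 * (r * (M + 1))" using r by simp
    also have "\<dots> = t" using M by (simp add: r_def field_simps)
    finally show ?thesis by simp
   qed
   then have "cmod (hinner H (\<Phi> f e) v - hinner H (cl f) v) \<le> 0" by (rule field_le_epsilon)
   then show "hinner H (\<Phi> f e) v = hinner H (cl f) v" by simp
  qed
  then show ?thesis using f by (simp add: B_def)
 qed
 define C where "C = {f \<in> cfun X. \<forall>g\<in>B. cf_mult X f g \<in> B \<and> cf_mult X (cf_star X f) g \<in> B}"
 have BX: "f \<in> cfun X" if "f \<in> B" for f using that by (simp add: B_def)
 have C: "cstar_subalgebra X C"
  unfolding cstar_subalgebra_def
 proof (intro conjI ballI allI)
  show "C \<subseteq> cfun X" by (auto simp: C_def)
  fix f assume "f \<in> C"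
  then have f: "f \<in> cfun X" "!!g. g \<in> B ==> cf_mult X f g \<in> B" "!!g. g \<in> B ==> cf_mult X (cf_star X f) g \<in> B"
   by (auto simp: C_def)
  have ss: "cf_star X (cf_star X f) = f" by (rule cfun_eqI) (use f in \<open>auto simp: cfun_closed\<close>)
  show "cf_star X f \<in> C" using f by (simp add: C_def ss cfun_closed)
  have s: "cf_mult X (cf_scale X c f) g = cf_scale X c (cf_mult X f g)"
   "cf_mult X (cf_star X (cf_scale X c f)) g = cf_scale X (cnj c) (cf_mult X (cf_star X f) g)" for c g
   by (auto simp: cf_mult_def cf_scale_def cf_star_def)
  show "cf_scale X c f \<in> C" for c using f B_scale by (simp add: C_def s cfun_closed)
  fix f' assume "f' \<in> C"
  then have f': "f' \<in> cfun X" "!!g. g \<in> B ==> cf_mult X f' g \<in> B" "!!g. g \<in> B ==> cf_mult X (cf_star X f') g \<in> B"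
   by (auto simp: C_def)
  have "cf_mult X (cf_add X f f') g = cf_add X (cf_mult X f g) (cf_mult X f' g)"
   "cf_mult X (cf_star X (cf_add X f f')) g = cf_add X (cf_mult X (cf_star X f) g) (cf_mult X (cf_star X f') g)" for g
   by (auto simp: cf_mult_def cf_add_def cf_star_def algebra_simps)
  then show "cf_add X f f' \<in> C" using f f' B_add by (simp add: C_def cfun_closed)
  have "cf_mult X (cf_mult X f f') g = cf_mult X f (cf_mult X f' g)"
   "cf_mult X (cf_star X (cf_mult X f f')) g = cf_mult X (cf_star X f) (cf_mult X (cf_star X f') g)" for g
   by (auto simp: cf_mult_def cf_star_def algebra_simps)
  then show "cf_mult X f f' \<in> C" using f f' by (simp add: C_def cfun_closed)
 next
  show "C \<noteq> {}"
  proof -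
   have "cf_mult X (cf_star X (cf_one X)) g = g" "cf_mult X (cf_one X) g = g" if "g \<in> B" for g
    using BX[OF that] by (auto intro!: cfun_eqI simp: cfun_closed)
   then have "cf_one X \<in> C" by (simp add: C_def)
   then show ?thesis by blast
  qed
  show "norm_closed X C"
   unfolding norm_closed_iff[OF X(1)]
  proof (intro conjI ballI impI)
   show "C \<subseteq> cfun X" by (auto simp: C_def)
   fix f assume f: "f \<in> cfun X" and near: "\<forall>r>0. \<exists>h\<in>C. \<forall>x\<in>topspace X. cmod (f x - h x) \<le> r"
   have "cf_mult X f g \<in> B \<and> cf_mult X (cf_star X f) g \<in> B" if g: "g \<in> B" for g
   proof -
    obtain G where G: "G \<ge> 0" "!!x. x \<in> topspace X ==> cmod (g x) \<le> G"
     by (rule cfun_bounded[OF X(1) BX[OF g]]) (rule that)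
    have ap: "\<exists>h\<in>C. \<forall>x\<in>topspace X. cmod (f x - h x) * cmod (g x) \<le> r" if r: "r > 0" for r
    proof -
     have "r / (G + 1) > 0" using r G by simp
     then obtain h where h: "h \<in> C" "!!x. x \<in> topspace X ==> cmod (f x - h x) \<le> r / (G + 1)" using near by blast
     have "cmod (f x - h x) * cmod (g x) \<le> r" if x: "x \<in> topspace X" for x
     proof -
      have "cmod (f x - h x) * cmod (g x) \<le> r / (G + 1) * (G + 1)"
       by (rule mult_mono) (use h(2)[OF x] G(2)[OF x] r G(1) in auto)
      then show ?thesis using G(1) by simp
     qed
     then show ?thesis using h(1) by blast
    qed
    have "cf_mult X f g \<in> B"
    proof (rule B_closed)
     fix r :: real assume "r > 0"
     from ap[OF this] obtain h where h: "h \<in> C" "!!x. x \<in> topspace X ==> cmod (f x - h x) * cmod (g x) \<le> r" by blast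
     have "cf_mult X h g \<in> B" using h(1) g by (simp add: C_def)
     moreover have "cmod (cf_mult X f g x - cf_mult X h g x) \<le> r" if "x \<in> topspace X" for x
      using h(2)[OF that] that by (simp flip: left_diff_distrib add: norm_mult)
     ultimately show "\<exists>k\<in>B. \<forall>x\<in>topspace X. cmod (cf_mult X f g x - k x) \<le> r" by blast
    qed (use f BX[OF g] in \<open>simp add: cfun_closed\<close>)
    moreover have "cf_mult X (cf_star X f) g \<in> B"
    proof (rule B_closed)
     fix r :: real assume "r > 0"
     from ap[OF this] obtain h where h: "h \<in> C" "!!x. x \<in> topspace X ==> cmod (f x - h x) * cmod (g x) \<le> r" by blast
     have "cf_mult X (cf_star X h) g \<in> B" using h(1) g by (simp add: C_def)
     moreover have "cmod (cf_mult X (cf_star X f) g x - cf_mult X (cf_star X h) g x) \<le> r" if "x \<in> topspace X" for x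
      using h(2)[OF that] that complex_mod_cnj[of "f x - h x"]
      by (simp flip: left_diff_distrib add: norm_mult)
     ultimately show "\<exists>k\<in>B. \<forall>x\<in>topspace X. cmod (cf_mult X (cf_star X f) g x - k x) \<le> r" by blast
    qed (use f BX[OF g] in \<open>simp add: cfun_closed\<close>)
    ultimately show ?thesis ..
   qed
   then show "f \<in> C" using f by (simp add: C_def)
  qed
 qed
 have "A \<subseteq> C" using A'(1,5) B_A by (auto simp: C_def)
 then have "cfun X \<subseteq> C" using gen C unfolding generates_cfun_def by blast
 moreover have "cf_one X \<in> B"
  using B_def e gne[OF cf_one_in] ext[OF A'(2)] by simp
 ultimately have all: "f \<in> B" if "f \<in> cfun X" for f
  using that one[OF that] by (auto simp: C_def subset_eq) metis
 show ?thesis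
 proof (rule extensionalityI[of _ "cfun X"])
  show "\<Phi> \<in> extensional (cfun X)" "gns_rep X \<mu> \<in> extensional (cfun X)"
   using \<Phi> by (auto simp: linear_into_bops_def gns_rep_def PiE_def)
  fix g assume g: "g \<in> cfun X"
  show "\<Phi> g = gns_rep X \<mu> g"
  proof (rule H.bops_eq_on_dense[OF lin(1)[OF g] gns_lin(1)[OF g]])
   show "l2_class \<mu> ` cfun X \<subseteq> hcarrier H" using cl_in by (auto simp: cl_def)
   show "\<exists>v\<in>l2_class \<mu> ` cfun X. hdist H v u < r" if "u \<in> hcarrier H" "r > 0" for u r
    using cfun_dense_L2[OF X \<mu>] that unfolding H_def by blast
   fix u assume "u \<in> l2_class \<mu> ` cfun X"
   then obtain f where f: "f \<in> cfun X" "u = cl f" by (auto simp: cl_def)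
   have "\<Phi> g (cl f) = \<Phi> (cf_mult X g f) e" using B_mult[OF all[OF f(1)] g] by simp
   also have "\<dots> = cl (cf_mult X g f)" using all[OF cf_mult_in[OF g f(1)]] by (simp add: B_def)
   finally show "\<Phi> g u = gns_rep X \<mu> g u" by (simp add: f(2) gcl[OF g f(1)])
  qed
 qed
qed


text \<open>Injections into the universe. Points of \<open>L\<^sup>2(\<mu>)\<close> are sets of functions
 on \<open>X\<close>, and vectors of the Stinespring space are functions on pairs of such a function and such a set.\<close>

lemma inj_universe_L2: "inj (\<lambda>S :: 'g set. Inl ((\<lambda>g k. k g) ` S) :: (('g => complex), 'u) hilbert_universe)"
proof -
 have "inj (\<lambda>(g :: 'g) k. k g :: complex)"
 proof (rule injI)
  fix g h :: 'g assume "(\<lambda>k. k g :: complex) = (\<lambda>k. k h)"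
  from fun_cong[OF this, of "\<lambda>y. if y = g then 1 else 0"] show "g = h" by (simp split: if_splits)
 qed
 then show ?thesis by (intro injI) (simp add: inj_image_eq_iff)
qed

lemma inj_universe_dilation:
 obtains j :: "('g \<times> 'g set => complex) => (('g => complex), 'u) hilbert_universe" where "inj j"
proof
 define J :: "'g \<times> 'g set => 'g => complex" where "J p y = Complex (of_bool (y \<in> snd p)) (of_bool (y = fst p))" for p y
 have J: "inj J"
 proof (rule injI)
  fix p p' assume eq: "J p = J p'"
  have "y \<in> snd p \<longleftrightarrow> y \<in> snd p'" "y = fst p \<longleftrightarrow> y = fst p'" for y
   using fun_cong[OF eq, of y] by (auto simp: J_def of_bool_def split: if_splits)
  then show "p = p'" by (metis prod_eqI subset_antisym subsetI)
 qed
 show "inj (\<lambda>\<phi>. Inl {\<lambda>k. \<phi> (inv J k)} :: (('g => complex), 'u) hilbert_universe)"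
 proof (rule injI)
  fix \<phi> \<psi> :: "'g \<times> 'g set => complex"
  assume "(Inl {\<lambda>k. \<phi> (inv J k)} :: (('g => complex), 'u) hilbert_universe) = Inl {\<lambda>k. \<psi> (inv J k)}"
  then have "(\<lambda>k. \<phi> (inv J k)) = (\<lambda>k. \<psi> (inv J k))" by simp
  from fun_cong[OF this] have "\<phi> (inv J (J p)) = \<psi> (inv J (J p))" for p .
  then show "\<phi> = \<psi>" by (simp add: inv_f_f[OF J] fun_eq_iff)
 qed
qed

text \<open>A completely positive extension \<open>\<Phi>\<close> of \<open>\<pi>\<^sub>\<mu>\<close> dilates to a representation of \<open>C(X)\<close>, which
 exhibits the measure on \<open>K\<close> representing \<open>f \<mapsto> \<langle>\<Phi>(q f)1, 1\<rangle>\<close> as larger in the dilation order.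
 By maximality the vector state of \<open>\<Phi>\<close> at \<open>1\<close> is integration against \<open>\<mu>\<close>.\<close>

theorem maximal_imp_unique_extension:
 fixes X :: "'x topology" and q :: "((('x => complex) => complex) => complex) => 'x => complex"
 assumes X: "compact_space X" "Hausdorff_space X" and A: "function_system X A" and gen: "generates_cfun X A"
  and \<mu>: "\<mu> \<in> pos_regular_measures X"
  and q: "star_hom (state_space X A) X q" "!!a. a \<in> A ==> q (iota X A a) = a"
  and max: "dilation_maximal TYPE((('x => complex) => complex, 'u) hilbert_universe) A (state_space X A)
   (distr \<mu> (borel_of_top (state_space X A)) (adjoint_point (state_space X A) q))"
 shows "unique_extension_property X A (L2 \<mu>) (gns_rep X \<mu>)"
proof -
 note A' = function_systemD[OF A] and \<mu>' = pos_regular_measuresD(1,2)[OF \<mu>]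
 let ?K = "state_space X A" and ?e = "l2_class \<mu> (cf_one X)" and ?H = "L2 \<mu>"
 let ?\<nu> = "distr \<mu> (borel_of_top ?K) (adjoint_point ?K q)"
 note K = compact_state_space[OF X(1) A] Hausdorff_state_space[of X A]
 have H: "hilbert_space ?H" by (rule hilbert_space_L2[OF \<mu>'(2)])
 note gns = star_rep_gns_rep[OF X(1) \<mu>']
 have e: "?e \<in> hcarrier ?H" by (rule l2_class_in[OF cfun_sq_integrable[OF X(1) \<mu>' cf_one_in]])
 have q': "q f \<in> cfun X" if "f \<in> cfun ?K" for f using q(1) that by (simp add: star_hom_def)
 have unique: "\<Phi> = gns_rep X \<mu>" if \<Phi>: "completely_positive X ?H \<Phi>" and ext: "!!a. a \<in> A ==> \<Phi> a = gns_rep X \<mu> a" for \<Phi>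
 proof -
  have lin: "linear_into_bops X ?H \<Phi>" using \<Phi> by (simp add: completely_positive_def)
  obtain L :: "(('x => complex) \<times> ('x => complex) set => complex) hspace" and \<rho> V
   where L: "hilbert_space L" and \<rho>: "star_rep X L \<rho>" and V: "hisometry ?H L V"
    and dil: "!!f u v. f \<in> cfun X ==> u \<in> hcarrier ?H ==> v \<in> hcarrier ?H ==> hinner L (\<rho> f (V u)) (V v) = hinner ?H (\<Phi> f u) v"
  proof (rule Stinespring[OF X(1) H \<Phi>])
   show "\<Phi> (cf_one X) u = u" if "u \<in> hcarrier ?H" for u
    using ext[OF A'(2)] gns_rep_one[OF X(1) \<mu>' that] by simp
  qed (rule that)
  have \<rho>cl: "\<rho> f (V u) \<in> hcarrier L" if "f \<in> cfun X" "u \<in> hcarrier ?H" for f u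
   using linear_into_bopsD(2)[OF star_repD(1)[OF L \<rho>] that(1)] V that(2) by (auto simp: hisometry_def hlinear_def)
  define \<phi> where "\<phi> f = hinner ?H (\<Phi> (q f) ?e) ?e" for f
  have vec: "positive_functional X (cfun X) (\<lambda>F. hinner ?H (\<Psi> F u) u)"
   if "completely_positive X ?H \<Psi>" "u \<in> hcarrier ?H" for \<Psi> u
   by (rule completely_positive_vector_functional[OF H that])
  have "positive_functional ?K (cfun ?K) \<phi>"
   using q(1) quotient_eval[OF X(1) A q] point_state_in_states[OF A] positive_functionalD[OF vec[OF \<Phi> e]]
   by (simp add: positive_functional_def \<phi>_def star_hom_def)
  then obtain \<nu> where \<nu>: "\<nu> \<in> pos_regular_measures ?K" and \<nu>\<phi>: "!!f. f \<in> cfun ?K ==> (\<integral>x. f x \<partial>\<nu>) = \<phi> f"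
   by (rule Riesz_representation_measure[OF K]) (rule that)
  obtain j' :: "(('x => complex) \<times> ('x => complex) set => complex) => (('x => complex) => complex, 'u) hilbert_universe"
   where j': "inj j'" by (rule inj_universe_dilation) (rule that)
  have "dilation_le TYPE((('x => complex) => complex, 'u) hilbert_universe) A ?K ?\<nu> \<nu>"
  proof (rule dilation_leI[OF q(1) H L inj_on_subset[OF inj_universe_L2 subset_UNIV] inj_on_subset[OF j' subset_UNIV] gns \<rho> V e])
   fix f assume f: "f \<in> cfun ?K"
   have "gns_rep X \<mu> (q f) ?e = l2_class \<mu> (q f)"
    unfolding gns_rep_cfun[OF X(1) \<mu>' q'[OF f] cf_one_in]
    by (rule arg_cong[where f = "l2_class \<mu>"], rule cfun_eqI) (use q'[OF f] in \<open>auto simp: cfun_closed\<close>)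
   then have "hinner ?H (gns_rep X \<mu> (q f) ?e) ?e = (\<integral>x. cf_mult X (q f) (cf_star X (cf_one X)) x \<partial>\<mu>)"
    by (simp add: L2_inner_cfun[OF X(1) \<mu>' q'[OF f] cf_one_in])
   also have "cf_mult X (q f) (cf_star X (cf_one X)) = q f"
    by (rule cfun_eqI) (use q'[OF f] in \<open>auto simp: cfun_closed\<close>)
   finally show "(\<integral>x. f x \<partial>?\<nu>) = hinner ?H (gns_rep X \<mu> (q f) ?e) ?e"
    using integral_pushforward(2)[OF X(1) A \<mu> q f] by simp
   show "(\<integral>x. f x \<partial>\<nu>) = hinner L (\<rho> (q f) (V ?e)) (V ?e)"
    using \<nu>\<phi>[OF f] dil[OF q'[OF f] e e] by (simp add: \<phi>_def)
  next
   fix a u v assume a: "a \<in> affine_cfun A ?K" and uv: "u \<in> hcarrier ?H" "v \<in> hcarrier ?H"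
   have aK: "a \<in> cfun ?K" using a by (simp add: affine_cfun_def)
   have qa: "q a = (\<lambda>x\<in>topspace X. a (point_state A x))"
    by (rule extensionalityI[of _ "topspace X"])
     (use q'[OF aK] quotient_eval[OF X(1) A q aK] in \<open>auto simp: cfun_def\<close>)
   have op: "hlinear ?H ?H (\<Phi> (q a))" "hlinear ?H ?H (gns_rep X \<mu> (q a))"
    using linear_into_bopsD(1)[OF lin q'[OF aK]] linear_into_bopsD(1)[OF star_repD(1)[OF H gns] q'[OF aK]]
    by (simp_all add: bops_def)
   have "hinner ?H (\<Phi> (q a) w) w = hinner ?H (gns_rep X \<mu> (q a) w) w" if w: "w \<in> hcarrier ?H" for w
    unfolding qa
    by (rule affine_determined_on_system[OF X(1) A a vec[OF \<Phi> w] vec[OF star_rep_completely_positive[OF H gns] w]])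
     (simp add: ext)
   then have "hinner ?H (\<Phi> (q a) u) v = hinner ?H (gns_rep X \<mu> (q a) u) v"
    by (rule hilbert_space.polarization[OF H op _ uv])
   then show "hinner L (\<rho> (q a) (V u)) (V v) = hinner ?H (gns_rep X \<mu> (q a) u) v"
    using dil[OF q'[OF aK] uv] by simp
  qed
  then have \<nu>_eq: "\<nu> = ?\<nu>" using max \<nu> unfolding dilation_maximal_def by blast
  show ?thesis
  proof (rule vector_state_determines_extension[OF X A gen \<mu> lin ext L \<rho> V dil])
   fix F assume F: "F \<in> cfun X"
   obtain f where f: "f \<in> cfun ?K" "!!x. x \<in> topspace X ==> f (point_state A x) = F x"
    by (rule cfun_extend_along_embedding[OF X(1) K continuous_map_point_state[OF A] inj_on_point_state[OF X A gen] F]) (rule that)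
   have "q f = F"
    by (rule cfun_eqI) (use q'[OF f(1)] F quotient_eval[OF X(1) A q f(1)] f(2) in auto)
   then show "hinner ?H (\<Phi> F ?e) ?e = (\<integral>x. F x \<partial>\<mu>)"
    using \<nu>\<phi>[OF f(1)] integral_pushforward(2)[OF X(1) A \<mu> q f(1)] by (simp add: \<nu>_eq \<phi>_def)
  qed
 qed
 show ?thesis
  unfolding unique_extension_property_def
  by (rule ex1I[of _ "gns_rep X \<mu>"]) (use star_rep_completely_positive[OF H gns] unique in auto)
qed

section \<open>Approximation of states\<close>

text \<open>States of \<open>A\<close> are limits of restrictions of states \<open>m\<close> of \<open>C(X)\<close>. Let \<open>m\<close> nearly minimise the
 distance \<open>\<Sum>\<^sub>a \<bar>v\<^sub>a\<bar>\<^sup>2\<close>, \<open>v\<^sub>a = m(a) - \<alpha>(a)\<close>, on finitely many \<open>a\<close>. Moving \<open>m\<close> towards the evaluation at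
 any point cannot decrease it much, so that \<open>b = \<Sum> v\<^sub>a\<^sup>* a\<close> has real part at least \<open>Re m(b)\<close> up to a
 small error; applying \<open>\<alpha>\<close> gives \<open>Re \<alpha>(b) \<ge> Re m(b)\<close> up to this error, where
 \<open>m(b) - \<alpha>(b)\<close> is the squared distance itself.\<close>

lemma state_approximation:
 assumes X: "compact_space X" and A: "function_system X A" and \<alpha>: "\<alpha> \<in> states X A"
  and F: "finite F" "F \<subseteq> A" and e: "e > 0"
 obtains m where "positive_functional X (cfun X) m" "m (cf_one X) = 1" "!!a. a \<in> F ==> cmod (m a - \<alpha> a) \<le> e"
proof -
 note A' = function_systemD[OF A]
 have pf: "positive_functional X A \<alpha>" and unit: "\<alpha> (cf_one X) = 1" using \<alpha> by (auto simp: states_iff)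
 note pf' = positive_functionalD[OF pf]
 define P where "P = {m. positive_functional X (cfun X) m \<and> m (cf_one X) = 1}"
 define d where "d m = (\<Sum>a\<in>F. (cmod (m a - \<alpha> a))\<^sup>2)" for m
 have ev: "(\<lambda>f. f x) \<in> P" if "x \<in> topspace X" for x using that by (auto simp: P_def positive_functional_def)
 obtain x0 where x0: "x0 \<in> topspace X"
 proof (cases "topspace X = {}")
  case True
  then have "cf_one X = cf_scale X 0 (cf_one X)" by (auto simp: cf_one_def cf_scale_def)
  then show ?thesis using pf'(2)[OF A'(2), of 0] unit by simp
 qed blast
 have bdd: "bdd_below (d ` P)" by (rule bdd_belowI[of _ 0]) (auto simp: d_def sum_nonneg)
 define \<delta> where "\<delta> = Inf (d ` P)"
 have lower: "\<delta> \<le> d m" if "m \<in> P" for m unfolding \<delta>_def by (rule cInf_lower[OF imageI[OF that] bdd])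
 have "\<forall>a\<in>F. \<exists>B. \<forall>m\<in>P. cmod (m a) \<le> B"
 proof
  fix a assume "a \<in> F"
  then have aX: "a \<in> cfun X" using F(2) A'(1) by blast
  obtain B where B: "!!x. x \<in> topspace X ==> cmod (a x) \<le> B" by (rule cfun_bounded[OF X aX]) (rule that)
  have "cmod (m a) \<le> B" if "m \<in> P" for m
   using positive_functional_norm_le[OF X function_system_cfun[OF X] _ aX B, of m] that by (simp add: P_def)
  then show "\<exists>B. \<forall>m\<in>P. cmod (m a) \<le> B" by blast
 qed
 from bchoice[OF this] obtain B where B: "\<forall>a\<in>F. \<forall>m\<in>P. cmod (m a) \<le> B a" by (rule exE)
 define C where "C = (\<Sum>a\<in>F. (2 * B a)\<^sup>2)"
 have C: "C \<ge> 0" by (auto simp: C_def intro: sum_nonneg)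
 \<comment> \<open>the step by which \<open>m\<close> is moved; the defect \<open>t\<^sup>2\<close> of \<open>m\<close> and the quadratic term then cost \<open>t (1 + C) / 2\<close>\<close>
 define t where "t = min 1 (2 * e\<^sup>2 / (1 + C))"
 have t: "t > 0" "t \<le> 1" using e C by (auto simp: t_def)
 have te: "t * (1 + C) / 2 \<le> e\<^sup>2"
 proof -
  have "t * (1 + C) \<le> 2 * e\<^sup>2 / (1 + C) * (1 + C)" using C by (intro mult_right_mono) (auto simp: t_def)
  then show ?thesis using C by simp
 qed
 have "Inf (d ` P) < \<delta> + t\<^sup>2" using t by (simp add: \<delta>_def)
 then obtain m where m: "m \<in> P" "d m < \<delta> + t\<^sup>2" using cInf_lessD[of "d ` P"] ev[OF x0] by blast
 define v where "v a = m a - \<alpha> a" for a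
 have expand: "(cmod (p + of_real t * w))\<^sup>2 = (cmod p)\<^sup>2 + 2 * t * Re (cnj p * w) + t\<^sup>2 * (cmod w)\<^sup>2" for p w
  unfolding cmod_power2 by (simp add: power2_eq_square algebra_simps)
 have step: "(\<Sum>a\<in>F. Re (cnj (v a) * (a x - m a))) \<ge> - (t * (1 + C) / 2)" if x: "x \<in> topspace X" for x
 proof -
  define m' where "m' f = of_real (1 - t) * m f + of_real t * f x" for f :: "'a => complex"
  have mix: "t * r \<le> r + t * r'" if "0 \<le> r" "0 \<le> r'" for r r' :: real
   using mult_left_le_one_le[of r t] mult_nonneg_nonneg[of t r'] that t by linarith
  have "m' \<in> P"
   using m(1) x t by (auto simp: P_def positive_functional_def m'_def algebra_simps complex_nonneg_Reals_iff intro!: mix)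
  then have "\<delta> \<le> d m'" by (rule lower)
  also have "d m' \<le> (\<Sum>a\<in>F. (cmod (v a))\<^sup>2 + 2 * t * Re (cnj (v a) * (a x - m a)) + t\<^sup>2 * (2 * B a)\<^sup>2)"
   unfolding d_def
  proof (rule sum_mono)
   fix a assume a: "a \<in> F"
   let ?w = "a x - m a"
   have "cmod ?w \<le> cmod (a x) + cmod (m a)" by (rule norm_triangle_ineq4)
   moreover have "cmod (a x) \<le> B a" by (rule bspec[OF bspec[OF B a] ev[OF x]])
   moreover have "cmod (m a) \<le> B a" by (rule bspec[OF bspec[OF B a] m(1)])
   ultimately have "cmod ?w \<le> 2 * B a" by simp
   then have w: "(cmod ?w)\<^sup>2 \<le> (2 * B a)\<^sup>2" by (intro power_mono) auto
   have "m' a - \<alpha> a = v a + of_real t * ?w" by (simp add: m'_def v_def algebra_simps)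
   then have "(cmod (m' a - \<alpha> a))\<^sup>2 = (cmod (v a))\<^sup>2 + 2 * t * Re (cnj (v a) * ?w) + t\<^sup>2 * (cmod ?w)\<^sup>2"
    by (simp only: expand)
   also have "\<dots> \<le> (cmod (v a))\<^sup>2 + 2 * t * Re (cnj (v a) * ?w) + t\<^sup>2 * (2 * B a)\<^sup>2"
    using w by (intro add_left_mono mult_left_mono) auto
   finally show "(cmod (m' a - \<alpha> a))\<^sup>2 \<le> \<dots>" .
  qed
  also have "\<dots> = d m + 2 * t * (\<Sum>a\<in>F. Re (cnj (v a) * (a x - m a))) + t\<^sup>2 * C"
   by (simp add: sum.distrib sum_distrib_left d_def v_def C_def)
  finally have "0 \<le> t * (t * (1 + C) + 2 * (\<Sum>a\<in>F. Re (cnj (v a) * (a x - m a))))"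
   using m(2) by (simp add: power2_eq_square algebra_simps)
  then show ?thesis using t(1) by (simp add: zero_le_mult_iff)
 qed
 define b where "b J = (\<lambda>x\<in>topspace X. \<Sum>a\<in>J. cnj (v a) * a x)" for J
 have b: "b J \<in> A \<and> \<alpha> (b J) = (\<Sum>a\<in>J. cnj (v a) * \<alpha> a)" if "finite J" "J \<subseteq> F" for J
  using that
 proof (induction J)
  case empty
  have "b {} = cf_scale X 0 (cf_one X)" by (auto simp: b_def cf_scale_def)
  then show ?case using A'(2,4) pf'(2) by simp
 next
  case (insert a J)
  have "b (insert a J) = cf_add X (cf_scale X (cnj (v a)) a) (b J)"
   using insert by (auto simp: b_def cf_add_def cf_scale_def)
  then show ?case using insert F(2) A'(3,4) pf'(1,2) by (simp add: subset_eq)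
 qed
 define s where "s = (\<Sum>a\<in>F. Re (cnj (v a) * m a)) - t * (1 + C) / 2"
 have s1: "cf_scale X (of_real s) (cf_one X) \<in> A" "\<alpha> (cf_scale X (of_real s) (cf_one X)) = of_real s"
  using A'(2,4) pf'(2) unit by auto
 have "Re (\<alpha> (cf_scale X (of_real s) (cf_one X))) \<le> Re (\<alpha> (b F))"
 proof (rule positive_functional_Re_mono[OF X A pf s1(1)])
  show "b F \<in> A" using b[OF F(1)] by blast
  show "Re (cf_scale X (of_real s) (cf_one X) x) \<le> Re (b F x)" if x: "x \<in> topspace X" for x
   using step[OF x] x by (simp add: b_def s_def sum_subtractf right_diff_distrib)
 qed
 then have "s \<le> (\<Sum>a\<in>F. Re (cnj (v a) * \<alpha> a))" using b[OF F(1)] s1(2) by simp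
 then have "(\<Sum>a\<in>F. Re (cnj (v a) * m a) - Re (cnj (v a) * \<alpha> a)) \<le> t * (1 + C) / 2"
  by (simp add: s_def sum_subtractf)
 also have "(\<Sum>a\<in>F. Re (cnj (v a) * m a) - Re (cnj (v a) * \<alpha> a)) = d m"
  unfolding d_def v_def cmod_power2 by (intro sum.cong refl) (simp add: power2_eq_square algebra_simps)
 finally have dm: "d m \<le> e\<^sup>2" using te by simp
 have "cmod (m a - \<alpha> a) \<le> e" if a: "a \<in> F" for a
 proof -
  have "(cmod (m a - \<alpha> a))\<^sup>2 \<le> d m" unfolding d_def by (rule member_le_sum[OF a]) (use F in auto)
  then have "(cmod (m a - \<alpha> a))\<^sup>2 \<le> e\<^sup>2" using dm by simp
  then show ?thesis by (rule power2_le_imp_le) (use e in simp)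
 qed
 with m(1) show thesis by (intro that[of m]) (auto simp: P_def)
qed

section \<open>The Stone--Weierstrass theorem on the state space\<close>

text \<open>A copy of the function type, whose product topology is Hausdorff as a type class instance.\<close>

typedef 'i family = "UNIV :: ('i => complex) set" morphisms member family by simp

instantiation family :: (type) t2_space
begin

definition open_family :: "'a family set => bool" where
 "open_family U \<longleftrightarrow> open (family -` U)"

instance
proof
 show "open (UNIV :: 'a family set)" by (simp add: open_family_def)
 show "open (S \<inter> T)" if "open S" "open T" for S T :: "'a family set"
  using that by (simp add: open_family_def open_Int)
 show "open (\<Union>\<K>)" if "\<forall>S\<in>\<K>. open S" for \<K> :: "'a family set set"
  using that by (simp add: open_family_def vimage_Union open_UN)
 fix x y :: "'a family" assume "x \<noteq> y"
 then obtain i where "member x i \<noteq> member y i" by (metis ext member_inject)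
 then obtain U V where UV: "open U" "open V" "member x i \<in> U" "member y i \<in> V" "U \<inter> V = {}"
  using hausdorff by metis
 have ev: "open ((\<lambda>f :: 'a => complex. f i) -` U)" if "open U" for U
  by (rule open_vimage[OF that]) (rule continuous_on_product_coordinates)
 have "open (member -` ((\<lambda>f. f i) -` U) :: 'a family set)" if "open U" for U
  using ev[OF that] by (simp add: open_family_def vimage_def family_inverse)
 then show "\<exists>U V. open U \<and> open V \<and> x \<in> U \<and> y \<in> V \<and> U \<inter> V = {}"
  using UV by (intro exI[of _ "member -` ((\<lambda>f. f i) -` U)"] exI[of _ "member -` ((\<lambda>f. f i) -` V)"]) auto
qed

end

lemma continuous_on_family: "continuous_on S family" "continuous_on T member"
proof -
 have "continuous_on UNIV family" by (rule continuous_on_open_vimage[THEN iffD2]) (auto simp: open_family_def)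
 then show "continuous_on S family" by (rule continuous_on_subset) simp
 have "continuous_on UNIV member"
  by (rule continuous_on_open_vimage[THEN iffD2]) (auto simp: open_family_def vimage_def family_inverse)
 then show "continuous_on T member" by (rule continuous_on_subset) simp
qed

lemma Stone_Weierstrass_fun:
 fixes S :: "('i => complex) set" and P :: "(('i => complex) => real) => bool"
 assumes S: "compact S" and const: "!!c. P (\<lambda>x. c)" and cont: "!!f. P f ==> continuous_on S f"
  and add: "!!f g. P f ==> P g ==> P (\<lambda>x. f x + g x)" and mult: "!!f g. P f ==> P g ==> P (\<lambda>x. f x * g x)"
  and sep: "!!x y. x \<in> S ==> y \<in> S ==> x \<noteq> y ==> \<exists>f. P f \<and> f x \<noteq> f y"
  and f: "continuous_on S f" and e: "e > 0"
 shows "\<exists>g. P g \<and> (\<forall>x\<in>S. \<bar>f x - g x\<bar> < e)"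
proof -
 have m: "member z \<in> S" "family (member z) = z" if "z \<in> family ` S" for z using that by (auto simp: family_inverse member_inverse)
 have pull: "continuous_on (family ` S) (\<lambda>z. h (member z))" if "continuous_on S h" for h :: "('i => complex) => real"
  by (rule continuous_on_compose2[OF that continuous_on_family(2)]) (use m in auto)
 have "\<exists>g. P (g \<circ> family) \<and> (\<forall>z\<in>family ` S. \<bar>(f \<circ> member) z - g z\<bar> < e)"
 proof (rule Stone_Weierstrass_HOL)
  show "compact (family ` S)" by (rule compact_continuous_image[OF continuous_on_family(1) S])
  show "continuous_on (family ` S) g" if "P (g \<circ> family)" for g
   using pull[OF cont[OF that]] by (rule continuous_on_eq) (use m in simp)
  show "continuous_on (family ` S) (f \<circ> member)" using pull[OF f] by (simp add: o_def)
  fix z w assume "z \<in> family ` S \<and> w \<in> family ` S \<and> z \<noteq> w"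
  then obtain h where "P h" "h (member z) \<noteq> h (member w)" using sep m by metis
  then show "\<exists>g. P (g \<circ> family) \<and> g z \<noteq> g w"
   by (intro exI[of _ "h \<circ> member"]) (simp add: o_def family_inverse)
 qed (use const add mult e in \<open>auto simp: o_def\<close>)
 then obtain g where "P (g \<circ> family)" "\<forall>z\<in>family ` S. \<bar>(f \<circ> member) z - g z\<bar> < e" by blast
 then show ?thesis by (intro exI[of _ "g \<circ> family"]) (auto simp: family_inverse)
qed

text \<open>The real functions in \<open>C\<close> separate states, by the real and imaginary parts of the evaluations.\<close>

theorem iota_generates_cfun:
 assumes X: "compact_space X" and A: "function_system X A"
  and C: "cstar_subalgebra (state_space X A) C" and iota: "!!a. a \<in> A ==> iota X A a \<in> C"
 shows "C = cfun (state_space X A)"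
proof -
 note A' = function_systemD[OF A]
 let ?K = "state_space X A" and ?S = "states X A"
 have C': "C \<subseteq> cfun ?K" "!!f g. f \<in> C ==> g \<in> C ==> cf_add ?K f g \<in> C" "!!c f. f \<in> C ==> cf_scale ?K c f \<in> C"
  "!!f g. f \<in> C ==> g \<in> C ==> cf_mult ?K f g \<in> C" "!!f. f \<in> C ==> cf_star ?K f \<in> C" "norm_closed ?K C"
  using C by (auto simp: cstar_subalgebra_def)
 have cont: "continuous_on ?S f" if "f \<in> cfun ?K" for f
  using cfun_continuous[OF that] by (simp add: state_space_eq_top_of_set)
 define R where "R g = (\<lambda>\<alpha>\<in>?S. complex_of_real (g \<alpha>))" for g
 define P where "P g \<longleftrightarrow> continuous_on ?S g \<and> R g \<in> C" for g
 have approx: "\<exists>g. P g \<and> (\<forall>\<alpha>\<in>?S. \<bar>f \<alpha> - g \<alpha>\<bar> < e)" if f: "continuous_on ?S f" and e: "e > 0" for f e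
 proof (rule Stone_Weierstrass_fun[OF compact_states[OF X A] _ _ _ _ _ f e])
  have one: "iota X A (cf_one X) = cf_one ?K"
   by (rule cfun_eqI[OF iota_in_cfun]) (auto simp: states_iff)
  have "R (\<lambda>\<alpha>. c) = cf_scale ?K (of_real c) (cf_one ?K)" for c by (auto simp: R_def cf_scale_def cf_one_def)
  then show "P (\<lambda>\<alpha>. c)" for c using C'(3)[OF iota[OF A'(2)]] by (simp add: P_def one)
  have "R (\<lambda>\<alpha>. g \<alpha> + h \<alpha>) = cf_add ?K (R g) (R h)" "R (\<lambda>\<alpha>. g \<alpha> * h \<alpha>) = cf_mult ?K (R g) (R h)" for g h
   by (auto simp: R_def cf_add_def cf_mult_def)
  then show "P (\<lambda>\<alpha>. g \<alpha> + h \<alpha>)" "P (\<lambda>\<alpha>. g \<alpha> * h \<alpha>)" if "P g" "P h" for g h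
   using that C' by (auto simp: P_def intro: continuous_intros)
  show "\<exists>g. P g \<and> g \<alpha> \<noteq> g \<beta>" if \<alpha>: "\<alpha> \<in> ?S" "\<beta> \<in> ?S" "\<alpha> \<noteq> \<beta>" for \<alpha> \<beta>
  proof -
   have "\<alpha> \<in> extensional A" "\<beta> \<in> extensional A" using \<alpha> by (auto simp: states_iff)
   with \<alpha>(3) obtain a where a: "a \<in> A" "\<alpha> a \<noteq> \<beta> a" by (meson extensionalityI)
   define b where "b = (if Re (\<alpha> a) = Re (\<beta> a) then cf_scale X (-\<i>) a else a)"
   have b: "b \<in> A" using a A' by (simp add: b_def)
   have Re: "Re (\<alpha> b) \<noteq> Re (\<beta> b)"
    using a \<alpha> by (auto simp: b_def states_def complex_eq_iff)
   define h where "h = cf_scale ?K (1/2) (cf_add ?K (iota X A b) (cf_star ?K (iota X A b)))"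
   have h: "h \<in> C" using C' iota[OF b] by (simp add: h_def)
   have hv: "h \<gamma> = of_real (Re (\<gamma> b))" if "\<gamma> \<in> ?S" for \<gamma>
    using that by (simp add: h_def complex_eq_iff)
   have "R (\<lambda>\<gamma>. Re (\<gamma> b)) = h"
    by (rule extensionalityI[of _ ?S]) (use h C'(1) hv in \<open>auto simp: R_def cfun_def\<close>)
   moreover have "continuous_on ?S (\<lambda>\<gamma>. Re (\<gamma> b))"
    using cfun_continuous[OF iota_in_cfun[of X A b]] continuous_map_Re[OF continuous_map_state_eval[of X A b]]
    by (simp add: state_space_eq_top_of_set)
   ultimately show ?thesis using h Re by (intro exI[of _ "\<lambda>\<gamma>. Re (\<gamma> b)"]) (simp add: P_def)
  qed
 qed (auto simp: P_def)
 have "f \<in> C" if f: "f \<in> cfun ?K" for f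
 proof -
  have "\<exists>g\<in>C. \<forall>\<alpha>\<in>topspace ?K. cmod (f \<alpha> - g \<alpha>) \<le> e" if e: "e > 0" for e
  proof -
   obtain g where g: "P g" "\<forall>\<alpha>\<in>?S. \<bar>Re (f \<alpha>) - g \<alpha>\<bar> < e/2"
    using approx[OF continuous_on_Re[OF cont[OF f]], of "e/2"] e by auto
   obtain h where h: "P h" "\<forall>\<alpha>\<in>?S. \<bar>Im (f \<alpha>) - h \<alpha>\<bar> < e/2"
    using approx[OF continuous_on_Im[OF cont[OF f]], of "e/2"] e by auto
   let ?g = "cf_add ?K (R g) (cf_scale ?K \<i> (R h))"
   have "cmod (f \<alpha> - ?g \<alpha>) \<le> e" if \<alpha>: "\<alpha> \<in> ?S" for \<alpha>
   proof -
    have "cmod (f \<alpha> - ?g \<alpha>) \<le> \<bar>Re (f \<alpha> - ?g \<alpha>)\<bar> + \<bar>Im (f \<alpha> - ?g \<alpha>)\<bar>" by (rule cmod_le)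
    also have "\<dots> \<le> e/2 + e/2" using g(2) h(2) \<alpha> by (intro add_mono) (auto simp: R_def less_imp_le)
    finally show ?thesis by simp
   qed
   moreover have "?g \<in> C" using g h C' by (simp add: P_def)
   ultimately show ?thesis by (intro bexI[of _ ?g]) auto
  qed
  then show ?thesis using C'(6) f unfolding norm_closed_iff[OF compact_state_space[OF X A]] by blast
 qed
 then show ?thesis using C'(1) by blast
qed

section \<open>Extending a representation of \<open>C(K)\<close> from \<open>A\<close> to \<open>C(X)\<close>\<close>

lemma star_rep_norm_le:
 assumes K: "compact_space K" and L: "hilbert_space L" and \<sigma>: "star_rep K L \<sigma>" and f: "f \<in> cfun K"
  and B: "B \<ge> 0" "!!x. x \<in> topspace K ==> cmod (f x) \<le> B" and h: "h \<in> hcarrier L"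
 shows "hnorm L (\<sigma> f h) \<le> B * hnorm L h" and "Re (hinner L (\<sigma> (cf_one K) h) h) \<le> (hnorm L h)\<^sup>2"
proof -
 interpret L: hilbert_space L by fact
 note \<sigma>' = star_repD(2,3)[OF L \<sigma>] and lin = linear_into_bopsD[OF star_repD(1)[OF L \<sigma>]]
 note m = completely_positive_vector_functional[OF L star_rep_completely_positive[OF L \<sigma>] h]
 let ?p = "\<sigma> (cf_one K) h"
 have p: "?p \<in> hcarrier L" using lin(2) h by simp
 have one: "cf_mult K (cf_one K) (cf_one K) = cf_one K" "cf_star K (cf_one K) = cf_one K"
  by (auto simp: cf_mult_def cf_one_def cf_star_def)
 have "hinner L ?p h = hinner L ?p ?p"
  using \<sigma>'(1)[of "cf_one K" "cf_one K" h] \<sigma>'(2)[of "cf_one K" ?p h] h p by (simp add: one)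
 then have pp: "Re (hinner L ?p h) = (hnorm L ?p)\<^sup>2" using p by (simp add: L.norm_sq)
 have "(hnorm L ?p)\<^sup>2 \<le> hnorm L ?p * hnorm L h"
  using L.Cauchy_Schwarz[OF p h] complex_Re_le_cmod[of "hinner L ?p h"] pp by simp
 then have "hnorm L ?p \<le> hnorm L h" using p h by (simp add: power2_eq_square) (metis L.norm_nonneg mult_le_cancel_left_pos less_eq_real_def)
 then have "(hnorm L ?p)\<^sup>2 \<le> (hnorm L h)\<^sup>2" using p by (intro power_mono) auto
 then show ph: "Re (hinner L ?p h) \<le> (hnorm L h)\<^sup>2" by (simp add: pp)
 have ff: "cf_mult K (cf_star K f) f \<in> cfun K" using f by (simp add: cfun_closed)
 have "cmod (cf_mult K (cf_star K f) f x) \<le> B\<^sup>2" if "x \<in> topspace K" for x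
  using power_mono[OF B(2)[OF that], of 2] that by (simp add: norm_mult power2_eq_square)
 from positive_functional_norm_le[OF K function_system_cfun[OF K] m ff this]
 have "cmod (hinner L (\<sigma> (cf_mult K (cf_star K f) f) h) h) \<le> B\<^sup>2 * Re (hinner L ?p h)" .
 moreover have "hinner L (\<sigma> (cf_mult K (cf_star K f) f) h) h = hinner L (\<sigma> f h) (\<sigma> f h)"
  using \<sigma>'(1)[OF cf_star_in[OF f] f h] \<sigma>'(2)[OF cf_star_in[OF f] lin(2)[OF f h] h] cfun_eqI[of "cf_star K (cf_star K f)" K f] f
  by (simp add: cfun_closed)
 ultimately have "(hnorm L (\<sigma> f h))\<^sup>2 \<le> B\<^sup>2 * Re (hinner L ?p h)"
  using L.norm_sq[OF lin(2)[OF f h]] complex_Re_le_cmod[of "hinner L (\<sigma> f h) (\<sigma> f h)"] by simp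
 also have "\<dots> \<le> (B * hnorm L h)\<^sup>2" using ph by (simp add: power_mult_distrib mult_left_mono)
 finally show "hnorm L (\<sigma> f h) \<le> B * hnorm L h" by (rule power2_le_imp_le) (use B h in auto)
qed

text \<open>A state applied to one factor of a positive matrix over \<open>C(X)\<close> leaves it positive: pointwise
 \<open>\<Sum> \<langle>v\<^sub>j, v\<^sub>i\<rangle> f\<^sub>i\<^sup>* f\<^sub>j\<close> is the square norm of \<open>\<Sum> f\<^sub>j v\<^sub>j\<close>.\<close>

lemma positive_functional_gram:
 fixes n :: nat
 assumes m: "positive_functional X (cfun X) m" and L: "hilbert_space L"
  and f: "!!i. i < n ==> f i \<in> cfun X" and v: "!!i. i < n ==> v i \<in> hcarrier L"
 shows "(\<Sum>i<n. \<Sum>j<n. m (cf_mult X (cf_star X (f i)) (f j)) * hinner L (v j) (v i)) \<in> \<real>\<^sub>\<ge>\<^sub>0"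
proof -
 interpret L: hilbert_space L by fact
 define g where "g i j = cf_scale X (hinner L (v j) (v i)) (cf_mult X (cf_star X (f i)) (f j))" for i j
 define G where "G i = (\<lambda>x\<in>topspace X. \<Sum>j<n. g i j x)" for i
 have g: "g i j \<in> cfun X" if "i < n" "j < n" for i j using f that by (simp add: g_def cfun_closed)
 have G: "G i \<in> cfun X" "m (G i) = (\<Sum>j<n. m (g i j))" if "i < n" for i
  unfolding G_def using positive_functional_sum[OF m finite_lessThan] g that by auto
 have "(\<Sum>i<n. \<Sum>j<n. m (cf_mult X (cf_star X (f i)) (f j)) * hinner L (v j) (v i)) = (\<Sum>i<n. m (G i))"
  using f by (intro sum.cong refl) (auto simp: G g_def positive_functionalD(2)[OF m] cfun_closed mult.commute intro!: sum.cong)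
 also have "\<dots> = m (\<lambda>x\<in>topspace X. \<Sum>i<n. G i x)" by (rule positive_functional_sum(1)[OF m finite_lessThan, symmetric]) (use G in auto)
 also have "\<dots> \<in> \<real>\<^sub>\<ge>\<^sub>0"
 proof (rule positive_functionalD(3)[OF m])
  show "(\<lambda>x\<in>topspace X. \<Sum>i<n. G i x) \<in> cfun X" by (rule positive_functional_sum(2)[OF m finite_lessThan]) (use G in auto)
  fix x assume x: "x \<in> topspace X"
  have "(\<Sum>i<n. \<Sum>j<n. hinner L (hscale L (f j x) (v j)) (hscale L (f i x) (v i))) \<in> \<real>\<^sub>\<ge>\<^sub>0"
   by (rule L.gram_sum_nonneg) (use v in auto)
  also have "(\<Sum>i<n. \<Sum>j<n. hinner L (hscale L (f j x) (v j)) (hscale L (f i x) (v i))) = (\<Sum>i<n. \<Sum>j<n. g i j x)"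
   using x v by (intro sum.cong refl) (simp add: L.inner_simps g_def)
  finally show "(\<lambda>x\<in>topspace X. \<Sum>i<n. G i x) x \<in> \<real>\<^sub>\<ge>\<^sub>0" using x by (simp add: G_def)
 qed
 finally show ?thesis .
qed

text \<open>A completely positive map from \<open>C(X)\<close> to operators on \<open>L\<close>, given by its matrix coefficients: in this form
 such maps are points of a product space.\<close>

definition positive_form :: "'x topology => 'l hspace => (('x => complex) \<times> 'l \<times> 'l => complex) => bool" where
 "positive_form X L t \<longleftrightarrow>
  (\<forall>f\<in>cfun X. \<forall>h\<in>hcarrier L. \<forall>k\<in>hcarrier L.
   (\<forall>g\<in>cfun X. t (cf_add X f g, h, k) = t (f, h, k) + t (g, h, k)) \<and>
   (\<forall>c. t (cf_scale X c f, h, k) = c * t (f, h, k)) \<and>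
   (\<forall>h'\<in>hcarrier L. t (f, hadd L h h', k) = t (f, h, k) + t (f, h', k)) \<and>
   (\<forall>c. t (f, hscale L c h, k) = c * t (f, h, k)) \<and>
   (\<forall>k'\<in>hcarrier L. t (f, h, hadd L k k') = t (f, h, k) + t (f, h, k')) \<and>
   (\<forall>c. t (f, h, hscale L c k) = cnj c * t (f, h, k))) \<and>
  (\<forall>p\<in>{(n :: nat, f, u). \<forall>i<n. f i \<in> cfun X \<and> u i \<in> hcarrier L}. case p of (n, f, u) =>
   (\<Sum>i<n. \<Sum>j<n. t (cf_mult X (cf_star X (f i)) (f j), u j, u i)) \<in> \<real>\<^sub>\<ge>\<^sub>0)"

lemma closed_positive_form: "closed {t. positive_form X L t}"
proof -
 have ball: "closed {t. \<forall>x\<in>S. P x t}" if "!!x. x \<in> S ==> closed {t. P x t}"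
  for S :: "'i set" and P :: "'i => (('x => complex) \<times> 'l \<times> 'l => complex) => bool"
  unfolding Collect_ball_eq by (rule closed_INT) (use that in blast)
 have eval: "continuous_on UNIV (\<lambda>t :: ('x => complex) \<times> 'l \<times> 'l => complex. t i)" for i
  by (rule continuous_on_product_coordinates)
 have add: "closed {t :: ('x => complex) \<times> 'l \<times> 'l => complex. t i = t j + t k}" for i j k
  by (intro closed_Collect_eq continuous_on_add eval)
 have scale: "closed {t :: ('x => complex) \<times> 'l \<times> 'l => complex. t i = c * t j}" for i j c
  by (intro closed_Collect_eq continuous_on_mult continuous_on_const eval)
 have sum: "closed {t :: ('x => complex) \<times> 'l \<times> 'l => complex. (\<Sum>i<n. \<Sum>j<n. t (F i j)) \<in> \<real>\<^sub>\<ge>\<^sub>0}" for n :: nat and F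
  using closed_vimage[OF closed_nonneg_Reals_complex, of "\<lambda>t. \<Sum>i<n. \<Sum>j<n. t (F i j)"]
  by (simp add: vimage_def continuous_on_sum eval)
 show ?thesis
  unfolding positive_form_def
  by (intro closed_Collect_conj ball closed_Collect_all add scale) (auto intro!: sum)
qed

text \<open>The form \<open>\<Sum>\<^sub>j m\<^sub>j(f) \<langle>\<sigma>(\<phi>\<^sub>j)h, k\<rangle>\<close>, where the states \<open>m\<^sub>j\<close> of \<open>C(X)\<close> nearly extend the centres \<open>j\<close> of
 the partition of unity. Writing \<open>\<phi>\<^sub>j = c\<^sub>j\<^sup>* c\<^sub>j\<close> reduces positivity to that of \<open>m\<^sub>j\<close> on the vectors \<open>\<sigma>(c\<^sub>j)h\<close>,
 and the bound to the Cauchy-Schwarz inequality for sums over \<open>j\<close>.\<close>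

lemma approximate_extension:
 assumes X: "compact_space X" and A: "function_system X A" and L: "hilbert_space L"
  and \<sigma>: "star_rep (state_space X A) L \<sigma>" and F: "finite F" "F \<subseteq> A" and e: "e > 0"
 shows "\<exists>t. positive_form X L t \<and>
  (\<forall>f\<in>cfun X. \<forall>h\<in>hcarrier L. \<forall>k\<in>hcarrier L. \<forall>B\<ge>0. (\<forall>x\<in>topspace X. cmod (f x) \<le> B) \<longrightarrow>
   cmod (t (f, h, k)) \<le> B * (hnorm L h * hnorm L k)) \<and>
  (\<forall>a\<in>F. \<forall>h\<in>hcarrier L. \<forall>k\<in>hcarrier L.
   cmod (t (a, h, k) - hinner L (\<sigma> (iota X A a) h) k) \<le> e * (hnorm L h * hnorm L k))"
proof -
 interpret L: hilbert_space L by fact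
 let ?K = "state_space X A"
 note K = compact_state_space[OF X A] and A' = function_systemD[OF A] and FX = function_system_cfun[OF X]
 note \<sigma>1 = star_repD(1)[OF L \<sigma>]
 note \<sigma>' = star_repD(2,3)[OF L \<sigma>] and lin = linear_into_bopsD[OF \<sigma>1]
 have iota_cont: "continuous_map ?K euclidean f" if "f \<in> iota X A ` F" for f
  using that cfun_continuous[OF iota_in_cfun] by blast
 obtain J and \<phi> :: "(('a => complex) => complex) => (('a => complex) => complex) => real" where raw: "finite J" "J \<subseteq> topspace ?K" "!!j. j \<in> J ==> continuous_map ?K euclidean (\<phi> j)"
   "!!j \<alpha>. j \<in> J ==> \<alpha> \<in> topspace ?K ==> \<phi> j \<alpha> \<ge> (0::real)"
   "!!\<alpha>. \<alpha> \<in> topspace ?K ==> (\<Sum>j\<in>J. \<phi> j \<alpha>) = 1"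
   "!!f j \<alpha>. f \<in> iota X A ` F ==> j \<in> J ==> \<alpha> \<in> topspace ?K ==> \<phi> j \<alpha> \<noteq> 0 ==> cmod (f \<alpha> - f j) \<le> e/2"
 proof (rule adapted_partition_of_unity[OF K finite_imageI[OF F(1)] iota_cont half_gt_zero[OF e]], assumption)
  fix J and \<phi> :: "(('a => complex) => complex) => (('a => complex) => complex) => real"
  assume pu: "finite J" "J \<subseteq> topspace ?K" "!!j. j \<in> J ==> continuous_map ?K euclidean (\<phi> j)"
   "!!j \<alpha>. j \<in> J ==> \<alpha> \<in> topspace ?K ==> \<phi> j \<alpha> \<ge> 0"
   "!!\<alpha>. \<alpha> \<in> topspace ?K ==> (\<Sum>j\<in>J. \<phi> j \<alpha>) = 1"
   "!!f j \<alpha>. f \<in> iota X A ` F ==> j \<in> J ==> \<alpha> \<in> topspace ?K ==> \<phi> j \<alpha> \<noteq> 0 ==> cmod (f \<alpha> - f j) \<le> e/2"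
  show thesis by (rule that[of J \<phi>]) (fact pu)+
 qed
 note J = raw(1,2)[unfolded topspace_state_space] and \<phi>c = raw(3) and \<phi>0 = raw(4)[unfolded topspace_state_space]
  and \<phi>1 = raw(5)[unfolded topspace_state_space]
 have near: "cmod (\<alpha> a - j a) \<le> e/2" if "a \<in> F" "j \<in> J" "\<alpha> \<in> states X A" "\<phi> j \<alpha> \<noteq> 0" for a j \<alpha>
  using raw(6)[of "iota X A a" j \<alpha>] that J(2) by (auto simp: subset_eq)
 have "\<forall>j\<in>J. \<exists>m. positive_functional X (cfun X) m \<and> m (cf_one X) = 1 \<and> (\<forall>a\<in>F. cmod (m a - j a) \<le> e/2)"
 proof
  fix j assume "j \<in> J"
  then have "j \<in> states X A" using J by blast
  then obtain m where "positive_functional X (cfun X) m" "m (cf_one X) = 1" "!!a. a \<in> F ==> cmod (m a - j a) \<le> e/2"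
   by (rule state_approximation[OF X A _ F half_gt_zero[OF e]]) (rule that)
  then show "\<exists>m. positive_functional X (cfun X) m \<and> m (cf_one X) = 1 \<and> (\<forall>a\<in>F. cmod (m a - j a) \<le> e/2)" by blast
 qed
 from bchoice[OF this] obtain m where m: "\<forall>j\<in>J. positive_functional X (cfun X) (m j) \<and> m j (cf_one X) = 1 \<and>
  (\<forall>a\<in>F. cmod (m j a - j a) \<le> e/2)" by (rule exE)
 define \<Phi> where "\<Phi> j = (\<lambda>\<alpha>\<in>states X A. complex_of_real (\<phi> j \<alpha>))" for j
 have \<Phi>: "\<Phi> j \<in> cfun ?K" if "j \<in> J" for j
  unfolding \<Phi>_def using restrict_in_cfun[OF continuous_map_of_real[OF \<phi>c[OF that]]] by simp
 have "\<forall>j\<in>J. \<exists>c. c \<in> cfun ?K \<and> \<Phi> j = cf_mult ?K (cf_star ?K c) c"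
 proof
  fix j assume j: "j \<in> J"
  define c where "c = (\<lambda>\<alpha>\<in>topspace ?K. complex_of_real (sqrt (\<phi> j \<alpha>)))"
  have c: "c \<in> cfun ?K"
   unfolding c_def by (intro restrict_in_cfun continuous_map_of_real continuous_map_sqrt \<phi>c j)
  have "\<Phi> j = cf_mult ?K (cf_star ?K c) c"
   by (rule cfun_eqI[OF \<Phi>[OF j]])
    (use c \<phi>0[OF j] in \<open>auto simp: \<Phi>_def cfun_closed c_def simp flip: of_real_mult\<close>)
  with c show "\<exists>c. c \<in> cfun ?K \<and> \<Phi> j = cf_mult ?K (cf_star ?K c) c" by blast
 qed
 from bchoice[OF this] obtain c where c: "\<forall>j\<in>J. c j \<in> cfun ?K \<and> \<Phi> j = cf_mult ?K (cf_star ?K (c j)) (c j)" by (rule exE)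
 have cL: "\<sigma> (c j) h \<in> hcarrier L" if "j \<in> J" "h \<in> hcarrier L" for j h using c that lin(2) by blast
 have root: "hinner L (\<sigma> (\<Phi> j) h) k = hinner L (\<sigma> (c j) h) (\<sigma> (c j) k)"
  if j: "j \<in> J" and h: "h \<in> hcarrier L" and k: "k \<in> hcarrier L" for j h k
 proof -
  have cj: "c j \<in> cfun ?K" "\<Phi> j = cf_mult ?K (cf_star ?K (c j)) (c j)" using c j by auto
  have "cf_star ?K (cf_star ?K (c j)) = c j" by (rule cfun_eqI) (use cj in \<open>auto simp: cfun_closed\<close>)
  then show ?thesis
   using \<sigma>'(1)[OF cf_star_in[OF cj(1)] cj(1) h] \<sigma>'(2)[OF cf_star_in[OF cj(1)] cL[OF j h] k] cj(2) by simp
 qed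
 define t where "t = (\<lambda>(f, h, k). \<Sum>j\<in>J. m j f * hinner L (\<sigma> (\<Phi> j) h) k)"
 have t: "t (f, h, k) = (\<Sum>j\<in>J. m j f * hinner L (\<sigma> (\<Phi> j) h) k)" for f h k by (simp add: t_def)
 have m': "positive_functional X (cfun X) (m j)" if "j \<in> J" for j using m that by blast
 note mD = positive_functionalD[OF m']
 have \<Phi>L: "\<sigma> (\<Phi> j) h \<in> hcarrier L" if "j \<in> J" "h \<in> hcarrier L" for j h by (rule lin(2)[OF \<Phi>[OF that(1)] that(2)])
 have pos: "positive_form X L t"
  unfolding positive_form_def
 proof (intro conjI ballI allI)
  fix p :: "nat \<times> (nat => 'a => complex) \<times> (nat => 'b)"
  assume "p \<in> {(n, f, u). \<forall>i<n. f i \<in> cfun X \<and> u i \<in> hcarrier L}"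
  then obtain n f u where p: "p = (n, f, u)" "!!i. i < n ==> f i \<in> cfun X" "!!i. i < n ==> u i \<in> hcarrier L" by blast
  have "(\<Sum>i<n. \<Sum>l<n. t (cf_mult X (cf_star X (f i)) (f l), u l, u i)) =
   (\<Sum>i<n. \<Sum>l<n. \<Sum>j\<in>J. m j (cf_mult X (cf_star X (f i)) (f l)) * hinner L (\<sigma> (c j) (u l)) (\<sigma> (c j) (u i)))"
   unfolding t using p by (intro sum.cong refl) (simp add: root)
  also have "\<dots> = (\<Sum>i<n. \<Sum>j\<in>J. \<Sum>l<n. m j (cf_mult X (cf_star X (f i)) (f l)) * hinner L (\<sigma> (c j) (u l)) (\<sigma> (c j) (u i)))"
   by (intro sum.cong refl sum.swap)
  also have "\<dots> = (\<Sum>j\<in>J. \<Sum>i<n. \<Sum>l<n. m j (cf_mult X (cf_star X (f i)) (f l)) * hinner L (\<sigma> (c j) (u l)) (\<sigma> (c j) (u i)))"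
   by (rule sum.swap)
  also have "\<dots> \<in> \<real>\<^sub>\<ge>\<^sub>0"
   by (rule sum_in_nonneg_Reals, rule positive_functional_gram[OF m' L]) (use p cL in auto)
  finally show "case p of (n, f, u) => (\<Sum>i<n. \<Sum>j<n. t (cf_mult X (cf_star X (f i)) (f j), u j, u i)) \<in> \<real>\<^sub>\<ge>\<^sub>0"
   by (simp add: p(1))
 next
  fix f h k assume fhk: "f \<in> cfun X" "h \<in> hcarrier L" "k \<in> hcarrier L"
  show "t (cf_add X f g, h, k) = t (f, h, k) + t (g, h, k)" if "g \<in> cfun X" for g
   unfolding t sum.distrib[symmetric] using fhk that by (intro sum.cong refl) (simp add: mD algebra_simps)
  show "t (cf_scale X c f, h, k) = c * t (f, h, k)" for c
   unfolding t sum_distrib_left using fhk by (intro sum.cong refl) (simp add: mD)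
  show "t (f, hadd L h h', k) = t (f, h, k) + t (f, h', k)" if "h' \<in> hcarrier L" for h'
   unfolding t sum.distrib[symmetric] using fhk that
   by (intro sum.cong refl) (simp add: lin(5) \<Phi> \<Phi>L L.inner_add algebra_simps)
  show "t (f, hscale L c h, k) = c * t (f, h, k)" for c
   unfolding t sum_distrib_left using fhk by (intro sum.cong refl) (simp add: lin(6) \<Phi> \<Phi>L L.inner_scale)
  show "t (f, h, hadd L k k') = t (f, h, k) + t (f, h, k')" if "k' \<in> hcarrier L" for k'
   unfolding t sum.distrib[symmetric] using fhk that
   by (intro sum.cong refl) (simp add: \<Phi>L L.inner_add_right algebra_simps)
  show "t (f, h, hscale L c k) = cnj c * t (f, h, k)" for c
   unfolding t sum_distrib_left using fhk by (intro sum.cong refl) (simp add: \<Phi>L L.inner_scale_right)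
 qed
 have total: "(\<Sum>j\<in>J. (hnorm L (\<sigma> (c j) h))\<^sup>2) \<le> (hnorm L h)\<^sup>2" if h: "h \<in> hcarrier L" for h
 proof -
  have "(\<Sum>j\<in>J. hinner L (\<sigma> (\<Phi> j) h) h) = hinner L (\<sigma> (\<lambda>\<alpha>\<in>topspace ?K. \<Sum>j\<in>J. \<Phi> j \<alpha>) h) h"
   using linear_into_bops_inner_sum[OF L \<sigma>1 J(1), of \<Phi> h h] \<Phi> h by simp
  also have "(\<lambda>\<alpha>\<in>topspace ?K. \<Sum>j\<in>J. \<Phi> j \<alpha>) = cf_one ?K"
  proof -
   have "(\<Sum>j\<in>J. \<Phi> j \<alpha>) = 1" if "\<alpha> \<in> states X A" for \<alpha>
    using \<phi>1[OF that] that by (simp add: \<Phi>_def flip: of_real_sum)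
   then show ?thesis by (auto simp: cf_one_def)
  qed
  finally have "(\<Sum>j\<in>J. (hnorm L (\<sigma> (c j) h))\<^sup>2) = Re (hinner L (\<sigma> (cf_one ?K) h) h)"
   using h by (simp add: root L.norm_sq cL flip: Re_sum)
  also have "\<dots> \<le> (hnorm L h)\<^sup>2"
   by (rule star_rep_norm_le(2)[OF K L \<sigma> cf_one_in _ _ h, of 1]) auto
  finally show ?thesis .
 qed
 have bound: "cmod (t (f, h, k)) \<le> B * (hnorm L h * hnorm L k)"
  if f: "f \<in> cfun X" and h: "h \<in> hcarrier L" and k: "k \<in> hcarrier L" and B0: "B \<ge> 0"
   and B: "!!x. x \<in> topspace X ==> cmod (f x) \<le> B" for f h k B
 proof -
  have mB: "cmod (m j f) \<le> B" if j: "j \<in> J" for j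
  proof -
   have "m j (cf_one X) = 1" using m j by blast
   then show ?thesis using positive_functional_norm_le[OF X FX m'[OF j] f B] by simp
  qed
  have "cmod (t (f, h, k)) \<le> (\<Sum>j\<in>J. cmod (m j f) * cmod (hinner L (\<sigma> (c j) h) (\<sigma> (c j) k)))"
   unfolding t by (rule order_trans[OF norm_sum]) (use h k in \<open>simp add: norm_mult root\<close>)
  also have "\<dots> \<le> (\<Sum>j\<in>J. B * (hnorm L (\<sigma> (c j) h) * hnorm L (\<sigma> (c j) k)))"
   by (intro sum_mono mult_mono mB L.Cauchy_Schwarz B0) (use h k cL in auto)
  also have "\<dots> = B * (\<Sum>j\<in>J. \<bar>hnorm L (\<sigma> (c j) h)\<bar> * \<bar>hnorm L (\<sigma> (c j) k)\<bar>)"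
   using h k cL by (simp add: sum_distrib_left)
  also have "\<dots> \<le> B * (L2_set (\<lambda>j. hnorm L (\<sigma> (c j) h)) J * L2_set (\<lambda>j. hnorm L (\<sigma> (c j) k)) J)"
   by (rule mult_left_mono[OF L2_set_mult_ineq B0])
  also have "\<dots> \<le> B * (hnorm L h * hnorm L k)"
   using total[OF h] total[OF k] h k
   by (intro mult_left_mono mult_mono B0) (auto simp: L2_set_def intro!: real_le_lsqrt sum_nonneg)
  finally show ?thesis .
 qed
 have near_t: "cmod (t (a, h, k) - hinner L (\<sigma> (iota X A a) h) k) \<le> e * (hnorm L h * hnorm L k)"
  if a: "a \<in> F" and h: "h \<in> hcarrier L" and k: "k \<in> hcarrier L" for a h k
 proof -
  have aA: "a \<in> A" using a F by blast
  define g where "g j = cf_scale ?K (m j a) (\<Phi> j)" for j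
  have g: "g j \<in> cfun ?K" if "j \<in> J" for j using \<Phi>[OF that] by (simp add: g_def cfun_closed)
  define S where "S = (\<lambda>\<alpha>\<in>topspace ?K. \<Sum>j\<in>J. g j \<alpha>)"
  have S: "S \<in> cfun ?K" "hinner L (\<sigma> S h) k = (\<Sum>j\<in>J. hinner L (\<sigma> (g j) h) k)"
   unfolding S_def using linear_into_bops_inner_sum[OF L \<sigma>1 J(1) g h k] by auto
  have tS: "t (a, h, k) = hinner L (\<sigma> S h) k"
   unfolding t S(2) using h k
   by (intro sum.cong refl) (simp add: g_def lin(4) \<Phi> \<Phi>L L.inner_scale)
  define G where "G = cf_add ?K S (cf_scale ?K (-1) (iota X A a))"
  have G: "G \<in> cfun ?K" unfolding G_def by (intro cf_add_in cf_scale_in S(1) iota_in_cfun)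
  have "cmod (G \<alpha>) \<le> e" if \<alpha>: "\<alpha> \<in> states X A" for \<alpha>
  proof -
   have "\<alpha> a = (\<Sum>j\<in>J. of_real (\<phi> j \<alpha>)) * \<alpha> a" using \<phi>1[OF \<alpha>] by (simp flip: of_real_sum)
   then have "G \<alpha> = (\<Sum>j\<in>J. m j a * of_real (\<phi> j \<alpha>)) - (\<Sum>j\<in>J. of_real (\<phi> j \<alpha>)) * \<alpha> a"
    using \<alpha> by (simp add: G_def S_def g_def \<Phi>_def)
   also have "\<dots> = (\<Sum>j\<in>J. of_real (\<phi> j \<alpha>) * (m j a - \<alpha> a))"
    unfolding sum_distrib_right sum_subtractf[symmetric] by (intro sum.cong refl) (simp add: algebra_simps)
   also have "cmod \<dots> \<le> (\<Sum>j\<in>J. \<phi> j \<alpha> * e)"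
   proof (rule order_trans[OF norm_sum], rule sum_mono)
    fix j assume j: "j \<in> J"
    show "cmod (of_real (\<phi> j \<alpha>) * (m j a - \<alpha> a)) \<le> \<phi> j \<alpha> * e"
    proof (cases "\<phi> j \<alpha> = 0")
     case False
     then have "cmod (j a - \<alpha> a) \<le> e/2" using near[OF a j \<alpha> False] by (simp add: norm_minus_commute)
     moreover have "cmod (m j a - j a) \<le> e/2" using m a j by blast
     ultimately have "cmod (m j a - \<alpha> a) \<le> e" using norm_triangle_ineq[of "m j a - j a" "j a - \<alpha> a"] by simp
     then show ?thesis using \<phi>0[OF j \<alpha>] by (simp add: norm_mult mult_left_mono)
    qed simp
   qed
   also have "\<dots> = e" using \<phi>1[OF \<alpha>] by (simp flip: sum_distrib_right)
   finally show ?thesis .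
  qed
  then have n: "hnorm L (\<sigma> G h) \<le> e * hnorm L h"
   by (intro star_rep_norm_le(1)[OF K L \<sigma> G _ _ h]) (use e in auto)
  have "t (a, h, k) - hinner L (\<sigma> (iota X A a) h) k = hinner L (\<sigma> G h) k"
   unfolding tS G_def using S(1) iota_in_cfun[of X A a] h k
   by (simp add: lin(2-4) cfun_closed L.inner_simps)
  also have "cmod \<dots> \<le> hnorm L (\<sigma> G h) * hnorm L k" by (rule L.Cauchy_Schwarz[OF lin(2)[OF G h] k])
  also have "\<dots> \<le> e * hnorm L h * hnorm L k" using n k by (intro mult_right_mono) auto
  finally show ?thesis by (simp add: mult.assoc)
 qed
 show ?thesis using pos bound near_t by (intro exI[of _ t] conjI) blast+
qed

text \<open>A representation of \<open>C(K)\<close>, restricted to \<open>A\<close>, extends to a completely positive map on \<open>C(X)\<close>.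
 Averaging extensions of finitely many states against a partition of unity on \<open>K\<close> extends it up to
 any error on finitely many elements of \<open>A\<close>, and the forms of the extensions range over a compact set.\<close>

theorem completely_positive_extension_form:
 assumes X: "compact_space X" and A: "function_system X A" and L: "hilbert_space L"
  and \<sigma>: "star_rep (state_space X A) L \<sigma>"
 obtains t where "positive_form X L t"
  "!!f. f \<in> cfun X ==> \<exists>B. \<forall>h\<in>hcarrier L. \<forall>k\<in>hcarrier L. cmod (t (f, h, k)) \<le> B * (hnorm L h * hnorm L k)"
  "!!a h k. a \<in> A ==> h \<in> hcarrier L ==> k \<in> hcarrier L ==> t (a, h, k) = hinner L (\<sigma> (iota X A a) h) k"
proof -
 interpret L: hilbert_space L by fact
 define N where "N f = (SOME B. B \<ge> 0 \<and> (\<forall>x\<in>topspace X. cmod (f x) \<le> B))" for f :: "'a => complex"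
 have N: "N f \<ge> 0 \<and> (\<forall>x\<in>topspace X. cmod (f x) \<le> N f)" if f: "f \<in> cfun X" for f
 proof -
  obtain B where "B \<ge> 0" "!!x. x \<in> topspace X ==> cmod (f x) \<le> B" by (rule cfun_bounded[OF X f]) (rule that)
  then have "\<exists>B. B \<ge> 0 \<and> (\<forall>x\<in>topspace X. cmod (f x) \<le> B)" by blast
  then show ?thesis unfolding N_def by (rule someI_ex)
 qed
 define D where "D = cfun X \<times> hcarrier L \<times> hcarrier L"
 define box where "box = PiE UNIV (\<lambda>(f, h, k). cball (0::complex) (if (f, h, k) \<in> D then N f * (hnorm L h * hnorm L k) else 0))"
 have "compactin (product_topology (\<lambda>_. euclidean) UNIV) box"
  unfolding box_def by (subst compactin_PiE) auto
 then have "compact box" by (simp add: euclidean_product_topology)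
 define S where "S = box \<inter> {t. positive_form X L t}"
 have S: "compact S" unfolding S_def by (rule compact_Int_closed[OF \<open>compact box\<close> closed_positive_form])
 define Z where "Z = (\<lambda>(a, e). {t. \<forall>p\<in>hcarrier L \<times> hcarrier L.
  cmod (t (a, p) - hinner L (\<sigma> (iota X A a) (fst p)) (snd p)) \<le> e * (hnorm L (fst p) * hnorm L (snd p))})"
 have "S \<inter> (\<Inter>i\<in>A \<times> {0<..}. Z i) \<noteq> {}"
 proof (rule compact_imp_fip_image[OF S])
  fix i assume "i \<in> A \<times> {0::real<..}"
  then obtain a e where i: "i = (a, e)" by blast
  have "continuous_on UNIV (\<lambda>t :: ('a => complex) \<times> 'b \<times> 'b => complex. t j)" for j by (rule continuous_on_product_coordinates)
  then have "closed {t :: ('a => complex) \<times> 'b \<times> 'b => complex. cmod (t j - z) \<le> c}" for j z c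
   by (intro closed_Collect_le continuous_on_norm continuous_on_diff continuous_on_const)
  then show "closed (Z i)" unfolding i Z_def prod.case Collect_ball_eq by (rule closed_INT[OF ballI])
 next
  fix I assume I: "finite I" "I \<subseteq> A \<times> {0::real<..}"
  define e where "e = Min (insert 1 (snd ` I))"
  have e: "e > 0" "!!a d. (a, d) \<in> I ==> e \<le> d"
   using I by (auto simp: e_def Min_gr_iff intro!: Min_le image_eqI)
  have "fst ` I \<subseteq> A" using I(2) by auto
  from approximate_extension[OF X A L \<sigma> finite_imageI[OF I(1)] this e(1)]
  obtain t where "positive_form X L t \<and>
   (\<forall>f\<in>cfun X. \<forall>h\<in>hcarrier L. \<forall>k\<in>hcarrier L. \<forall>B\<ge>0. (\<forall>x\<in>topspace X. cmod (f x) \<le> B) \<longrightarrow>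
    cmod (t (f, h, k)) \<le> B * (hnorm L h * hnorm L k)) \<and>
   (\<forall>a\<in>fst ` I. \<forall>h\<in>hcarrier L. \<forall>k\<in>hcarrier L.
    cmod (t (a, h, k) - hinner L (\<sigma> (iota X A a) h) k) \<le> e * (hnorm L h * hnorm L k))" by (rule exE)
  then have t: "positive_form X L t"
   and bd: "!!f h k B. f \<in> cfun X ==> h \<in> hcarrier L ==> k \<in> hcarrier L ==> B \<ge> 0 ==>
    \<forall>x\<in>topspace X. cmod (f x) \<le> B ==> cmod (t (f, h, k)) \<le> B * (hnorm L h * hnorm L k)"
   and ap: "!!a h k. a \<in> fst ` I ==> h \<in> hcarrier L ==> k \<in> hcarrier L ==>
    cmod (t (a, h, k) - hinner L (\<sigma> (iota X A a) h) k) \<le> e * (hnorm L h * hnorm L k)" by blast+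
  define t' where "t' p = (if p \<in> D then t p else 0)" for p
  have t': "t' (f, h, k) = t (f, h, k)" if "f \<in> cfun X" "h \<in> hcarrier L" "k \<in> hcarrier L" for f h k
   using that by (simp add: t'_def D_def)
  have "t' \<in> box"
   using bd N by (auto simp: box_def t'_def D_def)
  moreover have "positive_form X L t'"
   unfolding positive_form_def
  proof (intro conjI ballI)
   note tp = t[unfolded positive_form_def]
   fix f h k assume fhk: "f \<in> cfun X" "h \<in> hcarrier L" "k \<in> hcarrier L"
   note tf = bspec[OF bspec[OF bspec[OF conjunct1[OF tp] fhk(1)] fhk(2)] fhk(3)]
   show "t' (cf_add X f g, h, k) = t' (f, h, k) + t' (g, h, k)" if "g \<in> cfun X" for g
    using tf fhk that by (simp add: t' cfun_closed)
   show "\<forall>c. t' (cf_scale X c f, h, k) = c * t' (f, h, k)" "\<forall>c. t' (f, hscale L c h, k) = c * t' (f, h, k)"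
    "\<forall>c. t' (f, h, hscale L c k) = cnj c * t' (f, h, k)" using tf fhk by (simp_all add: t' cfun_closed)
   show "t' (f, hadd L h h', k) = t' (f, h, k) + t' (f, h', k)" "t' (f, k, hadd L h h') = t' (f, k, h) + t' (f, k, h')"
    if "h' \<in> hcarrier L" for h'
    using tf bspec[OF bspec[OF bspec[OF conjunct1[OF tp] fhk(1)] fhk(3)] fhk(2)] fhk that by (simp_all add: t')
  next
   fix p :: "nat \<times> (nat => 'a => complex) \<times> (nat => 'b)"
   assume p: "p \<in> {(n, f, u). \<forall>i<n. f i \<in> cfun X \<and> u i \<in> hcarrier L}"
   obtain n f u where pe: "p = (n, f, u)" by (cases p)
   have "(\<Sum>i<n. \<Sum>j<n. t' (cf_mult X (cf_star X (f i)) (f j), u j, u i)) = (\<Sum>i<n. \<Sum>j<n. t (cf_mult X (cf_star X (f i)) (f j), u j, u i))"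
    using p by (intro sum.cong refl t') (auto simp: cfun_closed pe)
   then show "case p of (n, f, u) => (\<Sum>i<n. \<Sum>j<n. t' (cf_mult X (cf_star X (f i)) (f j), u j, u i)) \<in> \<real>\<^sub>\<ge>\<^sub>0"
    using bspec[OF conjunct2[OF t[unfolded positive_form_def]] p] by (simp add: pe)
  qed
  moreover have "t' \<in> Z i" if iI: "i \<in> I" for i
  proof -
   obtain a d where pair: "i = (a, d)" by (cases i)
   have "a \<in> A" using iI I(2) by (auto simp: pair)
   moreover have "e \<le> d" using e(2) iI by (simp add: pair)
   moreover have "a \<in> fst ` I" using iI by (simp add: pair image_iff) (rule bexI[of _ i], simp_all add: pair)
   ultimately have i: "i = (a, d)" "a \<in> A" "e \<le> d" "a \<in> fst ` I" by (simp_all add: pair)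
   have "a \<in> cfun X" using i function_systemD(1)[OF A] by blast
   have "cmod (t' (a, h, k) - hinner L (\<sigma> (iota X A a) h) k) \<le> d * (hnorm L h * hnorm L k)"
    if h: "h \<in> hcarrier L" and k: "k \<in> hcarrier L" for h k
    unfolding t'[OF \<open>a \<in> cfun X\<close> h k]
    by (rule order_trans[OF ap[OF i(4) h k]]) (use i(3) h k in \<open>auto intro!: mult_right_mono\<close>)
   then show ?thesis by (auto simp: Z_def i(1))
  qed
  ultimately show "S \<inter> (\<Inter>i\<in>I. Z i) \<noteq> {}" unfolding S_def by blast
 qed
 then obtain t where tS: "t \<in> S \<inter> (\<Inter>i\<in>A \<times> {0<..}. Z i)" by (meson ex_in_conv)
 then have t: "t \<in> box" "positive_form X L t" "!!a e. a \<in> A ==> e > 0 ==> t \<in> Z (a, e)"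
  by (simp_all add: S_def)
 have "\<exists>B. \<forall>h\<in>hcarrier L. \<forall>k\<in>hcarrier L. cmod (t (f, h, k)) \<le> B * (hnorm L h * hnorm L k)" if f: "f \<in> cfun X" for f
 proof (intro exI[of _ "N f"] ballI)
  fix h k assume "h \<in> hcarrier L" "k \<in> hcarrier L"
  then have "(f, h, k) \<in> D" using f by (simp add: D_def)
  moreover have "t (f, h, k) \<in> (case (f, h, k) of (f, h, k) => cball 0 (if (f, h, k) \<in> D then N f * (hnorm L h * hnorm L k) else 0))"
   using t(1) unfolding box_def by (rule PiE_mem) simp
  ultimately show "cmod (t (f, h, k)) \<le> N f * (hnorm L h * hnorm L k)" by simp
 qed
 moreover have "t (a, h, k) = hinner L (\<sigma> (iota X A a) h) k"
  if a: "a \<in> A" and h: "h \<in> hcarrier L" and k: "k \<in> hcarrier L" for a h k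
 proof -
  let ?M = "hnorm L h * hnorm L k"
  have M: "?M \<ge> 0" using h k by simp
  have "cmod (t (a, h, k) - hinner L (\<sigma> (iota X A a) h) k) \<le> 0 + r" if r: "r > 0" for r
  proof -
   have "r / (?M + 1) > 0" using r M by simp
   from t(3)[OF a this] have "cmod (t (a, h, k) - hinner L (\<sigma> (iota X A a) h) k) \<le> r / (?M + 1) * ?M"
    using h k unfolding Z_def by force
   also have "\<dots> \<le> r / (?M + 1) * (?M + 1)" using r M by (intro mult_left_mono) auto
   finally show ?thesis using M by simp
  qed
  then have "cmod (t (a, h, k) - hinner L (\<sigma> (iota X A a) h) k) \<le> 0" by (rule field_le_epsilon)
  then show ?thesis by simp
 qed
 ultimately show thesis using t(2) by (intro that[of t])
qed

section \<open>The unique extension property makes the measure maximal\<close>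

lemma (in hilbert_space) eqI_inner_dense:
 assumes x: "x \<in> hcarrier H" and y: "y \<in> hcarrier H" and S: "S \<subseteq> hcarrier H"
  and dense: "!!z e. z \<in> hcarrier H ==> e > 0 ==> \<exists>s\<in>S. hdist H s z < e"
  and eq: "!!s. s \<in> S ==> hinner H x s = hinner H y s"
 shows "x = y"
proof (rule eq_if_sub_null[OF x y], rule ccontr)
 let ?d = "sub x y"
 assume ne: "hinner H ?d ?d \<noteq> 0"
 have d: "?d \<in> hcarrier H" using x y by simp
 have pos: "hnorm H ?d > 0" using ne norm_nonneg[OF d] by (auto simp: inner_self[OF d] less_le)
 obtain s where s: "s \<in> S" "hdist H s ?d < hnorm H ?d" using dense[OF d pos] by blast
 have sH: "s \<in> hcarrier H" using s S by blast
 have "hinner H ?d s = 0" using eq[OF s(1)] x y sH by (simp add: inner_simps)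
 then have "hinner H s ?d = 0" using inner_commute[OF d sH] by simp
 then have "cmod (hinner H ?d ?d) \<le> hdist H s ?d * hnorm H ?d" using inner_diff_le[OF sH d d] by simp
 also have "\<dots> < hnorm H ?d * hnorm H ?d" using s(2) pos by simp
 finally show False by (simp add: inner_self[OF d] power2_eq_square norm_mult)
qed

lemma iota_in_affine_cfun: "function_system X A ==> a \<in> A ==> iota X A a \<in> affine_cfun A (state_space X A)"
 using iota_in_cfun[of X A a] iota_apply[OF convex_states, of X A _ _ _ a]
 by (simp add: affine_cfun_def del: of_real_diff)

lemma iota_star:
 assumes X: "compact_space X" and A: "function_system X A" and a: "a \<in> A"
 shows "iota X A (cf_star X a) = cf_star (state_space X A) (iota X A a)"
 by (rule cfun_eqI[OF iota_in_cfun cf_star_in[OF iota_in_cfun]])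
  (use positive_functional_star[OF X A _ a] in \<open>auto simp: states_iff\<close>)

text \<open>The form of a completely positive map on \<open>C(X)\<close> that agrees with \<open>\<sigma>\<close> on \<open>A\<close>, compressed along
 \<open>V\<close>, is a completely positive extension of \<open>\<pi>\<^sub>\<mu>\<close> restricted to \<open>A\<close>, hence \<open>\<pi>\<^sub>\<mu>\<close> itself. Its positivity on
 \<open>a \<otimes> Vg - 1 \<otimes> \<sigma>(a)Vg\<close> then says that \<open>\<sigma>(a)Vg\<close> is no longer than \<open>V(ag)\<close>, which is its projection to the
 range of \<open>V\<close>: the two coincide.\<close>

lemma unique_extension_intertwines:
 assumes X: "compact_space X" "Hausdorff_space X" and A: "function_system X A"
  and \<mu>: "\<mu> \<in> pos_regular_measures X" and uep: "unique_extension_property X A (L2 \<mu>) (gns_rep X \<mu>)"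
  and L: "hilbert_space L" and \<sigma>: "star_rep (state_space X A) L \<sigma>" and V: "hisometry (L2 \<mu>) L V"
  and dil: "!!a f g. a \<in> A ==> f \<in> cfun X ==> g \<in> cfun X ==>
   hinner L (\<sigma> (iota X A a) (V (l2_class \<mu> f))) (V (l2_class \<mu> g)) =
   hinner (L2 \<mu>) (gns_rep X \<mu> a (l2_class \<mu> f)) (l2_class \<mu> g)"
  and a: "a \<in> A" and g: "g \<in> hcarrier (L2 \<mu>)"
 shows "\<sigma> (iota X A a) (V g) = V (gns_rep X \<mu> a g)"
proof -
 note A' = function_systemD[OF A] and \<mu>' = pos_regular_measuresD(1,2)[OF \<mu>]
 let ?K = "state_space X A"
 define H where "H = L2 \<mu>"
 define \<gamma> where "\<gamma> = gns_rep X \<mu>"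
 have HH: "hilbert_space H" unfolding H_def by (rule hilbert_space_L2[OF \<mu>'(2)])
 interpret H: hilbert_space H by (rule HH)
 interpret L: hilbert_space L by (rule L)
 have gns: "star_rep X H \<gamma>" unfolding H_def \<gamma>_def by (rule star_rep_gns_rep[OF X(1) \<mu>'])
 note glin = linear_into_bopsD[OF star_repD(1)[OF HH gns]] and gr = star_repD(2,3)[OF HH gns]
 note slin = linear_into_bopsD[OF star_repD(1)[OF L \<sigma>]] and sr = star_repD(2,3)[OF L \<sigma>]
 have Vlin: "V u \<in> hcarrier L" "V (hscale H c u) = hscale L c (V u)"
  "v \<in> hcarrier H ==> V (hadd H u v) = hadd L (V u) (V v)" if "u \<in> hcarrier H" for u v c
  using V that unfolding H_def[symmetric] hisometry_def hlinear_def by auto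
 note Vin = hisometry_inner[OF HH L V[folded H_def]]
 let ?D = "l2_class \<mu> ` cfun X"
 have D: "?D \<subseteq> hcarrier H" "!!z e. z \<in> hcarrier H ==> e > 0 ==> \<exists>s\<in>?D. hdist H s z < e"
  unfolding H_def using l2_class_in[OF cfun_sq_integrable[OF X(1) \<mu>']] cfun_dense_L2[OF X \<mu>] by blast+
 obtain t where t: "positive_form X L t"
  and bd: "!!f. f \<in> cfun X ==> \<exists>B. \<forall>h\<in>hcarrier L. \<forall>k\<in>hcarrier L. cmod (t (f, h, k)) \<le> B * (hnorm L h * hnorm L k)"
  and tA: "!!a h k. a \<in> A ==> h \<in> hcarrier L ==> k \<in> hcarrier L ==> t (a, h, k) = hinner L (\<sigma> (iota X A a) h) k"
  by (rule completely_positive_extension_form[OF X(1) A L \<sigma>]) (rule that)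
 note t1 = conjunct1[OF t[unfolded positive_form_def]] and t2 = conjunct2[OF t[unfolded positive_form_def]]
 have tlin: "g \<in> cfun X ==> t (cf_add X f g, h, k) = t (f, h, k) + t (g, h, k)"
  "t (cf_scale X c f, h, k) = c * t (f, h, k)"
  "h' \<in> hcarrier L ==> t (f, hadd L h h', k) = t (f, h, k) + t (f, h', k)"
  "t (f, hscale L c h, k) = c * t (f, h, k)"
  "k' \<in> hcarrier L ==> t (f, h, hadd L k k') = t (f, h, k) + t (f, h, k')"
  "t (f, h, hscale L c k) = cnj c * t (f, h, k)"
  if "f \<in> cfun X" "h \<in> hcarrier L" "k \<in> hcarrier L" for f g h k h' k' c
  using bspec[OF bspec[OF bspec[OF t1 that(1)] that(2)] that(3)] by auto
 have tpos: "(\<Sum>i<n. \<Sum>j<n. t (cf_mult X (cf_star X (f i)) (f j), u j, u i)) \<in> \<real>\<^sub>\<ge>\<^sub>0"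
  if "!!i. i < n ==> f i \<in> cfun X" "!!i. i < n ==> u i \<in> hcarrier L" for n :: nat and f u
  using bspec[OF t2, of "(n, f, u)"] that by simp
 have "\<forall>f\<in>cfun X. \<exists>T. T \<in> bops H \<and> (\<forall>x\<in>hcarrier H. \<forall>y\<in>hcarrier H. hinner H (T x) y = t (f, V x, V y))"
 proof
  fix f assume f: "f \<in> cfun X"
  obtain B where B: "!!h k. h \<in> hcarrier L ==> k \<in> hcarrier L ==> cmod (t (f, h, k)) \<le> B * (hnorm L h * hnorm L k)"
   using bd[OF f] by blast
  have nV: "hnorm L (V x) = hnorm H x" if "x \<in> hcarrier H" for x using V that by (simp add: hisometry_def H_def)
  obtain T where "T \<in> bops H" "!!x y. x \<in> hcarrier H ==> y \<in> hcarrier H ==> hinner H (T x) y = t (f, V x, V y)"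
  proof (rule H.operator_of_form[of "\<lambda>x y. t (f, V x, V y)" B])
   show "cmod (t (f, V x, V y)) \<le> B * hnorm H x * hnorm H y" if "x \<in> hcarrier H" "y \<in> hcarrier H" for x y
    using B[OF Vlin(1)[OF that(1)] Vlin(1)[OF that(2)]] nV that by (simp add: mult.assoc)
  qed (simp_all add: Vlin tlin[OF f] that)
  then show "\<exists>T. T \<in> bops H \<and> (\<forall>x\<in>hcarrier H. \<forall>y\<in>hcarrier H. hinner H (T x) y = t (f, V x, V y))" by blast
 qed
 from bchoice[OF this] obtain T where T: "\<forall>f\<in>cfun X. T f \<in> bops H \<and>
  (\<forall>x\<in>hcarrier H. \<forall>y\<in>hcarrier H. hinner H (T f x) y = t (f, V x, V y))" by (rule exE)
 define \<Phi> where "\<Phi> = restrict T (cfun X)"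
 have \<Phi>: "\<Phi> f \<in> bops H" if "f \<in> cfun X" for f using T that by (simp add: \<Phi>_def)
 have \<Phi>t: "hinner H (\<Phi> f x) y = t (f, V x, V y)" if "f \<in> cfun X" "x \<in> hcarrier H" "y \<in> hcarrier H" for f x y
  using T that by (simp add: \<Phi>_def)
 have \<Phi>E: "\<Phi> f \<in> hcarrier H \<rightarrow>\<^sub>E hcarrier H" if "f \<in> cfun X" for f using \<Phi>[OF that] by (simp add: bops_def hlinear_def)
 have \<Phi>H: "\<Phi> f x \<in> hcarrier H" if "f \<in> cfun X" "x \<in> hcarrier H" for f x using PiE_mem[OF \<Phi>E[OF that(1)] that(2)] .
 have ext: "\<Phi> f \<in> extensional (hcarrier H)" if "f \<in> cfun X" for f using \<Phi>E[OF that] by (simp add: PiE_def)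
 have lin: "linear_into_bops X H \<Phi>"
  unfolding linear_into_bops_def
 proof (intro conjI ballI allI)
  show "\<Phi> \<in> cfun X \<rightarrow>\<^sub>E bops H" using \<Phi> by (auto simp: \<Phi>_def PiE_def)
  fix f assume f: "f \<in> cfun X"
  show "\<Phi> (cf_scale X c f) = (\<lambda>h\<in>hcarrier H. hscale H c (\<Phi> f h))" for c
  proof (rule extensionalityI[OF ext[OF cf_scale_in[OF f]] restrict_extensional])
   fix x assume x: "x \<in> hcarrier H"
   have "\<Phi> (cf_scale X c f) x = hscale H c (\<Phi> f x)"
    by (rule H.eqI_inner) (use f x in \<open>simp_all add: \<Phi>H \<Phi>t cfun_closed H.inner_scale tlin Vlin\<close>)
   then show "\<Phi> (cf_scale X c f) x = (\<lambda>h\<in>hcarrier H. hscale H c (\<Phi> f h)) x" using x by simp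
  qed
  fix g assume g: "g \<in> cfun X"
  show "\<Phi> (cf_add X f g) = (\<lambda>h\<in>hcarrier H. hadd H (\<Phi> f h) (\<Phi> g h))"
  proof (rule extensionalityI[OF ext[OF cf_add_in[OF f g]] restrict_extensional])
   fix x assume x: "x \<in> hcarrier H"
   have "\<Phi> (cf_add X f g) x = hadd H (\<Phi> f x) (\<Phi> g x)"
    by (rule H.eqI_inner) (use f g x in \<open>simp_all add: \<Phi>H \<Phi>t cfun_closed H.inner_add tlin Vlin\<close>)
   then show "\<Phi> (cf_add X f g) x = (\<lambda>h\<in>hcarrier H. hadd H (\<Phi> f h) (\<Phi> g h)) x" using x by simp
  qed
 qed
 have "completely_positive X H \<Phi>"
 proof (rule completely_positiveI[OF HH lin])
  fix n :: nat and f h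
  assume f: "!!i. i < n ==> f i \<in> cfun X" and h: "!!i. i < n ==> h i \<in> hcarrier H"
  have "(\<Sum>i<n. \<Sum>j<n. hinner H (\<Phi> (cf_mult X (cf_star X (f i)) (f j)) (h j)) (h i)) =
    (\<Sum>i<n. \<Sum>j<n. t (cf_mult X (cf_star X (f i)) (f j), V (h j), V (h i)))"
   using f h by (intro sum.cong refl \<Phi>t) (auto simp: cfun_closed)
  also have "\<dots> \<in> \<real>\<^sub>\<ge>\<^sub>0" by (rule tpos) (use f h Vlin(1) in auto)
  finally show "(\<Sum>i<n. \<Sum>j<n. hinner H (\<Phi> (cf_mult X (cf_star X (f i)) (f j)) (h j)) (h i)) \<in> \<real>\<^sub>\<ge>\<^sub>0" .
 qed
 moreover have "\<Phi> a = \<gamma> a" if a: "a \<in> A" for a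
 proof (rule H.bops_eq_on_dense[OF _ _ D])
  have aX: "a \<in> cfun X" using a A'(1) by blast
  show "\<Phi> a \<in> bops H" "\<gamma> a \<in> bops H" using \<Phi> glin(1) aX by blast+
  fix u assume u: "u \<in> ?D"
  then have uH: "u \<in> hcarrier H" using D(1) by blast
  show "\<Phi> a u = \<gamma> a u"
  proof (rule H.eqI_inner_dense[OF \<Phi>H[OF aX uH] glin(2)[OF aX uH] D])
   fix v assume v: "v \<in> ?D"
   then have vH: "v \<in> hcarrier H" using D(1) by blast
   have "hinner H (\<Phi> a u) v = hinner L (\<sigma> (iota X A a) (V u)) (V v)"
    unfolding \<Phi>t[OF aX uH vH] by (rule tA[OF a Vlin(1)[OF uH] Vlin(1)[OF vH]])
   also have "\<dots> = hinner H (\<gamma> a u) v" using u v dil[OF a] by (auto simp: H_def \<gamma>_def)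
   finally show "hinner H (\<Phi> a u) v = hinner H (\<gamma> a u) v" .
  qed
 qed
 ultimately have "\<Phi> = \<gamma>"
  using uep star_rep_completely_positive[OF HH gns] unfolding unique_extension_property_def H_def[symmetric] \<gamma>_def[symmetric]
  by blast
 then have t\<gamma>: "t (f, V x, V y) = hinner H (\<gamma> f x) y" if "f \<in> cfun X" "x \<in> hcarrier H" "y \<in> hcarrier H" for f x y
  using \<Phi>t[OF that] by simp
 have aX: "a \<in> cfun X" and gH: "g \<in> hcarrier H" using a A'(1) g by (auto simp: H_def)
 define u where "u = V g"
 define v where "v = \<sigma> (iota X A a) u"
 define w where "w = V (\<gamma> a g)"
 define r where "r = hinner H (\<gamma> a g) (\<gamma> a g)"
 have ag: "\<gamma> a g \<in> hcarrier H" by (rule glin(2)[OF aX gH])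
 have u: "u \<in> hcarrier L" and w: "w \<in> hcarrier L" using Vlin(1) gH ag by (auto simp: u_def w_def)
 have v: "v \<in> hcarrier L" unfolding v_def by (rule slin(2)[OF iota_in_cfun u])
 have ww: "hinner L w w = r" unfolding w_def r_def by (rule Vin[OF ag ag])
 have vw: "hinner L v w = r"
  unfolding v_def tA[OF a u w, symmetric] unfolding u_def w_def r_def by (rule t\<gamma>[OF aX gH ag])
 have wv: "hinner L w v = r" using L.inner_commute[OF v w] vw H.inner_commute[OF ag ag] by (simp add: r_def)
 have taa: "t (cf_mult X (cf_star X a) a, u, u) = r"
 proof -
  have "t (cf_mult X (cf_star X a) a, u, u) = hinner H (\<gamma> (cf_mult X (cf_star X a) a) g) g"
   unfolding u_def by (rule t\<gamma>) (use aX gH in \<open>auto simp: cfun_closed\<close>)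
  also have "\<dots> = hinner H (\<gamma> a g) (\<gamma> (cf_star X (cf_star X a)) g)"
   using gr(1)[OF cf_star_in[OF aX] aX gH] gr(2)[OF cf_star_in[OF aX] ag gH] by simp
  also have "cf_star X (cf_star X a) = a" by (rule cfun_eqI) (use aX in \<open>auto simp: cfun_closed\<close>)
  finally show ?thesis by (simp add: r_def)
 qed
 have star: "hinner L (\<sigma> (iota X A (cf_star X a)) v) u = hinner L v v"
 proof -
  have "cf_star ?K (cf_star ?K (iota X A a)) = iota X A a"
   by (rule cfun_eqI[where X = ?K]) (auto simp: cfun_closed iota_in_cfun)
  then show ?thesis
   using sr(2)[OF cf_star_in[OF iota_in_cfun[of X A a]] v u] by (simp add: iota_star[OF X(1) A a] v_def)
 qed
 have unit: "\<sigma> (iota X A (cf_one X)) v = v"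
 proof -
  have "cf_mult ?K (iota X A (cf_one X)) (iota X A a) = iota X A a"
   by (rule cfun_eqI[where X = ?K]) (auto simp: cfun_closed iota_in_cfun states_iff)
  then show ?thesis using sr(1)[OF iota_in_cfun iota_in_cfun u, of "cf_one X" a] by (simp add: v_def)
 qed
 have one: "cf_mult X (cf_star X a) (cf_one X) = cf_star X a" "cf_mult X (cf_star X (cf_one X)) a = a"
  "cf_mult X (cf_star X (cf_one X)) (cf_one X) = cf_one X"
  using aX by (auto intro!: cfun_eqI[where X = X] simp: cfun_closed)
 \<comment> \<open>positivity on \<open>a \<otimes> u - 1 \<otimes> v\<close>\<close>
 have nv: "hscale L (-1) v \<in> hcarrier L" using v by simp
 have "(\<Sum>i<(2::nat). \<Sum>j<(2::nat). t (cf_mult X (cf_star X (if i = 0 then a else cf_one X)) (if j = 0 then a else cf_one X),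
   if j = 0 then u else hscale L (-1) v, if i = 0 then u else hscale L (-1) v)) \<in> \<real>\<^sub>\<ge>\<^sub>0"
  by (rule tpos) (use aX u nv in auto)
 also have "(\<Sum>i<(2::nat). \<Sum>j<(2::nat). t (cf_mult X (cf_star X (if i = 0 then a else cf_one X)) (if j = 0 then a else cf_one X),
   if j = 0 then u else hscale L (-1) v, if i = 0 then u else hscale L (-1) v)) =
   t (cf_mult X (cf_star X a) a, u, u) + t (cf_star X a, hscale L (-1) v, u) +
   (t (a, u, hscale L (-1) v) + t (cf_one X, hscale L (-1) v, hscale L (-1) v))"
  by (simp add: numeral_2_eq_2 one)
 also have "\<dots> = r - hinner L v v"
  using aX u v nv tA[OF A'(5)[OF a] v u] tA[OF a u v] tA[OF A'(2) v v]
  by (simp add: taa tlin cfun_closed star unit flip: v_def)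
 finally have "r - hinner L v v \<in> \<real>\<^sub>\<ge>\<^sub>0" .
 moreover have "hinner L (L.sub v w) (L.sub v w) = hinner L v v - r"
  using v w by (simp add: L.inner_simps vw wv ww)
 moreover have "hinner L (L.sub v w) (L.sub v w) \<in> \<real>\<^sub>\<ge>\<^sub>0" using v w by (intro L.inner_nonneg) simp
 ultimately have "hinner L (L.sub v w) (L.sub v w) = 0" by (simp add: complex_nonneg_Reals_iff complex_eq_iff)
 then have "v = w" by (rule L.eq_if_sub_null[OF v w])
 then show ?thesis by (simp add: v_def u_def w_def \<gamma>_def)
qed


text \<open>The functions \<open>f\<close> on \<open>K\<close> for which \<open>V\<close> intertwines \<open>\<pi>\<^sub>\<mu>(q f)\<close> with \<open>\<sigma>(f)\<close> form a C*-algebra, and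
 \<open>C(K)\<close> is generated by the image of \<open>A\<close>.\<close>

lemma intertwiner_extends:
 assumes X: "compact_space X" and A: "function_system X A" and \<mu>: "\<mu> \<in> pos_regular_measures X"
  and q: "star_hom (state_space X A) X q" "!!a. a \<in> A ==> q (iota X A a) = a"
  and L: "hilbert_space L" and \<sigma>: "star_rep (state_space X A) L \<sigma>" and V: "hisometry (L2 \<mu>) L V"
  and iota: "!!a u. a \<in> A ==> u \<in> hcarrier (L2 \<mu>) ==> \<sigma> (iota X A a) (V u) = V (gns_rep X \<mu> a u)"
  and f: "f \<in> cfun (state_space X A)" and u: "u \<in> hcarrier (L2 \<mu>)"
 shows "\<sigma> f (V u) = V (gns_rep X \<mu> (q f) u)"
proof -
 note A' = function_systemD[OF A] and \<mu>' = pos_regular_measuresD(1,2)[OF \<mu>]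
 let ?K = "state_space X A"
 note K = compact_state_space[OF X A]
 define H where "H = L2 \<mu>"
 define \<gamma> where "\<gamma> = gns_rep X \<mu>"
 have HH: "hilbert_space H" unfolding H_def by (rule hilbert_space_L2[OF \<mu>'(2)])
 interpret H: hilbert_space H by (rule HH)
 interpret L: hilbert_space L by (rule L)
 have gns: "star_rep X H \<gamma>" unfolding H_def \<gamma>_def by (rule star_rep_gns_rep[OF X \<mu>'])
 note glin = linear_into_bopsD[OF star_repD(1)[OF HH gns]] and gr = star_repD(2,3)[OF HH gns]
 note slin = linear_into_bopsD[OF star_repD(1)[OF L \<sigma>]] and sr = star_repD(2,3)[OF L \<sigma>]
 have Vlin: "V u \<in> hcarrier L" "V (hscale H c u) = hscale L c (V u)" "hnorm L (V u) = hnorm H u"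
  "v \<in> hcarrier H ==> V (hadd H u v) = hadd L (V u) (V v)" if "u \<in> hcarrier H" for u v c
  using V that unfolding H_def[symmetric] hisometry_def hlinear_def by auto
 have q': "q f \<in> cfun X" "q (cf_scale ?K c f) = cf_scale X c (q f)" "q (cf_star ?K f) = cf_star X (q f)"
  "g \<in> cfun ?K ==> q (cf_add ?K f g) = cf_add X (q f) (q g)"
  "g \<in> cfun ?K ==> q (cf_mult ?K f g) = cf_mult X (q f) (q g)" if "f \<in> cfun ?K" for f g c
  using q(1) that by (auto simp: star_hom_def)
 define B where "B = {f \<in> cfun ?K. \<forall>u\<in>hcarrier H. \<sigma> f (V u) = V (\<gamma> (q f) u)}"
 have B: "f \<in> cfun ?K" "u \<in> hcarrier H ==> \<sigma> f (V u) = V (\<gamma> (q f) u)" if "f \<in> B" for f u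
  using that by (auto simp: B_def)
 have B_add: "cf_add ?K f g \<in> B" if "f \<in> B" "g \<in> B" for f g
  using B[OF that(1)] B[OF that(2)] by (simp add: B_def cfun_closed slin(3) glin(2,3) Vlin q')
 have B_scale: "cf_scale ?K c f \<in> B" if "f \<in> B" for f c
  using B[OF that] by (simp add: B_def cfun_closed slin(4) glin(2,4) Vlin q')
 have B_mult: "cf_mult ?K f g \<in> B" if "f \<in> B" "g \<in> B" for f g
  using B[OF that(1)] B[OF that(2)] by (simp add: B_def cfun_closed sr(1) gr(1) glin(2) Vlin q')
 have B_closed: "f \<in> B"
  if f: "f \<in> cfun ?K" and near: "!!e. e > 0 ==> \<exists>g\<in>B. \<forall>\<alpha>\<in>topspace ?K. cmod (f \<alpha> - g \<alpha>) \<le> e" for f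
 proof -
  have "\<sigma> f (V u) = V (\<gamma> (q f) u)" if u: "u \<in> hcarrier H" for u
  proof (rule L.eqI_inner)
   show c: "\<sigma> f (V u) \<in> hcarrier L" "V (\<gamma> (q f) u) \<in> hcarrier L" using slin(2) glin(2) Vlin(1) f u q' by auto
   fix z assume z: "z \<in> hcarrier L"
   define M where "M = hnorm H u * hnorm L z"
   have M: "M \<ge> 0" using u z by (simp add: M_def)
   have "cmod (hinner L (\<sigma> f (V u)) z - hinner L (V (\<gamma> (q f) u)) z) \<le> 0 + e" if e: "e > 0" for e
   proof -
    define r where "r = e / (2 * (M + 1))"
    have r: "r > 0" using e M by (simp add: r_def)
    obtain g where g: "g \<in> B" "!!\<alpha>. \<alpha> \<in> topspace ?K ==> cmod (f \<alpha> - g \<alpha>) \<le> r" using near[OF r] by blast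
    define k where "k = cf_add ?K f (cf_scale ?K (-1) g)"
    have k: "k \<in> cfun ?K" using f B(1)[OF g(1)] by (simp add: k_def cfun_closed)
    have kr: "cmod (k \<alpha>) \<le> r" if "\<alpha> \<in> topspace ?K" for \<alpha> using g(2)[OF that] that by (simp add: k_def)
    have f_eq: "f = cf_add ?K k g"
     by (rule cfun_eqI[where X = ?K]) (use f B(1)[OF g(1)] k in \<open>auto simp: k_def cfun_closed\<close>)
    have n1: "hnorm L (\<sigma> k (V u)) \<le> r * hnorm H u"
     using star_rep_norm_le(1)[OF K L \<sigma> k _ kr Vlin(1)[OF u]] r by (simp add: Vlin(3)[OF u])
    have n2: "hnorm L (V (\<gamma> (q k) u)) \<le> r * hnorm H u"
     unfolding Vlin(3)[OF glin(2)[OF q'(1)[OF k] u]]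
     by (rule star_rep_norm_le(1)[OF X HH gns q'(1)[OF k] _ _ u])
      (use r kr quotient_eval[OF X A q k] point_state_in_states[OF A] in auto)
    have cs: "\<sigma> k (V u) \<in> hcarrier L" "V (\<gamma> (q k) u) \<in> hcarrier L" using slin(2) glin(2) Vlin(1) k u q' by auto
    have "hinner L (\<sigma> f (V u)) z - hinner L (V (\<gamma> (q f) u)) z = hinner L (\<sigma> k (V u)) z - hinner L (V (\<gamma> (q k) u)) z"
     unfolding f_eq using k B[OF g(1)] u z cs
     by (simp add: slin(2,3) glin(2,3) q' Vlin L.inner_add)
    also have "cmod \<dots> \<le> cmod (hinner L (\<sigma> k (V u)) z) + cmod (hinner L (V (\<gamma> (q k) u)) z)" by (rule norm_triangle_ineq4)
    also have "\<dots> \<le> hnorm L (\<sigma> k (V u)) * hnorm L z + hnorm L (V (\<gamma> (q k) u)) * hnorm L z"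
     by (intro add_mono L.Cauchy_Schwarz cs z)
    also have "\<dots> \<le> r * hnorm H u * hnorm L z + r * hnorm H u * hnorm L z"
     using n1 n2 z by (intro add_mono mult_right_mono) auto
    also have "\<dots> = 2 * (r * M)" by (simp add: M_def)
    also have "\<dots> \<le> 2 * (r * (M + 1))" using r by simp
    also have "\<dots> = e" using M by (simp add: r_def field_simps)
    finally show ?thesis by simp
   qed
   then have "cmod (hinner L (\<sigma> f (V u)) z - hinner L (V (\<gamma> (q f) u)) z) \<le> 0" by (rule field_le_epsilon)
   then show "hinner L (\<sigma> f (V u)) z = hinner L (V (\<gamma> (q f) u)) z" by simp
  qed
  then show ?thesis using f by (simp add: B_def)
 qed
 have B_iota: "iota X A a \<in> B" if "a \<in> A" for a
  using iota[OF that] q(2)[OF that] iota_in_cfun[of X A a] by (simp add: B_def H_def \<gamma>_def)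
 define C where "C = {f \<in> B. cf_star ?K f \<in> B}"
 have "cstar_subalgebra ?K C"
  unfolding cstar_subalgebra_def
 proof (intro conjI ballI allI)
  show "C \<subseteq> cfun ?K" using B(1) by (auto simp: C_def)
  show "C \<noteq> {}" using B_iota[OF A'(2)] B_iota[OF A'(5)[OF A'(2)]] iota_star[OF X A A'(2)] by (auto simp: C_def)
  fix f assume "f \<in> C"
  then have f: "f \<in> B" "cf_star ?K f \<in> B" by (auto simp: C_def)
  have "cf_star ?K (cf_star ?K f) = f"
   by (rule cfun_eqI[where X = ?K]) (use B(1)[OF f(1)] in \<open>auto simp: cfun_closed\<close>)
  then show "cf_star ?K f \<in> C" using f by (simp add: C_def)
  have "cf_star ?K (cf_scale ?K c f) = cf_scale ?K (cnj c) (cf_star ?K f)" for c by (auto simp: cf_star_def cf_scale_def)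
  then show "cf_scale ?K c f \<in> C" for c using f B_scale by (simp add: C_def)
  fix g assume "g \<in> C"
  then have g: "g \<in> B" "cf_star ?K g \<in> B" by (auto simp: C_def)
  have "cf_star ?K (cf_add ?K f g) = cf_add ?K (cf_star ?K f) (cf_star ?K g)"
   "cf_star ?K (cf_mult ?K f g) = cf_mult ?K (cf_star ?K f) (cf_star ?K g)"
   by (auto simp: cf_star_def cf_add_def cf_mult_def)
  then show "cf_add ?K f g \<in> C" "cf_mult ?K f g \<in> C" using f g B_add B_mult by (simp_all add: C_def)
 next
  show "norm_closed ?K C"
   unfolding norm_closed_iff[OF K]
  proof (intro conjI ballI impI)
   show "C \<subseteq> cfun ?K" using B(1) by (auto simp: C_def)
   fix f assume f: "f \<in> cfun ?K" and near: "\<forall>e>0. \<exists>g\<in>C. \<forall>\<alpha>\<in>topspace ?K. cmod (f \<alpha> - g \<alpha>) \<le> e"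
   have "f \<in> B" by (rule B_closed[OF f]) (use near in \<open>force simp: C_def\<close>)
   moreover have "cf_star ?K f \<in> B"
   proof (rule B_closed[OF cf_star_in[OF f]])
    fix e :: real assume "e > 0"
    then obtain g where g: "g \<in> C" "!!\<alpha>. \<alpha> \<in> topspace ?K ==> cmod (f \<alpha> - g \<alpha>) \<le> e" using near by blast
    have "cmod (cf_star ?K f \<alpha> - cf_star ?K g \<alpha>) \<le> e" if "\<alpha> \<in> topspace ?K" for \<alpha>
     using g(2)[OF that] that complex_mod_cnj[of "f \<alpha> - g \<alpha>"] by simp
    then show "\<exists>h\<in>B. \<forall>\<alpha>\<in>topspace ?K. cmod (cf_star ?K f \<alpha> - h \<alpha>) \<le> e"
     using g(1) by (intro bexI[of _ "cf_star ?K g"]) (auto simp: C_def)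
   qed
   ultimately show "f \<in> C" by (simp add: C_def)
  qed
 qed
 moreover have "iota X A a \<in> C" if "a \<in> A" for a
  using B_iota[OF that] B_iota[OF A'(5)[OF that]] iota_star[OF X A that] by (simp add: C_def)
 ultimately have "C = cfun ?K" by (rule iota_generates_cfun[OF X A])
 then have "f \<in> B" using f by (auto simp: C_def)
 from B(2)[OF this u[folded H_def]] show ?thesis by (simp add: \<gamma>_def)
qed

text \<open>Compressing a dilation of a representation of \<open>\<mu> \<circ> (q\<^sup>*)\<^sup>-\<^sup>1\<close> to its cyclic part \<open>L\<^sup>2(\<mu>)\<close> leads to the
 intertwining situation; neither representation has to be unital, so the cyclic vector is \<open>\<pi>(1)\<xi>\<close>.\<close>

lemma unique_extension_imp_trivial_dilation:
 assumes X: "compact_space X" "Hausdorff_space X" and A: "function_system X A" and gen: "generates_cfun X A"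
  and \<mu>: "\<mu> \<in> pos_regular_measures X"
  and q: "star_hom (state_space X A) X q" "!!a. a \<in> A ==> q (iota X A a) = a"
  and uep: "unique_extension_property X A (L2 \<mu>) (gns_rep X \<mu>)"
  and H: "hilbert_space H" and \<pi>: "star_rep (state_space X A) H \<pi>" and \<xi>: "\<xi> \<in> hcarrier H"
  and state: "!!f. f \<in> cfun (state_space X A) ==> hinner H (\<pi> f \<xi>) \<xi> = (\<integral>x. q f x \<partial>\<mu>)"
  and L: "hilbert_space L" and \<sigma>: "star_rep (state_space X A) L \<sigma>" and V: "hisometry H L V"
  and dil: "!!a u v. a \<in> affine_cfun A (state_space X A) ==> u \<in> hcarrier H ==> v \<in> hcarrier H ==>
   hinner L (\<sigma> a (V u)) (V v) = hinner H (\<pi> a u) v"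
  and f: "f \<in> cfun (state_space X A)"
 shows "hinner L (\<sigma> f (V \<xi>)) (V \<xi>) = (\<integral>x. q f x \<partial>\<mu>)"
proof -
 note A' = function_systemD[OF A] and \<mu>' = pos_regular_measuresD(1,2)[OF \<mu>]
 let ?K = "state_space X A" and ?M = "L2 \<mu>" and ?cl = "l2_class \<mu>" and ?D = "l2_class \<mu> ` cfun X"
 note K = compact_state_space[OF X(1) A] Hausdorff_state_space[of X A]
 have M: "hilbert_space ?M" by (rule hilbert_space_L2[OF \<mu>'(2)])
 interpret H: hilbert_space H by (rule H)
 interpret L: hilbert_space L by (rule L)
 interpret M: hilbert_space ?M by (rule M)
 note plin = linear_into_bopsD[OF star_repD(1)[OF H \<pi>]] and pr = star_repD(2,3)[OF H \<pi>]
 note slin = linear_into_bopsD[OF star_repD(1)[OF L \<sigma>]] and sr = star_repD(2,3)[OF L \<sigma>]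
 have q': "q f \<in> cfun X" "q (cf_star ?K f) = cf_star X (q f)"
  "g \<in> cfun ?K ==> q (cf_mult ?K f g) = cf_mult X (q f) (q g)" if "f \<in> cfun ?K" for f g
  using q(1) that by (auto simp: star_hom_def)
 have star2: "cf_star ?K (cf_star ?K f) = f" if "f \<in> cfun ?K" for f
  by (rule cfun_eqI[where X = ?K]) (use that in \<open>auto simp: cfun_closed\<close>)
 have VL: "V u \<in> hcarrier L" if "u \<in> hcarrier H" for u using V that by (auto simp: hisometry_def hlinear_def)
 have cl: "?cl F \<in> hcarrier ?M" if "F \<in> cfun X" for F by (rule l2_class_in[OF cfun_sq_integrable[OF X(1) \<mu>' that]])
 have D: "?D \<subseteq> hcarrier ?M" "!!z e. z \<in> hcarrier ?M ==> e > 0 ==> \<exists>s\<in>?D. hdist ?M s z < e"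
  using cl cfun_dense_L2[OF X \<mu>] by blast+
 have \<pi>inn: "hinner H (\<pi> f \<xi>) (\<pi> g \<xi>) = hinner ?M (?cl (q f)) (?cl (q g))" if f: "f \<in> cfun ?K" and g: "g \<in> cfun ?K" for f g
 proof -
  have gf: "cf_mult ?K (cf_star ?K g) f \<in> cfun ?K" using f g by (simp add: cfun_closed)
  have "hinner H (\<pi> f \<xi>) (\<pi> g \<xi>) = hinner H (\<pi> (cf_star ?K g) (\<pi> f \<xi>)) \<xi>"
   using pr(2)[OF cf_star_in[OF g] plin(2)[OF f \<xi>] \<xi>] by (simp add: star2[OF g])
  also have "\<dots> = (\<integral>x. q (cf_mult ?K (cf_star ?K g) f) x \<partial>\<mu>)"
   using state[OF gf] pr(1)[OF cf_star_in[OF g] f \<xi>] by simp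
  also have "q (cf_mult ?K (cf_star ?K g) f) = cf_mult X (q f) (cf_star X (q g))"
   using f g by (simp add: q' cfun_closed) (auto simp: cf_mult_def)
  finally show ?thesis by (simp add: L2_inner_cfun[OF X(1) \<mu>' q'(1)[OF f] q'(1)[OF g]])
 qed
 have onto: "\<exists>f. f \<in> cfun ?K \<and> q f = F" if F: "F \<in> cfun X" for F
 proof -
  obtain f where f: "f \<in> cfun ?K" "!!x. x \<in> topspace X ==> f (point_state A x) = F x"
   by (rule cfun_extend_along_embedding[OF X(1) K continuous_map_point_state[OF A] inj_on_point_state[OF X A gen] F]) (rule that)
  have "q f = F" by (rule cfun_eqI) (use q'(1)[OF f(1)] F quotient_eval[OF X(1) A q f(1)] f(2) in auto)
  with f(1) show ?thesis by blast
 qed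
 have "\<forall>s\<in>?D. \<exists>f. f \<in> cfun ?K \<and> s = ?cl (q f)" using onto by blast
 from bchoice[OF this] obtain lf where lf: "\<forall>s\<in>?D. lf s \<in> cfun ?K \<and> s = ?cl (q (lf s))" by (rule exE)
 have lf: "lf s \<in> cfun ?K" "?cl (q (lf s)) = s" if "s \<in> ?D" for s using lf that by auto
 obtain W where W: "hisometry ?M H W" "!!s. s \<in> ?D ==> W s = \<pi> (lf s) \<xi>"
 proof (rule extend_isometry[OF M H D])
  show "\<pi> (lf s) \<xi> \<in> hcarrier H" if "s \<in> ?D" for s by (rule plin(2)[OF lf(1)[OF that] \<xi>])
  show "hinner H (\<pi> (lf s) \<xi>) (\<pi> (lf s') \<xi>) = hinner ?M s s'" if s: "s \<in> ?D" "s' \<in> ?D" for s s'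
   using \<pi>inn[OF lf(1)[OF s(1)] lf(1)[OF s(2)]] unfolding lf(2)[OF s(1)] lf(2)[OF s(2)] .
 qed (assumption+, rule that)
 have Wq: "W (?cl (q f)) = \<pi> f \<xi>" if f: "f \<in> cfun ?K" for f
 proof -
  define g where "g = lf (?cl (q f))"
  have D: "?cl (q f) \<in> ?D" using q'(1)[OF f] by blast
  have g: "g \<in> cfun ?K" "?cl (q g) = ?cl (q f)" "W (?cl (q f)) = \<pi> g \<xi>"
   unfolding g_def by (fact lf(1)[OF D], fact lf(2)[OF D], fact W(2)[OF D])
  have "\<pi> g \<xi> = \<pi> f \<xi>"
   using plin(2)[OF f \<xi>] plin(2)[OF g(1) \<xi>]
   by (intro H.eq_if_sub_null) (simp_all add: H.inner_simps \<pi>inn f g)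
  then show ?thesis using g by simp
 qed
 have WH: "W u \<in> hcarrier H" if "u \<in> hcarrier ?M" for u using W(1) that by (auto simp: hisometry_def hlinear_def)
 define V' where "V' = (\<lambda>u\<in>hcarrier ?M. V (W u))"
 have V': "hisometry ?M L V'"
  by (rule hisometryI[OF M L])
   (use VL WH hisometry_inner[OF H L V] hisometry_inner[OF M H W(1)] in \<open>auto simp: V'_def\<close>)
 have dil': "hinner L (\<sigma> (iota X A a) (V' (?cl F))) (V' (?cl G)) = hinner ?M (gns_rep X \<mu> a (?cl F)) (?cl G)"
  if a: "a \<in> A" and F: "F \<in> cfun X" and G: "G \<in> cfun X" for a F G
 proof -
  obtain f where f: "f \<in> cfun ?K" "q f = F" using onto[OF F] by blast
  obtain g where g: "g \<in> cfun ?K" "q g = G" using onto[OF G] by blast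
  have aX: "a \<in> cfun X" using a A'(1) by blast
  have af: "cf_mult ?K (iota X A a) f \<in> cfun ?K" by (rule cf_mult_in[OF iota_in_cfun f(1)])
  have "hinner L (\<sigma> (iota X A a) (V' (?cl F))) (V' (?cl G)) = hinner H (\<pi> (iota X A a) (\<pi> f \<xi>)) (\<pi> g \<xi>)"
   using dil[OF iota_in_affine_cfun[OF A a] WH[OF cl[OF F]] WH[OF cl[OF G]]] cl[OF F] cl[OF G] Wq[OF f(1)] Wq[OF g(1)]
   by (simp add: V'_def f g)
  also have "\<dots> = hinner ?M (?cl (q (cf_mult ?K (iota X A a) f))) (?cl G)"
   using pr(1)[OF iota_in_cfun f(1) \<xi>] \<pi>inn[OF af g(1)] by (simp add: g)
  also have "q (cf_mult ?K (iota X A a) f) = cf_mult X a F" using q'(3)[OF iota_in_cfun f(1)] q(2)[OF a] by (simp add: f)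
  finally show ?thesis by (simp add: gns_rep_cfun[OF X(1) \<mu>' aX F])
 qed
 have inter: "\<sigma> f (V' u) = V' (gns_rep X \<mu> (q f) u)" if u: "u \<in> hcarrier ?M" for u
 proof (rule intertwiner_extends[OF X(1) A \<mu> q L \<sigma> V' _ f u])
  show "\<sigma> (iota X A a) (V' v) = V' (gns_rep X \<mu> a v)" if "a \<in> A" "v \<in> hcarrier ?M" for a v
   by (rule unique_extension_intertwines[OF X A \<mu> uep L \<sigma> V' dil' that])
 qed
 let ?one = "cf_one ?K"
 have one_mult: "cf_mult ?K ?one g = g" "cf_mult ?K g ?one = g" "cf_star ?K ?one = ?one" if "g \<in> cfun ?K" for g
  using that by (auto intro!: cfun_eqI[where X = ?K] simp: cfun_closed)
 have iota1: "iota X A (cf_one X) = ?one" by (rule cfun_eqI[OF iota_in_cfun]) (auto simp: states_iff)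
 have one_aff: "?one \<in> affine_cfun A ?K" using iota_in_affine_cfun[OF A A'(2)] by (simp add: iota1)
 define p where "p = \<pi> ?one \<xi>"
 have p: "p \<in> hcarrier H" unfolding p_def by (rule plin(2)[OF cf_one_in \<xi>])
 have pp: "\<pi> ?one p = p" using pr(1)[OF cf_one_in cf_one_in \<xi>] by (simp add: p_def one_mult)
 have p\<xi>: "hinner H p \<xi> = hinner H p p"
  using pr(2)[OF cf_one_in p \<xi>] by (simp add: pp one_mult(3)[OF cf_one_in] flip: p_def)
 let ?s = "\<lambda>x. \<sigma> ?one (V x)"
 have sL: "?s x \<in> hcarrier L" if "x \<in> hcarrier H" for x by (rule slin(2)[OF cf_one_in VL[OF that]])
 have ss: "hinner L (?s x) (?s y) = hinner H (\<pi> ?one x) y" if x: "x \<in> hcarrier H" and y: "y \<in> hcarrier H" for x y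
  using sr(2)[OF cf_one_in sL[OF x] VL[OF y]] sr(1)[OF cf_one_in cf_one_in VL[OF x]] dil[OF one_aff x y]
  by (simp add: one_mult(1)[OF cf_one_in] one_mult(3)[OF cf_one_in])
 \<comment> \<open>\<open>\<sigma>(1)V\<close> cannot see the part \<open>\<xi> - p\<close> of \<open>\<xi>\<close> on which \<open>\<pi>\<close> vanishes\<close>
 have "?s \<xi> = ?s p"
  by (rule L.eq_if_sub_null[OF sL[OF \<xi>] sL[OF p]])
   (use sL[OF \<xi>] sL[OF p] \<xi> p in \<open>simp add: L.inner_simps ss pp p\<xi> flip: p_def\<close>)
 moreover have cut: "hinner L (\<sigma> f (V x)) (V x) = hinner L (\<sigma> f (?s x)) (?s x)" if x: "x \<in> hcarrier H" for x
 proof -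
  have fs: "\<sigma> f (?s x) = \<sigma> f (V x)" using sr(1)[OF f cf_one_in VL[OF x]] by (simp add: one_mult f)
  have "hinner L (\<sigma> f (V x)) (?s x) = hinner L (\<sigma> ?one (\<sigma> f (V x))) (V x)"
   using sr(2)[OF cf_one_in slin(2)[OF f VL[OF x]] VL[OF x]] by (simp add: one_mult(3)[OF f])
  also have "\<dots> = hinner L (\<sigma> f (V x)) (V x)" using sr(1)[OF cf_one_in f VL[OF x]] by (simp add: one_mult f)
  finally show ?thesis by (simp add: fs)
 qed
 ultimately have "hinner L (\<sigma> f (V \<xi>)) (V \<xi>) = hinner L (\<sigma> f (V p)) (V p)" using cut[OF \<xi>] cut[OF p] by simp
 also have "V p = V' (?cl (q ?one))" using Wq[OF cf_one_in] cl[OF q'(1)[OF cf_one_in]] by (simp add: V'_def p_def)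
 also have "q ?one = cf_one X" using q(2)[OF A'(2)] by (simp add: iota1)
 also have "\<sigma> f (V' (?cl (cf_one X))) = V' (gns_rep X \<mu> (q f) (?cl (cf_one X)))"
  by (rule inter[OF cl[OF cf_one_in]])
 also have "gns_rep X \<mu> (q f) (?cl (cf_one X)) = ?cl (cf_mult X (q f) (cf_one X))"
  by (rule gns_rep_cfun[OF X(1) \<mu>' q'(1)[OF f] cf_one_in])
 also have "cf_mult X (q f) (cf_one X) = q f"
  by (rule cfun_eqI) (use q'(1)[OF f] in \<open>auto simp: cfun_closed\<close>)
 also have "hinner L (V' (?cl (q f))) (V' (?cl (cf_one X))) = hinner ?M (?cl (q f)) (?cl (cf_one X))"
  by (rule hisometry_inner[OF M L V' cl[OF q'(1)[OF f]] cl[OF cf_one_in]])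
 also have "\<dots> = (\<integral>x. cf_mult X (q f) (cf_star X (cf_one X)) x \<partial>\<mu>)" by (rule L2_inner_cfun[OF X(1) \<mu>' q'(1)[OF f] cf_one_in])
 also have "cf_mult X (q f) (cf_star X (cf_one X)) = q f"
  by (rule cfun_eqI) (use q'(1)[OF f] in \<open>auto simp: cfun_closed\<close>)
 finally show ?thesis .
qed

theorem unique_extension_imp_maximal:
 fixes X :: "'x topology" and q :: "((('x => complex) => complex) => complex) => 'x => complex"
 assumes X: "compact_space X" "Hausdorff_space X" and A: "function_system X A" and gen: "generates_cfun X A"
  and \<mu>: "\<mu> \<in> pos_regular_measures X"
  and q: "star_hom (state_space X A) X q" "!!a. a \<in> A ==> q (iota X A a) = a"
  and uep: "unique_extension_property X A (L2 \<mu>) (gns_rep X \<mu>)"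
 shows "dilation_maximal TYPE('v) A (state_space X A)
   (distr \<mu> (borel_of_top (state_space X A)) (adjoint_point (state_space X A) q))"
 unfolding dilation_maximal_def
proof (intro conjI ballI impI)
 let ?K = "state_space X A"
 let ?\<nu> = "distr \<mu> (borel_of_top ?K) (adjoint_point ?K q)"
 note K = compact_state_space[OF X(1) A] Hausdorff_state_space[of X A]
 have push: "?\<nu> = distr \<mu> (borel_of_top ?K) (point_state A)"
  "f \<in> cfun ?K ==> (\<integral>x. f x \<partial>?\<nu>) = (\<integral>x. q f x \<partial>\<mu>)" for f
  by (rule integral_pushforward(1)[OF X(1) A \<mu> q], assumption) (rule integral_pushforward(2)[OF X(1) A \<mu> q])
 show reg: "?\<nu> \<in> pos_regular_measures ?K"
  unfolding push(1) by (rule regular_distr[OF X K \<mu> continuous_map_point_state[OF A]])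
 fix \<nu> assume \<nu>: "\<nu> \<in> pos_regular_measures ?K" and le: "dilation_le TYPE('v) A ?K ?\<nu> \<nu>"
 obtain \<pi> and H :: "'v hspace" and \<xi> \<sigma> and L :: "'v hspace" and \<eta>
  where r: "represents ?K ?\<nu> \<pi> H \<xi>" and r': "represents ?K \<nu> \<sigma> L \<eta>" and d: "dilated_by A ?K \<pi> H \<xi> \<sigma> L \<eta>"
  using le unfolding dilation_le_def by blast
 have H: "hilbert_space H" "star_rep ?K H \<pi>" "\<xi> \<in> hcarrier H" and L: "hilbert_space L" "star_rep ?K L \<sigma>"
  using r r' by (auto simp: represents_def)
 obtain V where V: "hisometry H L V" "\<eta> = V \<xi>"
  and dil: "!!a u v. a \<in> affine_cfun A ?K ==> u \<in> hcarrier H ==> v \<in> hcarrier H ==>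
   hinner L (\<sigma> a (V u)) (V v) = hinner H (\<pi> a u) v"
  by (rule dilated_byD[OF d H(1) L(2,1)]) (rule that)
 show "\<nu> = ?\<nu>"
 proof (rule regular_measure_eqI[OF K \<nu> reg])
  fix f assume f: "f \<in> cfun ?K"
  have st: "hinner H (\<pi> g \<xi>) \<xi> = (\<integral>x. q g x \<partial>\<mu>)" if "g \<in> cfun ?K" for g
   using r push(2)[OF that] that by (simp add: represents_def)
  have "(\<integral>x. f x \<partial>\<nu>) = hinner L (\<sigma> f (V \<xi>)) (V \<xi>)" using r' f by (simp add: represents_def V(2))
  also have "\<dots> = (\<integral>x. q f x \<partial>\<mu>)"
   by (rule unique_extension_imp_trivial_dilation[OF X A gen \<mu> q uep H st L V(1) dil f])
  also have "\<dots> = (\<integral>x. f x \<partial>?\<nu>)" using push(2)[OF f] by simp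
  finally show "(\<integral>x. f x \<partial>\<nu>) = (\<integral>x. f x \<partial>?\<nu>)" .
 qed
qed

section \<open>The characterisation\<close>

theorem corollary7p9:
  fixes X :: "'x topology"
    and A :: "('x \<Rightarrow> complex) set"
    and \<mu> :: "'x measure"
    and K :: "(('x \<Rightarrow> complex) \<Rightarrow> complex) topology"
    and q :: "((('x \<Rightarrow> complex) \<Rightarrow> complex) \<Rightarrow> complex) \<Rightarrow> 'x \<Rightarrow> complex"
  assumes "compact_space X" and "Hausdorff_space X"
    and "function_system X A" and "generates_cfun X A"
    and "\<mu> \<in> pos_regular_measures X"
    and "K = state_space X A"
    and "star_hom K X q" and "\<And>a. a \<in> A \<Longrightarrow> q (iota X A a) = a"
  shows "unique_extension_property X A (L2 \<mu>) (gns_rep X \<mu>) \<longleftrightarrow>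
    dilation_maximal TYPE((('x \<Rightarrow> complex) \<Rightarrow> complex, 'u) hilbert_universe) A K
      (distr \<mu> (borel_of_top K) (adjoint_point K q))"
proof
  note q = assms(7)[unfolded assms(6)] assms(8)
  show "dilation_maximal TYPE((('x \<Rightarrow> complex) \<Rightarrow> complex, 'u) hilbert_universe) A K
      (distr \<mu> (borel_of_top K) (adjoint_point K q))" if "unique_extension_property X A (L2 \<mu>) (gns_rep X \<mu>)"
    unfolding assms(6) by (rule unique_extension_imp_maximal[OF assms(1-5) q that])
  show "unique_extension_property X A (L2 \<mu>) (gns_rep X \<mu>)"
    if max: "dilation_maximal TYPE((('x \<Rightarrow> complex) \<Rightarrow> complex, 'u) hilbert_universe) A K
      (distr \<mu> (borel_of_top K) (adjoint_point K q))"
    by (rule maximal_imp_unique_extension[OF assms(1-5) q max[unfolded assms(6)]])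
qed

end
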